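(* Let $T>0$, let $(p,q)\in(2,\infty)^2$ satisfy $\frac2q+\frac dp<1$, let $f:[0,T]\times\mathbb{R}^d\to\mathbb{R}$ be a function in $\mathbb{L}^q_p$, let $R>0$ and $\alpha\in(0,\frac12-\frac d{2p}-\frac1q)$, and let $W$ be a standard $d$-dimensional Brownian motion on $(\Omega,\mathcal{F},\mathbb{P})$. Then there exists an event $\Omega'_{f,T,R}$ with full probability such that for every $\omega\in\Omega'_{f,T,R}$ and every $\varepsilon\in(0,\alpha)$, there is a deterministic constant $C=C(\varepsilon,\alpha)$ such that for every $0\le s\le t\le T$ and every function $\psi:[0,T]\to B_R$ of finite variation, we have $\int_0^T|f(r,W_r(\omega)+\psi_r)|\,dr<\infty$, $$\Big|\int_s^tf(r,W_r(\omega)+\psi_r)\,dr-\int_s^tf(r,W_r(\omega)+\psi_s)\,dr\Big|\le C\,\Xi_{T,R}(f)(\omega)\,[\psi]_{\mathrm{var};[s,t]}^{1-\varepsilon}(t-s)^\alpha$$ and $$\Big|\int_s^tf(r,W_r(\omega)+\psi_r)\,dr\Big|\le C\,\Xi_{T,R}(f)(\omega)\big(1+|\psi_s|^{1-\varepsilon}+[\psi]_{\mathrm{var};[s,t]}^{1-\varepsilon}\big)(t-s)^\alpha .$$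
   Context: $B_R$ is the closed ball of radius $R$ centered at $0$ in $\mathbb{R}^d$. $\mathbb{L}^q_p$ is the space of measurable functions with $\|f\|=\big(\int(\int_{\mathbb{R}^d}|f(r,x)|^pdx)^{q/p}dr\big)^{1/q}<\infty$ (here time ranges over $[0,T]$). $[\psi]_{\mathrm{var};[u,v]}=\sup_\pi\sum_{[s,t]\in\pi}|\psi_t-\psi_s|$, the supremum being over all partitions $\pi$ of $[u,v]$. The random variable $\Xi_{T,R}(f)=\Xi_{T,R,\alpha,\varepsilon}(f)$ is $$\Xi_{T,R}(f)=\Big(\iint_{[0,T]^2}\frac{|\int_s^tf(r,W_r)dr|^m}{|t-s|^{\alpha m+2}}ds\,dt+\iiiint_{[0,T]^2\times B_R^2}\frac{|\int_s^t[f(r,W_r+x)-f(r,W_r+y)]dr|^m}{|t-s|^{\alpha m+2}|x-y|^{(1-\varepsilon)m+2d}}ds\,dt\,dx\,dy\Big)^{1/m},$$ where $m=m(\alpha,\varepsilon)\ge1$ is a fixed number with $\frac1m<\frac12-\frac d{2p}-\frac1q-\alpha$ and $\frac dm<\varepsilon$. (For $f\in\mathbb{L}^q_p$ one has $\mathbb{E}[\Xi_{T,R}(f)]\le C'\|f\|_{\mathbb{L}^q_p([0,T])}$ with $C'$ independent of $f$; in particular it is a.s. finite.) *)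

theory Defs
  imports "HOL-Probability.Probability"
begin

text \<open>The space \<open>\<real>\<^sup>d\<close> is a type \<open>'a::euclidean_space\<close> with \<open>d = DIM('a)\<close>.\<close>

text \<open>Powers of extended nonnegative numbers; only used for exponents \<open>a > 0\<close>,
  where \<open>0\<close> and \<open>\<top>\<close> are fixed.\<close>

definition epowr :: "ennreal \<Rightarrow> real \<Rightarrow> ennreal" (infixr \<open>epowr\<close> 80) where
  "x epowr a = (if x = \<top> then \<top> else ennreal (enn2real x powr a))"

text \<open>Time runs over \<open>[0, \<infinity>)\<close>. The starting point and the continuity of the paths are only
  required almost surely; the density is that of the centred Gaussian law on \<open>\<real>\<^sup>d\<close> with
  covariance matrix \<open>t - s\<close> times the identity.\<close>

locale standard_brownian_motion = prob_space M for M :: "'w measure" +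
  fixes W :: "real \<Rightarrow> 'w \<Rightarrow> 'a::euclidean_space"
  assumes measurable: "0 \<le> t \<Longrightarrow> random_variable borel (W t)"
    and start: "AE \<omega> in M. W 0 \<omega> = 0"
    and independent_increments:
      "0 \<le> \<tau> (0::nat) \<Longrightarrow> (\<And>i. i < n \<Longrightarrow> \<tau> i < \<tau> (Suc i)) \<Longrightarrow>
        indep_vars (\<lambda>_. borel) (\<lambda>i \<omega>. W (\<tau> (Suc i)) \<omega> - W (\<tau> i) \<omega>) {..<n}"
    and gaussian_increments:
      "0 \<le> s \<Longrightarrow> s < t \<Longrightarrow>
        distributed M lborel (\<lambda>\<omega>. W t \<omega> - W s \<omega>)
          (\<lambda>x. ennreal (\<Prod>b\<in>Basis. normal_density 0 (sqrt (t - s)) (x \<bullet> b)))"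
    and continuous_paths: "AE \<omega> in M. continuous_on {0..} (\<lambda>t. W t \<omega>)"

text \<open>The mixed norm of \<open>L\<^sup>q\<^sub>p([0,T])\<close>: exponent \<open>p\<close> in space, \<open>q\<close> in time.\<close>

definition Lqp_norm :: "real \<Rightarrow> real \<Rightarrow> real \<Rightarrow> (real \<Rightarrow> 'a::euclidean_space \<Rightarrow> real) \<Rightarrow> ennreal" where
  "Lqp_norm T q p f =
     (\<integral>\<^sup>+ r\<in>{0..T}. (\<integral>\<^sup>+ x. ennreal (\<bar>f r x\<bar> powr p) \<partial>lborel) epowr (q / p) \<partial>lborel) epowr (1 / q)"

text \<open>Elements are genuine Borel functions, not classes modulo null sets. Only the values
  of \<open>f\<close> on \<open>[0,T] \<times> \<real>\<^sup>d\<close> matter.\<close>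

definition Lqp :: "real \<Rightarrow> real \<Rightarrow> real \<Rightarrow> (real \<Rightarrow> 'a::euclidean_space \<Rightarrow> real) set" where
  "Lqp T q p = {f. set_borel_measurable borel ({0..T} \<times> UNIV) (\<lambda>(r, x). f r x) \<and>
     Lqp_norm T q p f < \<top>}"

definition variation :: "(real \<Rightarrow> 'a::real_normed_vector) \<Rightarrow> real \<Rightarrow> real \<Rightarrow> ennreal" where
  "variation \<psi> u v =
     (SUP (n, \<tau>) \<in> {(n::nat, \<tau>). \<tau> 0 = u \<and> \<tau> n = v \<and> (\<forall>i<n. \<tau> i < \<tau> (Suc i))}.
        \<Sum>i<n. ennreal (norm (\<psi> (\<tau> (Suc i)) - \<psi> (\<tau> i))))"

text \<open>\<open>Xi T R \<alpha> \<epsilon> m f w\<close> is the value of \<open>\<Xi>\<^sub>T\<^sub>,\<^sub>R\<close> at a single path \<open>w\<close>,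
  with \<open>m\<close> the integrability exponent; it may be \<open>\<top>\<close>.
  The inner integrals are oriented, and both integrands are \<open>0\<close> on the null sets where
  a denominator vanishes.\<close>

definition Xi :: "real \<Rightarrow> real \<Rightarrow> real \<Rightarrow> real \<Rightarrow> real \<Rightarrow> (real \<Rightarrow> 'a::euclidean_space \<Rightarrow> real) \<Rightarrow>
    (real \<Rightarrow> 'a) \<Rightarrow> ennreal" where
  "Xi T R \<alpha> \<epsilon> m f w =
     ((\<integral>\<^sup>+ (s, t) \<in> {0..T} \<times> {0..T}.
         ennreal (\<bar>LBINT r=s..t. f r (w r)\<bar> powr m / \<bar>t - s\<bar> powr (\<alpha> * m + 2)) \<partial>lborel)
      + (\<integral>\<^sup>+ (s, t, x, y) \<in> {0..T} \<times> {0..T} \<times> cball 0 R \<times> cball 0 R.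
         ennreal (\<bar>LBINT r=s..t. (f r (w r + x) - f r (w r + y))\<bar> powr m
           / (\<bar>t - s\<bar> powr (\<alpha> * m + 2) *
              norm (x - y) powr ((1 - \<epsilon>) * m + 2 * real DIM('a)))) \<partial>lborel))
     epowr (1 / m)"

end

theory Submission
  imports Defs
begin

text \<open>By Garsia--Rodemich--Rumsey, finiteness of \<open>\<Xi>\<close> makes \<open>(t, x) \<mapsto> \<integral>\<^sub>0\<^sup>t f(r, W\<^sub>r + x) dr\<close>
  jointly Hoelder continuous, with exponent \<open>\<alpha>\<close> in time and \<open>1 - \<epsilon>\<close> in space, where
  \<open>\<epsilon> < \<alpha>\<close>. The integral along \<open>\<psi>\<close> is the limit of its Riemann-type sums over dyadic
  partitions, whose increments are summable by this regularity (sewing). Identifying the limit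
  with the Lebesgue integral along \<open>\<psi>\<close> is clear for continuous \<open>f\<close>. For general \<open>f\<close> one needs that
  almost surely, for all \<open>\<psi>\<close> at once, continuous approximations converge along \<open>W + \<psi>\<close>.
  To this end the moments of \<open>\<integral>(g(r, W\<^sub>r + x) - g(r, W\<^sub>r + y)) dr\<close> are bounded through the heat semigroup
  for bounded continuous \<open>g\<close>, whence \<open>\<integral>g(r, W\<^sub>r + \<psi>\<^sub>r) dr \<le> Y (1 + [\<psi>])\<close> for \<open>g \<ge> 0\<close> with
  \<open>E Y\<close> bounded by a multiple of the norm of \<open>g\<close>. Monotone limits give indicators of open sets; as
  null sets have open neighbourhoods of small norm, this controls \<open>f - f\<^sub>k\<close> everywhere.\<close>

section \<open>Mixed norms and convolutions\<close>

lemma epowr_ennreal [simp]: "0 \<le> x \<Longrightarrow> ennreal x epowr a = ennreal (x powr a)"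
  by (simp add: epowr_def)

lemma epowr_top [simp]: "\<top> epowr a = \<top>"
  by (simp add: epowr_def)

lemma epowr_zero [simp]: "0 epowr a = 0"
  by (simp add: epowr_def)

lemma epowr_one_base [simp]: "1 epowr a = 1"
  by (simp add: epowr_def)

lemma epowr_one [simp]: "x epowr 1 = x"
  by (cases x) (auto simp: epowr_def)

lemma epowr_eq_0_iff [simp]: "x epowr a = 0 \<longleftrightarrow> x = 0"
  by (cases x) (auto simp: ennreal_eq_0_iff)

lemma epowr_eq_top_iff [simp]: "x epowr a = \<top> \<longleftrightarrow> x = \<top>"
  by (cases x) auto

lemma epowr_less_top_iff [simp]: "x epowr a < \<top> \<longleftrightarrow> x < \<top>"
  by (simp add: less_top[symmetric] flip: less_top)

lemma epowr_mono: "0 \<le> a \<Longrightarrow> x \<le> y \<Longrightarrow> x epowr a \<le> y epowr a"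
  by (cases x; cases y) (auto simp: powr_mono2 ennreal_le_iff top_unique)

lemma epowr_mult: "(x * y) epowr a = x epowr a * y epowr a"
proof (cases x; cases y)
  fix r s :: real assume *: "0 \<le> r" "x = ennreal r" "0 \<le> s" "y = ennreal s"
  then show ?thesis by (simp add: powr_mult flip: ennreal_mult)
next
  fix r assume "0 \<le> r" "x = ennreal r" "y = \<top>"
  then show ?thesis by (cases "r = 0") (auto simp: ennreal_mult_top)
next
  fix r assume "0 \<le> r" "y = ennreal r" "x = \<top>"
  then show ?thesis by (cases "r = 0") (auto simp: ennreal_top_mult)
qed auto

lemma epowr_epowr [simp]: "(x epowr a) epowr b = x epowr (a * b)"
  by (cases x) (auto simp: powr_powr)

lemma epowr_add: "x epowr (a + b) = x epowr a * x epowr b"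
  by (cases x) (auto simp: powr_add simp flip: ennreal_mult)

lemma epowr_inverse_le_iff:
  assumes "0 < a" shows "x epowr (1 / a) \<le> y \<longleftrightarrow> x \<le> y epowr a"
proof
  assume "x epowr (1 / a) \<le> y"
  from epowr_mono[OF _ this, of a] assms show "x \<le> y epowr a" by simp
next
  assume "x \<le> y epowr a"
  from epowr_mono[OF _ this, of "1 / a"] assms show "x epowr (1 / a) \<le> y" by simp
qed

lemma epowr_measurable [measurable]: "(\<lambda>x. x epowr a) \<in> borel_measurable borel"
  unfolding epowr_def by measurable

definition Lnorm :: "'b measure \<Rightarrow> real \<Rightarrow> ('b \<Rightarrow> ennreal) \<Rightarrow> ennreal" where
  "Lnorm M p f = (\<integral>\<^sup>+x. f x epowr p \<partial>M) epowr (1 / p)"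

lemma Lnorm_epowr: "p \<noteq> 0 \<Longrightarrow> Lnorm M p f epowr p = (\<integral>\<^sup>+x. f x epowr p \<partial>M)"
  by (simp add: Lnorm_def)

lemma Lnorm_le_iff: "0 < p \<Longrightarrow> Lnorm M p f \<le> c \<longleftrightarrow> (\<integral>\<^sup>+x. f x epowr p \<partial>M) \<le> c epowr p"
  by (simp add: Lnorm_def epowr_inverse_le_iff)

lemma Lnorm_mono_AE:
  assumes "0 < p" "AE x in M. f x \<le> g x" shows "Lnorm M p f \<le> Lnorm M p g"
  unfolding Lnorm_def
proof (intro epowr_mono nn_integral_mono_AE)
  show "AE x in M. f x epowr p \<le> g x epowr p"
    using assms(2) by eventually_elim (use assms(1) in \<open>auto intro: epowr_mono\<close>)
qed (use assms(1) in auto)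

lemma Lnorm_mono:
  "0 < p \<Longrightarrow> (\<And>x. x \<in> space M \<Longrightarrow> f x \<le> g x) \<Longrightarrow> Lnorm M p f \<le> Lnorm M p g"
  by (intro Lnorm_mono_AE) auto

lemma Lnorm_cmult:
  assumes [measurable]: "f \<in> borel_measurable M" and "p \<noteq> 0"
  shows "Lnorm M p (\<lambda>x. c * f x) = c * Lnorm M p f"
  using assms(2) by (simp add: Lnorm_def epowr_mult nn_integral_cmult)

lemma Lnorm_one: "Lnorm M 1 f = (\<integral>\<^sup>+x. f x \<partial>M)"
  by (simp add: Lnorm_def)

lemma young_ennreal:
  assumes "1 < p" "1 < q" "1 / p + 1 / q = 1"
  shows "x * y \<le> ennreal (1 / p) * x epowr p + ennreal (1 / q) * y epowr q"
proof (cases x; cases y)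
  fix r s :: real assume *: "0 \<le> r" "x = ennreal r" "0 \<le> s" "y = ennreal s"
  then show ?thesis using Youngs_inequality[OF assms(1-3), of r s] assms
    by (simp flip: ennreal_mult ennreal_plus)
qed (use assms in \<open>auto simp: ennreal_mult_eq_top_iff ennreal_mult_top\<close>)

lemma hoelder:
  assumes [measurable]: "f \<in> borel_measurable M" "g \<in> borel_measurable M"
    and pq: "1 < p" "1 < q" "1 / p + 1 / q = 1"
  shows "(\<integral>\<^sup>+x. f x * g x \<partial>M) \<le> Lnorm M p f * Lnorm M q g"
proof -
  have zero: "(\<integral>\<^sup>+x. f x * g x \<partial>M) = 0"
    if "Lnorm M p f = 0 \<or> Lnorm M q g = 0"
  proof -
    from that have "(AE x in M. f x = 0) \<or> (AE x in M. g x = 0)"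
      by (auto simp: Lnorm_def nn_integral_0_iff_AE)
    then have "AE x in M. f x * g x = 0" by (auto elim!: AE_mp)
    then show ?thesis by (simp add: nn_integral_0_iff_AE)
  qed
  consider "Lnorm M p f = 0 \<or> Lnorm M q g = 0"
    | "Lnorm M p f \<noteq> 0" "Lnorm M q g \<noteq> 0" "Lnorm M p f = \<top> \<or> Lnorm M q g = \<top>"
    | "Lnorm M p f \<noteq> 0" "Lnorm M q g \<noteq> 0" "Lnorm M p f \<noteq> \<top>" "Lnorm M q g \<noteq> \<top>" by blast
  then show ?thesis
  proof cases
    case 1 then show ?thesis using zero by simp
  next
    case 2 then show ?thesis by (auto simp: ennreal_mult_top ennreal_top_mult)
  next
    case 3
    obtain a where a: "Lnorm M p f = ennreal a" "0 < a"
      using 3 by (cases "Lnorm M p f") (auto simp: ennreal_eq_0_iff less_le)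
    obtain b where b: "Lnorm M q g = ennreal b" "0 < b"
      using 3 by (cases "Lnorm M q g") (auto simp: ennreal_eq_0_iff less_le)
    have If: "(\<integral>\<^sup>+x. f x epowr p \<partial>M) = ennreal (a powr p)"
      using Lnorm_epowr[of p M f] pq a by simp
    have Ig: "(\<integral>\<^sup>+x. g x epowr q \<partial>M) = ennreal (b powr q)"
      using Lnorm_epowr[of q M g] pq b by simp
    have pt: "f x * g x \<le> ennreal (a * b) * (ennreal (1 / p) * (ennreal (a powr (-p)) * f x epowr p)
        + ennreal (1 / q) * (ennreal (b powr (-q)) * g x epowr q))" for x
    proof -
      have "f x * g x = ennreal (a * b) * ((ennreal (1/a) * f x) * (ennreal (1/b) * g x))"
      proof -
        have "ennreal (a * b) * (ennreal (1/a) * ennreal (1/b)) = 1"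
          using a b by (simp flip: ennreal_mult)
        then show ?thesis by (metis mult.assoc mult.commute mult.left_neutral mult.left_commute)
      qed
      also have "\<dots> \<le> ennreal (a * b) * (ennreal (1 / p) * (ennreal (1/a) * f x) epowr p
          + ennreal (1 / q) * (ennreal (1/b) * g x) epowr q)"
        by (intro mult_left_mono young_ennreal pq) auto
      finally show ?thesis using a b
        by (simp add: epowr_mult powr_minus powr_divide inverse_eq_divide)
    qed
    have "(\<integral>\<^sup>+x. f x * g x \<partial>M) \<le> (\<integral>\<^sup>+x. ennreal (a * b) * (ennreal (1 / p) * (ennreal (a powr (-p)) * f x epowr p)
        + ennreal (1 / q) * (ennreal (b powr (-q)) * g x epowr q)) \<partial>M)"
      by (intro nn_integral_mono pt)
    also have "\<dots> = ennreal (a * b) * (ennreal (1 / p) * (ennreal (a powr (-p)) * ennreal (a powr p))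
        + ennreal (1 / q) * (ennreal (b powr (-q)) * ennreal (b powr q)))"
      by (simp add: nn_integral_cmult nn_integral_add If Ig)
    also have "\<dots> = ennreal (a * b) * (ennreal (1 / p) + ennreal (1 / q))"
      using a b by (simp add: powr_minus flip: ennreal_mult)
    also have "\<dots> = ennreal (a * b)"
      using pq by (simp flip: ennreal_plus)
    finally show ?thesis using a b by (simp add: ennreal_mult)
  qed
qed

lemma jensen_weighted:
  assumes [measurable]: "f \<in> borel_measurable M" "k \<in> borel_measurable M" and p: "1 \<le> p"
  shows "(\<integral>\<^sup>+x. k x * f x \<partial>M) epowr p \<le> (\<integral>\<^sup>+x. k x \<partial>M) epowr (p - 1) * (\<integral>\<^sup>+x. k x * f x epowr p \<partial>M)"
proof (cases "p = 1")
  case True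
  show ?thesis
  proof (cases "(\<integral>\<^sup>+x. k x \<partial>M) = 0")
    case T: True
    then have "AE x in M. k x = 0" by (simp add: nn_integral_0_iff_AE)
    then have "(\<integral>\<^sup>+x. k x * f x \<partial>M) = 0"
      by (subst nn_integral_0_iff_AE) (auto elim!: AE_mp)
    then show ?thesis by simp
  next
    case False
    then have "1 \<le> (\<integral>\<^sup>+x. k x \<partial>M) epowr 0"
      by (cases "(\<integral>\<^sup>+x. k x \<partial>M)") (auto simp: ennreal_eq_0_iff)
    then have "1 * (\<integral>\<^sup>+x. k x * f x \<partial>M) \<le> (\<integral>\<^sup>+x. k x \<partial>M) epowr 0 * (\<integral>\<^sup>+x. k x * f x \<partial>M)"
      by (intro mult_right_mono) auto
    then show ?thesis using True by simp
  qed
next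
  case False
  with p have p: "1 < p" by simp
  define q where "q = p / (p - 1)"
  have q: "1 < q" "1 / q + 1 / p = 1" using p by (auto simp: q_def field_simps)
  have split: "k x * f x = (k x epowr (1 / q)) * (k x epowr (1 / p) * f x)" for x
    using q by (simp add: mult.assoc[symmetric] epowr_add[symmetric])
  have "(\<integral>\<^sup>+x. k x * f x \<partial>M) \<le> Lnorm M q (\<lambda>x. k x epowr (1 / q)) * Lnorm M p (\<lambda>x. k x epowr (1 / p) * f x)"
    unfolding split by (rule hoelder) (use p q in auto)
  from epowr_mono[OF _ this, of p] have "(\<integral>\<^sup>+x. k x * f x \<partial>M) epowr p
     \<le> (\<integral>\<^sup>+x. k x \<partial>M) epowr (1 / q * p) * (\<integral>\<^sup>+x. k x * f x epowr p \<partial>M)"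
    using p q by (simp add: epowr_mult Lnorm_def)
  also have "1 / q * p = p - 1" using p by (simp add: q_def)
  finally show ?thesis .
qed

lemma minkowski_integral:
  assumes "sigma_finite_measure M" "sigma_finite_measure N"
    and [measurable]: "(\<lambda>(r, x). f r x) \<in> borel_measurable (N \<Otimes>\<^sub>M M)" and p: "1 \<le> p"
  shows "Lnorm M p (\<lambda>x. \<integral>\<^sup>+r. f r x \<partial>N) \<le> (\<integral>\<^sup>+r. Lnorm M p (f r) \<partial>N)"
proof -
  interpret M: sigma_finite_measure M by fact
  interpret N: sigma_finite_measure N by fact
  interpret P: pair_sigma_finite N M ..
  interpret P': pair_sigma_finite M N ..
  define n where "n r = Lnorm M p (f r)" for r
  have n_meas [measurable]: "n \<in> borel_measurable N"
    unfolding n_def Lnorm_def by measurable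
  define L where "L = (\<integral>\<^sup>+r. n r \<partial>N)"
  show ?thesis
  proof (cases "L = \<top>")
    case True then show ?thesis by (simp add: L_def n_def)
  next
    case False
    then have fin: "AE r in N. n r \<noteq> \<top>"
      using nn_integral_PInf_AE[of n N] by (simp add: L_def)
    have z: "AE r in N. AE x in M. n r = 0 \<longrightarrow> f r x = 0"
    proof (rule AE_I2)
      fix r assume [measurable]: "r \<in> space N"
      show "AE x in M. n r = 0 \<longrightarrow> f r x = 0"
      proof (cases "n r = 0")
        case True
        then have "AE x in M. f r x epowr p = 0"
          unfolding n_def Lnorm_def by (simp add: nn_integral_0_iff_AE)
        then show ?thesis by simp
      qed simp
    qed
    have z': "AE x in M. AE r in N. n r = 0 \<longrightarrow> f r x = 0"
    proof (subst P.AE_commute[symmetric])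
      show "{x \<in> space (N \<Otimes>\<^sub>M M). n (fst x) = 0 \<longrightarrow> f (fst x) (snd x) = 0} \<in> sets (N \<Otimes>\<^sub>M M)"
        by measurable
      show "AE r in N. AE x in M. n r = 0 \<longrightarrow> f r x = 0" by (rule z)
    qed
    have pt: "AE x in M. (\<integral>\<^sup>+r. f r x \<partial>N) epowr p \<le> L epowr (p - 1) * (\<integral>\<^sup>+r. n r * (f r x / n r) epowr p \<partial>N)"
      using z' AE_space[of M]
    proof eventually_elim
      case (elim x)
      have [measurable]: "x \<in> space M" by fact
      have "(\<integral>\<^sup>+r. f r x \<partial>N) = (\<integral>\<^sup>+r. n r * (f r x / n r) \<partial>N)"
        using elim(1) fin
        by (intro nn_integral_cong_AE)
           (auto elim!: AE_mp simp: ennreal_times_divide mult_divide_eq_ennreal mult.commute[of "n _"])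
      also have "\<dots> epowr p \<le> L epowr (p - 1) * (\<integral>\<^sup>+r. n r * (f r x / n r) epowr p \<partial>N)"
        unfolding L_def by (rule jensen_weighted) (use p in \<open>auto\<close>)
      finally show ?case .
    qed
    have "(\<integral>\<^sup>+x. (\<integral>\<^sup>+r. f r x \<partial>N) epowr p \<partial>M) \<le> (\<integral>\<^sup>+x. L epowr (p - 1) * (\<integral>\<^sup>+r. n r * (f r x / n r) epowr p \<partial>N) \<partial>M)"
      by (intro nn_integral_mono_AE pt)
    also have "\<dots> = L epowr (p - 1) * (\<integral>\<^sup>+x. (\<integral>\<^sup>+r. n r * (f r x / n r) epowr p \<partial>N) \<partial>M)"
      by (intro nn_integral_cmult) measurable
    also have "(\<integral>\<^sup>+x. (\<integral>\<^sup>+r. n r * (f r x / n r) epowr p \<partial>N) \<partial>M)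
        = (\<integral>\<^sup>+r. (\<integral>\<^sup>+x. n r * (f r x / n r) epowr p \<partial>M) \<partial>N)"
      by (rule P'.Fubini'[symmetric]) measurable
    also have "\<dots> \<le> (\<integral>\<^sup>+r. n r \<partial>N)"
      using fin AE_space[of N]
    proof (intro nn_integral_mono_AE, eventually_elim)
      case (elim r)
      have [measurable]: "r \<in> space N" by fact
      show ?case
      proof (cases "n r = 0")
        case False
        have "(\<integral>\<^sup>+x. n r * (f r x / n r) epowr p \<partial>M)
            = n r * ((1 / n r) epowr p * (\<integral>\<^sup>+x. f r x epowr p \<partial>M))"
          by (subst (1) ennreal_times_divide[of _ 1, simplified, symmetric])
             (simp add: nn_integral_cmult epowr_mult mult.assoc[symmetric] mult.commute[of "f _ _ epowr p"] divide_ennreal_def)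
        also have "(\<integral>\<^sup>+x. f r x epowr p \<partial>M) = n r epowr p"
          unfolding n_def using Lnorm_epowr[of p M "f r"] p by simp
        also have "(1 / n r) epowr p * n r epowr p = ((1 / n r) * n r) epowr p"
          by (simp add: epowr_mult)
        also have "(1 / n r) * n r = 1" using False elim
          by (simp add: ennreal_divide_times ennreal_divide_self less_top)
        finally show ?thesis by simp
      qed simp
    qed
    also have "L epowr (p - 1) * (\<integral>\<^sup>+r. n r \<partial>N) = L epowr p"
      using epowr_add[of L "p - 1" 1] by (simp add: L_def)
    finally have "(\<integral>\<^sup>+x. (\<integral>\<^sup>+r. f r x \<partial>N) epowr p \<partial>M) \<le> L epowr p"
      by (simp add: mult_left_mono)
    then show ?thesis using p by (simp add: Lnorm_le_iff L_def n_def)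
  qed
qed

lemma Lnorm_add_le:
  assumes "sigma_finite_measure M" and [measurable]: "f \<in> borel_measurable M" "g \<in> borel_measurable M" and p: "1 \<le> p"
  shows "Lnorm M p (\<lambda>x. f x + g x) \<le> Lnorm M p f + Lnorm M p g"
proof -
  have "Lnorm M p (\<lambda>x. \<integral>\<^sup>+r. (if r then f x else g x) \<partial>count_space UNIV)
      \<le> (\<integral>\<^sup>+r. Lnorm M p (\<lambda>x. if r then f x else g x) \<partial>count_space UNIV)"
  proof (rule minkowski_integral)
    show "sigma_finite_measure (count_space (UNIV :: bool set))"
      by (simp add: sigma_finite_measure_count_space_finite)
  qed (use assms in \<open>auto\<close>)
  then show ?thesis
    by (simp add: nn_integral_count_space_finite UNIV_bool add.commute)
qed

lemma epowr_le_cancel: "0 < p \<Longrightarrow> x epowr p \<le> y epowr p \<Longrightarrow> x \<le> y"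
  using epowr_mono[of "1 / p" "x epowr p" "y epowr p"] by simp

lemma nn_integral_lborel_shift:
  fixes c :: "'a::euclidean_space"
  assumes [measurable]: "f \<in> borel_measurable borel"
  shows "(\<integral>\<^sup>+x. f (x + c) \<partial>lborel) = (\<integral>\<^sup>+x. f x \<partial>lborel)"
proof -
  have "(\<integral>\<^sup>+x. f x \<partial>lborel) = (\<integral>\<^sup>+x. f x \<partial>distr lborel borel ((+) c))"
    by (simp add: lborel_distr_plus)
  also have "\<dots> = (\<integral>\<^sup>+x. f (x + c) \<partial>lborel)"
    by (simp add: nn_integral_distr add.commute)
  finally show ?thesis by simp
qed

lemma Lnorm_lborel_shift:
  fixes c :: "'a::euclidean_space"
  assumes [measurable]: "f \<in> borel_measurable borel"
  shows "Lnorm lborel p (\<lambda>x. f (x + c)) = Lnorm lborel p f"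
  unfolding Lnorm_def by (subst nn_integral_lborel_shift[of "\<lambda>x. f x epowr p"]) auto

definition conv :: "('a::euclidean_space \<Rightarrow> ennreal) \<Rightarrow> ('a \<Rightarrow> ennreal) \<Rightarrow> 'a \<Rightarrow> ennreal" where
  "conv k f w = (\<integral>\<^sup>+v. k v * f (w + v) \<partial>lborel)"

lemma conv_measurable [measurable]:
  assumes [measurable]: "k \<in> borel_measurable borel" "f \<in> borel_measurable borel"
  shows "conv k f \<in> borel_measurable borel"
  unfolding conv_def by measurable

lemma conv_Lnorm:
  fixes k f :: "'a::euclidean_space \<Rightarrow> ennreal"
  assumes [measurable]: "k \<in> borel_measurable borel" "f \<in> borel_measurable borel" and p: "1 \<le> p"
  shows "Lnorm lborel p (conv k f) \<le> (\<integral>\<^sup>+v. k v \<partial>lborel) * Lnorm lborel p f"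
proof -
  have "Lnorm lborel p (conv k f) \<le> (\<integral>\<^sup>+v. Lnorm lborel p (\<lambda>w. k v * f (w + v)) \<partial>lborel)"
    unfolding conv_def[abs_def]
    by (rule minkowski_integral) (use p in \<open>auto intro: lborel.sigma_finite_measure_axioms\<close>)
  also have "\<dots> = (\<integral>\<^sup>+v. k v * Lnorm lborel p f \<partial>lborel)"
    using p by (simp add: Lnorm_cmult Lnorm_lborel_shift)
  finally show ?thesis by (simp add: nn_integral_multc)
qed

lemma conv_sup:
  fixes k f :: "'a::euclidean_space \<Rightarrow> ennreal"
  assumes [measurable]: "k \<in> borel_measurable borel" "f \<in> borel_measurable borel" and p: "1 \<le> p"
    and mass: "(\<integral>\<^sup>+v. k v \<partial>lborel) \<le> A" and sup: "\<And>v. k v \<le> A * S"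
  shows "conv k f w \<le> A * S epowr (1 / p) * Lnorm lborel p f"
proof -
  have "conv k f w epowr p \<le> (\<integral>\<^sup>+v. k v \<partial>lborel) epowr (p - 1) * (\<integral>\<^sup>+v. k v * f (w + v) epowr p \<partial>lborel)"
    unfolding conv_def by (rule jensen_weighted) (use p in auto)
  also have "\<dots> \<le> A epowr (p - 1) * (\<integral>\<^sup>+v. (A * S) * f (w + v) epowr p \<partial>lborel)"
    by (intro mult_mono epowr_mono mass nn_integral_mono sup) (use p in auto)
  also have "(\<integral>\<^sup>+v. (A * S) * f (w + v) epowr p \<partial>lborel) = A * S * Lnorm lborel p f epowr p"
    using nn_integral_lborel_shift[of "\<lambda>x. f x epowr p" w] p
    by (simp add: nn_integral_cmult Lnorm_epowr add.commute)
  also have "A epowr (p - 1) * (A * S * Lnorm lborel p f epowr p) = A epowr p * S * Lnorm lborel p f epowr p"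
    using epowr_add[of A "p - 1" 1] by (simp add: mult.assoc)
  also have "\<dots> = (A * S epowr (1 / p) * Lnorm lborel p f) epowr p"
    using p by (simp add: epowr_mult)
  finally show ?thesis using p by (auto intro: epowr_le_cancel[of p])
qed

lemma conv_Lnorm_half:
  fixes k f :: "'a::euclidean_space \<Rightarrow> ennreal"
  assumes [measurable]: "k \<in> borel_measurable borel" "f \<in> borel_measurable borel" and p: "2 \<le> p"
    and mass: "(\<integral>\<^sup>+v. k v \<partial>lborel) \<le> A" and sup: "\<And>v. k v \<le> A * S"
  shows "Lnorm lborel p (conv k f) \<le> A * S epowr (1 / p) * Lnorm lborel (p / 2) f"
proof -
  define N where "N = Lnorm lborel (p / 2) f"
  have b: "conv k f w \<le> A * S epowr (2 / p) * N" for w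
    using conv_sup[of k f "p / 2" A S w] assms by (simp add: N_def)
  have half: "x epowr p = x epowr (p / 2) * x epowr (p / 2)" for x
    by (simp add: epowr_add[symmetric])
  have "(\<integral>\<^sup>+w. conv k f w epowr p \<partial>lborel)
      \<le> (\<integral>\<^sup>+w. (A * S epowr (2 / p) * N) epowr (p / 2) * conv k f w epowr (p / 2) \<partial>lborel)"
    by (subst half, intro nn_integral_mono mult_right_mono epowr_mono b) (use p in auto)
  also have "\<dots> = (A * S epowr (2 / p) * N) epowr (p / 2) * Lnorm lborel (p / 2) (conv k f) epowr (p / 2)"
    using p by (simp add: nn_integral_cmult Lnorm_epowr)
  also have "\<dots> \<le> (A * S epowr (2 / p) * N) epowr (p / 2) * (A * N) epowr (p / 2)"
  proof (intro mult_left_mono epowr_mono)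
    have "Lnorm lborel (p / 2) (conv k f) \<le> (\<integral>\<^sup>+v. k v \<partial>lborel) * N"
      unfolding N_def by (rule conv_Lnorm) (use p in auto)
    also have "\<dots> \<le> A * N" by (intro mult_right_mono mass) auto
    finally show "Lnorm lborel (p / 2) (conv k f) \<le> A * N" .
  qed (use p in auto)
  also have "\<dots> = (A * S epowr (1 / p) * N) epowr p"
    using p by (simp add: epowr_mult half[of A] half[of N] mult_ac)
  finally show ?thesis
    using p by (simp add: Lnorm_le_iff N_def)
qed

section \<open>The heat kernel and its differences\<close>

definition heat :: "real \<Rightarrow> 'a::euclidean_space \<Rightarrow> real" where
  "heat \<tau> z = (2 * pi * \<tau>) powr (- real DIM('a) / 2) * exp (- (norm z)\<^sup>2 / (2 * \<tau>))"

lemma heat_measurable [measurable]: "(\<lambda>(\<tau>, z). heat \<tau> z) \<in> borel_measurable (borel \<Otimes>\<^sub>M borel)"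
  unfolding heat_def split_beta by measurable

lemma heat_nonneg [simp]: "0 \<le> heat \<tau> z"
  by (simp add: heat_def)

lemma heat_le: "0 < \<tau> \<Longrightarrow> heat \<tau> (z :: 'a::euclidean_space) \<le> (2 * pi * \<tau>) powr (- real DIM('a) / 2)"
  unfolding heat_def by (rule mult_left_le) auto

lemma heat_eq_prod:
  fixes z :: "'a::euclidean_space"
  assumes "0 < \<tau>"
  shows "(\<Prod>b\<in>Basis. normal_density 0 (sqrt \<tau>) (z \<bullet> b)) = heat \<tau> z"
proof -
  have "(\<Prod>b\<in>(Basis::'a set). normal_density 0 (sqrt \<tau>) (z \<bullet> b))
     = (1 / sqrt (2 * pi * \<tau>)) ^ DIM('a) * exp (\<Sum>b\<in>Basis. - (z \<bullet> b)\<^sup>2 / (2 * \<tau>))"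
    using assms unfolding normal_density_def by (simp add: prod_dividef exp_sum power_divide)
  also have "(\<Sum>b\<in>Basis. - (z \<bullet> b)\<^sup>2 / (2 * \<tau>)) = - (\<Sum>b\<in>Basis. (z \<bullet> b)\<^sup>2) / (2 * \<tau>)"
    by (simp add: sum_divide_distrib[symmetric] sum_negf)
  also have "(\<Sum>b\<in>Basis. (z \<bullet> b)\<^sup>2) = (norm z)\<^sup>2"
    unfolding power2_norm_eq_inner by (subst euclidean_inner) (simp add: power2_eq_square)
  also have "(1 / sqrt (2 * pi * \<tau>)) ^ DIM('a) = (2 * pi * \<tau>) powr (- real DIM('a) / 2)"
  proof -
    have pos: "0 < 2 * pi * \<tau>" using assms by simp
    have "1 / sqrt (2 * pi * \<tau>) = (2 * pi * \<tau>) powr (- 1 / 2)"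
      using pos by (simp add: powr_minus_divide powr_half_sqrt)
    moreover have "((2 * pi * \<tau>) powr (- 1 / 2)) ^ DIM('a) = ((2 * pi * \<tau>) powr (- 1 / 2)) powr real DIM('a)"
      by (rule powr_realpow[symmetric]) (use assms in simp)
    ultimately show ?thesis by (simp add: powr_powr)
  qed
  finally show ?thesis by (simp add: heat_def)
qed

lemma nn_integral_heat:
  assumes "0 < \<tau>" shows "(\<integral>\<^sup>+z. ennreal (heat \<tau> (z::'a::euclidean_space)) \<partial>lborel) = 1"
proof -
  have "(\<integral>\<^sup>+z. ennreal (heat \<tau> (z::'a)) \<partial>lborel)
      = (\<integral>\<^sup>+z. (\<Prod>b\<in>(Basis::'a set). ennreal (normal_density 0 (sqrt \<tau>) (z \<bullet> b))) \<partial>lborel)"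
    using assms by (simp add: heat_eq_prod[symmetric] prod_ennreal)
  also have "\<dots> = (\<Prod>b\<in>(Basis::'a set). \<integral>\<^sup>+x. ennreal (normal_density 0 (sqrt \<tau>) x) \<partial>lborel)"
    by (rule nn_integral_lborel_prod) auto
  also have "(\<integral>\<^sup>+x. ennreal (normal_density 0 (sqrt \<tau>) x) \<partial>lborel) = 1"
    using assms by (simp add: nn_integral_eq_integral[OF integrable_normal_density] integral_normal_density)
  finally show ?thesis by simp
qed

lemma integrable_heat: "0 < \<tau> \<Longrightarrow> integrable lborel (heat \<tau> :: 'a::euclidean_space \<Rightarrow> real)"
  by (rule integrableI_nonneg) (auto simp: nn_integral_heat)

lemma integral_heat: "0 < \<tau> \<Longrightarrow> (LINT z|lborel. heat \<tau> (z::'a::euclidean_space)) = 1"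
  by (subst integral_eq_nn_integral) (auto simp: nn_integral_heat)

lemma heat_mult:
  fixes z v :: "'a::euclidean_space"
  assumes "0 < h"
  shows "heat h (z - v) * heat h v = heat (2 * h) z * heat (h / 2) (v - (1/2) *\<^sub>R z)"
proof -
  have e: "(norm (z - v))\<^sup>2 / (2 * h) + (norm v)\<^sup>2 / (2 * h)
    = (norm z)\<^sup>2 / (4 * h) + (norm (v - (1/2) *\<^sub>R z))\<^sup>2 / h"
    using assms by (simp add: power2_norm_eq_inner inner_diff inner_commute field_simps)
  have c: "(2 * pi * h) powr x * (2 * pi * h) powr x = (4 * pi * h) powr x * (pi * h) powr x" for x
    using assms by (simp add: powr_mult[symmetric] mult_ac)
  have "heat h (z - v) * heat h v = ((2 * pi * h) powr (- real DIM('a) / 2) * (2 * pi * h) powr (- real DIM('a) / 2))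
      * exp (- ((norm (z - v))\<^sup>2 / (2 * h) + (norm v)\<^sup>2 / (2 * h)))"
    unfolding heat_def minus_add_distrib exp_add minus_divide_left by (simp only: mult_ac)
  also have "\<dots> = heat (2 * h) z * heat (h / 2) (v - (1/2) *\<^sub>R z)"
  proof -
    have "2 * pi * (2 * h) = 4 * pi * h" "2 * pi * (h / 2) = pi * h" "2 * (2 * h) = 4 * h" "2 * (h / 2) = h"
      by auto
    then show ?thesis
      unfolding e c heat_def minus_add_distrib exp_add minus_divide_left by (simp only: mult_ac)
  qed
  finally show ?thesis .
qed

lemma integral_lborel_shift:
  fixes c :: "'a::euclidean_space" and f :: "'a \<Rightarrow> real"
  assumes [measurable]: "f \<in> borel_measurable borel"
  shows "(LINT x|lborel. f (x + c)) = (LINT x|lborel. f x)"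
proof -
  have "(LINT x|lborel. f x) = (LINT x|distr lborel borel ((+) c). f x)"
    by (simp add: lborel_distr_plus)
  also have "\<dots> = (LINT x|lborel. f (x + c))"
    by (simp add: integral_distr add.commute)
  finally show ?thesis by simp
qed

lemma integrable_lborel_shift:
  fixes c :: "'a::euclidean_space" and f :: "'a \<Rightarrow> real"
  assumes "integrable lborel f"
  shows "integrable lborel (\<lambda>x. f (x + c))"
proof -
  have [measurable]: "f \<in> borel_measurable borel"
    using borel_measurable_integrable[OF assms] by simp
  have "integrable (distr lborel borel ((+) c)) f"
    using assms by (simp add: lborel_distr_plus)
  then show ?thesis by (simp add: integrable_distr_eq add.commute)
qed

lemma nn_integral_lborel_reflect:
  fixes c :: "'a::euclidean_space"
  assumes [measurable]: "f \<in> borel_measurable borel"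
  shows "(\<integral>\<^sup>+x. f (c - x) \<partial>lborel) = (\<integral>\<^sup>+x. f x \<partial>lborel)"
proof -
  have "(\<integral>\<^sup>+x. f x \<partial>lborel) = (\<integral>\<^sup>+x. f x \<partial>density (distr lborel borel (\<lambda>x. c + (-1) *\<^sub>R x)) (\<lambda>_. 1))"
    using lborel_affine[of "-1" c] by simp
  also have "\<dots> = (\<integral>\<^sup>+x. f (c - x) \<partial>lborel)"
    by (simp add: nn_integral_density nn_integral_distr)
  finally show ?thesis by simp
qed

lemma integrable_heat_conv:
  assumes "0 < h" shows "integrable lborel (\<lambda>v. heat h (z - v) * heat h (v::'a::euclidean_space))"
  unfolding heat_mult[OF assms]
  using integrable_lborel_shift[OF integrable_heat[of "h / 2"], of "- ((1/2) *\<^sub>R z)"] assms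
  by (intro integrable_mult_right) simp

lemma heat_semigroup:
  assumes "0 < h"
  shows "(LINT v|lborel. heat h (z - v) * heat h (v::'a::euclidean_space)) = heat (2 * h) z"
  unfolding heat_mult[OF assms]
  using integral_lborel_shift[of "heat (h / 2)" "- ((1/2) *\<^sub>R z)"] assms
  by (simp add: integral_heat)

definition diffk :: "'a::euclidean_space \<Rightarrow> ('a \<Rightarrow> real) \<Rightarrow> 'a \<Rightarrow> real" where
  "diffk z k v = k (v - z) - k v"

lemma diffk_measurable [measurable (raw)]:
  "(\<lambda>x. k x (v x - z)) \<in> borel_measurable M \<Longrightarrow> (\<lambda>x. k x (v x)) \<in> borel_measurable M \<Longrightarrow> (\<lambda>x. diffk z (k x) (v x)) \<in> borel_measurable M"
  unfolding diffk_def by measurable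

lemma diffk_heat_integrable: "0 < h \<Longrightarrow> integrable lborel (diffk z (heat h))"
  unfolding diffk_def[abs_def] using integrable_lborel_shift[OF integrable_heat[of h], of "-z"] integrable_heat[of h]
  by (intro Bochner_Integration.integrable_diff) auto

text \<open>With \<open>a = \<surd>heat (v - z)\<close> and \<open>b = \<surd>heat v\<close>, the bound follows from
  \<open>\<bar>a\<^sup>2 - b\<^sup>2\<bar> \<le> c (a - b)\<^sup>2 + (a + b)\<^sup>2 / (4c)\<close>, since
  \<open>a b\<close> is again a translated Gaussian.\<close>

lemma diffk_heat_mass_linear:
  fixes z :: "'a::euclidean_space"
  assumes t: "0 < \<tau>"
  shows "(LINT v|lborel. \<bar>diffk z (heat \<tau>) v\<bar>) \<le> norm z / sqrt \<tau>"
proof (cases "z = 0")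
  case True then show ?thesis by (simp add: diffk_def)
next
  case False
  define c where "c = sqrt \<tau> / norm z * 2"
  have c: "0 < c" using False t by (simp add: c_def)
  define e where "e = exp (- (norm z)\<^sup>2 / (8 * \<tau>))"
  have gm: "sqrt (heat \<tau> (v - z) * heat \<tau> v) = e * heat \<tau> (v - (1/2) *\<^sub>R z)" for v
  proof (rule real_sqrt_unique)
    have "(norm (v - z))\<^sup>2 / (2 * \<tau>) + (norm v)\<^sup>2 / (2 * \<tau>)
       = (norm z)\<^sup>2 / (4 * \<tau>) + 2 * ((norm (v - (1/2) *\<^sub>R z))\<^sup>2 / (2 * \<tau>))"
      using t by (simp add: power2_norm_eq_inner inner_diff inner_commute field_simps)
    then have "exp (- (norm (v - z))\<^sup>2 / (2 * \<tau>)) * exp (- (norm v)\<^sup>2 / (2 * \<tau>))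
       = e\<^sup>2 * (exp (- (norm (v - (1/2) *\<^sub>R z))\<^sup>2 / (2 * \<tau>)))\<^sup>2"
      unfolding e_def by (simp add: power2_eq_square exp_add[symmetric])
    then show "(e * heat \<tau> (v - (1/2) *\<^sub>R z))\<^sup>2 = heat \<tau> (v - z) * heat \<tau> v"
      unfolding heat_def by (simp add: power2_eq_square mult_ac)
  qed (simp add: e_def)
  have pt: "\<bar>diffk z (heat \<tau>) v\<bar> \<le> c * (heat \<tau> (v - z) + heat \<tau> v - 2 * (e * heat \<tau> (v - (1/2) *\<^sub>R z)))
       + (1 / (4 * c)) * (2 * (heat \<tau> (v - z) + heat \<tau> v))" for v
  proof -
    define a where "a = sqrt (heat \<tau> (v - z))"
    define b where "b = sqrt (heat \<tau> v)"
    have ab: "0 \<le> a" "0 \<le> b" "heat \<tau> (v - z) = a\<^sup>2" "heat \<tau> v = b\<^sup>2"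
      by (auto simp: a_def b_def)
    have g: "a * b = e * heat \<tau> (v - (1/2) *\<^sub>R z)"
      unfolding a_def b_def gm[symmetric] by (simp add: real_sqrt_mult)
    have "\<bar>a\<^sup>2 - b\<^sup>2\<bar> = \<bar>a - b\<bar> * (a + b)"
    proof -
      have "a\<^sup>2 - b\<^sup>2 = (a - b) * (a + b)" by (simp add: power2_eq_square algebra_simps)
      then show ?thesis using ab(1,2) by (simp add: abs_mult)
    qed
    also have "\<dots> \<le> c * (a - b)\<^sup>2 + (1 / (4 * c)) * (a + b)\<^sup>2"
    proof -
      have "0 \<le> (2 * c * \<bar>a - b\<bar> - (a + b))\<^sup>2 / (4 * c)" using c by simp
      also have "\<dots> = c * \<bar>a - b\<bar>\<^sup>2 + (1 / (4 * c)) * (a + b)\<^sup>2 - \<bar>a - b\<bar> * (a + b)"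
        using c by (simp add: field_simps power2_eq_square)
      finally show ?thesis by simp
    qed
    also have "\<dots> \<le> c * (a\<^sup>2 + b\<^sup>2 - 2 * (a * b)) + (1 / (4 * c)) * (2 * (a\<^sup>2 + b\<^sup>2))"
    proof -
      have "(a + b)\<^sup>2 \<le> 2 * (a\<^sup>2 + b\<^sup>2)"
        using zero_le_power2[of "a - b"] by (simp add: power2_sum power2_diff)
      then show ?thesis using c
        by (intro add_mono mult_left_mono) (auto simp: power2_diff)
    qed
    finally show ?thesis unfolding diffk_def ab g .
  qed
  have i: "integrable lborel (\<lambda>v. heat \<tau> (v - x))" "(LINT v|lborel. heat \<tau> (v - x)) = 1" for x :: 'a
    using integrable_lborel_shift[OF integrable_heat[OF t], of "-x"]
      integral_lborel_shift[of "heat \<tau>" "-x"] t by (auto simp: integral_heat)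
  note i0 = i[of 0, simplified]
  have "(LINT v|lborel. \<bar>diffk z (heat \<tau>) v\<bar>) \<le> (LINT v|lborel. c * (heat \<tau> (v - z) + heat \<tau> v - 2 * (e * heat \<tau> (v - (1/2) *\<^sub>R z)))
       + (1 / (4 * c)) * (2 * (heat \<tau> (v - z) + heat \<tau> v)))"
    using i(1) integrable_heat[OF t] diffk_heat_integrable[OF t, of z]
    by (intro integral_mono pt integrable_abs Bochner_Integration.integrable_add
        Bochner_Integration.integrable_diff integrable_mult_right)
  also have "\<dots> = c * (1 + 1 - 2 * (e * 1)) + 1 / (4 * c) * (2 * (1 + 1))"
  proof (rule has_bochner_integral_integral_eq)
    have H: "has_bochner_integral lborel (\<lambda>v. heat \<tau> (v - x)) 1" for x :: 'a
      using i[of x] by (simp add: has_bochner_integral_iff)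
    have H0: "has_bochner_integral lborel (\<lambda>v::'a. heat \<tau> v) 1"
      using H[of 0] by simp
    show "has_bochner_integral lborel (\<lambda>v. c * (heat \<tau> (v - z) + heat \<tau> v - 2 * (e * heat \<tau> (v - (1 / 2) *\<^sub>R z))) +
        1 / (4 * c) * (2 * (heat \<tau> (v - z) + heat \<tau> v))) (c * (1 + 1 - 2 * (e * 1)) + 1 / (4 * c) * (2 * (1 + 1)))"
      by (intro has_bochner_integral_add has_bochner_integral_diff has_bochner_integral_mult_right H H0)
  qed
  also have "\<dots> = c * (2 - 2 * e) + 1 / c"
    by simp
  also have "1 - e \<le> (norm z)\<^sup>2 / (8 * \<tau>)"
    using exp_ge_add_one_self[of "- (norm z)\<^sup>2 / (8 * \<tau>)"] by (simp add: e_def)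
  then have "c * (2 - 2 * e) + 1 / c \<le> c * (2 * ((norm z)\<^sup>2 / (8 * \<tau>))) + 1 / c"
    using c by (intro add_mono mult_left_mono) auto
  also have "\<dots> = norm z / sqrt \<tau>"
  proof -
    define s where "s = sqrt \<tau>"
    have "\<tau> = s * s" "0 < s" using t by (auto simp: s_def)
    then show ?thesis using False unfolding c_def s_def[symmetric]
      by (simp add: field_simps power2_eq_square)
  qed
  finally show ?thesis .
qed

lemma diffk_heat_mass:
  fixes z :: "'a::euclidean_space"
  assumes t: "0 < \<tau>" and b: "0 < \<beta>" "\<beta> \<le> 1"
  shows "(\<integral>\<^sup>+v. ennreal \<bar>diffk z (heat \<tau>) v\<bar> \<partial>lborel) \<le> ennreal (2 * (norm z / sqrt \<tau>) powr \<beta>)"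
proof -
  define x where "x = norm z / sqrt \<tau>"
  have x: "0 \<le> x" using t by (simp add: x_def)
  have i: "integrable lborel (\<lambda>v. heat \<tau> (v - z))" "(LINT v|lborel. heat \<tau> (v - z)) = 1"
    using integrable_lborel_shift[OF integrable_heat[OF t], of "-z"]
      integral_lborel_shift[of "heat \<tau>" "-z"] t by (auto simp: integral_heat)
  have "(LINT v|lborel. \<bar>diffk z (heat \<tau>) v\<bar>) \<le> (LINT v|lborel. heat \<tau> (v - z) + heat \<tau> v)"
  proof (intro integral_mono)
    fix v show "\<bar>diffk z (heat \<tau>) v\<bar> \<le> heat \<tau> (v - z) + heat \<tau> v"
      unfolding diffk_def using heat_nonneg[of \<tau> v] heat_nonneg[of \<tau> "v - z"] by linarith
  qed (use i integrable_heat[OF t] diffk_heat_integrable[OF t, of z] in auto)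
  also have "\<dots> = 2"
    by (subst Bochner_Integration.integral_add[OF i(1) integrable_heat[OF t]])
       (use i(2) integral_heat[OF t] in auto)
  finally have "(LINT v|lborel. \<bar>diffk z (heat \<tau>) v\<bar>) \<le> min 2 x"
    using diffk_heat_mass_linear[OF t, of z] by (simp add: x_def)
  also have "\<dots> \<le> 2 * x powr \<beta>"
  proof (cases "1 \<le> x")
    case True then have "1 \<le> x powr \<beta>" using b by (simp add: ge_one_powr_ge_zero)
    then show ?thesis by simp
  next
    case False
    then have "x \<le> x powr \<beta>"
      using powr_mono'[of \<beta> 1 x] b x by simp
    then show ?thesis using x by simp
  qed
  finally show ?thesis using diffk_heat_integrable[OF t, of z]
    by (subst nn_integral_eq_integral) (auto simp: x_def intro!: ennreal_leI)
qed

lemma diffk_heat_semigroup: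
  fixes z u :: "'a::euclidean_space"
  assumes h: "0 < h"
  shows "diffk z (heat (2 * h)) u = (LINT v|lborel. diffk z (heat h) (u - v) * heat h v)"
    and "integrable lborel (\<lambda>v. diffk z (heat h) (u - v) * heat h v)"
proof -
  have i: "integrable lborel (\<lambda>v. heat h (x - v) * heat h v)" for x :: 'a
    by (rule integrable_heat_conv[OF h])
  have e: "diffk z (heat h) (u - v) * heat h v = heat h ((u - z) - v) * heat h v - heat h (u - v) * heat h v" for v
    by (simp add: diffk_def algebra_simps)
  show "integrable lborel (\<lambda>v. diffk z (heat h) (u - v) * heat h v)"
    unfolding e by (intro Bochner_Integration.integrable_diff i)
  show "diffk z (heat (2 * h)) u = (LINT v|lborel. diffk z (heat h) (u - v) * heat h v)"
    unfolding e by (subst Bochner_Integration.integral_diff[OF i i]) (simp add: heat_semigroup[OF h] diffk_def)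
qed

lemma diffk_heat_sup:
  fixes z u :: "'a::euclidean_space"
  assumes t: "0 < \<tau>" and b: "0 < \<beta>" "\<beta> \<le> 1"
  shows "\<bar>diffk z (heat \<tau>) u\<bar>
    \<le> 2 * 2 powr ((\<beta> + real DIM('a)) / 2) * (norm z / sqrt \<tau>) powr \<beta> * (2 * pi * \<tau>) powr (- real DIM('a) / 2)"
proof -
  define h where "h = \<tau> / 2"
  have h: "0 < h" "\<tau> = 2 * h" using t by (auto simp: h_def)
  have "ennreal \<bar>diffk z (heat \<tau>) u\<bar> \<le> (\<integral>\<^sup>+v. ennreal \<bar>diffk z (heat h) (u - v) * heat h v\<bar> \<partial>lborel)"
    unfolding h(2) diffk_heat_semigroup(1)[OF h(1)]
    using integral_norm_bound_ennreal[OF diffk_heat_semigroup(2)[OF h(1)], of z u] by simp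
  also have "\<dots> \<le> (\<integral>\<^sup>+v. ennreal \<bar>diffk z (heat h) (u - v)\<bar> * ennreal ((2 * pi * h) powr (- real DIM('a) / 2)) \<partial>lborel)"
    by (intro nn_integral_mono)
       (auto simp: abs_mult ennreal_mult[symmetric] intro!: ennreal_leI mult_left_mono heat_le[OF h(1), simplified])
  also have "\<dots> = (\<integral>\<^sup>+v. ennreal \<bar>diffk z (heat h) v\<bar> \<partial>lborel) * ennreal ((2 * pi * h) powr (- real DIM('a) / 2))"
    by (subst nn_integral_multc)
       (auto simp: nn_integral_lborel_reflect[of "\<lambda>v. ennreal \<bar>diffk z (heat h) v\<bar>" u])
  also have "\<dots> \<le> ennreal (2 * (norm z / sqrt h) powr \<beta>) * ennreal ((2 * pi * h) powr (- real DIM('a) / 2))"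
    by (intro mult_right_mono diffk_heat_mass h b) auto
  finally have "\<bar>diffk z (heat \<tau>) u\<bar> \<le> 2 * (norm z / sqrt h) powr \<beta> * (2 * pi * h) powr (- real DIM('a) / 2)"
    by (simp add: ennreal_mult[symmetric])
  also have "(norm z / sqrt h) powr \<beta> = 2 powr (\<beta> / 2) * (norm z / sqrt \<tau>) powr \<beta>"
  proof -
    have "norm z / sqrt h = sqrt 2 * (norm z / sqrt \<tau>)" using t by (simp add: h_def real_sqrt_divide)
    then have "(norm z / sqrt h) powr \<beta> = sqrt 2 powr \<beta> * (norm z / sqrt \<tau>) powr \<beta>"
      by (simp only: powr_mult)
    then show ?thesis by (simp add: powr_half_sqrt[symmetric] powr_powr)
  qed
  also have "(2 * pi * h) powr (- real DIM('a) / 2) = 2 powr (real DIM('a) / 2) * (2 * pi * \<tau>) powr (- real DIM('a) / 2)"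
  proof -
    have "2 * pi * h = (1 / 2) * (2 * pi * \<tau>)" by (simp add: h_def)
    then have "(2 * pi * h) powr (- real DIM('a) / 2) = (1 / 2) powr (- real DIM('a) / 2) * (2 * pi * \<tau>) powr (- real DIM('a) / 2)"
      using t by (simp only: powr_mult)
    then show ?thesis by (simp add: powr_minus powr_divide)
  qed
  finally show ?thesis by (simp add: add_divide_distrib powr_add mult_ac)
qed

lemma diffk_diffk_heat_mass:
  fixes z :: "'a::euclidean_space"
  assumes t: "0 < \<tau>" and b: "0 < \<beta>" "\<beta> \<le> 1"
  shows "(\<integral>\<^sup>+u. ennreal \<bar>diffk z (diffk z (heat \<tau>)) u\<bar> \<partial>lborel)
    \<le> ennreal (4 * 2 powr \<beta> * (norm z / sqrt \<tau>) powr (2 * \<beta>))"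
proof -
  define h where "h = \<tau> / 2"
  have h: "0 < h" "\<tau> = 2 * h" using t by (auto simp: h_def)
  let ?D = "diffk z (heat h)"
  define m where "m = (\<integral>\<^sup>+v. ennreal \<bar>?D v\<bar> \<partial>lborel)"
  have pt: "ennreal \<bar>diffk z (diffk z (heat \<tau>)) u\<bar> \<le> (\<integral>\<^sup>+v. ennreal \<bar>?D (u - v)\<bar> * ennreal \<bar>?D v\<bar> \<partial>lborel)" for u
  proof -
    have i: "integrable lborel (\<lambda>v. ?D (x - v) * heat h v)" for x
      by (rule diffk_heat_semigroup(2)[OF h(1)])
    have i': "integrable lborel (\<lambda>v. ?D (x - v) * heat h (v - z))" for x
      using integrable_lborel_shift[OF i[of "x - z"], of "-z"] by (simp add: algebra_simps)
    have e': "(LINT v|lborel. ?D (x - v) * heat h (v - z)) = (LINT v|lborel. ?D ((x - z) - v) * heat h v)" for x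
      using integral_lborel_shift[of "\<lambda>v. ?D ((x - z) - v) * heat h v" "-z"] by (simp add: algebra_simps)
    have eq: "?D (u - v) * ?D v = ?D (u - v) * heat h (v - z) - ?D (u - v) * heat h v" for v
      by (simp add: diffk_def[of z "heat h" v] algebra_simps)
    have "(LINT v|lborel. ?D (u - v) * ?D v) = diffk z (diffk z (heat \<tau>)) u"
      unfolding eq
      by (subst Bochner_Integration.integral_diff[OF i' i])
         (simp add: e' h(2) diffk_heat_semigroup(1)[OF h(1), symmetric] diffk_def[of z "diffk z _"])
    moreover have "integrable lborel (\<lambda>v. ?D (u - v) * ?D v)"
      unfolding eq by (intro Bochner_Integration.integrable_diff i i')
    ultimately show ?thesis
      using integral_norm_bound_ennreal[of lborel "\<lambda>v. ?D (u - v) * ?D v"]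
      by (simp add: abs_mult ennreal_mult)
  qed
  have "(\<integral>\<^sup>+u. ennreal \<bar>diffk z (diffk z (heat \<tau>)) u\<bar> \<partial>lborel)
     \<le> (\<integral>\<^sup>+u. (\<integral>\<^sup>+v. ennreal \<bar>?D (u - v)\<bar> * ennreal \<bar>?D v\<bar> \<partial>lborel) \<partial>lborel)"
    by (intro nn_integral_mono pt)
  also have "\<dots> = (\<integral>\<^sup>+v. (\<integral>\<^sup>+u. ennreal \<bar>?D (u - v)\<bar> * ennreal \<bar>?D v\<bar> \<partial>lborel) \<partial>lborel)"
    by (rule lborel_pair.Fubini') measurable
  also have "\<dots> = m * m"
    using nn_integral_lborel_shift[of "\<lambda>u. ennreal \<bar>?D u\<bar>" "- _"]
    by (simp add: nn_integral_multc nn_integral_cmult m_def)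
  also have "\<dots> \<le> ennreal (2 * (norm z / sqrt h) powr \<beta>) * ennreal (2 * (norm z / sqrt h) powr \<beta>)"
    unfolding m_def by (intro mult_mono diffk_heat_mass h b) auto
  also have "\<dots> = ennreal (4 * ((norm z / sqrt h)\<^sup>2) powr \<beta>)"
    unfolding power2_eq_square powr_mult by (simp add: ennreal_mult[symmetric] mult_ac)
  also have "(norm z / sqrt h)\<^sup>2 = 2 * (norm z / sqrt \<tau>)\<^sup>2"
    using t by (simp add: h_def power_divide)
  also have "(2 * (norm z / sqrt \<tau>)\<^sup>2) powr \<beta> = 2 powr \<beta> * (norm z / sqrt \<tau>) powr (2 * \<beta>)"
    using t by (simp add: powr_mult powr_powr[symmetric])
  finally show ?thesis by (simp add: mult.assoc)
qed

section \<open>The Garsia--Rodemich--Rumsey inequality\<close>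

lemma geometric_increments_limit:
  fixes a :: "nat \<Rightarrow> real"
  assumes inc: "\<And>k. \<bar>a k - a (Suc k)\<bar> \<le> c * r ^ k" and r: "0 \<le> r" "r < 1" and c: "0 \<le> c"
    and lim: "a \<longlonglongrightarrow> l"
  shows "\<bar>a 0 - l\<bar> \<le> c / (1 - r)"
proof -
  have "\<bar>a 0 - a n\<bar> \<le> c / (1 - r)" for n
  proof -
    have "\<bar>a 0 - a n\<bar> \<le> (\<Sum>k<n. c * r ^ k)"
    proof (induction n)
      case (Suc n) then show ?case using inc[of n] by simp
    qed simp
    also have "\<dots> = c * (\<Sum>k<n. r ^ k)" by (simp add: sum_distrib_left)
    also have "\<dots> \<le> c * (1 / (1 - r))"
      using sum_le_suminf[of "\<lambda>k. r ^ k" "{..<n}"] suminf_geometric[of r] r c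
      by (intro mult_left_mono) auto
    finally show ?thesis by simp
  qed
  moreover have "(\<lambda>n. \<bar>a 0 - a n\<bar>) \<longlonglongrightarrow> \<bar>a 0 - l\<bar>"
    by (intro tendsto_intros lim)
  ultimately show ?thesis by (meson LIMSEQ_le_const2)
qed

lemma homothety_cball:
  fixes x :: "'a::euclidean_space"
  assumes "x \<in> cball c R" "z \<in> cball c R" "0 \<le> \<theta>" "\<theta> \<le> 1"
  shows "x + \<theta> *\<^sub>R (z - x) \<in> cball c R" "norm (\<theta> *\<^sub>R (z - x)) \<le> 2 * R * \<theta>"
proof -
  have "(1 - \<theta>) *\<^sub>R x + \<theta> *\<^sub>R z \<in> cball c R"
    using convex_cball assms by (intro convexD) auto
  then show "x + \<theta> *\<^sub>R (z - x) \<in> cball c R" by (simp add: algebra_simps)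
  have "norm (z - x) \<le> 2 * R"
    using assms dist_triangle2[of z x c] by (simp add: dist_norm norm_minus_commute)
  then show "norm (\<theta> *\<^sub>R (z - x)) \<le> 2 * R * \<theta>"
    using assms by (simp add: mult.commute mult_left_mono)
qed

lemma nn_integral_homothety_le:
  fixes x :: "'a::euclidean_space"
  assumes [measurable]: "h \<in> borel_measurable borel" and x: "x \<in> cball c R" and th: "0 < \<theta>" "\<theta> \<le> 1"
  shows "(\<integral>\<^sup>+z\<in>cball c R. h (x + \<theta> *\<^sub>R (z - x)) \<partial>lborel)
    \<le> ennreal (1 / \<theta> ^ DIM('a)) * (\<integral>\<^sup>+z\<in>cball c R. h z \<partial>lborel)"
proof -
  let ?t = "(1 - \<theta>) *\<^sub>R x"
  have [measurable]: "cball c R \<in> sets borel" by auto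
  have "(\<integral>\<^sup>+z. h z * indicator (cball c R) z \<partial>lborel)
     = (\<integral>\<^sup>+z. h z * indicator (cball c R) z \<partial>density (distr lborel borel (\<lambda>x. ?t + \<theta> *\<^sub>R x)) (\<lambda>_. \<bar>\<theta>\<bar>^DIM('a)))"
    using lborel_affine[of \<theta> ?t] th by simp
  also have "\<dots> = ennreal (\<theta> ^ DIM('a)) * (\<integral>\<^sup>+z. h (?t + \<theta> *\<^sub>R z) * indicator (cball c R) (?t + \<theta> *\<^sub>R z) \<partial>lborel)"
    using th
    apply (subst nn_integral_density, measurable)
    apply (subst nn_integral_distr, measurable)
    apply (simp add: nn_integral_cmult)
    done
  also have "\<dots> \<ge> ennreal (\<theta> ^ DIM('a)) * (\<integral>\<^sup>+z. h (x + \<theta> *\<^sub>R (z - x)) * indicator (cball c R) z \<partial>lborel)"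
  proof (intro mult_left_mono nn_integral_mono)
    fix z
    have "x + \<theta> *\<^sub>R (z - x) = ?t + \<theta> *\<^sub>R z" by (simp add: algebra_simps)
    then show "h (x + \<theta> *\<^sub>R (z - x)) * indicator (cball c R) z \<le> h (?t + \<theta> *\<^sub>R z) * indicator (cball c R) (?t + \<theta> *\<^sub>R z)"
      using homothety_cball(1)[OF x, of z \<theta>] th by (auto simp: indicator_def simp del: mem_cball)
  qed simp
  finally have "ennreal (1 / \<theta> ^ DIM('a)) * (ennreal (\<theta> ^ DIM('a)) * (\<integral>\<^sup>+z. h (x + \<theta> *\<^sub>R (z - x)) * indicator (cball c R) z \<partial>lborel))
     \<le> ennreal (1 / \<theta> ^ DIM('a)) * (\<integral>\<^sup>+z. h z * indicator (cball c R) z \<partial>lborel)"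
    by (intro mult_left_mono) auto
  moreover have "ennreal (1 / \<theta> ^ DIM('a)) * (ennreal (\<theta> ^ DIM('a)) * y) = y" for y
    using th by (simp add: mult.assoc[symmetric] ennreal_mult[symmetric])
  ultimately show ?thesis by simp
qed

lemma grr_average_step:
  fixes g :: "'a::euclidean_space \<Rightarrow> real"
  defines "B \<equiv> \<lambda>c R. cball (c::'a) R" and "\<gamma> \<equiv> \<lambda>m \<beta>. \<beta> * m + 2 * real DIM('a)"
  assumes R: "0 < R" and m: "1 \<le> m" and b: "0 < \<beta>"
    and [measurable]: "g \<in> borel_measurable borel" and bd: "\<And>z. \<bar>g z\<bar> \<le> K"
    and x: "x \<in> B c R" and y: "y \<in> B c R" and th: "0 < \<theta>" "\<theta> \<le> 1" "\<theta> / 2 \<le> \<theta>'" "\<theta>' \<le> \<theta>"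
    and xy: "norm (x - y) \<le> 2 * R * \<theta>" and q: "0 < q"
    and Q: "(\<integral>\<^sup>+u\<in>B c R. (\<integral>\<^sup>+v\<in>B c R. ennreal (\<bar>g u - g v\<bar> powr m / norm (u - v) powr \<gamma> m \<beta>) \<partial>lborel) \<partial>lborel) \<le> ennreal q"
  shows "\<bar>(LINT z|uniform_measure lborel (B c R). g (x + \<theta> *\<^sub>R (z - x))) - (LINT z|uniform_measure lborel (B c R). g (y + \<theta>' *\<^sub>R (z - y)))\<bar>
    \<le> 2 * ((2 ^ DIM('a) / (unit_ball_vol (real DIM('a)))\<^sup>2 * 6 powr \<gamma> m \<beta>) powr (1 / m) * (R * \<theta>) powr \<beta> * q powr (1 / m))"
proof -
  define U where "U = uniform_measure lborel (B c R)"
  define vol where "vol = unit_ball_vol (real DIM('a)) * R ^ DIM('a)"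
  have vol: "0 < vol" using R by (simp add: vol_def)
  have emB: "emeasure lborel (B c R) = ennreal vol"
    using R by (simp add: B_def vol_def emeasure_cball)
  have [measurable]: "B c R \<in> sets borel" by (simp add: B_def)
  interpret U: prob_space U
    unfolding U_def by (rule prob_space_uniform_measure) (use vol emB in auto)
  have setsU [measurable_cong]: "sets U = sets borel" by (simp add: U_def)
  have AEU: "AE z in U. z \<in> B c R"
    unfolding U_def by (rule AE_uniform_measureI) auto
  have nnU: "(\<integral>\<^sup>+z. f z \<partial>U) = (\<integral>\<^sup>+z\<in>B c R. f z \<partial>lborel) * ennreal (1 / vol)" if [measurable]: "f \<in> borel_measurable borel" for f
    unfolding U_def using vol
    by (subst nn_integral_uniform_measure) (auto simp: emB divide_ennreal_def inverse_ennreal field_simps)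
  have th': "0 < \<theta>'" "\<theta>' \<le> 1" using th by auto
  define \<phi> where "\<phi> z = x + \<theta> *\<^sub>R (z - x)" for z
  define \<phi>' where "\<phi>' z = y + \<theta>' *\<^sub>R (z - y)" for z
  have [measurable]: "\<phi> \<in> borel_measurable borel" "\<phi>' \<in> borel_measurable borel"
    by (auto simp: \<phi>_def[abs_def] \<phi>'_def[abs_def])
  define L where "L = 6 * (R * \<theta>)"
  have L: "0 < L" using R th by (simp add: L_def)
  have close: "norm (\<phi> z - \<phi>' z') \<le> L" if "z \<in> B c R" "z' \<in> B c R" for z z'
  proof -
    have "norm (\<phi> z - \<phi>' z') \<le> norm (x - y) + norm (\<theta> *\<^sub>R (z - x)) + norm (\<theta>' *\<^sub>R (z' - y))"
    proof -
      have "\<phi> z - \<phi>' z' = (x - y) + \<theta> *\<^sub>R (z - x) - \<theta>' *\<^sub>R (z' - y)" by (simp add: \<phi>_def \<phi>'_def)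
      then show ?thesis
        using norm_triangle_ineq4[of "(x - y) + \<theta> *\<^sub>R (z - x)" "\<theta>' *\<^sub>R (z' - y)"]
          norm_triangle_ineq[of "x - y" "\<theta> *\<^sub>R (z - x)"] by simp
    qed
    also have "\<dots> \<le> 2 * R * \<theta> + 2 * R * \<theta> + 2 * R * \<theta>'"
      using that x y th th' by (intro add_mono xy homothety_cball(2)) (auto simp: B_def)
    also have "\<dots> \<le> L" using R th by (simp add: L_def)
    finally show ?thesis .
  qed
  define P where "P u v = \<bar>g u - g v\<bar> powr m / norm (u - v) powr \<gamma> m \<beta>" for u v
  have [measurable]: "(\<lambda>(u, v). P u v) \<in> borel_measurable (borel \<Otimes>\<^sub>M borel)"
    unfolding P_def by measurable
  define \<mu> where "\<mu> = (2 ^ DIM('a) / (unit_ball_vol (real DIM('a)))\<^sup>2 * 6 powr \<gamma> m \<beta>) powr (1 / m) * (R * \<theta>) powr \<beta> * q powr (1 / m)"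
  have ubv: "unit_ball_vol (real DIM('a)) \<noteq> 0"
    by (metis less_irrefl of_nat_0_le_iff unit_ball_vol_pos)
  have lam: "0 < \<mu>" using R th q ubv by (simp add: \<mu>_def)
  have lam_m: "\<mu> powr m = 2 ^ DIM('a) / (unit_ball_vol (real DIM('a)))\<^sup>2 * 6 powr \<gamma> m \<beta> * (R * \<theta>) powr (\<beta> * m) * q"
    using m q by (simp add: \<mu>_def powr_mult powr_powr)
  have pt: "\<bar>g u - g v\<bar> \<le> \<mu> + \<mu> powr (1 - m) * L powr \<gamma> m \<beta> * P u v" if "norm (u - v) \<le> L" for u v
  proof (cases "u = v")
    case False
    define a where "a = \<bar>g u - g v\<bar>"
    have "a powr m \<le> L powr \<gamma> m \<beta> * P u v"
    proof -
      have "a powr m = norm (u - v) powr \<gamma> m \<beta> * P u v" using False by (simp add: P_def a_def)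
      also have "\<dots> \<le> L powr \<gamma> m \<beta> * P u v"
        using that m b by (intro mult_right_mono powr_mono2) (auto simp: \<gamma>_def P_def)
      finally show ?thesis .
    qed
    then have *: "\<mu> powr (1 - m) * a powr m \<le> \<mu> powr (1 - m) * (L powr \<gamma> m \<beta> * P u v)"
      by (intro mult_left_mono) auto
    have "a \<le> \<mu> + \<mu> powr (1 - m) * a powr m"
    proof (cases "a \<le> \<mu>")
      case True then show ?thesis by (smt (verit) mult_nonneg_nonneg powr_ge_zero)
    next
      case False
      then have "a = a powr (1 - m) * a powr m" using lam by (simp add: powr_add[symmetric])
      also have "\<dots> \<le> \<mu> powr (1 - m) * a powr m"
        using False lam m by (intro mult_right_mono powr_mono2') auto
      finally show ?thesis using lam by linarith
    qed
    with * show ?thesis by (simp add: a_def mult.assoc)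
  qed (use lam in \<open>simp add: P_def\<close>)
  have int: "integrable U (\<lambda>z. g (f z))" if [measurable]: "f \<in> borel_measurable borel" for f
    by (rule U.integrable_const_bound[where B=K]) (auto simp: bd)
  define A where "A = (LINT z|U. g (\<phi> z))"
  define A' where "A' = (LINT z|U. g (\<phi>' z))"
  have "A - A' = (LINT z|U. g (\<phi> z) - A')"
    unfolding A_def using int[of \<phi>] by (simp add: U.prob_space)
  then have "ennreal \<bar>A - A'\<bar> \<le> (\<integral>\<^sup>+z. ennreal \<bar>g (\<phi> z) - A'\<bar> \<partial>U)"
    using integral_norm_bound_ennreal[of U "\<lambda>z. g (\<phi> z) - A'"] int[of \<phi>] by simp
  also have "\<dots> \<le> (\<integral>\<^sup>+z. (\<integral>\<^sup>+z'. ennreal \<bar>g (\<phi> z) - g (\<phi>' z')\<bar> \<partial>U) \<partial>U)"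
  proof (intro nn_integral_mono)
    fix z
    have "g (\<phi> z) - A' = (LINT z'|U. g (\<phi> z) - g (\<phi>' z'))"
      unfolding A'_def using int[of \<phi>'] by (simp add: U.prob_space)
    then show "ennreal \<bar>g (\<phi> z) - A'\<bar> \<le> (\<integral>\<^sup>+z'. ennreal \<bar>g (\<phi> z) - g (\<phi>' z')\<bar> \<partial>U)"
      using integral_norm_bound_ennreal[of U "\<lambda>z'. g (\<phi> z) - g (\<phi>' z')"] int[of \<phi>'] by simp
  qed
  also have "\<dots> \<le> (\<integral>\<^sup>+z. (\<integral>\<^sup>+z'. ennreal \<mu> + ennreal (\<mu> powr (1 - m) * L powr \<gamma> m \<beta>) * ennreal (P (\<phi> z) (\<phi>' z')) \<partial>U) \<partial>U)"
  proof (rule nn_integral_mono_AE, use AEU in eventually_elim, rule nn_integral_mono_AE, use AEU in eventually_elim)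
    fix z z' assume "z \<in> B c R" "z' \<in> B c R"
    from pt[OF close[OF this]] show "ennreal \<bar>g (\<phi> z) - g (\<phi>' z')\<bar> \<le> ennreal \<mu> + ennreal (\<mu> powr (1 - m) * L powr \<gamma> m \<beta>) * ennreal (P (\<phi> z) (\<phi>' z'))"
      using lam by (simp add: P_def ennreal_mult[symmetric] ennreal_plus[symmetric] ennreal_leI del: ennreal_plus)
  qed
  also have "\<dots> = ennreal \<mu> + ennreal (\<mu> powr (1 - m) * L powr \<gamma> m \<beta>) * (\<integral>\<^sup>+z. (\<integral>\<^sup>+z'. ennreal (P (\<phi> z) (\<phi>' z')) \<partial>U) \<partial>U)"
    by (simp add: nn_integral_add nn_integral_cmult U.emeasure_space_1)
  also have "(\<integral>\<^sup>+z. (\<integral>\<^sup>+z'. ennreal (P (\<phi> z) (\<phi>' z')) \<partial>U) \<partial>U)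
     \<le> ennreal (1 / \<theta>' ^ DIM('a)) * ennreal (1 / \<theta> ^ DIM('a)) * (ennreal (1 / vol) * ennreal (1 / vol)) * ennreal q"
  proof -
    have "(\<integral>\<^sup>+z. (\<integral>\<^sup>+z'. ennreal (P (\<phi> z) (\<phi>' z')) \<partial>U) \<partial>U)
      = (\<integral>\<^sup>+z\<in>B c R. ((\<integral>\<^sup>+z'\<in>B c R. ennreal (P (\<phi> z) (\<phi>' z')) \<partial>lborel) * ennreal (1 / vol)) \<partial>lborel) * ennreal (1 / vol)"
      by (simp add: nnU)
    also have "\<dots> \<le> (\<integral>\<^sup>+z\<in>B c R. ((ennreal (1 / \<theta>' ^ DIM('a)) * (\<integral>\<^sup>+v\<in>B c R. ennreal (P (\<phi> z) v) \<partial>lborel)) * ennreal (1 / vol)) \<partial>lborel) * ennreal (1 / vol)"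
    proof (intro mult_right_mono nn_integral_mono)
      fix z
      show "(\<integral>\<^sup>+z'\<in>B c R. ennreal (P (\<phi> z) (\<phi>' z')) \<partial>lborel) \<le> ennreal (1 / \<theta>' ^ DIM('a)) * (\<integral>\<^sup>+v\<in>B c R. ennreal (P (\<phi> z) v) \<partial>lborel)"
        using nn_integral_homothety_le[of "\<lambda>v. ennreal (P (\<phi> z) v)" y c R \<theta>'] th' y unfolding \<phi>'_def B_def
        by simp
    qed auto
    also have "\<dots> = ennreal (1 / \<theta>' ^ DIM('a)) * (ennreal (1 / vol) * ennreal (1 / vol)) * (\<integral>\<^sup>+z\<in>B c R. (\<integral>\<^sup>+v\<in>B c R. ennreal (P (\<phi> z) v) \<partial>lborel) \<partial>lborel)"
    proof -
      have "(\<integral>\<^sup>+z\<in>B c R. ((ennreal (1 / \<theta>' ^ DIM('a)) * (\<integral>\<^sup>+v\<in>B c R. ennreal (P (\<phi> z) v) \<partial>lborel)) * ennreal (1 / vol)) \<partial>lborel)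
        = (\<integral>\<^sup>+z. (ennreal (1 / \<theta>' ^ DIM('a)) * ennreal (1 / vol)) * ((\<integral>\<^sup>+v\<in>B c R. ennreal (P (\<phi> z) v) \<partial>lborel) * indicator (B c R) z) \<partial>lborel)"
        by (intro nn_integral_cong) (simp add: mult_ac)
      also have "\<dots> = (ennreal (1 / \<theta>' ^ DIM('a)) * ennreal (1 / vol)) * (\<integral>\<^sup>+z\<in>B c R. (\<integral>\<^sup>+v\<in>B c R. ennreal (P (\<phi> z) v) \<partial>lborel) \<partial>lborel)"
        by (subst nn_integral_cmult) auto
      finally show ?thesis by (simp add: mult_ac)
    qed
    also have "\<dots> \<le> ennreal (1 / \<theta>' ^ DIM('a)) * (ennreal (1 / vol) * ennreal (1 / vol)) * (ennreal (1 / \<theta> ^ DIM('a)) *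
        (\<integral>\<^sup>+u\<in>B c R. (\<integral>\<^sup>+v\<in>B c R. ennreal (P u v) \<partial>lborel) \<partial>lborel))"
    proof (intro mult_left_mono)
      have "(\<lambda>u. \<integral>\<^sup>+v\<in>B c R. ennreal (P u v) \<partial>lborel) \<in> borel_measurable borel" by measurable
      from nn_integral_homothety_le[OF this, of x c R \<theta>] th x
      show "(\<integral>\<^sup>+z\<in>B c R. (\<integral>\<^sup>+v\<in>B c R. ennreal (P (\<phi> z) v) \<partial>lborel) \<partial>lborel)
         \<le> ennreal (1 / \<theta> ^ DIM('a)) * (\<integral>\<^sup>+u\<in>B c R. (\<integral>\<^sup>+v\<in>B c R. ennreal (P u v) \<partial>lborel) \<partial>lborel)"
        unfolding \<phi>_def B_def by simp
    qed auto
    also have "\<dots> \<le> ennreal (1 / \<theta>' ^ DIM('a)) * (ennreal (1 / vol) * ennreal (1 / vol)) * (ennreal (1 / \<theta> ^ DIM('a)) * ennreal q)"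
      by (intro mult_left_mono Q[folded P_def]) auto
    finally show ?thesis by (simp add: mult_ac)
  qed
  finally have "ennreal \<bar>A - A'\<bar> \<le> ennreal (\<mu> + \<mu> powr (1 - m) * L powr \<gamma> m \<beta> * (1 / \<theta>' ^ DIM('a) * (1 / \<theta> ^ DIM('a)) * (1 / vol * (1 / vol)) * q))"
    using lam vol q th th' by (simp add: mult_left_mono ennreal_mult[symmetric] ennreal_plus[symmetric] del: ennreal_plus)
  then have "\<bar>A - A'\<bar> \<le> \<mu> + \<mu> powr (1 - m) * (L powr \<gamma> m \<beta> * (1 / \<theta>' ^ DIM('a) * (1 / \<theta> ^ DIM('a)) * (1 / vol * (1 / vol)) * q))"
    using lam vol q th th' by (subst (asm) ennreal_le_iff) (auto simp: mult.assoc)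
  also have "L powr \<gamma> m \<beta> * (1 / \<theta>' ^ DIM('a) * (1 / \<theta> ^ DIM('a)) * (1 / vol * (1 / vol)) * q) \<le> \<mu> powr m"
  proof -
    have "1 / \<theta>' ^ DIM('a) \<le> 2 ^ DIM('a) / \<theta> ^ DIM('a)"
      using power_mono[of "\<theta> / 2" "\<theta>'" "DIM('a)"] th th' by (simp add: field_simps power_divide)
    then have le: "L powr \<gamma> m \<beta> * (1 / \<theta>' ^ DIM('a) * (1 / \<theta> ^ DIM('a)) * (1 / vol * (1 / vol)) * q)
      \<le> L powr \<gamma> m \<beta> * (2 ^ DIM('a) / \<theta> ^ DIM('a) * (1 / \<theta> ^ DIM('a)) * (1 / vol * (1 / vol)) * q)"
      using th vol q by (intro mult_left_mono mult_right_mono) auto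
    have Lp: "L powr \<gamma> m \<beta> = 6 powr \<gamma> m \<beta> * (R * \<theta>) powr (\<beta> * m) * ((R * \<theta>) ^ DIM('a))\<^sup>2"
    proof -
      have "(R * \<theta>) powr (2 * real DIM('a)) = ((R * \<theta>) ^ DIM('a))\<^sup>2"
        using powr_realpow[of "R * \<theta>" "2 * DIM('a)"] R th by (simp add: power_even_eq)
      then show ?thesis by (simp add: L_def powr_mult[of 6] \<gamma>_def powr_add[of "R * \<theta>"])
    qed
    have "L powr \<gamma> m \<beta> * (2 ^ DIM('a) / \<theta> ^ DIM('a) * (1 / \<theta> ^ DIM('a)) * (1 / vol * (1 / vol)) * q) = \<mu> powr m"
    proof -
      have alg: "x * y * (b * a)\<^sup>2 * (e / a * (1 / a) * (1 / (w * b) * (1 / (w * b))) * q) = e / w\<^sup>2 * x * y * q"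
        if "a \<noteq> 0" "b \<noteq> 0" "w \<noteq> 0" for x y a b e w :: real
        using that by (simp add: field_simps power2_eq_square)
      show ?thesis
        unfolding Lp lam_m vol_def power_mult_distrib[of R \<theta>] by (rule alg) (use R th ubv in auto)
    qed
    with le show ?thesis by simp
  qed
  then have "\<mu> powr (1 - m) * (L powr \<gamma> m \<beta> * (1 / \<theta>' ^ DIM('a) * (1 / \<theta> ^ DIM('a)) * (1 / vol * (1 / vol)) * q)) \<le> \<mu> powr (1 - m) * \<mu> powr m"
    by (intro mult_left_mono) auto
  also have "\<dots> = \<mu>" using lam by (simp add: powr_add[symmetric])
  finally have "\<bar>A - A'\<bar> \<le> 2 * \<mu>" by simp
  then show ?thesis
    unfolding A_def A'_def \<phi>_def \<phi>'_def U_def \<mu>_def .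
qed


definition grr_const :: "nat \<Rightarrow> real \<Rightarrow> real \<Rightarrow> real" where
  "grr_const d m \<beta> = (2 * (2 ^ d / (unit_ball_vol (real d))\<^sup>2 * 6 powr (\<beta> * m + 2 * real d)) powr (1 / m)
     * 2 powr (- \<beta>) * (1 + 2 / (1 - 2 powr (- \<beta>)))) powr m"

text \<open>The values at \<open>x\<close> and \<open>y\<close> are the limits of the averages over homothetic copies of the
  ball which shrink to \<open>x\<close> and \<open>y\<close>; the two largest copies have radius comparable to \<open>\<bar>x - y\<bar>\<close>.\<close>

lemma garsia_rodemich_rumsey:
  fixes G :: "'a::euclidean_space \<Rightarrow> real"
  assumes R: "0 < R" and m: "1 \<le> m" and b: "0 < \<beta>" and cont: "continuous_on (cball c R) G"
    and x: "x \<in> cball c R" and y: "y \<in> cball c R"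
  shows "ennreal (\<bar>G x - G y\<bar> powr m) \<le> ennreal (grr_const DIM('a) m \<beta> * norm (x - y) powr (\<beta> * m)) *
    (\<integral>\<^sup>+u\<in>cball c R. (\<integral>\<^sup>+v\<in>cball c R.
       ennreal (\<bar>G u - G v\<bar> powr m / norm (u - v) powr (\<beta> * m + 2 * real DIM('a))) \<partial>lborel) \<partial>lborel)"
    (is "_ \<le> _ * ?Q")
proof (cases "x = y")
  case True then show ?thesis by simp
next
  case False
  let ?B = "cball c R"
  define K1 where "K1 = (2 ^ DIM('a) / (unit_ball_vol (real DIM('a)))\<^sup>2 * 6 powr (\<beta> * m + 2 * real DIM('a))) powr (1 / m)"
  have ubv: "unit_ball_vol (real DIM('a)) \<noteq> 0"
    by (metis less_irrefl of_nat_0_le_iff unit_ball_vol_pos)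
  then have K1: "0 < K1" by (simp add: K1_def)
  have r: "0 < 2 powr (- \<beta>)" "2 powr (- \<beta>) < (1::real)"
    using b powr_less_mono[of "- \<beta>" 0 2] by auto
  define K where "K = 2 * K1 * 2 powr (- \<beta>) * (1 + 2 / (1 - 2 powr (- \<beta>)))"
  have K: "0 < K" unfolding K_def using K1 r
    by (intro mult_pos_pos add_pos_pos divide_pos_pos) auto
  have Kc: "grr_const DIM('a) m \<beta> = K powr m"
    by (simp add: grr_const_def K_def K1_def)
  define g where "g z = (if z \<in> ?B then G z else 0)" for z
  have gm [measurable]: "g \<in> borel_measurable borel"
    unfolding g_def[abs_def] using borel_measurable_continuous_on_if[of ?B G "\<lambda>_. 0"] cont
    by (auto intro!: borel_measurable_continuous_on_if)
  have "bounded (G ` ?B)"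
    using compact_continuous_image[OF cont] compact_imp_bounded by auto
  then obtain K0 where K0: "\<And>z. z \<in> ?B \<Longrightarrow> \<bar>G z\<bar> \<le> K0"
    by (auto simp: bounded_iff simp del: mem_cball)
  have K0': "0 \<le> K0" using K0[OF x] by linarith
  have bd: "\<bar>g z\<bar> \<le> K0" for z using K0 K0' by (auto simp: g_def)
  have Qg: "?Q = (\<integral>\<^sup>+u\<in>?B. (\<integral>\<^sup>+v\<in>?B.
       ennreal (\<bar>g u - g v\<bar> powr m / norm (u - v) powr (\<beta> * m + 2 * real DIM('a))) \<partial>lborel) \<partial>lborel)"
    by (intro nn_integral_cong) (auto simp: g_def indicator_def intro!: nn_integral_cong)
  define U where "U = uniform_measure lborel ?B"
  have emB: "emeasure lborel ?B = ennreal (unit_ball_vol (real DIM('a)) * R ^ DIM('a))"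
    using R by (simp add: emeasure_cball)
  interpret U: prob_space U
    unfolding U_def by (rule prob_space_uniform_measure) (use R emB ubv in auto)
  have setsU [measurable_cong]: "sets U = sets borel" by (simp add: U_def)
  have AEU: "AE z in U. z \<in> ?B"
    unfolding U_def by (rule AE_uniform_measureI) auto
  define A where "A x \<theta> = (LINT z|U. g (x + \<theta> *\<^sub>R (z - x)))" for x \<theta>
  have Alim: "(\<lambda>k. A x (t * (1 / 2) ^ k)) \<longlonglongrightarrow> G x" if x: "x \<in> ?B" and t: "0 < t" "t \<le> 1" for x t
  proof -
    have "(\<lambda>k. A x (t * (1 / 2) ^ k)) \<longlonglongrightarrow> (LINT z|U. G x)"
      unfolding A_def
    proof (rule integral_dominated_convergence[where w="\<lambda>_. K0"])
      show "AE z in U. (\<lambda>k. g (x + (t * (1 / 2) ^ k) *\<^sub>R (z - x))) \<longlonglongrightarrow> G x"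
        using AEU
      proof eventually_elim
        case (elim z)
        have in_B: "x + (t * (1 / 2) ^ k) *\<^sub>R (z - x) \<in> ?B" for k
          using homothety_cball(1)[OF x elim, of "t * (1/2)^k"] t
          by (simp add: mult_le_one power_le_one del: mem_cball)
        have "(\<lambda>k. x + (t * (1 / 2) ^ k) *\<^sub>R (z - x)) \<longlonglongrightarrow> x + (t * 0) *\<^sub>R (z - x)"
          by (intro tendsto_intros LIMSEQ_power_zero) auto
        then have "(\<lambda>k. G (x + (t * (1 / 2) ^ k) *\<^sub>R (z - x))) \<longlonglongrightarrow> G x"
          using cont x in_B by (auto simp: continuous_on_sequentially comp_def simp del: mem_cball)
        then show ?case using in_B by (simp add: g_def del: mem_cball)
      qed
    qed (auto simp: bd)
    then show ?thesis by (simp add: U.prob_space)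
  qed
  define t0 where "t0 = norm (x - y) / (2 * R)"
  have "norm (x - y) \<le> 2 * R"
    using x y dist_triangle2[of x y c] by (simp add: dist_norm norm_minus_commute)
  then have t0: "0 < t0" "t0 \<le> 1" using False R by (auto simp: t0_def)
  have main: "\<bar>G x - G y\<bar> powr m \<le> K powr m * norm (x - y) powr (\<beta> * m) * q" if q: "0 < q" and Q: "?Q \<le> ennreal q" for q
  proof -
    define c1 where "c1 = 2 * (K1 * (R * t0) powr \<beta> * q powr (1 / m))"
    have c1: "0 \<le> c1" using K1 by (simp add: c1_def)
    have step: "\<bar>A a \<theta> - A b \<theta>'\<bar> \<le> 2 * (K1 * (R * \<theta>) powr \<beta> * q powr (1 / m))"
      if "a \<in> ?B" "b \<in> ?B" "0 < \<theta>" "\<theta> \<le> 1" "\<theta> / 2 \<le> \<theta>'" "\<theta>' \<le> \<theta>" "norm (a - b) \<le> 2 * R * \<theta>" for a b \<theta> \<theta>'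
      using grr_average_step[OF R m \<open>0 < \<beta>\<close> gm bd that q Q[unfolded Qg]]
      unfolding A_def U_def K1_def .
    have each: "\<bar>A a t0 - G a\<bar> \<le> c1 / (1 - 2 powr (- \<beta>))" if a: "a \<in> ?B" for a
    proof -
      have "\<bar>A a (t0 * (1 / 2) ^ 0) - G a\<bar> \<le> c1 / (1 - 2 powr (- \<beta>))"
      proof (rule geometric_increments_limit[OF _ _ _ _ Alim[OF a t0]])
        fix k
        have "\<bar>A a (t0 * (1 / 2) ^ k) - A a (t0 * (1 / 2) ^ Suc k)\<bar> \<le> 2 * (K1 * (R * (t0 * (1 / 2) ^ k)) powr \<beta> * q powr (1 / m))"
          using t0 R by (intro step a) (auto simp: mult_le_one power_le_one)
        also have "(R * (t0 * (1 / 2) ^ k)) powr \<beta> = (R * t0) powr \<beta> * (2 powr (- \<beta>)) ^ k"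
        proof -
          have "((1 / 2) ^ k) powr \<beta> = (2 powr (- \<beta>)) ^ k"
            by (induction k) (simp_all add: powr_mult powr_minus powr_divide inverse_eq_divide power_divide)
          then show ?thesis by (simp add: powr_mult mult.assoc[symmetric])
        qed
        finally show "\<bar>A a (t0 * (1 / 2) ^ k) - A a (t0 * (1 / 2) ^ Suc k)\<bar> \<le> c1 * (2 powr (- \<beta>)) ^ k"
          by (simp add: c1_def mult_ac)
      qed (use r c1 in auto)
      then show ?thesis by simp
    qed
    have "\<bar>A x t0 - A y t0\<bar> \<le> c1"
      unfolding c1_def using t0 R by (intro step x y) (auto simp: t0_def)
    then have "\<bar>G x - G y\<bar> \<le> c1 + 2 * (c1 / (1 - 2 powr (- \<beta>)))"
      using each[OF x] each[OF y] by linarith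
    also have "\<dots> = K * norm (x - y) powr \<beta> * q powr (1 / m)"
    proof -
      have "(R * t0) powr \<beta> = norm (x - y) powr \<beta> * 2 powr (- \<beta>)"
      proof -
        have "R * t0 = norm (x - y) / 2" using R by (simp add: t0_def)
        then have "(R * t0) powr \<beta> = (norm (x - y) / 2) powr \<beta>" by (simp only:)
        then show ?thesis by (simp add: powr_divide powr_minus divide_inverse[of _ "2 powr \<beta>"])
      qed
      then show ?thesis by (simp add: c1_def K_def distrib_left mult_ac)
    qed
    finally have "\<bar>G x - G y\<bar> powr m \<le> (K * norm (x - y) powr \<beta> * q powr (1 / m)) powr m"
      using m by (intro powr_mono2) auto
    then show ?thesis using m q by (simp add: powr_mult powr_powr)
  qed
  have nz: "0 < K powr m * norm (x - y) powr (\<beta> * m)" using K False by simp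
  show ?thesis
  proof (cases ?Q)
    case (real q)
    have lim: "((\<lambda>\<eta>. K powr m * norm (x - y) powr (\<beta> * m) * (q + \<eta>)) \<longlongrightarrow> K powr m * norm (x - y) powr (\<beta> * m) * (q + 0)) (at_right 0)"
      by (intro tendsto_intros)
    have "\<bar>G x - G y\<bar> powr m \<le> K powr m * norm (x - y) powr (\<beta> * m) * (q + 0)"
    proof (rule tendsto_lowerbound[OF lim])
      show "\<forall>\<^sub>F \<eta> in at_right 0. \<bar>G x - G y\<bar> powr m \<le> K powr m * norm (x - y) powr (\<beta> * m) * (q + \<eta>)"
        using eventually_at_right_less[of 0]
        by eventually_elim (rule main, use real in \<open>auto simp: ennreal_leI\<close>)
    qed simp
    then show ?thesis using real nz unfolding Kc by (simp add: ennreal_mult[symmetric] ennreal_leI)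
  next
    case top
    have t: "ennreal x * \<top> = \<top>" if "0 < x" for x
      using that by (simp add: ennreal_mult_top)
    show ?thesis unfolding Kc top t[OF nz] by simp
  qed
qed

section \<open>Moment kernels\<close>

lemma Lnorm_mult_half:
  assumes [measurable]: "f \<in> borel_measurable M" "g \<in> borel_measurable M" and p: "0 < p"
  shows "Lnorm M (p / 2) (\<lambda>x. f x * g x) \<le> Lnorm M p f * Lnorm M p g"
proof -
  have "(\<integral>\<^sup>+x. (f x * g x) epowr (p / 2) \<partial>M) \<le> Lnorm M 2 (\<lambda>x. f x epowr (p / 2)) * Lnorm M 2 (\<lambda>x. g x epowr (p / 2))"
    unfolding epowr_mult by (rule hoelder) auto
  also have "\<dots> = (Lnorm M p f * Lnorm M p g) epowr (p / 2)"
    using p by (simp add: Lnorm_def epowr_mult)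
  finally show ?thesis using p by (simp add: Lnorm_le_iff)
qed

lemma conv_le_hoelder:
  fixes k b :: "'a::euclidean_space \<Rightarrow> ennreal"
  assumes [measurable]: "k \<in> borel_measurable borel" "b \<in> borel_measurable borel"
    and pq: "1 < p" "1 < q" "1 / p + 1 / q = 1"
  shows "conv k b s \<le> Lnorm lborel p k * Lnorm lborel q b"
proof -
  have "conv k b s \<le> Lnorm lborel p k * Lnorm lborel q (\<lambda>v. b (v + s))"
    unfolding conv_def add.commute[of s] by (rule hoelder) (use pq in auto)
  then show ?thesis by (simp add: Lnorm_lborel_shift)
qed

lemma Lnorm_conv_mult:
  fixes k a b :: "'a::euclidean_space \<Rightarrow> ennreal"
  assumes [measurable]: "k \<in> borel_measurable borel" "a \<in> borel_measurable borel" "b \<in> borel_measurable borel"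
    and q: "2 \<le> q"
  shows "Lnorm lborel q (conv k (\<lambda>r. a r * b r)) \<le> Lnorm lborel (q / (q - 1)) k * Lnorm lborel q a * Lnorm lborel q b"
proof -
  define q' where "q' = q / (q - 1)"
  have q': "1 < q'" "1 / q + 1 / q' = 1" "q' * (q - 1) = q" "q / q' = q - 1"
    using q by (auto simp: q'_def field_simps)
  define c where "c = conv (\<lambda>v. k v epowr q') (\<lambda>r. b r epowr q')"
  have [measurable]: "c \<in> borel_measurable borel" unfolding c_def by measurable
  have pt: "conv k (\<lambda>r. a r * b r) s \<le> Lnorm lborel q a * c s epowr (1 / q')" for s
  proof -
    have "conv k (\<lambda>r. a r * b r) s = (\<integral>\<^sup>+v. a (v + s) * (k v * b (v + s)) \<partial>lborel)"
      unfolding conv_def by (simp add: mult_ac add.commute)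
    also have "\<dots> \<le> Lnorm lborel q (\<lambda>v. a (v + s)) * Lnorm lborel q' (\<lambda>v. k v * b (v + s))"
      by (rule hoelder) (use q q' in auto)
    also have "Lnorm lborel q' (\<lambda>v. k v * b (v + s)) = c s epowr (1 / q')"
      by (simp add: Lnorm_def c_def conv_def epowr_mult add.commute)
    finally show ?thesis by (simp add: Lnorm_lborel_shift)
  qed
  have "Lnorm lborel q (conv k (\<lambda>r. a r * b r)) \<le> Lnorm lborel q (\<lambda>s. Lnorm lborel q a * c s epowr (1 / q'))"
    by (rule Lnorm_mono) (use q pt in auto)
  also have eq: "\<dots> = Lnorm lborel q a * Lnorm lborel q (\<lambda>s. c s epowr (1 / q'))"
    by (rule Lnorm_cmult) (use q in auto)
  finally have le: "Lnorm lborel q (conv k (\<lambda>r. a r * b r)) \<le> Lnorm lborel q a * Lnorm lborel q (\<lambda>s. c s epowr (1 / q'))" .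
  have "Lnorm lborel q (\<lambda>s. c s epowr (1 / q')) = (Lnorm lborel (q - 1) c) epowr (1 / q')"
    using q q'(1,3,4) by (simp add: Lnorm_def) (simp add: field_simps)
  also have "\<dots> \<le> ((\<integral>\<^sup>+v. k v epowr q' \<partial>lborel) * Lnorm lborel (q - 1) (\<lambda>r. b r epowr q')) epowr (1 / q')"
    unfolding c_def by (intro epowr_mono conv_Lnorm) (use q q' in auto)
  also have "\<dots> = Lnorm lborel q' k * Lnorm lborel q b"
    using q q'(1,3) by (simp add: Lnorm_def epowr_mult) (simp add: field_simps)
  finally have "Lnorm lborel q a * Lnorm lborel q (\<lambda>s. c s epowr (1 / q')) \<le> Lnorm lborel q a * (Lnorm lborel q' k * Lnorm lborel q b)"
    by (intro mult_left_mono) auto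
  with le show ?thesis
    unfolding q'_def by (simp add: mult_ac)
qed

lemma nn_integral_powr_neg:
  assumes "0 < H" "\<gamma> < 1"
  shows "(\<integral>\<^sup>+v. ennreal (v powr (- \<gamma>)) * indicator {0<..<H} v \<partial>lborel) = ennreal (H powr (1 - \<gamma>) / (1 - \<gamma>))"
proof -
  have hi: "((\<lambda>x. x powr (- \<gamma>)) has_integral (H powr (- \<gamma> + 1) / (- \<gamma> + 1))) {0..H}"
    by (rule has_integral_powr_from_0) (use assms in auto)
  have "(\<integral>\<^sup>+v. ennreal (v powr (- \<gamma>)) * indicator {0<..<H} v \<partial>lborel)
      = (\<integral>\<^sup>+v. ennreal (v powr (- \<gamma>) * indicator {0..H} v) \<partial>lborel)"
  proof (intro nn_integral_cong_AE)
    show "AE v in lborel. ennreal (v powr (- \<gamma>)) * indicator {0<..<H} v = ennreal (v powr (- \<gamma>) * indicator {0..H} v)"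
      using AE_lborel_singleton[of 0] AE_lborel_singleton[of H]
      by eventually_elim (auto simp: indicator_def)
  qed
  also have "\<dots> = ennreal (H powr (- \<gamma> + 1) / (- \<gamma> + 1))"
  proof (rule nn_integral_has_integral_lborel)
    show "((\<lambda>v. v powr (- \<gamma>) * indicator {0..H} v) has_integral (H powr (- \<gamma> + 1) / (- \<gamma> + 1))) UNIV"
    proof -
      have "(\<lambda>v. v powr (- \<gamma>) * indicator {0..H} v) = (\<lambda>v. if v \<in> {0..H} then v powr (- \<gamma>) else 0)"
        by (auto simp: fun_eq_iff)
      then show ?thesis using hi by (simp only: has_integral_restrict_UNIV)
    qed
  qed auto
  finally show ?thesis by (simp add: add.commute)
qed

definition power_kernel :: "real \<Rightarrow> real \<Rightarrow> real \<Rightarrow> real \<Rightarrow> ennreal" where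
  "power_kernel c \<gamma> H v = ennreal (c * v powr (- \<gamma>)) * indicator {0<..<H} v"

lemma power_kernel_measurable [measurable]: "power_kernel c \<gamma> H \<in> borel_measurable borel"
  unfolding power_kernel_def[abs_def] by measurable

lemma Lnorm_power_kernel:
  assumes "0 < H" "0 < \<rho>" "\<gamma> * \<rho> < 1" "0 \<le> c"
  shows "Lnorm lborel \<rho> (power_kernel c \<gamma> H)
    = ennreal (c * (1 / (1 - \<gamma> * \<rho>)) powr (1 / \<rho>) * H powr (1 / \<rho> - \<gamma>))"
proof -
  have "(\<integral>\<^sup>+v. power_kernel c \<gamma> H v epowr \<rho> \<partial>lborel)
    = (\<integral>\<^sup>+v. ennreal (c powr \<rho>) * (ennreal (v powr (- (\<gamma> * \<rho>))) * indicator {0<..<H} v) \<partial>lborel)"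
    using assms
    by (intro nn_integral_cong)
       (auto simp: power_kernel_def indicator_def powr_mult powr_powr ennreal_mult epowr_mult)
  also have "\<dots> = ennreal (c powr \<rho> * (H powr (1 - \<gamma> * \<rho>) / (1 - \<gamma> * \<rho>)))"
    using assms by (subst nn_integral_cmult) (auto simp: nn_integral_powr_neg ennreal_mult[symmetric])
  finally have "Lnorm lborel \<rho> (power_kernel c \<gamma> H) = ennreal ((c powr \<rho> * (H powr (1 - \<gamma> * \<rho>) * (1 / (1 - \<gamma> * \<rho>)))) powr (1 / \<rho>))"
    unfolding Lnorm_def using assms by simp
  also have "(c powr \<rho> * (H powr (1 - \<gamma> * \<rho>) * (1 / (1 - \<gamma> * \<rho>)))) powr (1 / \<rho>)
     = (c powr \<rho>) powr (1 / \<rho>) * ((H powr (1 - \<gamma> * \<rho>)) powr (1 / \<rho>) * (1 / (1 - \<gamma> * \<rho>)) powr (1 / \<rho>))"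
    by (simp only: powr_mult)
  also have "(H powr (1 - \<gamma> * \<rho>)) powr (1 / \<rho>) = H powr (1 / \<rho> - \<gamma>)"
    using assms by (simp add: powr_powr diff_divide_distrib)
  also have "(c powr \<rho>) powr (1 / \<rho>) = c" using assms by (simp add: powr_powr)
  finally show ?thesis by (simp add: mult_ac)
qed

text \<open>Iterated Duhamel formula for the conditional moment of an additive functional: for a Brownian
  motion \<open>B\<close> started at \<open>w\<close> at time \<open>s\<close>, \<open>mom h t n s w\<close> is the expectation of
  \<open>(\<integral>\<^sub>s\<^sup>t h(r, B\<^sub>r) dr)\<^sup>n\<close>.\<close>

primrec mom :: "(real \<Rightarrow> 'a::euclidean_space \<Rightarrow> real) \<Rightarrow> real \<Rightarrow> nat \<Rightarrow> real \<Rightarrow> 'a \<Rightarrow> real" where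
  "mom h t 0 s w = 1"
| "mom h t (Suc n) s w = real (Suc n) * (LINT r|lborel. (if s < r \<and> r < t
     then (LINT v|lborel. heat (r - s) v * (h r (w + v) * mom h t n r (w + v))) else 0))"

lemma mom_measurable:
  assumes [measurable]: "(\<lambda>(r, w). h r w) \<in> borel_measurable (borel \<Otimes>\<^sub>M borel)"
  shows "(\<lambda>(s, w). mom h t n s w) \<in> borel_measurable (borel \<Otimes>\<^sub>M borel)"
proof (induction n)
  case (Suc n)
  note Suc[measurable]
  show ?case unfolding mom.simps split_beta by measurable
qed simp

lemma mom_measurable' [measurable (raw)]:
  assumes "(\<lambda>(r, w). h r w) \<in> borel_measurable (borel \<Otimes>\<^sub>M borel)"
    and "f \<in> borel_measurable M" "g \<in> borel_measurable M"
  shows "(\<lambda>x. mom h t n (f x) (g x)) \<in> borel_measurable M"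
  using measurable_compose[OF measurable_Pair[OF assms(2,3)] mom_measurable[OF assms(1), of t n]]
  by simp

lemma integrable_heat_mult:
  fixes f :: "'a::euclidean_space \<Rightarrow> real"
  assumes t: "0 < \<tau>" and [measurable]: "f \<in> borel_measurable borel" and b: "\<And>v. \<bar>f v\<bar> \<le> K"
  shows "integrable lborel (\<lambda>v. heat \<tau> v * f v)" "\<bar>LINT v|lborel. heat \<tau> v * f v\<bar> \<le> K"
proof -
  have K: "0 \<le> K" using b[of 0] by linarith
  have le: "\<bar>heat \<tau> v * f v\<bar> \<le> heat \<tau> v * K" for v
    using b[of v] by (simp add: abs_mult mult_left_mono)
  show i: "integrable lborel (\<lambda>v. heat \<tau> v * f v)"
    by (rule Bochner_Integration.integrable_bound[OF integrable_mult_left[OF integrable_heat[OF t], of K]])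
       (use le K in \<open>auto intro!: AE_I2\<close>)
  have "\<bar>LINT v|lborel. heat \<tau> v * f v\<bar> \<le> (LINT v|lborel. \<bar>heat \<tau> v * f v\<bar>)"
    by (rule integral_abs_bound)
  also have "\<dots> \<le> (LINT v::'a|lborel. heat \<tau> v * K)"
    using i by (intro integral_mono le integrable_abs integrable_mult_left integrable_heat t)
  finally have "\<bar>LINT v|lborel. heat \<tau> v * f v\<bar> \<le> (LINT v::'a|lborel. heat \<tau> v * K)" .
  then show "\<bar>LINT v|lborel. heat \<tau> v * f v\<bar> \<le> K" using integral_heat[OF t, where 'a='a] by simp
qed

lemma mom_bounded:
  fixes h :: "real \<Rightarrow> 'a::euclidean_space \<Rightarrow> real"
  assumes [measurable]: "(\<lambda>(r, w). h r w) \<in> borel_measurable (borel \<Otimes>\<^sub>M borel)"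
    and b: "\<And>r w. \<bar>h r w\<bar> \<le> B" and st: "s0 \<le> t"
  shows "\<exists>K. \<forall>s\<in>{s0..t}. \<forall>w. \<bar>mom h t n s w\<bar> \<le> K"
proof (induction n)
  case (Suc n)
  then obtain K where K: "\<And>s w. s \<in> {s0..t} \<Longrightarrow> \<bar>mom h t n s w\<bar> \<le> K" by blast
  have B: "0 \<le> B" using b[of 0 0] by linarith
  have K0: "0 \<le> K" using K[of t 0] st by force
  have "\<bar>mom h t (Suc n) s w\<bar> \<le> real (Suc n) * ((t - s0) * (B * K))" if s: "s \<in> {s0..t}" for s w
  proof -
    let ?I = "\<lambda>r. if s < r \<and> r < t then (LINT v|lborel. heat (r - s) v * (h r (w + v) * mom h t n r (w + v))) else 0"
    have le: "\<bar>?I r\<bar> \<le> indicator {s..t} r * (B * K)" for r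
    proof (cases "s < r \<and> r < t")
      case True
      then have "\<bar>LINT v|lborel. heat (r - s) v * (h r (w + v) * mom h t n r (w + v))\<bar> \<le> B * K"
        using s B by (intro integrable_heat_mult) (auto simp: abs_mult intro!: mult_mono b K)
      with True show ?thesis by simp
    qed (use B K0 in auto)
    have i: "integrable lborel (\<lambda>r. indicator {s..t} r * (B * K))"
      by (intro integrable_mult_left integrable_real_indicator) (use s in auto)
    have "\<bar>LINT r|lborel. ?I r\<bar> \<le> (LINT r|lborel. \<bar>?I r\<bar>)"
      by (rule integral_abs_bound)
    also have "\<dots> \<le> (LINT r|lborel. indicator {s..t} r * (B * K))"
    proof (intro integral_mono le i integrable_abs)
      show "integrable lborel ?I"
        by (rule Bochner_Integration.integrable_bound[OF i])
           (use le B K0 in \<open>auto intro!: AE_I2 simp: abs_mult\<close>)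
    qed
    also have "\<dots> = (t - s) * (B * K)" using s by simp
    also have "\<dots> \<le> (t - s0) * (B * K)" using s B K0 by (intro mult_right_mono) auto
    finally show ?thesis unfolding mom.simps abs_mult by (intro mult_mono) auto
  qed
  then show ?case by blast
qed auto

lemma kernel_shift_difference:
  fixes k f :: "'a::euclidean_space \<Rightarrow> real"
  assumes k: "integrable lborel k" and [measurable]: "f \<in> borel_measurable borel" and b: "\<And>v. \<bar>f v\<bar> \<le> K"
  shows "(LINT v|lborel. k v * f (w + z + v)) - (LINT v|lborel. k v * f (w + v)) = (LINT v|lborel. diffk z k v * f (w + v))"
    and "integrable lborel (\<lambda>v. k v * f (w + v))"
    and "ennreal \<bar>LINT v|lborel. k v * f (w + v)\<bar> \<le> conv (\<lambda>v. ennreal \<bar>k v\<bar>) (\<lambda>v. ennreal \<bar>f v\<bar>) w"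
proof -
  have [measurable]: "k \<in> borel_measurable borel" using borel_measurable_integrable[OF k] by simp
  have K: "0 \<le> K" using b[of 0] by linarith
  have i: "integrable lborel (\<lambda>v. k v * f (x + v))" for x
    by (rule Bochner_Integration.integrable_bound[OF integrable_mult_right[OF integrable_abs[OF k], of K]])
       (use b K in \<open>auto intro!: AE_I2 mult_right_mono simp: abs_mult mult.commute[of "\<bar>k _\<bar>"]\<close>)
  show i0: "integrable lborel (\<lambda>v. k v * f (w + v))" by (rule i)
  have i': "integrable lborel (\<lambda>v. k (v - z) * f (w + v))"
    using integrable_lborel_shift[OF i[of "w + z"], of "-z"] by (simp add: algebra_simps)
  have e': "(LINT v|lborel. k (v - z) * f (w + v)) = (LINT v|lborel. k v * f (w + z + v))"
    using integral_lborel_shift[of "\<lambda>v. k v * f (w + z + v)" "-z"] by (simp add: algebra_simps)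
  have eq: "diffk z k v * f (w + v) = k (v - z) * f (w + v) - k v * f (w + v)" for v
    by (simp add: diffk_def algebra_simps)
  show "(LINT v|lborel. k v * f (w + z + v)) - (LINT v|lborel. k v * f (w + v)) = (LINT v|lborel. diffk z k v * f (w + v))"
    unfolding eq by (subst Bochner_Integration.integral_diff[OF i' i]) (simp add: e')
  show "ennreal \<bar>LINT v|lborel. k v * f (w + v)\<bar> \<le> conv (\<lambda>v. ennreal \<bar>k v\<bar>) (\<lambda>v. ennreal \<bar>f v\<bar>) w"
    using integral_norm_bound_ennreal[OF i0] by (simp add: conv_def abs_mult ennreal_mult)
qed

text \<open>Moving the difference from \<open>G\<close> to the heat kernel and to \<open>U\<close>:
  \<open>(G (y + z) - G y) U y\<close> is the difference at \<open>y\<close> of \<open>G U (\<cdot> - z)\<close> minus \<open>G (U - U (\<cdot> - z))\<close>.\<close>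

lemma heat_difference_split:
  fixes G U :: "'a::euclidean_space \<Rightarrow> real" and z w :: 'a
  assumes t: "0 < \<tau>" and [measurable]: "G \<in> borel_measurable borel" "U \<in> borel_measurable borel"
    and bG: "\<And>v. \<bar>G v\<bar> \<le> B" and bU: "\<And>v. \<bar>U v\<bar> \<le> K"
  defines "I \<equiv> \<lambda>w. LINT v|lborel. heat \<tau> v * ((G (w + v + z) - G (w + v)) * U (w + v))"
  shows "ennreal \<bar>I w\<bar> \<le> conv (\<lambda>v. ennreal \<bar>diffk z (heat \<tau>) v\<bar>) (\<lambda>v. ennreal \<bar>G v\<bar> * ennreal \<bar>U (v - z)\<bar>) w
      + conv (\<lambda>v. ennreal (heat \<tau> v)) (\<lambda>v. ennreal \<bar>G v\<bar> * ennreal \<bar>U (v - z + z) - U (v - z)\<bar>) w" (is ?T1)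
    and "ennreal \<bar>I (w + z) - I w\<bar> \<le> conv (\<lambda>v. ennreal \<bar>diffk z (diffk z (heat \<tau>)) v\<bar>) (\<lambda>v. ennreal \<bar>G v\<bar> * ennreal \<bar>U (v - z)\<bar>) w
      + conv (\<lambda>v. ennreal \<bar>diffk z (heat \<tau>) v\<bar>) (\<lambda>v. ennreal \<bar>G v\<bar> * ennreal \<bar>U (v - z + z) - U (v - z)\<bar>) w" (is ?T2)
proof -
  have B: "0 \<le> B" and K: "0 \<le> K" using bG[of 0] bU[of 0] by linarith+
  let ?f = "\<lambda>v. G v * U (v - z)" and ?f' = "\<lambda>v. G v * (U (v - z + z) - U (v - z))" and ?fz = "\<lambda>v. G v * U v"
  have bf: "\<bar>?f v\<bar> \<le> B * K" for v unfolding abs_mult by (intro mult_mono bG bU B) auto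
  have bf0: "\<bar>?fz v\<bar> \<le> B * K" for v unfolding abs_mult by (intro mult_mono bG bU B) auto
  have bf': "\<bar>?f' v\<bar> \<le> B * (2 * K)" for v
    unfolding abs_mult using bU[of v] bU[of "v - z"] by (intro mult_mono bG B) auto
  note k0 = integrable_heat[OF t, where 'a='a] and k1 = diffk_heat_integrable[OF t, of z]
  have k2: "integrable lborel (diffk z (diffk z (heat \<tau>)))"
    unfolding diffk_def[of z "diffk z _", abs_def]
    using integrable_lborel_shift[OF k1, of "-z"] k1 by (intro Bochner_Integration.integrable_diff) auto
  have [measurable]: "heat \<tau> \<in> borel_measurable borel" for \<tau> :: real by measurable
  have eqI: "I x = (LINT v|lborel. diffk z (heat \<tau>) v * ?f (x + v)) - (LINT v|lborel. heat \<tau> v * ?f' (x + v))" for x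
  proof -
    have "I x = (LINT v|lborel. heat \<tau> v * ?f (x + z + v) - heat \<tau> v * ?fz (x + v))"
    proof -
      have e: "x + z + v - z = x + v" "x + z + v = x + v + z" for v by auto
      have "heat \<tau> v * ((G (x + v + z) - G (x + v)) * U (x + v))
          = heat \<tau> v * (G (x + z + v) * U (x + z + v - z)) - heat \<tau> v * (G (x + v) * U (x + v))" for v
        by (subst e(1), subst e(2)) (simp add: left_diff_distrib right_diff_distrib)
      then show ?thesis unfolding I_def by simp
    qed
    also have "\<dots> = (LINT v|lborel. heat \<tau> v * ?f (x + z + v)) - (LINT v|lborel. heat \<tau> v * ?fz (x + v))"
      by (intro Bochner_Integration.integral_diff kernel_shift_difference(2)[OF k0, of ?f] kernel_shift_difference(2)[OF k0, of ?fz])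
         (use bf bf0 in \<open>auto intro: bf bf0\<close>)
    also have "(LINT v|lborel. heat \<tau> v * ?fz (x + v)) = (LINT v|lborel. heat \<tau> v * ?f' (x + v) + heat \<tau> v * ?f (x + v))"
      by (intro Bochner_Integration.integral_cong) (auto simp: right_diff_distrib)
    also have "\<dots> = (LINT v|lborel. heat \<tau> v * ?f' (x + v)) + (LINT v|lborel. heat \<tau> v * ?f (x + v))"
      by (intro Bochner_Integration.integral_add kernel_shift_difference(2)[OF k0, of ?f'] kernel_shift_difference(2)[OF k0, of ?f])
         (use bf bf' in \<open>auto intro: bf bf'\<close>)
    finally show ?thesis
      using kernel_shift_difference(1)[OF k0, of ?f "B * K" x z] bf by simp
  qed
  have tri: "ennreal \<bar>a - b\<bar> \<le> ennreal \<bar>a\<bar> + ennreal \<bar>b\<bar>" for a b :: real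
    by (simp add: ennreal_plus[symmetric] ennreal_leI del: ennreal_plus)
  have "ennreal \<bar>I w\<bar> \<le> ennreal \<bar>LINT v|lborel. diffk z (heat \<tau>) v * ?f (w + v)\<bar> + ennreal \<bar>LINT v|lborel. heat \<tau> v * ?f' (w + v)\<bar>"
    unfolding eqI by (rule tri)
  also have "\<dots> \<le> conv (\<lambda>v. ennreal \<bar>diffk z (heat \<tau>) v\<bar>) (\<lambda>v. ennreal \<bar>?f v\<bar>) w + conv (\<lambda>v. ennreal \<bar>heat \<tau> v\<bar>) (\<lambda>v. ennreal \<bar>?f' v\<bar>) w"
    by (intro add_mono kernel_shift_difference(3)[OF k1] kernel_shift_difference(3)[OF k0]) (use bf bf' in \<open>auto intro: bf bf'\<close>)
  finally show ?T1 by (simp add: abs_mult ennreal_mult)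
  have "I (w + z) - I w = (LINT v|lborel. diffk z (diffk z (heat \<tau>)) v * ?f (w + v)) - (LINT v|lborel. diffk z (heat \<tau>) v * ?f' (w + v))"
    using kernel_shift_difference(1)[OF k1, of ?f "B * K" w z] bf
      kernel_shift_difference(1)[OF k0, of ?f' "B * (2 * K)" w z] bf'
    unfolding eqI by simp
  then have "ennreal \<bar>I (w + z) - I w\<bar> \<le> ennreal \<bar>LINT v|lborel. diffk z (diffk z (heat \<tau>)) v * ?f (w + v)\<bar> + ennreal \<bar>LINT v|lborel. diffk z (heat \<tau>) v * ?f' (w + v)\<bar>"
    using tri by simp
  also have "\<dots> \<le> conv (\<lambda>v. ennreal \<bar>diffk z (diffk z (heat \<tau>)) v\<bar>) (\<lambda>v. ennreal \<bar>?f v\<bar>) w + conv (\<lambda>v. ennreal \<bar>diffk z (heat \<tau>) v\<bar>) (\<lambda>v. ennreal \<bar>?f' v\<bar>) w"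
    by (intro add_mono kernel_shift_difference(3)[OF k2] kernel_shift_difference(3)[OF k1]) (use bf bf' in \<open>auto intro: bf bf'\<close>)
  finally show ?T2 by (simp add: abs_mult ennreal_mult)
qed

lemma integral_norm_bound_ennreal': "ennreal \<bar>LINT x|M. f x\<bar> \<le> (\<integral>\<^sup>+x. ennreal \<bar>f x\<bar> \<partial>M)" for f :: "'b \<Rightarrow> real"
  using integral_norm_bound_ennreal[of M f] by (cases "integrable M f") (auto simp: not_integrable_integral_eq)

lemma heat_sup_factor:
  fixes d :: real
  assumes "0 < \<tau>" "0 < e" "0 \<le> d"
  shows "ennreal ((2 * pi * \<tau>) powr (- d / 2)) epowr e \<le> ennreal (\<tau> powr (- (d / 2 * e)))"
proof -
  have "((2 * pi * \<tau>) powr (- d / 2)) powr e = (2 * pi) powr (- (d / 2 * e)) * \<tau> powr (- (d / 2 * e))"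
    by (simp add: powr_powr powr_mult)
  also have "(2 * pi) powr (- (d / 2 * e)) \<le> (2 * pi) powr 0"
    using assms pi_gt3 by (intro powr_mono) auto
  then have "(2 * pi) powr (- (d / 2 * e)) * \<tau> powr (- (d / 2 * e)) \<le> 1 * \<tau> powr (- (d / 2 * e))"
    by (intro mult_right_mono) auto
  finally show ?thesis by (simp add: ennreal_leI)
qed

locale gradient_setup =
  fixes g :: "real \<Rightarrow> 'a::euclidean_space \<Rightarrow> real" and z :: 'a and p q \<beta> B s0 t A d :: real
  assumes d_eq: "d = real DIM('a)"
    and gm [measurable]: "(\<lambda>(r, w). g r w) \<in> borel_measurable (borel \<Otimes>\<^sub>M borel)"
    and gb: "\<And>r w. \<bar>g r w\<bar> \<le> B"
    and p: "2 < p" and q: "2 < q" and pq: "2 / q + d / p < 1"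
    and beta: "0 < \<beta>" "\<beta> < 1" and st: "s0 < t"
    and A: "0 \<le> A" "Lnorm lborel q (\<lambda>r. indicator {s0<..<t} r * Lnorm lborel p (\<lambda>w. ennreal \<bar>g r w\<bar>)) \<le> ennreal A"
begin

definition "h r w = g r (w + z) - g r w"
abbreviation "u \<equiv> mom h t"
definition "H = t - s0"
definition "c1 = 2 * 2 powr ((\<beta> + d) / 2)"
definition "c2 = 4 * 2 powr \<beta>"
definition "\<gamma> = \<beta> / 2 + d / (2 * p)"
definition "k1 = power_kernel (c1 * norm z powr \<beta>) \<gamma> H"
definition "k2 = power_kernel 1 (d / p) H"
definition "k3 = power_kernel (c2 * norm z powr (2 * \<beta>)) \<beta> H"
definition "na r = Lnorm lborel p (\<lambda>w. ennreal \<bar>g r w\<bar>)"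
definition "nd n r = Lnorm lborel p (\<lambda>w. ennreal \<bar>u n r (w + z) - u n r w\<bar>)"
definition "a0 r = indicator {s0<..<t} r * na r"
definition "d0 n r = indicator {s0<..<t} r * nd n r"

lemma h_measurable [measurable]: "(\<lambda>(r, w). h r w) \<in> borel_measurable (borel \<Otimes>\<^sub>M borel)"
  unfolding h_def split_beta by measurable

lemma na_measurable [measurable]: "na \<in> borel_measurable borel"
  unfolding na_def[abs_def] Lnorm_def by measurable

lemma nd_measurable [measurable]: "nd n \<in> borel_measurable borel"
  unfolding nd_def[abs_def] Lnorm_def by measurable

lemma a0_measurable [measurable]: "a0 \<in> borel_measurable borel"
  unfolding a0_def[abs_def] by measurable

lemma d0_measurable [measurable]: "d0 n \<in> borel_measurable borel"
  unfolding d0_def[abs_def] by measurable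

lemma k_measurable [measurable]: "k1 \<in> borel_measurable borel" "k2 \<in> borel_measurable borel" "k3 \<in> borel_measurable borel"
  unfolding k1_def k2_def k3_def by measurable

lemma root_factor:
  assumes "0 < \<tau>" shows "(norm z / sqrt \<tau>) powr b = norm z powr b * \<tau> powr (- (b / 2))"
proof -
  have "(norm z / sqrt \<tau>) powr b = norm z powr b / sqrt \<tau> powr b" by (rule powr_divide)
  also have "sqrt \<tau> powr b = \<tau> powr (b / 2)"
    using assms by (simp add: powr_half_sqrt[symmetric] powr_powr)
  finally show ?thesis by (simp add: powr_minus_divide)
qed

lemma k1_bound:
  assumes "0 < \<tau>" "\<tau> < H"
  shows "ennreal (c1 * (norm z / sqrt \<tau>) powr \<beta>) * ennreal ((2 * pi * \<tau>) powr (- d / 2)) epowr (1 / p) \<le> k1 \<tau>"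
proof -
  have "ennreal (c1 * (norm z / sqrt \<tau>) powr \<beta>) * ennreal ((2 * pi * \<tau>) powr (- d / 2)) epowr (1 / p)
     \<le> ennreal (c1 * (norm z / sqrt \<tau>) powr \<beta>) * ennreal (\<tau> powr (- (d / 2 * (1 / p))))"
    using assms p by (intro mult_left_mono heat_sup_factor) (auto simp: d_eq)
  also have "\<dots> = ennreal (c1 * norm z powr \<beta> * (\<tau> powr (- (\<beta> / 2)) * \<tau> powr (- (d / 2 * (1 / p)))))"
    by (simp add: root_factor[OF assms(1)] ennreal_mult[symmetric] c1_def mult_ac)
  also have "\<tau> powr (- (\<beta> / 2)) * \<tau> powr (- (d / 2 * (1 / p))) = \<tau> powr (- \<gamma>)"
    by (simp add: powr_add[symmetric] \<gamma>_def)
  finally show ?thesis using assms by (simp add: k1_def power_kernel_def)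
qed

lemma k2_bound:
  assumes "0 < \<tau>" "\<tau> < H"
  shows "1 * ennreal ((2 * pi * \<tau>) powr (- d / 2)) epowr (1 / (p / 2)) \<le> k2 \<tau>"
proof -
  have "0 \<le> d" by (simp add: d_eq)
  then show ?thesis
    using heat_sup_factor[OF assms(1), of "1 / (p / 2)" d] assms p by (simp add: k2_def power_kernel_def)
qed

lemma k3_bound:
  assumes "0 < \<tau>" "\<tau> < H"
  shows "ennreal (c2 * (norm z / sqrt \<tau>) powr (2 * \<beta>)) \<le> k3 \<tau>"
  using assms by (simp add: root_factor k3_def power_kernel_def mult_ac)

lemma diffk_mass:
  assumes "0 < \<tau>"
  shows "(\<integral>\<^sup>+v. ennreal \<bar>diffk z (heat \<tau>) v\<bar> \<partial>lborel) \<le> ennreal (c1 * (norm z / sqrt \<tau>) powr \<beta>)"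
proof -
  have "1 \<le> 2 powr ((\<beta> + d) / 2)" using beta by (intro ge_one_powr_ge_zero) (auto simp: d_eq)
  then have "2 * (norm z / sqrt \<tau>) powr \<beta> \<le> c1 * (norm z / sqrt \<tau>) powr \<beta>"
    unfolding c1_def by (intro mult_right_mono) auto
  then show ?thesis using diffk_heat_mass[OF assms, of \<beta> z] beta
    by (meson ennreal_leI less_imp_le order_trans)
qed

lemma diffk_sup:
  assumes "0 < \<tau>"
  shows "ennreal \<bar>diffk z (heat \<tau>) v\<bar> \<le> ennreal (c1 * (norm z / sqrt \<tau>) powr \<beta>) * ennreal ((2 * pi * \<tau>) powr (- d / 2))"
  using diffk_heat_sup[OF assms, of \<beta> z v] beta
  unfolding c1_def unfolding d_eq by (simp add: ennreal_mult[symmetric] ennreal_leI)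

lemma Lnorm_gU:
  assumes M: "0 \<le> M" "\<And>w. \<bar>U w\<bar> \<le> M" and [measurable]: "U \<in> borel_measurable borel"
  shows "Lnorm lborel p (\<lambda>v. ennreal \<bar>g r v\<bar> * ennreal \<bar>U (v - z)\<bar>) \<le> ennreal M * na r"
proof -
  have "Lnorm lborel p (\<lambda>v. ennreal \<bar>g r v\<bar> * ennreal \<bar>U (v - z)\<bar>) \<le> Lnorm lborel p (\<lambda>v. ennreal M * ennreal \<bar>g r v\<bar>)"
    using p M by (intro Lnorm_mono) (auto simp: mult.commute[of "ennreal M"] intro!: mult_left_mono ennreal_leI)
  also have "\<dots> = ennreal M * na r"
    unfolding na_def using p by (intro Lnorm_cmult) auto
  finally show ?thesis .
qed

lemma Lnorm_gdU:
  "Lnorm lborel (p / 2) (\<lambda>v. ennreal \<bar>g r v\<bar> * ennreal \<bar>u n r (v - z + z) - u n r (v - z)\<bar>) \<le> na r * nd n r"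
proof -
  have "Lnorm lborel (p / 2) (\<lambda>v. ennreal \<bar>g r v\<bar> * ennreal \<bar>u n r (v - z + z) - u n r (v - z)\<bar>)
    \<le> na r * Lnorm lborel p (\<lambda>v. ennreal \<bar>u n r (v - z + z) - u n r (v - z)\<bar>)"
    unfolding na_def using p by (intro Lnorm_mult_half) auto
  also have "Lnorm lborel p (\<lambda>v. ennreal \<bar>u n r (v - z + z) - u n r (v - z)\<bar>) = nd n r"
    unfolding nd_def
    using Lnorm_lborel_shift[of "\<lambda>v. ennreal \<bar>u n r (v + z) - u n r v\<bar>" p "-z"] by simp
  finally show ?thesis .
qed

lemma conv_eq: "conv k b s = (\<integral>\<^sup>+r. k (r - s) * b r \<partial>lborel)"
  if [measurable]: "k \<in> borel_measurable borel" "b \<in> borel_measurable borel" for k b :: "real \<Rightarrow> ennreal"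
  using nn_integral_lborel_shift[of "\<lambda>r. k (r - s) * b r" s] by (simp add: conv_def add.commute)

definition "I n s r w = (if s < r \<and> r < t then (LINT v|lborel. heat (r - s) v * (h r (w + v) * u n r (w + v))) else 0)"

lemma I_measurable [measurable]: "(\<lambda>(r, w). I n s r w) \<in> borel_measurable (borel \<Otimes>\<^sub>M borel)"
  unfolding I_def split_beta by measurable

context
  fixes n :: nat and M s :: real
  assumes M: "0 \<le> M" "\<And>r w. r \<in> {s0..t} \<Longrightarrow> \<bar>u n r w\<bar> \<le> M" and s: "s0 \<le> s" "s \<le> t"
begin

lemma I_split:
  assumes "s < r" "r < t"
  shows "ennreal \<bar>I n s r w\<bar> \<le> conv (\<lambda>v. ennreal \<bar>diffk z (heat (r - s)) v\<bar>) (\<lambda>v. ennreal \<bar>g r v\<bar> * ennreal \<bar>u n r (v - z)\<bar>) w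
      + conv (\<lambda>v. ennreal (heat (r - s) v)) (\<lambda>v. ennreal \<bar>g r v\<bar> * ennreal \<bar>u n r (v - z + z) - u n r (v - z)\<bar>) w"
   and "ennreal \<bar>I n s r (w + z) - I n s r w\<bar> \<le> conv (\<lambda>v. ennreal \<bar>diffk z (diffk z (heat (r - s))) v\<bar>) (\<lambda>v. ennreal \<bar>g r v\<bar> * ennreal \<bar>u n r (v - z)\<bar>) w
      + conv (\<lambda>v. ennreal \<bar>diffk z (heat (r - s)) v\<bar>) (\<lambda>v. ennreal \<bar>g r v\<bar> * ennreal \<bar>u n r (v - z + z) - u n r (v - z)\<bar>) w"
  using heat_difference_split[of "r - s" "g r" "u n r" B M w z] assms s gb M(2)[of r]
  by (simp_all add: I_def h_def)

lemma I_bound: "ennreal \<bar>I n s r w\<bar> \<le> ennreal M * (k1 (r - s) * a0 r) + k2 (r - s) * (a0 r * d0 n r)"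
proof (cases "s < r \<and> r < t")
  case True
  define \<tau> where "\<tau> = r - s"
  have t: "0 < \<tau>" "\<tau> < H" and r: "a0 r = na r" "d0 n r = nd n r" "r \<in> {s0..t}"
    using True s by (auto simp: \<tau>_def H_def a0_def d0_def)
  have "conv (\<lambda>v. ennreal \<bar>diffk z (heat (r - s)) v\<bar>) (\<lambda>v. ennreal \<bar>g r v\<bar> * ennreal \<bar>u n r (v - z)\<bar>) w
      \<le> ennreal (c1 * (norm z / sqrt \<tau>) powr \<beta>) * ennreal ((2 * pi * \<tau>) powr (- d / 2)) epowr (1 / p)
        * Lnorm lborel p (\<lambda>v. ennreal \<bar>g r v\<bar> * ennreal \<bar>u n r (v - z)\<bar>)"
    unfolding \<tau>_def[symmetric] using t p by (intro conv_sup diffk_mass diffk_sup) auto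
  also have "\<dots> \<le> k1 \<tau> * (ennreal M * na r)"
    using M r by (intro mult_mono k1_bound t Lnorm_gU) auto
  finally have e1: "conv (\<lambda>v. ennreal \<bar>diffk z (heat (r - s)) v\<bar>) (\<lambda>v. ennreal \<bar>g r v\<bar> * ennreal \<bar>u n r (v - z)\<bar>) w
      \<le> k1 \<tau> * (ennreal M * na r)" .
  have "conv (\<lambda>v. ennreal (heat (r - s) v)) (\<lambda>v. ennreal \<bar>g r v\<bar> * ennreal \<bar>u n r (v - z + z) - u n r (v - z)\<bar>) w
      \<le> 1 * ennreal ((2 * pi * \<tau>) powr (- d / 2)) epowr (1 / (p / 2)) *
        Lnorm lborel (p / 2) (\<lambda>v. ennreal \<bar>g r v\<bar> * ennreal \<bar>u n r (v - z + z) - u n r (v - z)\<bar>)"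
    unfolding \<tau>_def[symmetric] using t p heat_le[OF t(1), where 'a='a]
    by (intro conv_sup) (auto simp: nn_integral_heat d_eq intro!: ennreal_leI)
  also have "\<dots> \<le> k2 \<tau> * (na r * nd n r)"
    by (intro mult_mono k2_bound t Lnorm_gdU) auto
  finally have e2: "conv (\<lambda>v. ennreal (heat (r - s) v)) (\<lambda>v. ennreal \<bar>g r v\<bar> * ennreal \<bar>u n r (v - z + z) - u n r (v - z)\<bar>) w
      \<le> k2 \<tau> * (na r * nd n r)" .
  show ?thesis
    using order_trans[OF I_split(1)[of r w] add_mono[OF e1 e2]] True by (simp add: \<tau>_def r mult_ac)
qed (auto simp: I_def)

lemma dI_bound: "Lnorm lborel p (\<lambda>w. ennreal \<bar>I n s r (w + z) - I n s r w\<bar>) \<le> ennreal M * (k3 (r - s) * a0 r) + k1 (r - s) * (a0 r * d0 n r)"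
proof (cases "s < r \<and> r < t")
  case True
  define \<tau> where "\<tau> = r - s"
  have t: "0 < \<tau>" "\<tau> < H" and r: "a0 r = na r" "d0 n r = nd n r" "r \<in> {s0..t}"
    using True s by (auto simp: \<tau>_def H_def a0_def d0_def)
  define f1 where "f1 = (\<lambda>v. ennreal \<bar>g r v\<bar> * ennreal \<bar>u n r (v - z)\<bar>)"
  define f2 where "f2 = (\<lambda>v. ennreal \<bar>g r v\<bar> * ennreal \<bar>u n r (v - z + z) - u n r (v - z)\<bar>)"
  have [measurable]: "f1 \<in> borel_measurable borel" "f2 \<in> borel_measurable borel"
    by (auto simp: f1_def f2_def)
  define K1 where "K1 = (\<lambda>v. ennreal \<bar>diffk z (heat \<tau>) v\<bar>)"
  define K2 where "K2 = (\<lambda>v. ennreal \<bar>diffk z (diffk z (heat \<tau>)) v\<bar>)"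
  have [measurable]: "K1 \<in> borel_measurable borel" "K2 \<in> borel_measurable borel"
    by (auto simp: K1_def K2_def)
  have "Lnorm lborel p (\<lambda>w. ennreal \<bar>I n s r (w + z) - I n s r w\<bar>) \<le> Lnorm lborel p (\<lambda>w. conv K2 f1 w + conv K1 f2 w)"
    unfolding K1_def K2_def f1_def f2_def \<tau>_def using p True by (intro Lnorm_mono I_split(2)) auto
  also have "\<dots> \<le> Lnorm lborel p (conv K2 f1) + Lnorm lborel p (conv K1 f2)"
    using p by (intro Lnorm_add_le lborel.sigma_finite_measure_axioms) auto
  also have "\<dots> \<le> ennreal (c2 * (norm z / sqrt \<tau>) powr (2 * \<beta>)) * (ennreal M * na r)
      + ennreal (c1 * (norm z / sqrt \<tau>) powr \<beta>) * ennreal ((2 * pi * \<tau>) powr (- d / 2)) epowr (1 / p) * (na r * nd n r)"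
  proof (intro add_mono)
    have "Lnorm lborel p (conv K2 f1) \<le> (\<integral>\<^sup>+v. K2 v \<partial>lborel) * Lnorm lborel p f1"
      using p by (intro conv_Lnorm) auto
    also have "\<dots> \<le> ennreal (c2 * (norm z / sqrt \<tau>) powr (2 * \<beta>)) * (ennreal M * na r)"
      unfolding K2_def f1_def c2_def using M r t beta by (intro mult_mono Lnorm_gU diffk_diffk_heat_mass) auto
    finally show "Lnorm lborel p (conv K2 f1) \<le> \<dots>" .
    have "Lnorm lborel p (conv K1 f2) \<le> ennreal (c1 * (norm z / sqrt \<tau>) powr \<beta>) * ennreal ((2 * pi * \<tau>) powr (- d / 2)) epowr (1 / p) * Lnorm lborel (p / 2) f2"
      using p diffk_mass[OF t(1)] diffk_sup[OF t(1)] unfolding K1_def by (intro conv_Lnorm_half) auto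
    also have "\<dots> \<le> ennreal (c1 * (norm z / sqrt \<tau>) powr \<beta>) * ennreal ((2 * pi * \<tau>) powr (- d / 2)) epowr (1 / p) * (na r * nd n r)"
      unfolding f2_def by (intro mult_left_mono Lnorm_gdU) auto
    finally show "Lnorm lborel p (conv K1 f2) \<le> \<dots>" .
  qed
  also have "\<dots> \<le> k3 \<tau> * (ennreal M * na r) + k1 \<tau> * (na r * nd n r)"
    by (intro add_mono mult_right_mono k1_bound k3_bound t) auto
  finally show ?thesis by (simp add: r \<tau>_def mult_ac)
qed (auto simp: I_def Lnorm_def)

lemma step_sup: "ennreal \<bar>u (Suc n) s w\<bar> \<le> ennreal (real (Suc n)) * (ennreal M * conv k1 a0 s + conv k2 (\<lambda>r. a0 r * d0 n r) s)"
proof -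
  have "ennreal \<bar>u (Suc n) s w\<bar> = ennreal (real (Suc n)) * ennreal \<bar>LINT r|lborel. I n s r w\<bar>"
    unfolding I_def mom.simps abs_mult by (subst ennreal_mult) auto
  also have "\<dots> \<le> ennreal (real (Suc n)) * (\<integral>\<^sup>+r. ennreal M * (k1 (r - s) * a0 r) + k2 (r - s) * (a0 r * d0 n r) \<partial>lborel)"
    by (intro mult_left_mono order_trans[OF integral_norm_bound_ennreal'] nn_integral_mono I_bound) auto
  also have "\<dots> = ennreal (real (Suc n)) * (ennreal M * conv k1 a0 s + conv k2 (\<lambda>r. a0 r * d0 n r) s)"
    by (simp add: conv_eq nn_integral_add nn_integral_cmult)
  finally show ?thesis .
qed

lemma I_integrable: "integrable lborel (\<lambda>r. I n s r w)"
proof -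
  obtain K where K: "\<And>r. \<bar>I n s r w\<bar> \<le> K * indicator {s..t} r"
  proof
    fix r
    show "\<bar>I n s r w\<bar> \<le> (2 * B * M) * indicator {s..t} r"
    proof (cases "s < r \<and> r < t")
      case True
      have "\<bar>h r v\<bar> \<le> 2 * B" for v using gb[of r "v + z"] gb[of r v] by (simp add: h_def)
      moreover have "0 \<le> B" using gb[of 0 0] by linarith
      ultimately have "\<bar>LINT v|lborel. heat (r - s) v * (h r (w + v) * u n r (w + v))\<bar> \<le> 2 * B * M"
        using True s by (intro integrable_heat_mult) (auto simp: abs_mult intro!: mult_mono M)
      with True show ?thesis by (simp add: I_def)
    qed (use M gb[of 0 0] in \<open>auto simp: I_def indicator_def\<close>)
  qed
  show ?thesis
    by (rule Bochner_Integration.integrable_bound[of lborel "\<lambda>r. K * indicator {s..t} r"])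
       (use K s in \<open>auto intro!: AE_I2 integrable_mult_right order_trans[OF K]\<close>)
qed

lemma step_diff: "nd (Suc n) s \<le> ennreal (real (Suc n)) * (ennreal M * conv k3 a0 s + conv k1 (\<lambda>r. a0 r * d0 n r) s)"
proof -
  have "nd (Suc n) s \<le> Lnorm lborel p (\<lambda>w. ennreal (real (Suc n)) * (\<integral>\<^sup>+r. ennreal \<bar>I n s r (w + z) - I n s r w\<bar> \<partial>lborel))"
    unfolding nd_def
  proof (rule Lnorm_mono)
    fix w
    have "u (Suc n) s (w + z) - u (Suc n) s w = real (Suc n) * (LINT r|lborel. I n s r (w + z) - I n s r w)"
      unfolding mom.simps I_def[symmetric]
      by (subst Bochner_Integration.integral_diff[OF I_integrable I_integrable]) (simp add: right_diff_distrib)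
    then have "ennreal \<bar>u (Suc n) s (w + z) - u (Suc n) s w\<bar> = ennreal (real (Suc n)) * ennreal \<bar>LINT r|lborel. I n s r (w + z) - I n s r w\<bar>"
      by (simp only: abs_mult) (subst ennreal_mult, auto)
    also have "\<dots> \<le> ennreal (real (Suc n)) * (\<integral>\<^sup>+r. ennreal \<bar>I n s r (w + z) - I n s r w\<bar> \<partial>lborel)"
      by (intro mult_left_mono integral_norm_bound_ennreal') auto
    finally show "ennreal \<bar>u (Suc n) s (w + z) - u (Suc n) s w\<bar> \<le> \<dots>" .
  qed (use p in auto)
  also have "\<dots> = ennreal (real (Suc n)) * Lnorm lborel p (\<lambda>w. \<integral>\<^sup>+r. ennreal \<bar>I n s r (w + z) - I n s r w\<bar> \<partial>lborel)"
    using p by (intro Lnorm_cmult) auto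
  also have "\<dots> \<le> ennreal (real (Suc n)) * (\<integral>\<^sup>+r. Lnorm lborel p (\<lambda>w. ennreal \<bar>I n s r (w + z) - I n s r w\<bar>) \<partial>lborel)"
    using p by (intro mult_left_mono minkowski_integral lborel.sigma_finite_measure_axioms) auto
  also have "\<dots> \<le> ennreal (real (Suc n)) * (\<integral>\<^sup>+r. ennreal M * (k3 (r - s) * a0 r) + k1 (r - s) * (a0 r * d0 n r) \<partial>lborel)"
    by (intro mult_left_mono nn_integral_mono dI_bound) auto
  also have "\<dots> = ennreal (real (Suc n)) * (ennreal M * conv k3 a0 s + conv k1 (\<lambda>r. a0 r * d0 n r) s)"
    by (simp add: conv_eq nn_integral_add nn_integral_cmult)
  finally show ?thesis .
qed

end

definition "q' = q / (q - 1)"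
definition "\<kappa> = 1 - \<beta> / 2 - d / (2 * p) - 1 / q"
definition "e1 = c1 * (1 / (1 - \<gamma> * q')) powr (1 / q')"
definition "e2 = (1 / (1 - d / p * (q / (q - 2)))) powr (1 - 2 / q)"
definition "e3 = c2 / (1 - \<beta>)"
definition "X = norm z powr \<beta> * A * H powr \<kappa>"
definition "Y = norm z powr \<beta> * H powr (d / (2 * p) + 1 / q - \<beta> / 2)"
definition "C n = fact n * (e1 + e2 + e3) ^ n"

lemma pos: "0 < H" "0 \<le> e1" "0 \<le> e2" "0 \<le> e3" "0 \<le> X" "0 \<le> Y" "0 \<le> C n"
proof -
  show "0 < H" using st by (simp add: H_def)
  show 1: "0 \<le> e1" "0 \<le> e2" "0 \<le> e3" using beta by (auto simp: e1_def e2_def e3_def c1_def c2_def)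
  show "0 \<le> X" "0 \<le> Y" using A by (auto simp: X_def Y_def)
  show "0 \<le> C n" using 1 by (auto simp: C_def)
qed

lemma k1_norm: "Lnorm lborel q' k1 = ennreal (e1 * norm z powr \<beta> * H powr \<kappa>)"
proof -
  have "\<gamma> + 1 / q < 1" using pq beta by (simp add: \<gamma>_def)
  then have "\<gamma> * q' < 1" using q by (simp add: q'_def field_simps)
  moreover have "0 < q'" using q by (simp add: q'_def)
  moreover have "1 / q' - \<gamma> = \<kappa>" using q by (simp add: q'_def \<kappa>_def \<gamma>_def field_simps)
  ultimately show ?thesis
    unfolding k1_def using pos(1) by (subst Lnorm_power_kernel) (auto simp: e1_def c1_def mult_ac)
qed

lemma k2_norm: "Lnorm lborel (q / (q - 2)) k2 = ennreal (e2 * H powr (1 - 2 / q - d / p))"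
proof -
  have "d / p * (q / (q - 2)) < 1" using pq q p by (simp add: field_simps)
  moreover have "1 / (q / (q - 2)) = 1 - 2 / q" using q by (simp add: field_simps)
  ultimately show ?thesis
    unfolding k2_def using pos(1) q by (subst Lnorm_power_kernel) (auto simp: e2_def)
qed

lemma k3_norm: "(\<integral>\<^sup>+v. k3 v \<partial>lborel) = ennreal (e3 * norm z powr (2 * \<beta>) * H powr (1 - \<beta>))"
  unfolding Lnorm_one[symmetric] k3_def
  using pos(1) beta by (subst Lnorm_power_kernel) (auto simp: e3_def c2_def mult_ac)

lemma a0_norm: "Lnorm lborel q a0 \<le> ennreal A"
  using A(2) unfolding a0_def[abs_def] na_def by simp

lemma moment_bounds:
  "(\<forall>s\<in>{s0..t}. \<forall>w. \<bar>u n s w\<bar> \<le> C n * X ^ n) \<and> Lnorm lborel q (d0 n) \<le> ennreal (C n * X ^ n * Y)"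
proof (induction n)
  case 0
  have "d0 0 = (\<lambda>_. 0)" by (simp add: d0_def nd_def Lnorm_def fun_eq_iff)
  then show ?case by (simp add: C_def Lnorm_def)
next
  case (Suc n)
  define M where "M = C n * X ^ n"
  have M: "0 \<le> M" "\<And>r w. r \<in> {s0..t} \<Longrightarrow> \<bar>u n r w\<bar> \<le> M"
    using Suc pos by (auto simp: M_def)
  have dn: "Lnorm lborel q (d0 n) \<le> ennreal (M * Y)" using Suc by (simp add: M_def)
  have E: "0 \<le> e1" "0 \<le> e2" "0 \<le> e3" by (rule pos)+
  have Cs: "C (Suc n) = real (Suc n) * (e1 + e2 + e3) * C n" by (simp add: C_def algebra_simps)
  have ad: "Lnorm lborel (q / 2) (\<lambda>r. a0 r * d0 n r) \<le> ennreal A * ennreal (M * Y)"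
    using q by (intro order_trans[OF Lnorm_mult_half] mult_mono a0_norm dn) auto
  have k1a: "conv k1 a0 s \<le> ennreal (e1 * X)" for s
  proof -
    have "conv k1 a0 s \<le> Lnorm lborel q' k1 * Lnorm lborel q a0"
      using q by (intro conv_le_hoelder) (auto simp: q'_def field_simps)
    also have "\<dots> \<le> ennreal (e1 * norm z powr \<beta> * H powr \<kappa>) * ennreal A"
      unfolding k1_norm by (intro mult_left_mono a0_norm) auto
    also have "\<dots> = ennreal (e1 * X)" using E A by (simp add: X_def ennreal_mult[symmetric] mult_ac)
    finally show ?thesis .
  qed
  have k2ad: "conv k2 (\<lambda>r. a0 r * d0 n r) s \<le> ennreal (e2 * M * X)" for s
  proof -
    have "conv k2 (\<lambda>r. a0 r * d0 n r) s \<le> Lnorm lborel (q / (q - 2)) k2 * Lnorm lborel (q / 2) (\<lambda>r. a0 r * d0 n r)"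
      using q by (intro conv_le_hoelder) (auto simp: field_simps)
    also have "\<dots> \<le> ennreal (e2 * H powr (1 - 2 / q - d / p)) * (ennreal A * ennreal (M * Y))"
      unfolding k2_norm by (intro mult_left_mono ad) auto
    also have "\<dots> = ennreal (e2 * M * (norm z powr \<beta> * A * (H powr (1 - 2 / q - d / p) * H powr (d / (2 * p) + 1 / q - \<beta> / 2))))"
      using E A M(1) pos(6) unfolding Y_def by (simp add: ennreal_mult[symmetric] mult_ac)
    also have "H powr (1 - 2 / q - d / p) * H powr (d / (2 * p) + 1 / q - \<beta> / 2) = H powr \<kappa>"
      unfolding powr_add[symmetric] \<kappa>_def using p q by (intro arg_cong2[where f="(powr)"]) (auto simp: field_simps)
    finally show ?thesis by (simp add: X_def)
  qed
  have sup: "\<bar>u (Suc n) s w\<bar> \<le> C (Suc n) * X ^ Suc n" if s: "s \<in> {s0..t}" for s w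
  proof -
    have "ennreal \<bar>u (Suc n) s w\<bar> \<le> ennreal (real (Suc n)) * (ennreal M * conv k1 a0 s + conv k2 (\<lambda>r. a0 r * d0 n r) s)"
      using step_sup[OF M, of s w] s by auto
    also have "\<dots> \<le> ennreal (real (Suc n)) * (ennreal M * ennreal (e1 * X) + ennreal (e2 * M * X))"
      by (intro mult_left_mono add_mono k1a k2ad) auto
    also have "\<dots> = ennreal (real (Suc n) * (M * (e1 * X) + e2 * M * X))"
      using E M(1) pos by (simp add: ennreal_mult[symmetric] ennreal_plus[symmetric] del: ennreal_plus of_nat_Suc)
    finally have "\<bar>u (Suc n) s w\<bar> \<le> real (Suc n) * (M * (e1 * X) + e2 * M * X)"
      using E M(1) pos by (subst (asm) ennreal_le_iff) (auto intro!: mult_nonneg_nonneg add_nonneg_nonneg)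
    also have "\<dots> \<le> real (Suc n) * (M * (e1 * X) + e2 * M * X + e3 * M * X)"
      using E M(1) pos by (intro mult_left_mono) auto
    also have "\<dots> = C (Suc n) * X ^ Suc n" by (simp add: Cs M_def algebra_simps)
    finally show ?thesis .
  qed
  have "Lnorm lborel q (d0 (Suc n)) \<le> Lnorm lborel q (\<lambda>s. ennreal (real (Suc n)) * (ennreal M * conv k3 a0 s + conv k1 (\<lambda>r. a0 r * d0 n r) s))"
  proof (rule Lnorm_mono)
    fix s show "d0 (Suc n) s \<le> ennreal (real (Suc n)) * (ennreal M * conv k3 a0 s + conv k1 (\<lambda>r. a0 r * d0 n r) s)"
      using step_diff[OF M, of s] by (auto simp: d0_def indicator_def simp del: of_nat_Suc)
  qed (use q in auto)
  also have "\<dots> = ennreal (real (Suc n)) * Lnorm lborel q (\<lambda>s. ennreal M * conv k3 a0 s + conv k1 (\<lambda>r. a0 r * d0 n r) s)"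
    using q by (intro Lnorm_cmult) auto
  also have "\<dots> \<le> ennreal (real (Suc n)) * (Lnorm lborel q (\<lambda>s. ennreal M * conv k3 a0 s) + Lnorm lborel q (conv k1 (\<lambda>r. a0 r * d0 n r)))"
    using q by (intro mult_left_mono Lnorm_add_le lborel.sigma_finite_measure_axioms) auto
  also have "Lnorm lborel q (\<lambda>s. ennreal M * conv k3 a0 s) = ennreal M * Lnorm lborel q (conv k3 a0)"
    using q by (intro Lnorm_cmult) auto
  also have "ennreal (real (Suc n)) * (ennreal M * Lnorm lborel q (conv k3 a0) + Lnorm lborel q (conv k1 (\<lambda>r. a0 r * d0 n r)))
     \<le> ennreal (real (Suc n)) * (ennreal M * ennreal (e3 * X * Y) + ennreal (e1 * M * X * Y))"
  proof (intro mult_left_mono add_mono)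
    have "Lnorm lborel q (conv k3 a0) \<le> (\<integral>\<^sup>+v. k3 v \<partial>lborel) * Lnorm lborel q a0"
      using q by (intro conv_Lnorm) auto
    also have "\<dots> \<le> ennreal (e3 * norm z powr (2 * \<beta>) * H powr (1 - \<beta>)) * ennreal A"
      unfolding k3_norm by (intro mult_left_mono a0_norm) auto
    also have "\<dots> = ennreal (e3 * A * norm z powr (2 * \<beta>) * H powr (1 - \<beta>))"
      using E A by (simp add: ennreal_mult[symmetric] mult_ac)
    also have "norm z powr (2 * \<beta>) = norm z powr \<beta> * norm z powr \<beta>" by (simp add: powr_add[symmetric])
    also have "H powr (1 - \<beta>) = H powr \<kappa> * H powr (d / (2 * p) + 1 / q - \<beta> / 2)"
      by (simp add: powr_add[symmetric] \<kappa>_def)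
    finally show "Lnorm lborel q (conv k3 a0) \<le> ennreal (e3 * X * Y)" by (simp add: X_def Y_def mult_ac)
    have "Lnorm lborel q (conv k1 (\<lambda>r. a0 r * d0 n r)) \<le> Lnorm lborel q' k1 * Lnorm lborel q a0 * Lnorm lborel q (d0 n)"
      unfolding q'_def using q by (intro Lnorm_conv_mult) auto
    also have "\<dots> \<le> ennreal (e1 * norm z powr \<beta> * H powr \<kappa>) * ennreal A * ennreal (M * Y)"
      unfolding k1_norm by (intro mult_mono a0_norm dn) auto
    also have "\<dots> = ennreal (e1 * M * X * Y)"
      using E A M(1) pos(6) by (simp add: X_def ennreal_mult[symmetric] mult_ac)
    finally show "Lnorm lborel q (conv k1 (\<lambda>r. a0 r * d0 n r)) \<le> ennreal (e1 * M * X * Y)" .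
  qed auto
  also have "\<dots> = ennreal (real (Suc n) * (M * (e3 * X * Y) + e1 * M * X * Y))"
    using E M(1) pos by (simp add: ennreal_mult[symmetric] ennreal_plus[symmetric] del: ennreal_plus of_nat_Suc)
  also have "\<dots> \<le> ennreal (real (Suc n) * (M * (e3 * X * Y) + e1 * M * X * Y + e2 * M * X * Y))"
    using E M(1) pos by (intro ennreal_leI mult_left_mono) auto
  also have "real (Suc n) * (M * (e3 * X * Y) + e1 * M * X * Y + e2 * M * X * Y) = C (Suc n) * X ^ Suc n * Y"
    by (simp add: Cs M_def algebra_simps)
  finally show ?case using sup by blast
qed

end

lemma gradient_moment_bound:
  fixes p q \<beta> :: real
  assumes "2 < p" "2 < q" "2 / q + real DIM('a::euclidean_space) / p < 1" "0 < \<beta>" "\<beta> < 1"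
  shows "\<exists>C :: nat \<Rightarrow> real. (\<forall>n. 0 \<le> C n) \<and> (\<forall>(g :: real \<Rightarrow> 'a \<Rightarrow> real) z B s0 t A n s w.
    (\<lambda>(r, w). g r w) \<in> borel_measurable (borel \<Otimes>\<^sub>M borel) \<longrightarrow> (\<forall>r w. \<bar>g r w\<bar> \<le> B) \<longrightarrow> s0 < t \<longrightarrow> 0 \<le> A \<longrightarrow>
    Lnorm lborel q (\<lambda>r. indicator {s0<..<t} r * Lnorm lborel p (\<lambda>w. ennreal \<bar>g r w\<bar>)) \<le> ennreal A \<longrightarrow> s \<in> {s0..t} \<longrightarrow>
    \<bar>mom (\<lambda>r w. g r (w + z) - g r w) t n s w\<bar>
      \<le> C n * (norm z powr \<beta> * A * (t - s0) powr (1 - \<beta> / 2 - real DIM('a) / (2 * p) - 1 / q)) ^ n)"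
proof (intro exI[of _ "gradient_setup.C p q \<beta> (real DIM('a))"] conjI allI impI)
  fix g :: "real \<Rightarrow> 'a \<Rightarrow> real" and z B s0 t A n s w
  assume a: "(\<lambda>(r, w). g r w) \<in> borel_measurable (borel \<Otimes>\<^sub>M borel)" "\<forall>r w. \<bar>g r w\<bar> \<le> B" "s0 < t" "0 \<le> A"
    "Lnorm lborel q (\<lambda>r. indicator {s0<..<t} r * Lnorm lborel p (\<lambda>w. ennreal \<bar>g r w\<bar>)) \<le> ennreal A" "s \<in> {s0..t}"
  interpret gradient_setup g z p q \<beta> B s0 t A "real DIM('a)"
    by unfold_locales (use a assms in auto)
  show "\<bar>mom (\<lambda>r w. g r (w + z) - g r w) t n s w\<bar>
      \<le> gradient_setup.C p q \<beta> (real DIM('a)) n * (norm z powr \<beta> * A * (t - s0) powr (1 - \<beta> / 2 - real DIM('a) / (2 * p) - 1 / q)) ^ n"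
    using moment_bounds[of n] a unfolding X_def \<kappa>_def H_def h_def[abs_def] by blast
next
  fix n
  interpret gradient_setup "\<lambda>_ _. 0" "0::'a" p q \<beta> 0 0 1 0 "real DIM('a)"
    by unfold_locales (use assms in \<open>auto simp: Lnorm_def\<close>)
  show "0 \<le> gradient_setup.C p q \<beta> (real DIM('a)) n" by (rule pos)
qed

section \<open>Moments of Brownian functionals\<close>

lemma jointly_measurable_of_continuous:
  fixes V :: "real \<Rightarrow> 'w \<Rightarrow> 'a::euclidean_space"
  assumes V: "\<And>r. V r \<in> borel_measurable M" and cont: "\<And>\<omega>. \<omega> \<in> space M \<Longrightarrow> continuous_on UNIV (\<lambda>r. V r \<omega>)"
  shows "(\<lambda>(r, \<omega>). V r \<omega>) \<in> borel_measurable (borel \<Otimes>\<^sub>M M)"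
proof (rule borel_measurable_LIMSEQ_metric)
  fix n :: nat
  have "(\<lambda>x. V (real_of_int \<lfloor>(fst x :: real) * 2 ^ n\<rfloor> / 2 ^ n) (snd x)) \<in> borel_measurable (borel \<Otimes>\<^sub>M M)"
  proof (rule measurable_compose_countable[where f="\<lambda>i x. V (real_of_int i / 2 ^ n) (snd x)"])
    show "(\<lambda>x. V (real_of_int i / 2 ^ n) (snd x)) \<in> borel_measurable (borel \<Otimes>\<^sub>M M)" for i
      by (rule measurable_compose[OF measurable_snd V])
  qed measurable
  then show "(\<lambda>(r, \<omega>). V (real_of_int \<lfloor>(r::real) * 2 ^ n\<rfloor> / 2 ^ n) \<omega>) \<in> borel_measurable (borel \<Otimes>\<^sub>M M)"
    by (simp add: split_beta)
next
  fix x :: "real \<times> 'w" assume x: "x \<in> space (borel \<Otimes>\<^sub>M M)"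
  obtain r \<omega> where [simp]: "x = (r, \<omega>)" by (cases x)
  have lim: "(\<lambda>n. real_of_int \<lfloor>r * 2 ^ n\<rfloor> / 2 ^ n) \<longlonglongrightarrow> r"
  proof (rule tendsto_sandwich[of "\<lambda>n. r - (1/2) ^ n" _ _ "\<lambda>_. r"])
    show "\<forall>\<^sub>F n in sequentially. r - (1/2) ^ n \<le> real_of_int \<lfloor>r * 2 ^ n\<rfloor> / 2 ^ n"
    proof (intro always_eventually allI)
      fix n
      have "r * 2 ^ n - 1 \<le> real_of_int \<lfloor>r * 2 ^ n\<rfloor>" by linarith
      then have "(r * 2 ^ n - 1) / 2 ^ n \<le> real_of_int \<lfloor>r * 2 ^ n\<rfloor> / 2 ^ n"
        by (intro divide_right_mono) auto
      then show "r - (1/2) ^ n \<le> real_of_int \<lfloor>r * 2 ^ n\<rfloor> / 2 ^ n"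
        by (simp add: diff_divide_distrib power_divide)
    qed
    show "\<forall>\<^sub>F n in sequentially. real_of_int \<lfloor>r * 2 ^ n\<rfloor> / 2 ^ n \<le> r"
      by (intro always_eventually allI) (simp add: divide_le_eq)
    have "(\<lambda>n. r - (1/2) ^ n) \<longlonglongrightarrow> r - 0"
      by (intro tendsto_intros LIMSEQ_power_zero) auto
    then show "(\<lambda>n. r - (1/2) ^ n) \<longlonglongrightarrow> r" by simp
  qed auto
  have "isCont (\<lambda>r. V r \<omega>) r"
    using cont[of \<omega>] x by (auto simp: space_pair_measure continuous_on_eq_continuous_at)
  from isCont_tendsto_compose[OF this lim]
  show "(\<lambda>n. case x of (r, \<omega>) \<Rightarrow> V (real_of_int \<lfloor>r * 2 ^ n\<rfloor> / 2 ^ n) \<omega>) \<longlonglongrightarrow> (case x of (r, \<omega>) \<Rightarrow> V r \<omega>)"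
    by simp
qed

locale modified_brownian_motion = standard_brownian_motion M W for M :: "'w measure" and W :: "real \<Rightarrow> 'w \<Rightarrow> 'a::euclidean_space" +
  fixes V :: "real \<Rightarrow> 'w \<Rightarrow> 'a"
  assumes V_AE: "AE \<omega> in M. \<forall>r\<ge>0. V r \<omega> = W r \<omega>"
    and V_measurable [measurable]: "(\<lambda>(r, \<omega>). V r \<omega>) \<in> borel_measurable (borel \<Otimes>\<^sub>M M)"
    and V_start: "V 0 \<omega> = 0"
    and V_continuous: "continuous_on UNIV (\<lambda>r. V r \<omega>)"

lemma (in standard_brownian_motion) modification_exists:
  "\<exists>V. modified_brownian_motion M W V"
proof -
  from start continuous_paths have "AE \<omega> in M. W 0 \<omega> = 0 \<and> continuous_on {0..} (\<lambda>t. W t \<omega>)" by eventually_elim simp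
  then obtain N where N: "N \<in> null_sets M" "{\<omega> \<in> space M. \<not> (W 0 \<omega> = 0 \<and> continuous_on {0..} (\<lambda>t. W t \<omega>))} \<subseteq> N"
    by (auto simp: eventually_ae_filter)
  define V where "V r \<omega> = (if \<omega> \<in> space M - N then W (max 0 r) \<omega> else 0)" for r \<omega>
  have good: "W 0 \<omega> = 0" "continuous_on {0..} (\<lambda>t. W t \<omega>)" if "\<omega> \<in> space M - N" for \<omega>
    using N that by auto
  have cont: "continuous_on UNIV (\<lambda>r. V r \<omega>)" for \<omega>
  proof (cases "\<omega> \<in> space M - N")
    case True
    have "continuous_on UNIV (\<lambda>r. W (max 0 r) \<omega>)"
      by (rule continuous_on_compose2[OF good(2)[OF True]]) (auto intro!: continuous_intros)
    with True show ?thesis by (simp add: V_def)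
  next
    case False
    then have "(\<lambda>r. V r \<omega>) = (\<lambda>_. 0)" by (auto simp: V_def)
    then show ?thesis by (metis continuous_on_const)
  qed
  have [measurable]: "N \<in> sets M" using N by auto
  have Vm: "V r \<in> borel_measurable M" for r
  proof -
    have [measurable]: "W (max 0 r) \<in> borel_measurable M" by (rule measurable) simp
    show ?thesis unfolding V_def[abs_def] by measurable
  qed
  have "modified_brownian_motion M W V"
  proof unfold_locales
    show "AE \<omega> in M. \<forall>r\<ge>0. V r \<omega> = W r \<omega>"
      using AE_not_in[OF N(1)] AE_space by eventually_elim (auto simp: V_def max_def)
    show "(\<lambda>(r, \<omega>). V r \<omega>) \<in> borel_measurable (borel \<Otimes>\<^sub>M M)"
      by (rule jointly_measurable_of_continuous[OF Vm cont])
    show "V 0 \<omega> = 0" for \<omega> using good by (auto simp: V_def)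
    show "continuous_on UNIV (\<lambda>r. V r \<omega>)" for \<omega> by (rule cont)
  qed
  then show ?thesis by blast
qed

context modified_brownian_motion
begin

definition increments :: "(nat \<Rightarrow> real) \<Rightarrow> nat \<Rightarrow> 'w \<Rightarrow> nat \<Rightarrow> 'a" where
  "increments \<tau> k \<omega> = (\<lambda>i\<in>{..<k}. V (\<tau> (Suc i)) \<omega> - V (\<tau> i) \<omega>)"

text \<open>Bounded functionals of finitely many values of the path up to time \<open>s\<close>, written as functions
  of the increments because the Brownian motion is specified through them.\<close>

definition past :: "real \<Rightarrow> ('w \<Rightarrow> real) \<Rightarrow> bool" where
  "past s Z \<longleftrightarrow> (\<exists>k \<tau> G B. \<tau> 0 = 0 \<and> (\<forall>i<k. \<tau> i < \<tau> (Suc i)) \<and> \<tau> k = s \<and>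
     G \<in> borel_measurable (PiM {..<k} (\<lambda>_. borel :: 'a measure)) \<and> (\<forall>x. \<bar>G x\<bar> \<le> B) \<and> Z = (\<lambda>\<omega>. G (increments \<tau> k \<omega>)))"

lemma increments_measurable [measurable]: "increments \<tau> k \<in> measurable M (PiM {..<k} (\<lambda>_. borel))"
  unfolding increments_def[abs_def] by measurable

lemma increments_sum: "\<tau> 0 = 0 \<Longrightarrow> (\<Sum>i<k. increments \<tau> k \<omega> i) = V (\<tau> k) \<omega>"
  using sum_lessThan_telescope[of "\<lambda>i. V (\<tau> i) \<omega>" k] by (simp add: increments_def V_start)

lemma past_measurable: "past s Z \<Longrightarrow> Z \<in> borel_measurable M"
  unfolding past_def by auto

lemma past_bounded: "past s Z \<Longrightarrow> \<exists>B. \<forall>\<omega>. \<bar>Z \<omega>\<bar> \<le> B"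
  unfolding past_def by auto

lemma past_const: "0 \<le> s \<Longrightarrow> past s (\<lambda>_. c)"
  unfolding past_def
  by (rule exI[of _ "if s = 0 then 0 else 1"], rule exI[of _ "\<lambda>i. if i = 0 then 0 else s"],
      rule exI[of _ "\<lambda>_. c"], rule exI[of _ "\<bar>c\<bar>"]) auto

lemma past_extend:
  assumes Z: "past s Z" and sr: "s < r" and [measurable]: "\<phi> \<in> borel_measurable borel" and b: "\<And>v. \<bar>\<phi> v\<bar> \<le> K"
  shows "past r (\<lambda>\<omega>. Z \<omega> * \<phi> (V r \<omega>))"
proof -
  obtain k \<tau> G B where Z: "\<tau> 0 = 0" "\<And>i. i < k \<Longrightarrow> \<tau> i < \<tau> (Suc i)" "\<tau> k = s"
     "G \<in> borel_measurable (PiM {..<k} (\<lambda>_. borel :: 'a measure))" "\<And>x. \<bar>G x\<bar> \<le> B" "Z = (\<lambda>\<omega>. G (increments \<tau> k \<omega>))"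
    using Z unfolding past_def by blast
  note Z(4)[measurable]
  define \<tau>' where "\<tau>' = \<tau>(Suc k := r)"
  have \<tau>': "\<tau>' 0 = 0" "\<And>i. i < Suc k \<Longrightarrow> \<tau>' i < \<tau>' (Suc i)" "\<tau>' (Suc k) = r"
    using Z sr by (auto simp: \<tau>'_def less_Suc_eq)
  have restr: "restrict (increments \<tau>' (Suc k) \<omega>) {..<k} = increments \<tau> k \<omega>" for \<omega>
    by (auto simp: increments_def \<tau>'_def fun_eq_iff)
  have "(\<lambda>x. G (restrict x {..<k}) * \<phi> (\<Sum>i<Suc k. x i)) \<in> borel_measurable (PiM {..<Suc k} (\<lambda>_. borel :: 'a measure))"
  proof -
    have [measurable]: "(\<lambda>x. restrict x {..<k}) \<in> measurable (PiM {..<Suc k} (\<lambda>_. borel :: 'a measure)) (PiM {..<k} (\<lambda>_. borel))"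
      by (rule measurable_restrict_subset) auto
    show ?thesis by measurable
  qed
  moreover have "\<bar>G (restrict x {..<k}) * \<phi> (\<Sum>i<Suc k. x i)\<bar> \<le> B * K" for x
    unfolding abs_mult using Z(5)[of "restrict x {..<k}"] by (intro mult_mono Z(5) b) auto
  moreover have "(\<lambda>\<omega>. Z \<omega> * \<phi> (V r \<omega>)) = (\<lambda>\<omega>. G (restrict (increments \<tau>' (Suc k) \<omega>) {..<k}) * \<phi> (\<Sum>i<Suc k. increments \<tau>' (Suc k) \<omega> i))"
    using increments_sum[of \<tau>' "Suc k"] \<tau>' by (simp only: restr Z(6))
  ultimately show ?thesis unfolding past_def using \<tau>' by blast
qed

lemma increment_integral:
  assumes \<tau>: "\<tau> 0 = 0" "\<And>i. i < Suc k \<Longrightarrow> \<tau> i < \<tau> (Suc i)"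
    and [measurable]: "(\<lambda>(x, v). F x v) \<in> borel_measurable (PiM {..<k} (\<lambda>_. borel) \<Otimes>\<^sub>M borel)" and b: "\<And>x v. \<bar>F x v\<bar> \<le> K"
  shows "(LINT \<omega>|M. F (increments \<tau> k \<omega>) (V (\<tau> (Suc k)) \<omega> - V (\<tau> k) \<omega>))
    = (LINT \<omega>|M. (LINT v|lborel. heat (\<tau> (Suc k) - \<tau> k) v * F (increments \<tau> k \<omega>) v))"
proof -
  have \<tau>0: "0 \<le> \<tau> i" if "i \<le> Suc k" for i
    using that
  proof (induction i)
    case (Suc i) then show ?case using \<tau>(2)[of i] by simp
  qed (use \<tau> in simp)
  define X where "X i \<omega> = W (\<tau> (Suc i)) \<omega> - W (\<tau> i) \<omega>" for i \<omega>
  have ind: "indep_vars (\<lambda>_. borel) X {..<Suc k}"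
    unfolding X_def using \<tau> by (intro independent_increments) auto
  have Xm [measurable]: "X i \<in> borel_measurable M" if "i < Suc k" for i
    using ind that by (auto simp: indep_vars_def)
  have Xk [measurable]: "X k \<in> borel_measurable M" by (rule Xm) simp
  define I where "I \<omega> = (\<lambda>i\<in>{..<k}. X i \<omega>)" for \<omega>
  define J where "J \<omega> = (\<lambda>i\<in>{k}. X i \<omega>)" for \<omega>
  have Jk [simp]: "J \<omega> k = X k \<omega>" for \<omega> by (simp add: J_def)
  have iv: "indep_var (PiM {..<k} (\<lambda>_. borel)) I (PiM {k} (\<lambda>_. borel)) J"
    unfolding I_def[abs_def] J_def[abs_def] by (rule indep_var_restrict[OF ind]) auto
  have I_meas [measurable]: "I \<in> measurable M (PiM {..<k} (\<lambda>_. borel))" using indep_var_rv1[OF iv] .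
  have J_meas [measurable]: "J \<in> measurable M (PiM {k} (\<lambda>_. borel))" using indep_var_rv2[OF iv] .
  have AEI: "AE \<omega> in M. increments \<tau> k \<omega> = I \<omega> \<and> V (\<tau> (Suc k)) \<omega> - V (\<tau> k) \<omega> = X k \<omega>"
    using V_AE
  proof eventually_elim
    case (elim \<omega>)
    then show ?case using \<tau>0 by (auto simp: increments_def I_def X_def fun_eq_iff)
  qed
  let ?P = "distr M (PiM {..<k} (\<lambda>_. borel)) I" and ?Q = "distr M (PiM {k} (\<lambda>_. borel)) J"
  interpret P: prob_space ?P by (rule prob_space_distr) measurable
  interpret Q: prob_space ?Q by (rule prob_space_distr) measurable
  interpret PQ: pair_prob_space ?P ?Q ..
  have dist: "distributed M lborel (X k) (\<lambda>x. ennreal (heat (\<tau> (Suc k) - \<tau> k) x))"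
    using gaussian_increments[of "\<tau> k" "\<tau> (Suc k)"] \<tau>(2)[of k] \<tau>0[of k]
    unfolding X_def by (simp add: heat_eq_prod)
  have "(LINT \<omega>|M. F (increments \<tau> k \<omega>) (V (\<tau> (Suc k)) \<omega> - V (\<tau> k) \<omega>)) = (LINT \<omega>|M. F (I \<omega>) (X k \<omega>))"
  proof (rule integral_cong_AE)
    show "AE \<omega> in M. F (increments \<tau> k \<omega>) (V (\<tau> (Suc k)) \<omega> - V (\<tau> k) \<omega>) = F (I \<omega>) (X k \<omega>)"
      using AEI by eventually_elim simp
  qed measurable
  also have "\<dots> = (LINT y|distr M (PiM {..<k} (\<lambda>_. borel) \<Otimes>\<^sub>M PiM {k} (\<lambda>_. borel)) (\<lambda>\<omega>. (I \<omega>, J \<omega>)). F (fst y) (snd y k))"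
    by (subst integral_distr) auto
  also have "distr M (PiM {..<k} (\<lambda>_. borel) \<Otimes>\<^sub>M PiM {k} (\<lambda>_. borel)) (\<lambda>\<omega>. (I \<omega>, J \<omega>)) = ?P \<Otimes>\<^sub>M ?Q"
    using iv unfolding indep_var_distribution_eq by simp
  also have "(LINT y|(?P \<Otimes>\<^sub>M ?Q). F (fst y) (snd y k)) = (LINT x|?P. (LINT v|?Q. F x (v k)))"
    by (subst PQ.integral_fst'[symmetric])
       (auto intro!: PQ.P.integrable_const_bound[where B=K] simp: b cong: measurable_cong_sets)
  also have "\<dots> = (LINT \<omega>|M. (LINT v|?Q. F (I \<omega>) (v k)))"
    by (subst integral_distr) auto
  also have "\<dots> = (LINT \<omega>|M. (LINT v|lborel. heat (\<tau> (Suc k) - \<tau> k) v * F (I \<omega>) v))"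
  proof (rule Bochner_Integration.integral_cong)
    fix \<omega> assume [measurable]: "\<omega> \<in> space M"
    have "(LINT v|?Q. F (I \<omega>) (v k)) = (LINT \<omega>'|M. F (I \<omega>) (X k \<omega>'))"
      by (subst integral_distr) auto
    also have "\<dots> = (LINT v|lborel. heat (\<tau> (Suc k) - \<tau> k) v * F (I \<omega>) v)"
      by (rule distributed_integral[OF dist, symmetric]) auto
    finally show "(LINT v|?Q. F (I \<omega>) (v k)) = (LINT v|lborel. heat (\<tau> (Suc k) - \<tau> k) v * F (I \<omega>) v)" .
  qed simp
  also have "\<dots> = (LINT \<omega>|M. (LINT v|lborel. heat (\<tau> (Suc k) - \<tau> k) v * F (increments \<tau> k \<omega>) v))"
  proof (rule integral_cong_AE)
    show "AE \<omega> in M. (LINT v|lborel. heat (\<tau> (Suc k) - \<tau> k) v * F (I \<omega>) v) = (LINT v|lborel. heat (\<tau> (Suc k) - \<tau> k) v * F (increments \<tau> k \<omega>) v)"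
      using AEI by eventually_elim simp
  qed measurable
  finally show ?thesis .
qed

lemma past_markov:
  assumes Z: "past s Z" and sr: "s < r" and [measurable]: "\<phi> \<in> borel_measurable borel" and b: "\<And>v. \<bar>\<phi> v\<bar> \<le> K"
  shows "(LINT \<omega>|M. Z \<omega> * \<phi> (V r \<omega>)) = (LINT \<omega>|M. Z \<omega> * (LINT v|lborel. heat (r - s) v * \<phi> (V s \<omega> + v)))"
proof -
  obtain k \<tau> G B where Z: "\<tau> 0 = 0" "\<And>i. i < k \<Longrightarrow> \<tau> i < \<tau> (Suc i)" "\<tau> k = s"
     "G \<in> borel_measurable (PiM {..<k} (\<lambda>_. borel :: 'a measure))" "\<And>x. \<bar>G x\<bar> \<le> B" "Z = (\<lambda>\<omega>. G (increments \<tau> k \<omega>))"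
    using Z unfolding past_def by blast
  note Z(4)[measurable]
  define \<tau>' where "\<tau>' = \<tau>(Suc k := r)"
  have \<tau>': "\<tau>' 0 = 0" "\<And>i. i < Suc k \<Longrightarrow> \<tau>' i < \<tau>' (Suc i)" "\<tau>' (Suc k) = r" "\<tau>' k = s"
    using Z sr by (auto simp: \<tau>'_def less_Suc_eq)
  have inc: "increments \<tau>' k \<omega> = increments \<tau> k \<omega>" for \<omega>
    by (auto simp: increments_def \<tau>'_def fun_eq_iff)
  define F where "F x v = G x * \<phi> ((\<Sum>i<k. x i) + v)" for x v
  have Fm: "(\<lambda>(x, v). F x v) \<in> borel_measurable (PiM {..<k} (\<lambda>_. borel) \<Otimes>\<^sub>M borel)"
    unfolding F_def split_beta by measurable
  have Fb: "\<bar>F x v\<bar> \<le> B * K" for x v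
    unfolding abs_mult F_def using Z(5)[of x] by (intro mult_mono Z(5) b) auto
  have eq: "F (increments \<tau>' k \<omega>) v = Z \<omega> * \<phi> (V s \<omega> + v)" for \<omega> v
    unfolding F_def inc Z(6) using increments_sum[of \<tau> k \<omega>] Z(1,3) by simp
  have "(LINT \<omega>|M. Z \<omega> * \<phi> (V r \<omega>)) = (LINT \<omega>|M. F (increments \<tau>' k \<omega>) (V (\<tau>' (Suc k)) \<omega> - V (\<tau>' k) \<omega>))"
    unfolding eq by (simp add: \<tau>')
  also have "\<dots> = (LINT \<omega>|M. (LINT v|lborel. heat (\<tau>' (Suc k) - \<tau>' k) v * F (increments \<tau>' k \<omega>) v))"
    by (rule increment_integral[OF \<tau>'(1,2) Fm Fb])
  also have "\<dots> = (LINT \<omega>|M. Z \<omega> * (LINT v|lborel. heat (r - s) v * \<phi> (V s \<omega> + v)))"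
    unfolding eq by (simp add: \<tau>' mult.left_commute)
  finally show ?thesis .
qed

lemma fubini_bounded:
  fixes f :: "real \<Rightarrow> 'w \<Rightarrow> real"
  assumes [measurable]: "(\<lambda>(r, \<omega>). f r \<omega>) \<in> borel_measurable (borel \<Otimes>\<^sub>M M)"
    and b: "\<And>r \<omega>. \<bar>f r \<omega>\<bar> \<le> K * indicator {s..t::real} r"
  shows "(LINT \<omega>|M. (LINT r|lborel. f r \<omega>)) = (LINT r|lborel. (LINT \<omega>|M. f r \<omega>))"
proof -
  interpret PS: pair_sigma_finite lborel M ..
  have "integrable (lborel \<Otimes>\<^sub>M M) (\<lambda>(r, \<omega>). f r \<omega>)"
  proof (rule integrableI_bounded)
    have "(\<integral>\<^sup>+x. ennreal (norm (case x of (r, \<omega>) \<Rightarrow> f r \<omega>)) \<partial>(lborel \<Otimes>\<^sub>M M)) = (\<integral>\<^sup>+r. (\<integral>\<^sup>+\<omega>. ennreal \<bar>f r \<omega>\<bar> \<partial>M) \<partial>lborel)"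
      by (subst nn_integral_fst[symmetric]) auto
    also have "\<dots> \<le> (\<integral>\<^sup>+r. (\<integral>\<^sup>+\<omega>. ennreal \<bar>K\<bar> * indicator {s..t} r \<partial>M) \<partial>lborel)"
    proof (intro nn_integral_mono)
      fix r \<omega> show "ennreal \<bar>f r \<omega>\<bar> \<le> ennreal \<bar>K\<bar> * indicator {s..t} r"
        using b[of r \<omega>] by (auto simp: indicator_def intro!: ennreal_leI split: if_splits)
    qed
    also have "\<dots> = ennreal \<bar>K\<bar> * emeasure lborel {s..t}"
      by (simp add: emeasure_space_1 nn_integral_cmult)
    also have "\<dots> < \<infinity>" by (auto simp: ennreal_mult_less_top emeasure_lborel_Icc_eq)
    finally show "(\<integral>\<^sup>+x. ennreal (norm (case x of (r, \<omega>) \<Rightarrow> f r \<omega>)) \<partial>(lborel \<Otimes>\<^sub>M M)) < \<infinity>" .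
  qed measurable
  from PS.Fubini_integral[OF this] show ?thesis .
qed

end

lemma power_of_tail_integral:
  fixes f :: "real \<Rightarrow> real"
  assumes cont: "continuous_on UNIV f" and st: "s \<le> t"
  defines "F \<equiv> \<lambda>r. LINT \<rho>|lborel. indicator {r..t} \<rho> * f \<rho>"
  shows "F s ^ Suc n = real (Suc n) * (LINT r|lborel. indicator {s..t} r * (f r * F r ^ n))"
proof -
  have c: "continuous_on A f" for A using cont continuous_on_subset by blast
  have Fi: "F r = integral {r..t} f" for r
    using set_borel_integral_eq_integral(2)[OF borel_integrable_atLeastAtMost'[OF c], of r t]
    by (simp add: F_def set_lebesgue_integral_def)
  have split: "F r = integral {s..t} f - integral {s..r} f" if "r \<in> {s..t}" for r
    using Henstock_Kurzweil_Integration.integral_combine[of s r t f] that integrable_continuous_interval[OF c] by (simp add: Fi)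
  have der: "(F has_real_derivative - f r) (at r within {s..t})" if r: "r \<in> {s..t}" for r
  proof -
    have "((\<lambda>r. integral {s..r} f) has_real_derivative f r) (at r within {s..t})"
      using integral_has_real_derivative[OF c r] .
    then have "((\<lambda>r. integral {s..t} f - integral {s..r} f) has_real_derivative 0 - f r) (at r within {s..t})"
      by (intro derivative_intros)
    then have "(F has_real_derivative 0 - f r) (at r within {s..t})"
      by (rule has_field_derivative_transform_within[OF _ zero_less_one r]) (use split in auto)
    then show ?thesis by simp
  qed
  have Fc: "continuous_on {s..t} F"
    by (rule DERIV_continuous_on[OF der]) 
  have I: "((\<lambda>r. - (real (Suc n) * (f r * F r ^ n))) has_integral (F t ^ Suc n - F s ^ Suc n)) {s..t}"
  proof (rule fundamental_theorem_of_calculus[OF st])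
    fix r assume r: "r \<in> {s..t}"
    have "((\<lambda>r. F r ^ Suc n) has_real_derivative real (Suc n) * F r ^ n * (- f r)) (at r within {s..t})"
      using DERIV_power[OF der[OF r], of "Suc n"] by (simp add: mult_ac)
    then show "((\<lambda>r. F r ^ Suc n) has_vector_derivative - (real (Suc n) * (f r * F r ^ n))) (at r within {s..t})"
      by (simp add: has_real_derivative_iff_has_vector_derivative mult_ac)
  qed
  have "F t = 0" by (simp add: Fi)
  then have "F t ^ Suc n = 0" by simp
  with has_integral_neg[OF I] have "((\<lambda>r. real (Suc n) * (f r * F r ^ n)) has_integral F s ^ Suc n) {s..t}"
    by (simp only: minus_minus minus_diff_eq diff_0_right)
  from integral_unique[OF this, symmetric]
  have "F s ^ Suc n = integral {s..t} (\<lambda>r. real (Suc n) * (f r * F r ^ n))" .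
  also have "\<dots> = real (Suc n) * integral {s..t} (\<lambda>r. f r * F r ^ n)"
    by (rule integral_mult_right)
  also have "integral {s..t} (\<lambda>r. f r * F r ^ n) = (LINT r|lborel. indicator {s..t} r * (f r * F r ^ n))"
  proof -
    have "continuous_on {s..t} (\<lambda>r. f r * F r ^ n)" by (intro continuous_intros c Fc)
    from set_borel_integral_eq_integral(2)[OF borel_integrable_atLeastAtMost'[OF this]]
    show ?thesis by (simp add: set_lebesgue_integral_def)
  qed
  finally show ?thesis .
qed

context modified_brownian_motion
begin

definition tail :: "(real \<Rightarrow> 'a \<Rightarrow> real) \<Rightarrow> real \<Rightarrow> real \<Rightarrow> 'w \<Rightarrow> real" where
  "tail h t r \<omega> = (LINT \<rho>|lborel. indicator {r..t} \<rho> * h \<rho> (V \<rho> \<omega>))"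

context
  fixes h :: "real \<Rightarrow> 'a \<Rightarrow> real" and B t :: real
  assumes hc: "continuous_on UNIV (\<lambda>(r, w). h r w)" and hb: "\<And>r w. \<bar>h r w\<bar> \<le> B"
begin

lemma h_meas [measurable]: "(\<lambda>(r, w). h r w) \<in> borel_measurable (borel \<Otimes>\<^sub>M borel)"
  unfolding borel_prod using hc by (rule borel_measurable_continuous_onI)

lemma h_meas' [measurable]: "h r \<in> borel_measurable borel"
  using measurable_compose[OF measurable_Pair1' h_meas, of r] by simp

lemma h_path_meas [measurable]: "(\<lambda>(r, \<omega>). h r (V r \<omega>)) \<in> borel_measurable (borel \<Otimes>\<^sub>M M)"
  using measurable_compose[OF measurable_Pair[OF measurable_fst V_measurable] h_meas] by (simp add: split_beta)

lemma tail_meas [measurable]: "(\<lambda>(r, \<omega>). tail h t r \<omega>) \<in> borel_measurable (borel \<Otimes>\<^sub>M M)"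
proof -
  have [measurable]: "(\<lambda>x. h (f x) (V (f x) (g x))) \<in> borel_measurable N"
    if "f \<in> borel_measurable N" "g \<in> measurable N M" for f g and N :: "((real \<times> 'w) \<times> real) measure"
    using measurable_compose[OF measurable_Pair[OF that] h_path_meas] by simp
  have "(\<lambda>(r, \<omega>). LINT \<rho>|lborel. (if r \<le> \<rho> \<and> \<rho> \<le> t then h \<rho> (V \<rho> \<omega>) else 0)) \<in> borel_measurable (borel \<Otimes>\<^sub>M M)"
    unfolding split_beta by measurable
  moreover have "tail h t r \<omega> = (LINT \<rho>|lborel. (if r \<le> \<rho> \<and> \<rho> \<le> t then h \<rho> (V \<rho> \<omega>) else 0))" for r \<omega>
    unfolding tail_def by (intro Bochner_Integration.integral_cong) (auto simp: indicator_def)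
  ultimately show ?thesis by simp
qed

lemma tail_bound: "r \<le> t \<Longrightarrow> \<bar>tail h t r \<omega>\<bar> \<le> B * (t - r)"
proof -
  assume rt: "r \<le> t"
  have B: "0 \<le> B" using hb[of 0 0] by linarith
  have "\<bar>tail h t r \<omega>\<bar> \<le> (LINT \<rho>|lborel. \<bar>indicator {r..t} \<rho> * h \<rho> (V \<rho> \<omega>)\<bar>)"
    unfolding tail_def by (rule integral_abs_bound)
  also have "\<dots> \<le> (LINT \<rho>|lborel. indicator {r..t} \<rho> * B)"
  proof (rule integral_mono')
    show "integrable lborel (\<lambda>\<rho>. indicator {r..t} \<rho> * B)"
      by (intro integrable_mult_left integrable_real_indicator) (use rt in auto)
  qed (use hb B in \<open>auto simp: indicator_def\<close>)
  also have "\<dots> = B * (t - r)" using rt by simp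
  finally show ?thesis .
qed

lemma moment_identity:
  assumes "0 \<le> s" "s \<le> t" "past s Z"
  shows "(LINT \<omega>|M. Z \<omega> * tail h t s \<omega> ^ n) = (LINT \<omega>|M. Z \<omega> * mom h t n s (V s \<omega>))"
  using assms
proof (induction n arbitrary: s Z)
  case (Suc n)
  note Zm [measurable] = past_measurable[OF Suc.prems(3)]
  obtain BZ where BZ: "\<And>\<omega>. \<bar>Z \<omega>\<bar> \<le> BZ" using past_bounded[OF Suc.prems(3)] by blast
  have BZ0: "0 \<le> BZ" using BZ[of undefined] by linarith
  have B0: "0 \<le> B" using hb[of 0 0] by linarith
  obtain K where K: "\<And>r w. r \<in> {s..t} \<Longrightarrow> \<bar>mom h t n r w\<bar> \<le> K"
    using mom_bounded[OF h_meas hb Suc.prems(2), of n] by blast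
  have K0: "0 \<le> K" using K[of s 0] Suc.prems by force
  have cont: "continuous_on UNIV (\<lambda>r. h r (V r \<omega>))" for \<omega>
  proof -
    have "continuous_on UNIV (\<lambda>r. (r, V r \<omega>))"
      by (intro continuous_on_Pair continuous_on_id V_continuous)
    from continuous_on_compose2[OF hc this] show ?thesis by simp
  qed
  have pw: "tail h t s \<omega> ^ Suc n = real (Suc n) * (LINT r|lborel. indicator {s..t} r * (h r (V r \<omega>) * tail h t r \<omega> ^ n))" for \<omega>
    unfolding tail_def by (rule power_of_tail_integral[OF cont Suc.prems(2)])
  have "(LINT \<omega>|M. Z \<omega> * tail h t s \<omega> ^ Suc n)
     = real (Suc n) * (LINT \<omega>|M. (LINT r|lborel. Z \<omega> * (indicator {s..t} r * (h r (V r \<omega>) * tail h t r \<omega> ^ n))))"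
    unfolding pw by (simp only: mult.left_commute[of "Z _" "real (Suc n)"] integral_mult_right_zero)
  also have "(LINT \<omega>|M. (LINT r|lborel. Z \<omega> * (indicator {s..t} r * (h r (V r \<omega>) * tail h t r \<omega> ^ n))))
     = (LINT r|lborel. (LINT \<omega>|M. Z \<omega> * (indicator {s..t} r * (h r (V r \<omega>) * tail h t r \<omega> ^ n))))"
  proof (rule fubini_bounded)
    show "\<bar>Z \<omega> * (indicator {s..t} r * (h r (V r \<omega>) * tail h t r \<omega> ^ n))\<bar> \<le> (BZ * (B * (B * (t - s)) ^ n)) * indicator {s..t} r" for r \<omega>
    proof (cases "r \<in> {s..t}")
      case True
      have "\<bar>tail h t r \<omega>\<bar> \<le> B * (t - s)"
        using tail_bound[of r \<omega>] True B0 by (intro order_trans[OF tail_bound] mult_left_mono) auto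
      then have "\<bar>tail h t r \<omega>\<bar> ^ n \<le> (B * (t - s)) ^ n" by (intro power_mono) auto
      then show ?thesis using True B0 BZ0
        by (auto simp: abs_mult power_abs intro!: mult_mono BZ hb)
    qed simp
  qed measurable
  also have "\<dots> = (LINT r|lborel. (LINT \<omega>|M. Z \<omega> * (if s < r \<and> r < t then (LINT v|lborel. heat (r - s) v * (h r (V s \<omega> + v) * mom h t n r (V s \<omega> + v))) else 0)))"
  proof (rule integral_cong_AE)
    show "AE r in lborel. (LINT \<omega>|M. Z \<omega> * (indicator {s..t} r * (h r (V r \<omega>) * tail h t r \<omega> ^ n)))
      = (LINT \<omega>|M. Z \<omega> * (if s < r \<and> r < t then (LINT v|lborel. heat (r - s) v * (h r (V s \<omega> + v) * mom h t n r (V s \<omega> + v))) else 0))"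
      using AE_lborel_singleton[of s] AE_lborel_singleton[of t]
    proof eventually_elim
      case (elim r)
      show ?case
      proof (cases "s < r \<and> r < t")
        case True
        have "(LINT \<omega>|M. Z \<omega> * (h r (V r \<omega>) * tail h t r \<omega> ^ n)) = (LINT \<omega>|M. (Z \<omega> * h r (V r \<omega>)) * tail h t r \<omega> ^ n)"
          by (simp add: mult.assoc)
        also have "\<dots> = (LINT \<omega>|M. (Z \<omega> * h r (V r \<omega>)) * mom h t n r (V r \<omega>))"
          using True Suc.prems by (intro Suc.IH past_extend[where K=B]) (auto simp: hb)
        also have "\<dots> = (LINT \<omega>|M. Z \<omega> * (h r (V r \<omega>) * mom h t n r (V r \<omega>)))"
          by (simp add: mult.assoc)
        also have "\<dots> = (LINT \<omega>|M. Z \<omega> * (LINT v|lborel. heat (r - s) v * (h r (V s \<omega> + v) * mom h t n r (V s \<omega> + v))))"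
          using True Suc.prems B0
          by (intro past_markov[of s Z r "\<lambda>v. h r v * mom h t n r v" "B * K"]) (auto simp: abs_mult intro!: mult_mono hb K)
        finally show ?thesis using True by simp
      qed (use elim in \<open>auto simp: indicator_def\<close>)
    qed
  qed measurable
  also have "\<dots> = (LINT \<omega>|M. (LINT r|lborel. Z \<omega> * (if s < r \<and> r < t then (LINT v|lborel. heat (r - s) v * (h r (V s \<omega> + v) * mom h t n r (V s \<omega> + v))) else 0)))"
  proof (rule fubini_bounded[symmetric])
    show "\<bar>Z \<omega> * (if s < r \<and> r < t then (LINT v|lborel. heat (r - s) v * (h r (V s \<omega> + v) * mom h t n r (V s \<omega> + v))) else 0)\<bar>
       \<le> (BZ * (B * K)) * indicator {s..t} r" for r \<omega>
    proof (cases "s < r \<and> r < t")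
      case True
      have "\<bar>LINT v|lborel. heat (r - s) v * (h r (V s \<omega> + v) * mom h t n r (V s \<omega> + v))\<bar> \<le> B * K"
        using True B0 by (intro integrable_heat_mult) (auto simp: abs_mult intro!: mult_mono hb K)
      then show ?thesis using True BZ0 by (auto simp: abs_mult intro!: mult_mono BZ)
    qed (use B0 BZ0 K0 in auto)
  qed measurable
  finally show ?case by (simp only: mom.simps mult.left_commute[of "Z _" "real (Suc n)"] integral_mult_right_zero)
qed simp

end

end

section \<open>Paths of finite variation\<close>

definition partitions :: "real \<Rightarrow> real \<Rightarrow> (nat \<times> (nat \<Rightarrow> real)) set" where
  "partitions u v = {(n, \<tau>). \<tau> 0 = u \<and> \<tau> n = v \<and> (\<forall>i<n. \<tau> i < \<tau> (Suc i))}"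

lemma variation_eq: "variation \<psi> u v = (SUP x \<in> partitions u v. \<Sum>i<fst x. ennreal (norm (\<psi> (snd x (Suc i)) - \<psi> (snd x i))))"
  by (simp add: variation_def partitions_def split_beta)

lemma variation_ge:
  assumes "\<tau> 0 = u" "\<tau> n = v" "\<And>i. i < n \<Longrightarrow> \<tau> i < \<tau> (Suc i)"
  shows "(\<Sum>i<n. ennreal (norm (\<psi> (\<tau> (Suc i)) - \<psi> (\<tau> i)))) \<le> variation \<psi> u v"
  unfolding variation_eq
  by (rule SUP_upper2[of "(n, \<tau>)"]) (use assms in \<open>auto simp: partitions_def\<close>)

lemma variation_le:
  assumes "\<And>n \<tau>. \<tau> 0 = u \<Longrightarrow> \<tau> n = v \<Longrightarrow> (\<And>i. i < n \<Longrightarrow> \<tau> i < \<tau> (Suc i)) \<Longrightarrow>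
    (\<Sum>i<n. ennreal (norm (\<psi> (\<tau> (Suc i)) - \<psi> (\<tau> i)))) \<le> c"
  shows "variation \<psi> u v \<le> c"
  unfolding variation_eq by (rule SUP_least) (use assms in \<open>auto simp: partitions_def\<close>)

lemma partitions_nonempty: "u \<le> v \<Longrightarrow> partitions u v \<noteq> {}"
proof (cases "u = v")
  case True
  then have "(0, \<lambda>_. u) \<in> partitions u v" by (simp add: partitions_def)
  then show ?thesis by blast
next
  case False
  moreover assume "u \<le> v"
  ultimately have "(1, \<lambda>i. if i = 0 then u else v) \<in> partitions u v" by (simp add: partitions_def)
  then show ?thesis by blast
qed

lemma variation_append:
  assumes "a \<le> b" "b \<le> c"
  shows "variation \<psi> a b + ennreal (norm (\<psi> c - \<psi> b)) \<le> variation \<psi> a c"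
proof (cases "b = c")
  case False
  with assms have bc: "b < c" by simp
  show ?thesis
    unfolding variation_eq[of \<psi> a b] ennreal_SUP_add_left[OF partitions_nonempty[OF assms(1)], symmetric]
  proof (rule SUP_least)
    fix x assume x: "x \<in> partitions a b"
    obtain n \<tau> where [simp]: "x = (n, \<tau>)" by (cases x)
    have \<tau>: "\<tau> 0 = a" "\<tau> n = b" "\<And>i. i < n \<Longrightarrow> \<tau> i < \<tau> (Suc i)" using x by (auto simp: partitions_def)
    have "(\<Sum>i<Suc n. ennreal (norm (\<psi> ((\<tau>(Suc n := c)) (Suc i)) - \<psi> ((\<tau>(Suc n := c)) i)))) \<le> variation \<psi> a c"
      by (rule variation_ge) (use \<tau> bc in \<open>auto simp: less_Suc_eq\<close>)
    then show "(\<Sum>i<fst x. ennreal (norm (\<psi> (snd x (Suc i)) - \<psi> (snd x i)))) + ennreal (norm (\<psi> c - \<psi> b)) \<le> variation \<psi> a c"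
      by (simp add: \<tau>(2))
  qed
qed simp

lemma variation_prepend:
  assumes "a \<le> b" "b \<le> c"
  shows "ennreal (norm (\<psi> b - \<psi> a)) + variation \<psi> b c \<le> variation \<psi> a c"
proof (cases "a = b")
  case False
  with assms have ab: "a < b" by simp
  have "variation \<psi> b c + ennreal (norm (\<psi> b - \<psi> a)) \<le> variation \<psi> a c"
    unfolding variation_eq[of \<psi> b c] ennreal_SUP_add_left[OF partitions_nonempty[OF assms(2)], symmetric]
  proof (rule SUP_least)
    fix x assume x: "x \<in> partitions b c"
    obtain n \<tau> where [simp]: "x = (n, \<tau>)" by (cases x)
    have \<tau>: "\<tau> 0 = b" "\<tau> n = c" "\<And>i. i < n \<Longrightarrow> \<tau> i < \<tau> (Suc i)" using x by (auto simp: partitions_def)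
    let ?\<tau> = "case_nat a \<tau>"
    have "(\<Sum>i<Suc n. ennreal (norm (\<psi> (?\<tau> (Suc i)) - \<psi> (?\<tau> i)))) \<le> variation \<psi> a c"
      by (rule variation_ge) (use \<tau> ab in \<open>auto split: nat.split\<close>)
    then show "(\<Sum>i<fst x. ennreal (norm (\<psi> (snd x (Suc i)) - \<psi> (snd x i)))) + ennreal (norm (\<psi> b - \<psi> a)) \<le> variation \<psi> a c"
      by (simp add: \<tau>(1) sum.lessThan_Suc_shift add.commute del: sum.lessThan_Suc)
  qed
  then show ?thesis by (simp add: add.commute)
qed simp

lemma variation_mono:
  assumes "a' \<le> a" "a \<le> b" "b \<le> b'"
  shows "variation \<psi> a b \<le> variation \<psi> a' b'"
proof -
  have "variation \<psi> a b \<le> variation \<psi> a b'"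
    by (rule order_trans[OF _ variation_append[of a b b' \<psi>]]) (use assms in auto)
  also have "\<dots> \<le> variation \<psi> a' b'"
    by (rule order_trans[OF _ variation_prepend[of a' a b' \<psi>]]) (use assms in auto)
  finally show ?thesis .
qed

lemma variation_self [simp]: "variation \<psi> a a = 0"
proof -
  have "variation \<psi> a a \<le> 0"
  proof (rule variation_le)
    fix n and \<tau> :: "nat \<Rightarrow> real"
    assume \<tau>: "\<tau> 0 = a" "\<tau> n = a" "\<And>i. i < n \<Longrightarrow> \<tau> i < \<tau> (Suc i)"
    have "n = 0"
    proof (rule ccontr)
      assume "n \<noteq> 0"
      have "i \<le> n \<Longrightarrow> 0 < i \<Longrightarrow> \<tau> 0 < \<tau> i" for i
      proof (induction i)
        case (Suc i) then show ?case using \<tau>(3)[of i] by (cases "i = 0") auto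
      qed simp
      from this[of n] \<tau> \<open>n \<noteq> 0\<close> show False by simp
    qed
    then show "(\<Sum>i<n. ennreal (norm (\<psi> (\<tau> (Suc i)) - \<psi> (\<tau> i)))) \<le> 0" by simp
  qed
  then show ?thesis by simp
qed

lemma norm_le_variation: "a \<le> b \<Longrightarrow> ennreal (norm (\<psi> b - \<psi> a)) \<le> variation \<psi> a b"
  using variation_append[of a a b \<psi>] by simp

lemma sum_le_variation:
  assumes "\<And>i. i < n \<Longrightarrow> \<tau> i \<le> \<tau> (Suc i)"
  shows "(\<Sum>i<n. ennreal (norm (\<psi> (\<tau> (Suc i)) - \<psi> (\<tau> i)))) \<le> variation \<psi> (\<tau> 0) (\<tau> n)"
  using assms
proof (induction n)
  case (Suc n)
  have mono: "i \<le> n \<Longrightarrow> \<tau> 0 \<le> \<tau> i" for i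
  proof (induction i)
    case (Suc i) then show ?case using Suc.prems \<open>\<And>i. i < Suc n \<Longrightarrow> \<tau> i \<le> \<tau> (Suc i)\<close>[of i] by simp
  qed simp
  have "(\<Sum>i<Suc n. ennreal (norm (\<psi> (\<tau> (Suc i)) - \<psi> (\<tau> i))))
     \<le> variation \<psi> (\<tau> 0) (\<tau> n) + ennreal (norm (\<psi> (\<tau> (Suc n)) - \<psi> (\<tau> n)))"
    using Suc by (auto intro!: add_mono)
  also have "\<dots> \<le> variation \<psi> (\<tau> 0) (\<tau> (Suc n))"
    using mono[of n] Suc.prems[of n] by (intro variation_append) auto
  finally show ?case .
qed simp

lemma variation_comp_le:
  assumes \<rho>: "mono_on {a..b} \<rho>" "\<And>r. r \<in> {a..b} \<Longrightarrow> \<rho> r \<in> {s..t}"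
  shows "variation (\<lambda>r. \<psi> (\<rho> r)) a b \<le> variation \<psi> s t"
proof (rule variation_le)
  fix n and \<tau> :: "nat \<Rightarrow> real"
  assume \<tau>: "\<tau> 0 = a" "\<tau> n = b" "\<And>i. i < n \<Longrightarrow> \<tau> i < \<tau> (Suc i)"
  have le: "i \<le> j \<Longrightarrow> j \<le> n \<Longrightarrow> \<tau> i \<le> \<tau> j" for i j
  proof (induction j)
    case (Suc j) then show ?case using \<tau>(3)[of j] by (cases "i = Suc j") auto
  qed simp
  have in_ab: "\<tau> i \<in> {a..b}" if "i \<le> n" for i
    using le[of 0 i] le[of i n] that \<tau> by auto
  have "(\<Sum>i<n. ennreal (norm (\<psi> (\<rho> (\<tau> (Suc i))) - \<psi> (\<rho> (\<tau> i))))) \<le> variation \<psi> (\<rho> (\<tau> 0)) (\<rho> (\<tau> n))"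
    by (rule sum_le_variation[of n "\<lambda>i. \<rho> (\<tau> i)"])
       (auto intro!: mono_onD[OF \<rho>(1)] in_ab le simp del: atLeastAtMost_iff)
  also have "\<dots> \<le> variation \<psi> s t"
    using \<rho>(2)[OF in_ab[of 0]] \<rho>(2)[OF in_ab[of n]] mono_onD[OF \<rho>(1) in_ab[of 0] in_ab[of n] le[of 0 n]]
    by (intro variation_mono) auto
  finally show "(\<Sum>i<n. ennreal (norm (\<psi> (\<rho> (\<tau> (Suc i))) - \<psi> (\<rho> (\<tau> i))))) \<le> variation \<psi> s t" .
qed

lemma finite_variation_discontinuities:
  assumes "variation \<psi> 0 T < \<top>"
  shows "countable {r \<in> {0<..<T}. \<not> isCont \<psi> r}"
proof -
  define c where "c r = max 0 (min T r)" for r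
  define v where "v r = enn2real (variation \<psi> 0 (c r))" for r
  show ?thesis
  proof (cases "0 \<le> T")
    case True
    have c: "0 \<le> c r" "c r \<le> T" "r \<le> r' \<Longrightarrow> c r \<le> c r'" for r r' using True by (auto simp: c_def)
    have fin: "variation \<psi> 0 (c r) < \<top>" for r
      using variation_mono[of 0 0 "c r" T \<psi>] c[of r] assms by (auto intro: le_less_trans)
    have v: "ennreal (v r) = variation \<psi> 0 (c r)" for r
      using fin[of r] by (simp add: v_def)
    have inc: "norm (\<psi> (c r') - \<psi> (c r)) \<le> v r' - v r" if "r \<le> r'" for r r'
    proof -
      have "ennreal (v r) + ennreal (norm (\<psi> (c r') - \<psi> (c r))) \<le> ennreal (v r')"
        unfolding v using c[of r] c[of r'] c(3)[OF that] by (intro variation_append) auto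
      then show ?thesis by (simp add: ennreal_plus[symmetric] v_def del: ennreal_plus)
    qed
    have "mono v"
    proof (rule monoI)
      fix r r' :: real assume "r \<le> r'" from inc[OF this] show "v r \<le> v r'"
        using norm_ge_zero[of "\<psi> (c r') - \<psi> (c r)"] by linarith
    qed
    then have "countable {r. \<not> isCont v r}" by (rule mono_ctble_discont)
    moreover have "isCont \<psi> r" if r: "r \<in> {0<..<T}" "isCont v r" for r
    proof -
      have ev: "\<forall>\<^sub>F r' in at r. c r' = r'"
        using eventually_at_in_open'[of "{0<..<T}" r] r by (auto elim!: eventually_mono simp: c_def)
      have cr: "c r = r" using r by (auto simp: c_def)
      have "((\<lambda>r'. \<bar>v r' - v r\<bar>) \<longlongrightarrow> \<bar>v r - v r\<bar>) (at r)"
        using r(2) unfolding isCont_def by (intro tendsto_intros)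
      then have lim: "((\<lambda>r'. \<bar>v r' - v r\<bar>) \<longlongrightarrow> 0) (at r)" by simp
      have "((\<lambda>r'. \<psi> r' - \<psi> r) \<longlongrightarrow> 0) (at r)"
      proof (rule Lim_null_comparison[OF _ lim])
        show "\<forall>\<^sub>F r' in at r. norm (\<psi> r' - \<psi> r) \<le> \<bar>v r' - v r\<bar>"
          using ev
        proof eventually_elim
          case (elim r')
          show ?case
          proof (cases "r \<le> r'")
            case True with inc[of r r'] elim cr show ?thesis by auto
          next
            case False with inc[of r' r] elim cr show ?thesis by (auto simp: norm_minus_commute)
          qed
        qed
      qed
      then show ?thesis unfolding isCont_def by (simp add: LIM_zero_iff)
    qed
    then have "{r \<in> {0<..<T}. \<not> isCont \<psi> r} \<subseteq> {r. \<not> isCont v r}" by blast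
    ultimately show ?thesis by (rule countable_subset[rotated])
  qed simp
qed

lemma finite_variation_measurable:
  fixes \<psi> :: "real \<Rightarrow> 'a::euclidean_space"
  assumes "variation \<psi> 0 T < \<top>"
  shows "(\<lambda>r. if r \<in> {0..T} then \<psi> r else 0) \<in> borel_measurable borel"
proof -
  let ?g = "\<lambda>r. if r \<in> {0..T} then \<psi> r else 0"
  have "countable (insert 0 (insert T {r \<in> {0<..<T}. \<not> isCont \<psi> r}))"
    using finite_variation_discontinuities[OF assms] by simp
  then show ?thesis
  proof (rule borel_measurable_continuous_countable_exceptions)
    show "continuous_on (- insert 0 (insert T {r \<in> {0<..<T}. \<not> isCont \<psi> r})) ?g"
    proof (intro continuous_at_imp_continuous_on ballI)
      fix r assume r: "r \<in> - insert 0 (insert T {r \<in> {0<..<T}. \<not> isCont \<psi> r})"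
      show "isCont ?g r"
      proof (cases "r \<in> {0<..<T}")
        case True
        then have "isCont \<psi> r" using r by auto
        moreover have "\<forall>\<^sub>F x in nhds r. ?g x = \<psi> x"
          using eventually_nhds_in_open[of "{0<..<T}" r] True by (auto elim!: eventually_mono)
        ultimately show ?thesis by (subst isCont_cong) auto
      next
        case False
        have "\<forall>\<^sub>F x in nhds r. x \<in> - {0..T}"
          by (rule eventually_nhds_in_open) (use False r in \<open>auto simp: open_Compl\<close>)
        then have "\<forall>\<^sub>F x in nhds r. ?g x = 0" by eventually_elim auto
        then show ?thesis by (subst isCont_cong[of _ "\<lambda>_. 0"]) auto
      qed
    qed
  qed
qed

section \<open>Nonlinear integrals along perturbed paths\<close>

definition Iv :: "real \<Rightarrow> real \<Rightarrow> (real \<Rightarrow> real) \<Rightarrow> real" where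
  "Iv s t \<phi> = (LINT r|lborel. indicator {s..<t} r * \<phi> r)"

lemma interval_integral_eq_Iv: "s \<le> t \<Longrightarrow> (LBINT r=s..t. \<phi> r) = Iv s t \<phi>"
  unfolding Iv_def interval_lebesgue_integral_def set_lebesgue_integral_def
  by (simp add: einterval_eq) (rule integral_discrete_difference[where X="{s}"], auto simp: indicator_def)

lemma interval_integral_eq_Iv': "t \<le> s \<Longrightarrow> (LBINT r=s..t. \<phi> r) = - Iv t s \<phi>"
  using interval_integral_eq_Iv[of t s \<phi>] interval_integral_endpoints_reverse[of s t \<phi>] by simp

lemma Iv_cong: "(\<And>r. s \<le> r \<Longrightarrow> r < t \<Longrightarrow> \<phi> r = \<phi>' r) \<Longrightarrow> Iv s t \<phi> = Iv s t \<phi>'"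
  unfolding Iv_def by (intro Bochner_Integration.integral_cong) (auto simp: indicator_def)

lemma Iv_empty [simp]: "t \<le> s \<Longrightarrow> Iv s t \<phi> = 0"
  by (simp add: Iv_def)

lemma integrable_restrict:
  fixes \<phi> :: "real \<Rightarrow> real"
  assumes i: "integrable lborel (\<lambda>r. indicator A r * \<phi> r)" and [measurable]: "B \<in> sets borel" and BA: "B \<subseteq> A"
  shows "integrable lborel (\<lambda>r. indicator B r * \<phi> r)"
proof -
  have eq: "indicator B r * \<phi> r = indicator B r * (indicator A r * \<phi> r)" for r
    using BA by (auto simp: indicator_def)
  note m [measurable] = borel_measurable_integrable[OF i]
  show ?thesis unfolding eq
  proof (rule Bochner_Integration.integrable_bound[OF i])
    show "(\<lambda>r. indicator B r * (indicator A r * \<phi> r)) \<in> borel_measurable lborel"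
      by (rule borel_measurable_times[OF _ m]) simp
  qed (auto intro!: AE_I2 simp: indicator_def)
qed

lemma Iv_add:
  assumes i: "integrable lborel (\<lambda>r. indicator A r * \<phi> r)" and A: "{s..<t} \<subseteq> A" and st: "s \<le> u" "u \<le> t"
  shows "Iv s t \<phi> = Iv s u \<phi> + Iv u t \<phi>"
proof -
  have "integrable lborel (\<lambda>r. indicator {s..<u} r * \<phi> r)" "integrable lborel (\<lambda>r. indicator {u..<t} r * \<phi> r)"
    by (rule integrable_restrict[OF i]; use A st in \<open>auto\<close>)+
  then have "Iv s u \<phi> + Iv u t \<phi> = (LINT r|lborel. indicator {s..<u} r * \<phi> r + indicator {u..<t} r * \<phi> r)"
    unfolding Iv_def by simp
  also have "\<dots> = Iv s t \<phi>"
    unfolding Iv_def using st by (intro Bochner_Integration.integral_cong) (auto simp: indicator_def)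
  finally show ?thesis by simp
qed

lemma Iv_diff:
  assumes i: "integrable lborel (\<lambda>r. indicator A r * \<phi> r)" "integrable lborel (\<lambda>r. indicator A r * \<phi>' r)" and A: "{s..<t} \<subseteq> A"
  shows "Iv s t \<phi> - Iv s t \<phi>' = Iv s t (\<lambda>r. \<phi> r - \<phi>' r)"
proof -
  have "integrable lborel (\<lambda>r. indicator {s..<t} r * \<phi> r)" "integrable lborel (\<lambda>r. indicator {s..<t} r * \<phi>' r)"
    by (rule integrable_restrict; use i A in \<open>auto\<close>)+
  then show ?thesis unfolding Iv_def by (simp add: right_diff_distrib)
qed

lemma perturbed_path_measurable:
  fixes h :: "real \<Rightarrow> 'a::euclidean_space \<Rightarrow> 'b::topological_space"
  assumes hm: "(\<lambda>(r, x). h r x) \<in> borel_measurable (borel \<Otimes>\<^sub>M borel)" and w: "continuous_on UNIV w"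
    and \<psi>: "variation \<psi> 0 T < \<top>"
  shows "(\<lambda>r. h r (w r + (if r \<in> {0..T} then \<psi> r else 0))) \<in> borel_measurable borel"
proof -
  let ?\<psi> = "\<lambda>r. if r \<in> {0..T} then \<psi> r else 0"
  have [measurable]: "w \<in> borel_measurable borel" using w by (rule borel_measurable_continuous_onI)
  have [measurable]: "?\<psi> \<in> borel_measurable borel" by (rule finite_variation_measurable[OF \<psi>])
  have "(\<lambda>r. (r, w r + ?\<psi> r)) \<in> borel \<rightarrow>\<^sub>M borel \<Otimes>\<^sub>M borel" by measurable
  from measurable_compose[OF this hm] show ?thesis by simp
qed

lemma path_measurable:
  fixes h :: "real \<Rightarrow> 'a::euclidean_space \<Rightarrow> real"
  assumes hm: "(\<lambda>(r, x). h r x) \<in> borel_measurable (borel \<Otimes>\<^sub>M borel)" and w: "continuous_on UNIV w"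
    and \<psi>: "variation \<psi> 0 T < \<top>"
  shows "(\<lambda>r. indicator {0..T} r * h r (w r + \<psi> r)) \<in> borel_measurable borel"
proof -
  note [measurable] = perturbed_path_measurable[OF hm w \<psi>]
  have "(\<lambda>r. indicator {0..T} r * h r (w r + (if r \<in> {0..T} then \<psi> r else 0))) \<in> borel_measurable borel" by measurable
  also have "(\<lambda>r. indicator {0..T} r * h r (w r + (if r \<in> {0..T} then \<psi> r else 0))) = (\<lambda>r. indicator {0..T} r * h r (w r + \<psi> r))"
    by (auto simp: indicator_def fun_eq_iff)
  finally show ?thesis .
qed

lemma path_measurable_ennreal:
  fixes h :: "real \<Rightarrow> 'a::euclidean_space \<Rightarrow> ennreal"
  assumes hm: "(\<lambda>(r, x). h r x) \<in> borel_measurable (borel \<Otimes>\<^sub>M borel)" and w: "continuous_on UNIV w"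
    and \<psi>: "variation \<psi> 0 T < \<top>"
  shows "(\<lambda>r. indicator {0..T} r * h r (w r + \<psi> r)) \<in> borel_measurable borel"
proof -
  note [measurable] = perturbed_path_measurable[OF hm w \<psi>]
  have "(\<lambda>r. indicator {0..T} r * h r (w r + (if r \<in> {0..T} then \<psi> r else 0))) \<in> borel_measurable borel" by measurable
  also have "(\<lambda>r. indicator {0..T} r * h r (w r + (if r \<in> {0..T} then \<psi> r else 0))) = (\<lambda>r. indicator {0..T} r * h r (w r + \<psi> r))"
    by (auto simp: indicator_def fun_eq_iff)
  finally show ?thesis .
qed

definition dyad :: "real \<Rightarrow> real \<Rightarrow> nat \<Rightarrow> nat \<Rightarrow> real" where
  "dyad s t n i = s + (t - s) * real i / 2 ^ n"

definition dyad_floor :: "real \<Rightarrow> real \<Rightarrow> nat \<Rightarrow> real \<Rightarrow> real" where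
  "dyad_floor s t n r = s + (t - s) * real_of_int \<lfloor>(max s (min t r) - s) * 2 ^ n / (t - s)\<rfloor> / 2 ^ n"

context
  fixes s t :: real
  assumes st: "s < t"
begin

lemma dyad_simps: "dyad s t n 0 = s" "dyad s t n (2 ^ n) = t" "dyad s t (Suc n) (2 * i) = dyad s t n i"
  "dyad s t n i < dyad s t n (Suc i)" "dyad s t n (Suc i) - dyad s t n i = (t - s) / 2 ^ n"
  using st by (auto simp: dyad_def field_simps)

lemma dyad_mono: "i \<le> j \<Longrightarrow> dyad s t n i \<le> dyad s t n j"
  using st by (auto simp: dyad_def intro!: divide_right_mono mult_left_mono)

lemma dyad_in: "i \<le> 2 ^ n \<Longrightarrow> s \<le> dyad s t n i" "i \<le> 2 ^ n \<Longrightarrow> dyad s t n i \<le> t"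
  using dyad_mono[of 0 i n] dyad_mono[of i "2 ^ n" n] dyad_simps(1,2) by auto

lemma dyad_floor_eq:
  assumes "i < 2 ^ n" "dyad s t n i \<le> r" "r < dyad s t n (Suc i)"
  shows "dyad_floor s t n r = dyad s t n i"
proof -
  have "s \<le> r" "r \<le> t" using assms dyad_in(1)[of i n] dyad_in(2)[of "Suc i" n] by auto
  then have m: "max s (min t r) = r" by simp
  have "\<lfloor>(r - s) * 2 ^ n / (t - s)\<rfloor> = int i"
    by (rule floor_unique) (use assms st in \<open>auto simp: dyad_def field_simps\<close>)
  then show ?thesis by (simp add: dyad_floor_def dyad_def m)
qed

lemma dyad_floor_mono: "mono_on A (dyad_floor s t n)"
proof (rule mono_onI)
  fix r r' :: real assume "r \<le> r'"
  then have "\<lfloor>(max s (min t r) - s) * 2 ^ n / (t - s)\<rfloor> \<le> \<lfloor>(max s (min t r') - s) * 2 ^ n / (t - s)\<rfloor>"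
    using st by (intro floor_mono divide_right_mono mult_right_mono) auto
  then show "dyad_floor s t n r \<le> dyad_floor s t n r'"
    unfolding dyad_floor_def using st by (intro add_left_mono divide_right_mono mult_left_mono) auto
qed

lemma dyad_floor_bounds: "dyad_floor s t n r \<in> {s..t}" "r \<in> {s..t} \<Longrightarrow> \<bar>dyad_floor s t n r - r\<bar> \<le> (t - s) * (1 / 2) ^ n"
proof -
  define x where "x = (max s (min t r) - s) * 2 ^ n / (t - s)"
  have x: "0 \<le> x" "x \<le> 2 ^ n" using st by (auto simp: x_def divide_le_eq)
  have fl: "0 \<le> real_of_int \<lfloor>x\<rfloor>" "real_of_int \<lfloor>x\<rfloor> \<le> 2 ^ n" "x - 1 \<le> real_of_int \<lfloor>x\<rfloor>" "real_of_int \<lfloor>x\<rfloor> \<le> x"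
    using x order_trans[OF of_int_floor_le x(2)] by (auto simp del: of_int_floor_le) linarith+
  have e: "dyad_floor s t n r = s + (t - s) * (real_of_int \<lfloor>x\<rfloor> / 2 ^ n)" by (simp add: dyad_floor_def x_def)
  have "(t - s) * (real_of_int \<lfloor>x\<rfloor> / 2 ^ n) \<le> (t - s) * 1" using fl st by (intro mult_left_mono) (auto simp: divide_le_eq)
  moreover have "0 \<le> (t - s) * (real_of_int \<lfloor>x\<rfloor> / 2 ^ n)" using fl st by simp
  ultimately show "dyad_floor s t n r \<in> {s..t}" unfolding e by auto
  assume r: "r \<in> {s..t}"
  then have re: "r = s + (t - s) * (x / 2 ^ n)" using st by (simp add: x_def)
  have "(t - s) * ((x - 1) / 2 ^ n) \<le> (t - s) * (real_of_int \<lfloor>x\<rfloor> / 2 ^ n)" "(t - s) * (real_of_int \<lfloor>x\<rfloor> / 2 ^ n) \<le> (t - s) * (x / 2 ^ n)"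
    using fl st by (intro mult_left_mono divide_right_mono; auto)+
  moreover have "(t - s) * ((x - 1) / 2 ^ n) = (t - s) * (x / 2 ^ n) - (t - s) * (1 / 2) ^ n"
    by (simp add: right_diff_distrib diff_divide_distrib power_divide)
  ultimately show "\<bar>dyad_floor s t n r - r\<bar> \<le> (t - s) * (1 / 2) ^ n"
    unfolding e using re by (simp add: abs_le_iff)
qed

lemma dyad_floor_tendsto: "r \<in> {s..t} \<Longrightarrow> (\<lambda>n. dyad_floor s t n r) \<longlonglongrightarrow> r"
proof -
  assume r: "r \<in> {s..t}"
  have "(\<lambda>n. (t - s) * (1 / 2) ^ n) \<longlonglongrightarrow> (t - s) * 0" by (intro tendsto_intros LIMSEQ_power_zero) auto
  then have lim: "(\<lambda>n. (t - s) * (1 / 2) ^ n) \<longlonglongrightarrow> 0" by simp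
  have "(\<lambda>n. dyad_floor s t n r - r) \<longlonglongrightarrow> 0"
    by (rule Lim_null_comparison[OF _ lim]) (use dyad_floor_bounds(2)[OF r] in auto)
  then show ?thesis by (simp add: LIM_zero_iff)
qed

end

text \<open>Concavity in the form \<open>x\<^sup>\<theta> \<le> l\<^sup>\<theta> + x l\<^sup>\<theta>\<^sup>-\<^sup>1\<close>, with \<open>l\<close> the average.\<close>

lemma sum_powr_le:
  fixes b :: "nat \<Rightarrow> real"
  assumes b: "\<And>i. i < N \<Longrightarrow> 0 \<le> b i" and S: "(\<Sum>i<N. b i) \<le> S" and e: "0 < e" "e < 1"
  shows "(\<Sum>i<N. b i powr (1 - e)) \<le> 2 * real N powr e * S powr (1 - e)"
proof (cases "(\<Sum>i<N. b i) = 0")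
  case True
  then have "\<forall>i<N. b i = 0" using b by (subst (asm) sum_nonneg_eq_0_iff) auto
  then show ?thesis by simp
next
  case False
  then have N: "0 < N" by (cases N) auto
  have S0: "0 < S" using False S sum_nonneg[of "{..<N}" b] b by fastforce
  define l where "l = S / N"
  have l: "0 < l" using S0 N by (simp add: l_def)
  have "b i powr (1 - e) \<le> l powr (1 - e) + b i * l powr (- e)" if "i < N" for i
  proof (cases "b i \<le> l")
    case True
    then have "b i powr (1 - e) \<le> l powr (1 - e)" using b[OF that] e by (intro powr_mono2) auto
    then show ?thesis using b[OF that] by (smt (verit) mult_nonneg_nonneg powr_ge_zero)
  next
    case F: False
    then have "b i powr (1 - e) = b i * b i powr (- e)" using l by (simp add: powr_diff powr_minus_divide)
    also have "\<dots> \<le> b i * l powr (- e)" using F l e by (intro mult_left_mono powr_mono2') auto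
    finally show ?thesis by (smt (verit) powr_ge_zero)
  qed
  then have "(\<Sum>i<N. b i powr (1 - e)) \<le> (\<Sum>i<N. l powr (1 - e) + b i * l powr (- e))"
    by (intro sum_mono) auto
  also have "\<dots> = N * l powr (1 - e) + (\<Sum>i<N. b i) * l powr (- e)"
    by (simp add: sum.distrib sum_distrib_right)
  also have "\<dots> \<le> N * l powr (1 - e) + S * l powr (- e)"
    using S by (intro add_left_mono mult_right_mono) auto
  also have "S = N * l" using N by (simp add: l_def)
  also have "N * l powr (1 - e) + N * l * l powr (- e) = 2 * (N * l powr (1 - e))"
    using l by (simp add: powr_diff powr_minus_divide)
  also have "N * l powr (1 - e) = N powr e * S powr (1 - e)"
    using N S0 by (simp add: l_def powr_divide powr_diff)
  finally show ?thesis by (simp add: l_def[symmetric])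
qed

text \<open>The sum of the geometric series with ratio \<open>2\<^sup>\<epsilon>\<^sup>-\<^sup>\<alpha>\<close> produced by dyadic refinement.\<close>

definition sewing_const :: "real \<Rightarrow> real \<Rightarrow> real" where
  "sewing_const \<epsilon> \<alpha> = 2 * 2 powr (- \<alpha>) / (1 - 2 powr (\<epsilon> - \<alpha>))"

text \<open>The deterministic property of a path \<open>w\<close> that makes the estimates work. The approximations
  \<open>fk\<close> of \<open>f\<close> converge along all perturbations \<open>\<psi>\<close> at once, with a rate that is affine in
  the variation of \<open>\<psi>\<close>; the property refers neither to \<open>\<alpha>\<close> and \<open>\<epsilon>\<close> nor to the
  finiteness of \<open>\<Xi>\<close>, so that one event serves all exponents.\<close>

locale good_path =
  fixes T R :: real and w :: "real \<Rightarrow> 'a::euclidean_space" and f :: "real \<Rightarrow> 'a \<Rightarrow> real"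
    and fk :: "nat \<Rightarrow> real \<Rightarrow> 'a \<Rightarrow> real" and c :: "nat \<Rightarrow> real"
  assumes T: "0 < T" and R: "0 < R" and w: "continuous_on UNIV w"
    and fm: "(\<lambda>(r, x). f r x) \<in> borel_measurable (borel \<Otimes>\<^sub>M borel)"
    and fkc: "\<And>k. continuous_on UNIV (\<lambda>(r, x). fk k r x)" and fkb: "\<And>k. \<exists>B. \<forall>r x. \<bar>fk k r x\<bar> \<le> B"
    and c: "c \<longlonglongrightarrow> 0" and c0: "\<And>k. 0 \<le> c k"
    and good: "\<And>\<psi> v k. \<psi> ` {0..T} \<subseteq> cball 0 R \<Longrightarrow> variation \<psi> 0 T \<le> ennreal v \<Longrightarrow> 0 \<le> v \<Longrightarrow>
      (\<integral>\<^sup>+r. ennreal \<bar>indicator {0..T} r * (f r (w r + \<psi> r) - fk k r (w r + \<psi> r))\<bar> \<partial>lborel) \<le> ennreal (c k * (1 + v))"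
begin

lemma w_meas [measurable]: "w \<in> borel_measurable borel"
  using w by (rule borel_measurable_continuous_onI)

lemma fm' [measurable (raw)]:
  "a \<in> borel_measurable N \<Longrightarrow> b \<in> borel_measurable N \<Longrightarrow> (\<lambda>x. f (a x) (b x)) \<in> borel_measurable N"
  using measurable_compose[OF measurable_Pair fm, of a N b] by simp

lemma fkm: "(\<lambda>(r, x). fk k r x) \<in> borel_measurable (borel \<Otimes>\<^sub>M borel)"
  unfolding borel_prod using fkc by (rule borel_measurable_continuous_onI)

lemma fk_integrable:
  assumes "variation \<psi> 0 T < \<top>" shows "integrable lborel (\<lambda>r. indicator {0..T} r * fk k r (w r + \<psi> r))"
proof -
  obtain B where B: "\<And>r x. \<bar>fk k r x\<bar> \<le> B" using fkb by blast
  have i: "integrable lborel (\<lambda>r. B * indicator {0..T} r)" by (intro integrable_mult_right integrable_real_indicator) (use T in auto)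
  show ?thesis
  proof (rule Bochner_Integration.integrable_bound[OF i])
    show "(\<lambda>r. indicator {0..T} r * fk k r (w r + \<psi> r)) \<in> borel_measurable lborel"
      using path_measurable[OF fkm w assms] by simp
    show "AE r in lborel. norm (indicator {0..T} r * fk k r (w r + \<psi> r)) \<le> norm (B * indicator {0..T} r)"
      using order_trans[OF B abs_ge_self] by (auto intro!: AE_I2 simp: indicator_def)
  qed
qed

lemma diff_integrable:
  assumes "\<psi> ` {0..T} \<subseteq> cball 0 R" "variation \<psi> 0 T < \<top>"
  shows "integrable lborel (\<lambda>r. indicator {0..T} r * (f r (w r + \<psi> r) - fk k r (w r + \<psi> r)))"
proof (rule integrableI_bounded)
  show "(\<lambda>r. indicator {0..T} r * (f r (w r + \<psi> r) - fk k r (w r + \<psi> r))) \<in> borel_measurable lborel"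
    using borel_measurable_diff[OF path_measurable[OF fm w assms(2)] path_measurable[OF fkm w assms(2)]]
    by (simp add: right_diff_distrib)
  have "variation \<psi> 0 T \<le> ennreal (enn2real (variation \<psi> 0 T))" using assms(2) by simp
  from good[OF assms(1) this, of k]
  have "(\<integral>\<^sup>+r. ennreal \<bar>indicator {0..T} r * (f r (w r + \<psi> r) - fk k r (w r + \<psi> r))\<bar> \<partial>lborel) < \<top>"
    by (rule le_less_trans) auto
  then show "(\<integral>\<^sup>+r. ennreal (norm (indicator {0..T} r * (f r (w r + \<psi> r) - fk k r (w r + \<psi> r)))) \<partial>lborel) < \<infinity>"
    by simp
qed

lemma f_integrable:
  assumes "\<psi> ` {0..T} \<subseteq> cball 0 R" "variation \<psi> 0 T < \<top>"
  shows "integrable lborel (\<lambda>r. indicator {0..T} r * f r (w r + \<psi> r))"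
  using Bochner_Integration.integrable_add[OF diff_integrable[OF assms, of 0] fk_integrable[OF assms(2), of 0]]
  by (simp add: right_diff_distrib)

lemma const_ok:
  assumes "x \<in> cball 0 R" shows "(\<lambda>_. x) ` {0..T} \<subseteq> cball 0 R" "variation (\<lambda>_. x) 0 T \<le> ennreal 0"
proof -
  show "(\<lambda>_. x) ` {0..T} \<subseteq> cball 0 R" using assms by auto
  show "variation (\<lambda>_. x) 0 T \<le> ennreal 0" by (rule variation_le) simp
qed

lemma const_integrable:
  assumes "x \<in> cball 0 R" shows "integrable lborel (\<lambda>r. indicator {0..T} r * f r (w r + x))"
  using f_integrable[of "\<lambda>_. x"] const_ok[OF assms] by (auto intro: le_less_trans)

lemma Iv_approx:
  assumes "\<psi> ` {0..T} \<subseteq> cball 0 R" "variation \<psi> 0 T \<le> ennreal v" "0 \<le> v" "0 \<le> s" "t \<le> T"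
  shows "\<bar>Iv s t (\<lambda>r. f r (w r + \<psi> r)) - Iv s t (\<lambda>r. fk k r (w r + \<psi> r))\<bar> \<le> c k * (1 + v)"
proof -
  have fin: "variation \<psi> 0 T < \<top>" using assms(2) by (auto intro: le_less_trans)
  let ?d = "\<lambda>r. f r (w r + \<psi> r) - fk k r (w r + \<psi> r)"
  have sub: "{s..<t} \<subseteq> {0..T}" using assms by auto
  have eq: "Iv s t (\<lambda>r. f r (w r + \<psi> r)) - Iv s t (\<lambda>r. fk k r (w r + \<psi> r)) = Iv s t ?d"
    by (rule Iv_diff[OF f_integrable[OF assms(1) fin] fk_integrable[OF fin] sub])
  have i: "integrable lborel (\<lambda>r. indicator {s..<t} r * ?d r)"
    by (rule integrable_restrict[OF diff_integrable[OF assms(1) fin] _ sub]) simp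
  have "ennreal \<bar>Iv s t ?d\<bar> \<le> (\<integral>\<^sup>+r. ennreal \<bar>indicator {s..<t} r * ?d r\<bar> \<partial>lborel)"
    unfolding Iv_def using integral_norm_bound_ennreal[OF i] by simp
  also have "\<dots> \<le> (\<integral>\<^sup>+r. ennreal \<bar>indicator {0..T} r * ?d r\<bar> \<partial>lborel)"
    using sub by (intro nn_integral_mono) (auto simp: indicator_def)
  also have "\<dots> \<le> ennreal (c k * (1 + v))" by (rule good) (use assms in auto)
  finally show ?thesis unfolding eq using c0[of k] assms(3) by simp
qed

definition G :: "real \<Rightarrow> 'a \<Rightarrow> real" where "G t x = Iv 0 t (\<lambda>r. f r (w r + x))"
definition Gk :: "nat \<Rightarrow> real \<Rightarrow> 'a \<Rightarrow> real" where "Gk k t x = Iv 0 t (\<lambda>r. fk k r (w r + x))"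

lemma G_approx: "x \<in> cball 0 R \<Longrightarrow> t \<le> T \<Longrightarrow> \<bar>G t x - Gk k t x\<bar> \<le> c k"
  using Iv_approx[of "\<lambda>_. x" 0 0 t k] const_ok[of x] by (simp add: G_def Gk_def)

lemma G_increment: "x \<in> cball 0 R \<Longrightarrow> 0 \<le> s \<Longrightarrow> s \<le> t \<Longrightarrow> t \<le> T \<Longrightarrow> G t x - G s x = Iv s t (\<lambda>r. f r (w r + x))"
proof -
  assume a: "x \<in> cball 0 R" "0 \<le> s" "s \<le> t" "t \<le> T"
  have "{0..<t} \<subseteq> {0..T}" using a(4) by auto
  from Iv_add[OF const_integrable[OF a(1)] this a(2,3)] show ?thesis by (simp add: G_def)
qed

lemma uniform_G: "\<forall>\<^sub>F k in sequentially. \<forall>y\<in>Y. \<bar>F k y - F' y\<bar> < e"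
  if "0 < e" "\<And>k y. y \<in> Y \<Longrightarrow> \<bar>F' y - F k y\<bar> \<le> c k" for F F' Y e
proof -
  have "\<forall>\<^sub>F k in sequentially. c k < e" using order_tendstoD(2)[OF c that(1)] .
  then show ?thesis
  proof eventually_elim
    case (elim k)
    then show ?case using that(2) by (metis abs_minus_commute le_less_trans)
  qed
qed

lemma fk_path_measurable [measurable]: "(\<lambda>r. fk k r (w r + x)) \<in> borel_measurable borel"
proof -
  have "(\<lambda>r. (r, w r + x)) \<in> borel \<rightarrow>\<^sub>M borel \<Otimes>\<^sub>M borel" by measurable
  from measurable_compose[OF this fkm] show ?thesis by simp
qed

lemma G_continuous_space: "t \<le> T \<Longrightarrow> continuous_on (cball 0 R) (G t)"
proof (rule uniform_limit_theorem[where f="\<lambda>k. Gk k t" and F=sequentially])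
  assume t: "t \<le> T"
  show "uniform_limit (cball 0 R) (\<lambda>k. Gk k t) (G t) sequentially"
    unfolding uniform_limit_iff dist_real_def
  proof (intro allI impI)
    fix e :: real assume "0 < e"
    then show "\<forall>\<^sub>F k in sequentially. \<forall>x\<in>cball 0 R. \<bar>Gk k t x - G t x\<bar> < e"
      by (rule uniform_G) (rule G_approx[OF _ t])
  qed
  show "\<forall>\<^sub>F k in sequentially. continuous_on (cball 0 R) (Gk k t)"
  proof (intro always_eventually allI continuous_on_sequentiallyI)
    fix k and u :: "nat \<Rightarrow> 'a" and x assume "\<forall>n. u n \<in> cball 0 R" "x \<in> cball 0 R" and u: "u \<longlonglongrightarrow> x"
    obtain B where B: "\<And>r x. \<bar>fk k r x\<bar> \<le> B" using fkb by blast
    show "(\<lambda>n. Gk k t (u n)) \<longlonglongrightarrow> Gk k t x"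
      unfolding Gk_def Iv_def
    proof (rule integral_dominated_convergence[where w="\<lambda>r. B * indicator {0..<t} r"])
      show "integrable lborel (\<lambda>r. B * indicator {0..<t} r)"
        by (cases "0 \<le> t") (auto intro!: integrable_mult_right integrable_real_indicator)
      show "AE r in lborel. (\<lambda>n. indicator {0..<t} r * fk k r (w r + u n)) \<longlonglongrightarrow> indicator {0..<t} r * fk k r (w r + x)"
      proof (intro AE_I2 tendsto_intros)
        fix r
        have "(\<lambda>n. (r, w r + u n)) \<longlonglongrightarrow> (r, w r + x)" by (intro tendsto_intros u)
        then have "(\<lambda>n. (\<lambda>(r, x). fk k r x) (r, w r + u n)) \<longlonglongrightarrow> (\<lambda>(r, x). fk k r x) (r, w r + x)"
          using fkc[of k] by (intro isCont_tendsto_compose[of "(r, w r + x)" "\<lambda>(r, x). fk k r x"]) (auto simp: continuous_on_eq_continuous_at)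
        then show "(\<lambda>n. fk k r (w r + u n)) \<longlonglongrightarrow> fk k r (w r + x)" by simp
      qed
      show "AE r in lborel. norm (indicator {0..<t} r * fk k r (w r + u n)) \<le> B * indicator {0..<t} r" for n
        using B by (auto intro!: AE_I2 simp: indicator_def)
    qed measurable
  qed
qed simp

lemma G_continuous_time: "x \<in> cball 0 R \<Longrightarrow> continuous_on {0..T} (\<lambda>t. G t x)"
proof (rule uniform_limit_theorem[where f="\<lambda>k t. Gk k t x" and F=sequentially])
  assume x: "x \<in> cball 0 R"
  show "uniform_limit {0..T} (\<lambda>k t. Gk k t x) (\<lambda>t. G t x) sequentially"
    unfolding uniform_limit_iff dist_real_def
  proof (intro allI impI)
    fix e :: real assume "0 < e"
    then show "\<forall>\<^sub>F k in sequentially. \<forall>t\<in>{0..T}. \<bar>Gk k t x - G t x\<bar> < e"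
      by (rule uniform_G) (rule G_approx[OF x], simp)
  qed
  show "\<forall>\<^sub>F k in sequentially. continuous_on {0..T} (\<lambda>t. Gk k t x)"
  proof (intro always_eventually allI)
    fix k
    obtain B where B: "\<And>r x. \<bar>fk k r x\<bar> \<le> B" using fkb by blast
    have B0: "0 \<le> B" using B[of 0 0] by linarith
    have le: "\<bar>Gk k t x - Gk k s x\<bar> \<le> B * (t - s)" if "0 \<le> s" "s \<le> t" "t \<le> T" for s t
    proof -
      have "variation (\<lambda>_. x) 0 T < \<top>" using const_ok(2)[OF x] by (auto intro: le_less_trans)
      moreover have "{0..<t} \<subseteq> {0..T}" using that by auto
      ultimately have "Gk k t x - Gk k s x = Iv s t (\<lambda>r. fk k r (w r + x))"
        using Iv_add[OF fk_integrable, of "\<lambda>_. x" 0 t s k] that unfolding Gk_def by simp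
      also have "\<bar>\<dots>\<bar> \<le> (LINT r|lborel. B * indicator {s..<t} r)"
        unfolding Iv_def
      proof (rule order_trans[OF integral_abs_bound], rule integral_mono')
        show "integrable lborel (\<lambda>r. B * indicator {s..<t} r)"
          using that by (intro integrable_mult_right integrable_real_indicator) auto
      qed (use B B0 in \<open>auto simp: indicator_def\<close>)
      also have "\<dots> = B * (t - s)" using that by simp
      finally show ?thesis .
    qed
    show "continuous_on {0..T} (\<lambda>t. Gk k t x)"
    proof (rule continuous_on_sequentiallyI)
      fix u t assume u: "\<forall>n. u n \<in> {0..T}" "t \<in> {0..T}" "u \<longlonglongrightarrow> t"
      have "(\<lambda>n. B * \<bar>u n - t\<bar>) \<longlonglongrightarrow> B * \<bar>t - t\<bar>" by (intro tendsto_intros u)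
      then have lim: "(\<lambda>n. B * \<bar>u n - t\<bar>) \<longlonglongrightarrow> 0" by simp
      have "(\<lambda>n. Gk k (u n) x - Gk k t x) \<longlonglongrightarrow> 0"
      proof (rule Lim_null_comparison[OF _ lim], intro always_eventually allI)
        fix n show "norm (Gk k (u n) x - Gk k t x) \<le> B * \<bar>u n - t\<bar>"
          using le[of t "u n"] le[of "u n" t] u(1,2) by (cases "t \<le> u n") (auto simp: abs_minus_commute)
      qed
      then show "(\<lambda>n. Gk k (u n) x) \<longlonglongrightarrow> Gk k t x" by (simp add: LIM_zero_iff)
    qed
  qed
qed simp

definition D :: "real \<Rightarrow> real \<Rightarrow> 'a \<Rightarrow> 'a \<Rightarrow> real" where
  "D s t x y = (G t x - G s x) - (G t y - G s y)"

lemma G_measurable: "(\<lambda>(t, x). G t x) \<in> borel_measurable (borel \<Otimes>\<^sub>M borel)"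
proof -
  have "(\<lambda>(t, x). LINT r|lborel. (if 0 \<le> r \<and> r < t then f r (w r + x) else 0)) \<in> borel_measurable (borel \<Otimes>\<^sub>M borel)"
    unfolding split_beta by measurable
  moreover have "G t x = (LINT r|lborel. (if 0 \<le> r \<and> r < t then f r (w r + x) else 0))" for t x
    unfolding G_def Iv_def by (intro Bochner_Integration.integral_cong) (auto simp: indicator_def)
  ultimately show ?thesis by simp
qed

lemma G_measurable' [measurable (raw)]:
  "a \<in> borel_measurable N \<Longrightarrow> b \<in> borel_measurable N \<Longrightarrow> (\<lambda>x. G (a x) (b x)) \<in> borel_measurable N"
  using measurable_compose[OF measurable_Pair G_measurable, of a N b] by simp

lemma D_measurable' [measurable (raw)]:
  "a \<in> borel_measurable N \<Longrightarrow> b \<in> borel_measurable N \<Longrightarrow> x \<in> borel_measurable N \<Longrightarrow> y \<in> borel_measurable N \<Longrightarrow>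
    (\<lambda>z. D (a z) (b z) (x z) (y z)) \<in> borel_measurable N"
  unfolding D_def by (intro borel_measurable_diff G_measurable')

definition P1 :: "real \<Rightarrow> real \<Rightarrow> ennreal" where
  "P1 \<alpha> m = (\<integral>\<^sup>+s\<in>{0..T}. (\<integral>\<^sup>+t\<in>{0..T}. ennreal (\<bar>G t 0 - G s 0\<bar> powr m / \<bar>t - s\<bar> powr (\<alpha> * m + 2)) \<partial>lborel) \<partial>lborel)"

definition Q1 :: "real \<Rightarrow> real \<Rightarrow> real \<Rightarrow> ennreal" where
  "Q1 \<alpha> \<epsilon> m = (\<integral>\<^sup>+s\<in>{0..T}. (\<integral>\<^sup>+t\<in>{0..T}. (\<integral>\<^sup>+x\<in>cball 0 R. (\<integral>\<^sup>+y\<in>cball 0 R.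
     ennreal (\<bar>D s t x y\<bar> powr m / (\<bar>t - s\<bar> powr (\<alpha> * m + 2) * norm (x - y) powr ((1 - \<epsilon>) * m + 2 * real DIM('a)))) \<partial>lborel) \<partial>lborel) \<partial>lborel) \<partial>lborel)"

lemma time_interval: "{0..T} = cball (T / 2) (T / 2)"
  using T by (auto simp: cball_def dist_real_def abs_if split: if_splits)

lemma time_bound:
  assumes m: "1 \<le> m" and a: "0 < \<alpha>" and p: "P1 \<alpha> m \<le> ennreal p" "0 \<le> p" and st: "s \<in> {0..T}" "t \<in> {0..T}"
  shows "\<bar>G t 0 - G s 0\<bar> \<le> (grr_const 1 m \<alpha>) powr (1 / m) * \<bar>t - s\<bar> powr \<alpha> * p powr (1 / m)"
proof -
  have "ennreal (\<bar>G s 0 - G t 0\<bar> powr m) \<le> ennreal (grr_const DIM(real) m \<alpha> * norm (s - t) powr (\<alpha> * m)) *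
    (\<integral>\<^sup>+u\<in>{0..T}. (\<integral>\<^sup>+v\<in>{0..T}. ennreal (\<bar>G u 0 - G v 0\<bar> powr m / norm (u - v) powr (\<alpha> * m + 2 * real DIM(real))) \<partial>lborel) \<partial>lborel)"
    using garsia_rodemich_rumsey[of "T / 2" m \<alpha> "T / 2" "\<lambda>t. G t 0" s t, folded time_interval] T m a G_continuous_time[of 0] R st by simp
  also have "\<dots> = ennreal (grr_const 1 m \<alpha> * \<bar>t - s\<bar> powr (\<alpha> * m)) * P1 \<alpha> m"
    unfolding P1_def by (simp add: abs_minus_commute)
  also have "\<dots> \<le> ennreal (grr_const 1 m \<alpha> * \<bar>t - s\<bar> powr (\<alpha> * m)) * ennreal p"
    by (intro mult_left_mono p) auto
  finally have "\<bar>G t 0 - G s 0\<bar> powr m \<le> grr_const 1 m \<alpha> * \<bar>t - s\<bar> powr (\<alpha> * m) * p"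
    using p by (simp add: ennreal_mult[symmetric] grr_const_def abs_minus_commute)
  then have "(\<bar>G t 0 - G s 0\<bar> powr m) powr (1 / m) \<le> (grr_const 1 m \<alpha> * \<bar>t - s\<bar> powr (\<alpha> * m) * p) powr (1 / m)"
    using m by (intro powr_mono2) auto
  then show ?thesis using m by (simp add: powr_powr powr_mult)
qed

lemma space_time_bound:
  assumes m: "1 \<le> m" and a: "0 < \<alpha>" and e: "\<epsilon> < 1" and q: "Q1 \<alpha> \<epsilon> m \<le> ennreal q" "0 \<le> q"
    and st: "s \<in> {0..T}" "t \<in> {0..T}" and xy: "x \<in> cball 0 R" "y \<in> cball 0 R"
  shows "\<bar>D s t x y\<bar> \<le> (grr_const 1 m \<alpha> * grr_const DIM('a) m (1 - \<epsilon>)) powr (1 / m) * \<bar>t - s\<bar> powr \<alpha> * norm (x - y) powr (1 - \<epsilon>) * q powr (1 / m)"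
proof -
  define gs where "gs = (1 - \<epsilon>) * m + 2 * real DIM('a)"
  define K where "K = grr_const DIM('a) m (1 - \<epsilon>) * norm (x - y) powr ((1 - \<epsilon>) * m)"
  have K: "0 \<le> K" by (simp add: K_def grr_const_def)
  define I where "I a b = (\<integral>\<^sup>+u\<in>cball 0 R. (\<integral>\<^sup>+v\<in>cball 0 R. ennreal (\<bar>D a b u v\<bar> powr m / norm (u - v) powr gs) \<partial>lborel) \<partial>lborel)" for a b
  have [measurable]: "(cball 0 R :: 'a set) \<in> sets borel" by simp
  have [measurable]: "(\<lambda>(a, b). I a b) \<in> borel_measurable (borel \<Otimes>\<^sub>M borel)"
    unfolding I_def split_beta by measurable
  have space: "ennreal (\<bar>D a b x y\<bar> powr m) \<le> ennreal K * I a b" if "a \<in> {0..T}" "b \<in> {0..T}" for a b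
  proof -
    have "continuous_on (cball 0 R) (\<lambda>x. G b x - G a x)"
      using that by (intro continuous_intros G_continuous_space) auto
    from garsia_rodemich_rumsey[OF R m _ this xy, of "1 - \<epsilon>"] e
    show ?thesis by (simp add: K_def I_def D_def gs_def)
  qed
  have cont: "continuous_on {0..T} (\<lambda>t. G t x - G t y)"
    using xy by (intro continuous_intros G_continuous_time) auto
  have "ennreal (\<bar>D s t x y\<bar> powr m) \<le> ennreal (grr_const 1 m \<alpha> * \<bar>t - s\<bar> powr (\<alpha> * m)) *
    (\<integral>\<^sup>+a\<in>{0..T}. (\<integral>\<^sup>+b\<in>{0..T}. ennreal (\<bar>D a b x y\<bar> powr m / \<bar>b - a\<bar> powr (\<alpha> * m + 2)) \<partial>lborel) \<partial>lborel)"
  proof -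
    have flip: "\<bar>(G a x - G a y) - (G b x - G b y)\<bar> = \<bar>D a b x y\<bar>" for a b unfolding D_def by linarith
    show ?thesis
      using garsia_rodemich_rumsey[of "T / 2" m \<alpha> "T / 2" "\<lambda>t. G t x - G t y" s t, folded time_interval] T m a cont st
      by (simp add: flip abs_minus_commute)
  qed
  also have "\<dots> \<le> ennreal (grr_const 1 m \<alpha> * \<bar>t - s\<bar> powr (\<alpha> * m)) *
    (\<integral>\<^sup>+a\<in>{0..T}. (\<integral>\<^sup>+b\<in>{0..T}. ennreal K * (ennreal (1 / \<bar>b - a\<bar> powr (\<alpha> * m + 2)) * I a b) \<partial>lborel) \<partial>lborel)"
  proof (rule mult_left_mono, rule nn_integral_mono)
    fix a
    show "(\<integral>\<^sup>+b\<in>{0..T}. ennreal (\<bar>D a b x y\<bar> powr m / \<bar>b - a\<bar> powr (\<alpha> * m + 2)) \<partial>lborel) * indicator {0..T} a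
      \<le> (\<integral>\<^sup>+b\<in>{0..T}. ennreal K * (ennreal (1 / \<bar>b - a\<bar> powr (\<alpha> * m + 2)) * I a b) \<partial>lborel) * indicator {0..T} a"
    proof (cases "a \<in> {0..T}")
      case True
      show ?thesis
      proof (rule mult_right_mono, rule nn_integral_mono)
        fix b
        show "ennreal (\<bar>D a b x y\<bar> powr m / \<bar>b - a\<bar> powr (\<alpha> * m + 2)) * indicator {0..T} b
          \<le> ennreal K * (ennreal (1 / \<bar>b - a\<bar> powr (\<alpha> * m + 2)) * I a b) * indicator {0..T} b"
        proof (cases "b \<in> {0..T}")
          case b: True
          have "ennreal (\<bar>D a b x y\<bar> powr m / \<bar>b - a\<bar> powr (\<alpha> * m + 2)) = ennreal (1 / \<bar>b - a\<bar> powr (\<alpha> * m + 2)) * ennreal (\<bar>D a b x y\<bar> powr m)"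
            by (simp add: ennreal_mult[symmetric])
          also have "\<dots> \<le> ennreal (1 / \<bar>b - a\<bar> powr (\<alpha> * m + 2)) * (ennreal K * I a b)"
            by (intro mult_left_mono space True b) auto
          finally show ?thesis using b by (simp add: mult_ac)
        qed simp
      qed simp
    qed simp
  qed simp
  also have "(\<integral>\<^sup>+a\<in>{0..T}. (\<integral>\<^sup>+b\<in>{0..T}. ennreal K * (ennreal (1 / \<bar>b - a\<bar> powr (\<alpha> * m + 2)) * I a b) \<partial>lborel) \<partial>lborel)
     = ennreal K * (\<integral>\<^sup>+a\<in>{0..T}. (\<integral>\<^sup>+b\<in>{0..T}. ennreal (1 / \<bar>b - a\<bar> powr (\<alpha> * m + 2)) * I a b \<partial>lborel) \<partial>lborel)"
    by (simp add: mult.assoc nn_integral_cmult)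
  also have "(\<integral>\<^sup>+a\<in>{0..T}. (\<integral>\<^sup>+b\<in>{0..T}. ennreal (1 / \<bar>b - a\<bar> powr (\<alpha> * m + 2)) * I a b \<partial>lborel) \<partial>lborel) = Q1 \<alpha> \<epsilon> m"
  proof -
    have "ennreal (1 / \<bar>b - a\<bar> powr (\<alpha> * m + 2)) * I a b = (\<integral>\<^sup>+x\<in>cball 0 R. (\<integral>\<^sup>+y\<in>cball 0 R.
       ennreal (\<bar>D a b x y\<bar> powr m / (\<bar>b - a\<bar> powr (\<alpha> * m + 2) * norm (x - y) powr gs)) \<partial>lborel) \<partial>lborel)" for a b
    proof -
      have e: "ennreal (\<bar>D a b u v\<bar> powr m / (\<bar>b - a\<bar> powr (\<alpha> * m + 2) * norm (u - v) powr gs))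
        = ennreal (1 / \<bar>b - a\<bar> powr (\<alpha> * m + 2)) * ennreal (\<bar>D a b u v\<bar> powr m / norm (u - v) powr gs)" for u v
        by (simp add: ennreal_mult[symmetric])
      show ?thesis unfolding I_def e by (simp add: mult.assoc nn_integral_cmult)
    qed
    then show ?thesis by (simp add: Q1_def gs_def)
  qed
  also have "ennreal (grr_const 1 m \<alpha> * \<bar>t - s\<bar> powr (\<alpha> * m)) * (ennreal K * Q1 \<alpha> \<epsilon> m) \<le> ennreal (grr_const 1 m \<alpha> * \<bar>t - s\<bar> powr (\<alpha> * m)) * (ennreal K * ennreal q)"
    by (intro mult_left_mono q) auto
  finally have "\<bar>D s t x y\<bar> powr m \<le> grr_const 1 m \<alpha> * \<bar>t - s\<bar> powr (\<alpha> * m) * (K * q)"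
    using q K by (simp add: ennreal_mult[symmetric] grr_const_def)
  then have "(\<bar>D s t x y\<bar> powr m) powr (1 / m) \<le> (grr_const 1 m \<alpha> * \<bar>t - s\<bar> powr (\<alpha> * m) * (K * q)) powr (1 / m)"
    using m by (intro powr_mono2) auto
  then show ?thesis using m by (simp add: powr_powr powr_mult K_def mult_ac)
qed

end

lemma sum_lessThan_double: "(\<Sum>i<2 * N. g i) = (\<Sum>i<N. g (2 * i) + g (Suc (2 * i)))" for g :: "nat \<Rightarrow> 'b::comm_monoid_add"
  by (induction N) (auto simp: add_ac)

context good_path
begin

lemma D_eq_Iv:
  assumes "x \<in> cball 0 R" "y \<in> cball 0 R" "0 \<le> s" "s \<le> t" "t \<le> T"
  shows "D s t x y = Iv s t (\<lambda>r. f r (w r + x)) - Iv s t (\<lambda>r. f r (w r + y))"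
  unfolding D_def G_increment[OF assms(1,3-5)] G_increment[OF assms(2,3-5)] ..

context
  fixes s t :: real and \<psi> :: "real \<Rightarrow> 'a"
  assumes st: "0 \<le> s" "s < t" "t \<le> T" and \<psi>: "\<psi> ` {0..T} \<subseteq> cball 0 R" and fin: "variation \<psi> 0 T < \<top>"
begin

definition dyadic_sum :: "nat \<Rightarrow> real" where
  "dyadic_sum n = (\<Sum>i<2 ^ n. Iv (dyad s t n i) (dyad s t n (Suc i)) (\<lambda>r. f r (w r + \<psi> (dyad s t n i))))"

lemma \<psi>_in: "r \<in> {s..t} \<Longrightarrow> \<psi> r \<in> cball 0 R"
  using \<psi> st by (auto simp: image_subset_iff simp del: mem_cball)

lemma dyad_range: "i \<le> 2 ^ n \<Longrightarrow> dyad s t n i \<in> {s..t}"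
  using dyad_in[OF st(2)] by auto

lemma dyadic_sum_step:
  assumes e: "0 < \<epsilon>" "\<epsilon> < 1" and K: "0 \<le> K"
    and H: "\<And>a b x y. 0 \<le> a \<Longrightarrow> a \<le> b \<Longrightarrow> b \<le> T \<Longrightarrow> x \<in> cball 0 R \<Longrightarrow> y \<in> cball 0 R \<Longrightarrow>
      \<bar>D a b x y\<bar> \<le> K * (b - a) powr \<alpha> * norm (x - y) powr (1 - \<epsilon>)"
    and V: "variation \<psi> s t \<le> ennreal V" "0 \<le> V"
  shows "\<bar>dyadic_sum n - dyadic_sum (Suc n)\<bar> \<le> (2 * 2 powr (- \<alpha>) * K * V powr (1 - \<epsilon>) * (t - s) powr \<alpha>) * (2 powr (\<epsilon> - \<alpha>)) ^ n"
proof -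
  let ?d = "dyad s t (Suc n)"
  let ?g = "\<lambda>x r. f r (w r + x)"
  define b where "b i = norm (\<psi> (?d (Suc (2 * i))) - \<psi> (?d (2 * i)))" for i
  have d2: "?d (2 * i) = dyad s t n i" "?d (Suc (Suc (2 * i))) = dyad s t n (Suc i)" for i
    using dyad_simps(3)[OF st(2), of n i] dyad_simps(3)[OF st(2), of n "Suc i"] by simp_all
  have split: "dyadic_sum n - dyadic_sum (Suc n) = (\<Sum>i<2 ^ n. D (?d (Suc (2 * i))) (?d (Suc (Suc (2 * i)))) (\<psi> (?d (2 * i))) (\<psi> (?d (Suc (2 * i)))))"
  proof -
    have "dyadic_sum (Suc n) = (\<Sum>i<2 ^ n. Iv (?d (2 * i)) (?d (Suc (2 * i))) (?g (\<psi> (?d (2 * i)))) + Iv (?d (Suc (2 * i))) (?d (Suc (Suc (2 * i)))) (?g (\<psi> (?d (Suc (2 * i))))))"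
      unfolding dyadic_sum_def power_Suc sum_lessThan_double ..
    moreover have "dyadic_sum n = (\<Sum>i<2 ^ n. Iv (?d (2 * i)) (?d (Suc (Suc (2 * i)))) (?g (\<psi> (?d (2 * i)))))"
      unfolding dyadic_sum_def d2 ..
    ultimately have "dyadic_sum n - dyadic_sum (Suc n) = (\<Sum>i<2 ^ n. Iv (?d (2 * i)) (?d (Suc (Suc (2 * i)))) (?g (\<psi> (?d (2 * i))))
        - (Iv (?d (2 * i)) (?d (Suc (2 * i))) (?g (\<psi> (?d (2 * i)))) + Iv (?d (Suc (2 * i))) (?d (Suc (Suc (2 * i)))) (?g (\<psi> (?d (Suc (2 * i)))))))"
      by (simp only: sum_subtractf)
    also have "\<dots> = (\<Sum>i<2 ^ n. D (?d (Suc (2 * i))) (?d (Suc (Suc (2 * i)))) (\<psi> (?d (2 * i))) (\<psi> (?d (Suc (2 * i)))))"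
    proof (rule sum.cong)
      fix i :: nat assume "i \<in> {..<2 ^ n}"
      then have i: "Suc (Suc (2 * i)) \<le> 2 ^ Suc n" by auto
      have r: "?d (2 * i) \<in> {s..t}" "?d (Suc (2 * i)) \<in> {s..t}" "?d (Suc (Suc (2 * i))) \<in> {s..t}"
        using i by (intro dyad_range; simp)+
      have o: "?d (2 * i) \<le> ?d (Suc (2 * i))" "?d (Suc (2 * i)) \<le> ?d (Suc (Suc (2 * i)))"
        by (intro dyad_mono[OF st(2)]; simp)+
      have sub: "{?d (2 * i)..<?d (Suc (Suc (2 * i)))} \<subseteq> {0..T}" using r st by auto
      have "Iv (?d (2 * i)) (?d (Suc (Suc (2 * i)))) (?g (\<psi> (?d (2 * i)))) = Iv (?d (2 * i)) (?d (Suc (2 * i))) (?g (\<psi> (?d (2 * i)))) + Iv (?d (Suc (2 * i))) (?d (Suc (Suc (2 * i)))) (?g (\<psi> (?d (2 * i))))"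
        by (rule Iv_add[OF const_integrable[OF \<psi>_in[OF r(1)]] sub o])
      moreover have "D (?d (Suc (2 * i))) (?d (Suc (Suc (2 * i)))) (\<psi> (?d (2 * i))) (\<psi> (?d (Suc (2 * i))))
          = Iv (?d (Suc (2 * i))) (?d (Suc (Suc (2 * i)))) (?g (\<psi> (?d (2 * i)))) - Iv (?d (Suc (2 * i))) (?d (Suc (Suc (2 * i)))) (?g (\<psi> (?d (Suc (2 * i)))))"
        using r st o by (intro D_eq_Iv \<psi>_in) auto
      ultimately show "Iv (?d (2 * i)) (?d (Suc (Suc (2 * i)))) (?g (\<psi> (?d (2 * i))))
        - (Iv (?d (2 * i)) (?d (Suc (2 * i))) (?g (\<psi> (?d (2 * i)))) + Iv (?d (Suc (2 * i))) (?d (Suc (Suc (2 * i)))) (?g (\<psi> (?d (Suc (2 * i)))))) =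
        D (?d (Suc (2 * i))) (?d (Suc (Suc (2 * i)))) (\<psi> (?d (2 * i))) (\<psi> (?d (Suc (2 * i))))"
        by linarith
    qed simp
    finally show ?thesis .
  qed
  have bsum: "(\<Sum>i<2 ^ n. b i) \<le> V"
  proof -
    have "(\<Sum>j<2 ^ Suc n. ennreal (norm (\<psi> (?d (Suc j)) - \<psi> (?d j)))) \<le> variation \<psi> s t"
      by (rule variation_ge) (use dyad_simps[OF st(2)] in auto)
    also have "\<dots> \<le> ennreal V" by (rule V)
    finally have "(\<Sum>j<2 ^ Suc n. norm (\<psi> (?d (Suc j)) - \<psi> (?d j))) \<le> V"
      using V(2) by (simp add: sum_nonneg)
    moreover have "(\<Sum>i<2 ^ n. b i) \<le> (\<Sum>j<2 ^ Suc n. norm (\<psi> (?d (Suc j)) - \<psi> (?d j)))"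
      unfolding power_Suc sum_lessThan_double b_def by (intro sum_mono) simp
    ultimately show ?thesis by linarith
  qed
  have "\<bar>dyadic_sum n - dyadic_sum (Suc n)\<bar> \<le> (\<Sum>i<2 ^ n. K * ((t - s) / 2 ^ Suc n) powr \<alpha> * b i powr (1 - \<epsilon>))"
    unfolding split
  proof (rule order_trans[OF sum_abs], rule sum_mono)
    fix i :: nat assume "i \<in> {..<2 ^ n}"
    then have i: "Suc (Suc (2 * i)) \<le> 2 ^ Suc n" by auto
    have r: "?d (2 * i) \<in> {s..t}" "?d (Suc (2 * i)) \<in> {s..t}" "?d (Suc (Suc (2 * i))) \<in> {s..t}"
      using i by (intro dyad_range; simp)+
    have o: "?d (Suc (2 * i)) \<le> ?d (Suc (Suc (2 * i)))" by (intro dyad_mono[OF st(2)]) simp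
    have "\<bar>D (?d (Suc (2 * i))) (?d (Suc (Suc (2 * i)))) (\<psi> (?d (2 * i))) (\<psi> (?d (Suc (2 * i))))\<bar>
      \<le> K * (?d (Suc (Suc (2 * i))) - ?d (Suc (2 * i))) powr \<alpha> * norm (\<psi> (?d (2 * i)) - \<psi> (?d (Suc (2 * i)))) powr (1 - \<epsilon>)"
      using r st o by (intro H \<psi>_in) auto
    then show "\<bar>D (?d (Suc (2 * i))) (?d (Suc (Suc (2 * i)))) (\<psi> (?d (2 * i))) (\<psi> (?d (Suc (2 * i))))\<bar>
      \<le> K * ((t - s) / 2 ^ Suc n) powr \<alpha> * b i powr (1 - \<epsilon>)"
      unfolding dyad_simps(5)[OF st(2)] b_def norm_minus_commute[of "\<psi> (?d (2 * i))"] .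
  qed
  also have "\<dots> = K * ((t - s) / 2 ^ Suc n) powr \<alpha> * (\<Sum>i<2 ^ n. b i powr (1 - \<epsilon>))"
    by (simp add: sum_distrib_left)
  also have "\<dots> \<le> K * ((t - s) / 2 ^ Suc n) powr \<alpha> * (2 * real (2 ^ n) powr \<epsilon> * V powr (1 - \<epsilon>))"
    using K e bsum by (intro mult_left_mono sum_powr_le) (auto simp: b_def)
  also have "\<dots> = (2 * 2 powr (- \<alpha>) * K * V powr (1 - \<epsilon>) * (t - s) powr \<alpha>) * (2 powr (\<epsilon> - \<alpha>)) ^ n"
  proof -
    have pw: "(2 ^ m) powr x = (2 powr x) ^ m" for m :: nat and x :: real
      by (induction m) (simp_all add: powr_mult)
    have "((t - s) / 2 ^ Suc n) powr \<alpha> = (t - s) powr \<alpha> * (2 powr (- \<alpha>) * (2 powr (- \<alpha>)) ^ n)"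
      unfolding powr_divide pw powr_minus power_inverse by (simp add: divide_inverse)
    moreover have "real (2 ^ n) powr \<epsilon> = (2 powr \<epsilon>) ^ n" by (simp add: pw)
    moreover have "(2 powr (\<epsilon> - \<alpha>)) ^ n = (2 powr \<epsilon>) ^ n * (2 powr (- \<alpha>)) ^ n"
      by (simp add: power_mult_distrib[symmetric] powr_add[symmetric])
    ultimately show ?thesis by (simp add: mult_ac)
  qed
  finally show ?thesis .
qed

lemma floor_path:
  "(\<lambda>r. \<psi> (dyad_floor s t n r)) ` {0..T} \<subseteq> cball 0 R"
  "variation (\<lambda>r. \<psi> (dyad_floor s t n r)) 0 T \<le> variation \<psi> 0 T"
proof -
  show "(\<lambda>r. \<psi> (dyad_floor s t n r)) ` {0..T} \<subseteq> cball 0 R"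
    using \<psi>_in[OF dyad_floor_bounds(1)[OF st(2)]] by (auto simp del: mem_cball)
  have "variation (\<lambda>r. \<psi> (dyad_floor s t n r)) 0 T \<le> variation \<psi> s t"
    by (rule variation_comp_le[OF dyad_floor_mono[OF st(2)] dyad_floor_bounds(1)[OF st(2)]])
  also have "\<dots> \<le> variation \<psi> 0 T" using st by (intro variation_mono) auto
  finally show "variation (\<lambda>r. \<psi> (dyad_floor s t n r)) 0 T \<le> variation \<psi> 0 T" .
qed

lemma dyadic_sum_eq: "dyadic_sum n = Iv s t (\<lambda>r. f r (w r + \<psi> (dyad_floor s t n r)))"
proof -
  let ?p = "\<lambda>r. f r (w r + \<psi> (dyad_floor s t n r))"
  have "variation (\<lambda>r. \<psi> (dyad_floor s t n r)) 0 T < \<top>" using floor_path(2) fin by (rule le_less_trans)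
  note int = f_integrable[OF floor_path(1) this]
  have "j \<le> 2 ^ n \<Longrightarrow> Iv s (dyad s t n j) ?p = (\<Sum>i<j. Iv (dyad s t n i) (dyad s t n (Suc i)) (\<lambda>r. f r (w r + \<psi> (dyad s t n i))))" for j
  proof (induction j)
    case 0 then show ?case by (simp add: dyad_simps(1)[OF st(2)])
  next
    case (Suc j)
    have r: "dyad s t n j \<in> {s..t}" "dyad s t n (Suc j) \<in> {s..t}" using Suc.prems by (intro dyad_range; simp)+
    have sub: "{s..<dyad s t n (Suc j)} \<subseteq> {0..T}" using r st by auto
    have "Iv s (dyad s t n (Suc j)) ?p = Iv s (dyad s t n j) ?p + Iv (dyad s t n j) (dyad s t n (Suc j)) ?p"
      by (rule Iv_add[OF int sub]) (use r dyad_mono[OF st(2), of j "Suc j" n] in auto)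
    also have "Iv (dyad s t n j) (dyad s t n (Suc j)) ?p = Iv (dyad s t n j) (dyad s t n (Suc j)) (\<lambda>r. f r (w r + \<psi> (dyad s t n j)))"
    proof (rule Iv_cong)
      fix r assume "dyad s t n j \<le> r" "r < dyad s t n (Suc j)"
      then have "dyad_floor s t n r = dyad s t n j" using Suc.prems by (intro dyad_floor_eq[OF st(2)]) auto
      then show "f r (w r + \<psi> (dyad_floor s t n r)) = f r (w r + \<psi> (dyad s t n j))" by simp
    qed
    finally show ?case using Suc by simp
  qed
  from this[of "2 ^ n"] show ?thesis by (simp add: dyadic_sum_def dyad_simps(2)[OF st(2)])
qed

lemma dyadic_sum_0: "dyadic_sum 0 = Iv s t (\<lambda>r. f r (w r + \<psi> s))"
  using dyad_simps(2)[OF st(2), of 0] by (simp add: dyadic_sum_def dyad_simps(1)[OF st(2)])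

lemma fk_floor_tendsto: "(\<lambda>n. Iv s t (\<lambda>r. fk k r (w r + \<psi> (dyad_floor s t n r)))) \<longlonglongrightarrow> Iv s t (\<lambda>r. fk k r (w r + \<psi> r))"
proof -
  obtain B where B: "\<And>r x. \<bar>fk k r x\<bar> \<le> B" using fkb by blast
  have sub: "{s..<t} \<subseteq> {0..T}" using st by auto
  have finn: "variation (\<lambda>r. \<psi> (dyad_floor s t n r)) 0 T < \<top>" for n using floor_path(2) fin by (rule le_less_trans)
  show ?thesis
    unfolding Iv_def
  proof (rule integral_dominated_convergence[where w="\<lambda>r. B * indicator {s..<t} r"])
    show "integrable lborel (\<lambda>r. B * indicator {s..<t} r)"
      using st by (intro integrable_mult_right integrable_real_indicator) auto
    show "(\<lambda>r. indicator {s..<t} r * fk k r (w r + \<psi> r)) \<in> borel_measurable lborel"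
      using borel_measurable_integrable[OF integrable_restrict[OF fk_integrable[OF fin] _ sub]] by simp
    show "(\<lambda>r. indicator {s..<t} r * fk k r (w r + \<psi> (dyad_floor s t n r))) \<in> borel_measurable lborel" for n
      using borel_measurable_integrable[OF integrable_restrict[OF fk_integrable[OF finn] _ sub]] by simp
    show "AE r in lborel. norm (indicator {s..<t} r * fk k r (w r + \<psi> (dyad_floor s t n r))) \<le> B * indicator {s..<t} r" for n
      using B by (auto intro!: AE_I2 simp: indicator_def)
    have "{r \<in> {0<..<T}. \<not> isCont \<psi> r} \<in> null_sets lborel"
      using finite_variation_discontinuities[OF fin] by (rule countable_imp_null_set_lborel)
    from AE_not_in[OF this]
    show "AE r in lborel. (\<lambda>n. indicator {s..<t} r * fk k r (w r + \<psi> (dyad_floor s t n r))) \<longlonglongrightarrow> indicator {s..<t} r * fk k r (w r + \<psi> r)"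
      using AE_lborel_singleton[of s]
    proof eventually_elim
      case (elim r)
      show ?case
      proof (cases "r \<in> {s<..<t}")
        case True
        then have "isCont \<psi> r" using elim st by auto
        from isCont_tendsto_compose[OF this dyad_floor_tendsto[OF st(2)]] True
        have "(\<lambda>n. \<psi> (dyad_floor s t n r)) \<longlonglongrightarrow> \<psi> r" by auto
        then have "(\<lambda>n. (r, w r + \<psi> (dyad_floor s t n r))) \<longlonglongrightarrow> (r, w r + \<psi> r)" by (intro tendsto_intros)
        then have "(\<lambda>n. (\<lambda>(r, x). fk k r x) (r, w r + \<psi> (dyad_floor s t n r))) \<longlonglongrightarrow> (\<lambda>(r, x). fk k r x) (r, w r + \<psi> r)"
          using fkc[of k] by (intro isCont_tendsto_compose[of "(r, w r + \<psi> r)" "\<lambda>(r, x). fk k r x"]) (auto simp: continuous_on_eq_continuous_at)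
        then show ?thesis by (intro tendsto_intros) simp
      qed (use elim in \<open>auto simp: indicator_def\<close>)
    qed
  qed
qed

lemma dyadic_sum_tendsto: "dyadic_sum \<longlonglongrightarrow> Iv s t (\<lambda>r. f r (w r + \<psi> r))"
proof (rule LIMSEQ_I)
  fix e :: real assume e: "0 < e"
  define v where "v = enn2real (variation \<psi> 0 T)"
  have v: "variation \<psi> 0 T \<le> ennreal v" "0 \<le> v" using fin by (auto simp: v_def)
  have "(\<lambda>k. c k * (1 + v)) \<longlonglongrightarrow> 0 * (1 + v)" by (intro tendsto_intros c)
  then have "\<forall>\<^sub>F k in sequentially. c k * (1 + v) < e / 3"
    using order_tendstoD(2)[of "\<lambda>k. c k * (1 + v)" 0 sequentially "e / 3"] e by simp
  then obtain k where k: "c k * (1 + v) < e / 3" by (auto simp: eventually_sequentially)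
  obtain n0 where n0: "\<And>n. n \<ge> n0 \<Longrightarrow> \<bar>Iv s t (\<lambda>r. fk k r (w r + \<psi> (dyad_floor s t n r))) - Iv s t (\<lambda>r. fk k r (w r + \<psi> r))\<bar> < e / 3"
    using LIMSEQ_D[OF fk_floor_tendsto[of k], of "e / 3"] e by auto
  have "\<bar>dyadic_sum n - Iv s t (\<lambda>r. f r (w r + \<psi> r))\<bar> < e" if "n \<ge> n0" for n
  proof -
    have "\<bar>Iv s t (\<lambda>r. f r (w r + \<psi> (dyad_floor s t n r))) - Iv s t (\<lambda>r. fk k r (w r + \<psi> (dyad_floor s t n r)))\<bar> \<le> c k * (1 + v)"
      using st v by (intro Iv_approx floor_path(1) order_trans[OF floor_path(2)]) auto
    moreover have "\<bar>Iv s t (\<lambda>r. f r (w r + \<psi> r)) - Iv s t (\<lambda>r. fk k r (w r + \<psi> r))\<bar> \<le> c k * (1 + v)"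
      using st v \<psi> by (intro Iv_approx) auto
    ultimately show ?thesis using n0[OF that] k unfolding dyadic_sum_eq by linarith
  qed
  then show "\<exists>n0. \<forall>n\<ge>n0. norm (dyadic_sum n - Iv s t (\<lambda>r. f r (w r + \<psi> r))) < e" by auto
qed

end

lemma sewing:
  assumes e: "0 < \<epsilon>" "\<epsilon> < \<alpha>" "\<epsilon> < 1" and K: "0 \<le> K"
    and H: "\<And>a b x y. 0 \<le> a \<Longrightarrow> a \<le> b \<Longrightarrow> b \<le> T \<Longrightarrow> x \<in> cball 0 R \<Longrightarrow> y \<in> cball 0 R \<Longrightarrow>
      \<bar>D a b x y\<bar> \<le> K * (b - a) powr \<alpha> * norm (x - y) powr (1 - \<epsilon>)"
    and st: "0 \<le> s" "s \<le> t" "t \<le> T" and \<psi>: "\<psi> ` {0..T} \<subseteq> cball 0 R" and fin: "variation \<psi> 0 T < \<top>"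
    and V: "variation \<psi> s t \<le> ennreal V" "0 \<le> V"
  shows "\<bar>Iv s t (\<lambda>r. f r (w r + \<psi> r)) - Iv s t (\<lambda>r. f r (w r + \<psi> s))\<bar> \<le> sewing_const \<epsilon> \<alpha> * K * V powr (1 - \<epsilon>) * (t - s) powr \<alpha>"
proof (cases "s = t")
  case False
  with st have st': "s < t" by simp
  have r: "0 \<le> 2 powr (\<epsilon> - \<alpha>)" "2 powr (\<epsilon> - \<alpha>) < (1::real)"
    using e powr_less_mono[of "\<epsilon> - \<alpha>" 0 2] by auto
  have "\<bar>dyadic_sum s t \<psi> 0 - Iv s t (\<lambda>r. f r (w r + \<psi> r))\<bar> \<le> (2 * 2 powr (- \<alpha>) * K * V powr (1 - \<epsilon>) * (t - s) powr \<alpha>) / (1 - 2 powr (\<epsilon> - \<alpha>))"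
    by (rule geometric_increments_limit[OF dyadic_sum_step[OF st(1) st' st(3) \<psi> fin e(1,3) K H V] r _ dyadic_sum_tendsto[OF st(1) st' st(3) \<psi> fin]])
       (use K V in auto)
  then show ?thesis
    unfolding dyadic_sum_0[OF st(1) st' st(3) \<psi> fin] by (simp add: sewing_const_def abs_minus_commute mult_ac)
qed simp

end

section \<open>Control by the mixed norm\<close>

lemma (in good_path) Q1_eq_product:
  "Q1 \<alpha> \<epsilon> m = (\<integral>\<^sup>+(s, t, x, y)\<in>{0..T} \<times> {0..T} \<times> cball 0 R \<times> cball 0 R.
     ennreal (\<bar>D s t x y\<bar> powr m / (\<bar>t - s\<bar> powr (\<alpha> * m + 2) * norm (x - y) powr ((1 - \<epsilon>) * m + 2 * real DIM('a)))) \<partial>lborel)"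
proof -
  have [measurable]: "(cball 0 R :: 'a set) \<in> sets borel" by simp
  define F where "F s t x y = ennreal (\<bar>D s t x y\<bar> powr m / (\<bar>t - s\<bar> powr (\<alpha> * m + 2) * norm (x - y) powr ((1 - \<epsilon>) * m + 2 * real DIM('a))))" for s t x y
  have Fm [measurable (raw)]: "(\<lambda>z. F (a z) (b z) (x z) (y z)) \<in> borel_measurable N"
    if "a \<in> borel_measurable N" "b \<in> borel_measurable N" "x \<in> borel_measurable N" "y \<in> borel_measurable N" for a b x y and N :: "'z measure"
    unfolding F_def using that by measurable
  define H where "H s t x y = F s t x y * (indicator {0..T} s * (indicator {0..T} t * (indicator (cball 0 R) x * indicator (cball 0 R) y)))" for s t x y
  have Hm [measurable (raw)]: "(\<lambda>z. H (a z) (b z) (x z) (y z)) \<in> borel_measurable N"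
    if "a \<in> borel_measurable N" "b \<in> borel_measurable N" "x \<in> borel_measurable N" "y \<in> borel_measurable N" for a b x y and N :: "'z measure"
    unfolding H_def using that by measurable
  have "(\<integral>\<^sup>+(s, t, x, y)\<in>{0..T} \<times> {0..T} \<times> cball 0 R \<times> cball 0 R. F s t x y \<partial>lborel)
    = (\<integral>\<^sup>+z. H (fst z) (fst (snd z)) (fst (snd (snd z))) (snd (snd (snd z))) \<partial>(lborel \<Otimes>\<^sub>M (lborel \<Otimes>\<^sub>M (lborel \<Otimes>\<^sub>M lborel))))"
    unfolding lborel_prod by (intro nn_integral_cong) (auto simp: H_def indicator_def)
  also have "\<dots> = (\<integral>\<^sup>+s. (\<integral>\<^sup>+t. (\<integral>\<^sup>+x. (\<integral>\<^sup>+y. H s t x y \<partial>lborel) \<partial>lborel) \<partial>lborel) \<partial>lborel)"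
  proof -
    have sf: "sigma_finite_measure (lborel \<Otimes>\<^sub>M (lborel \<Otimes>\<^sub>M lborel) :: (real \<times> 'a \<times> 'a) measure)" "sigma_finite_measure (lborel \<Otimes>\<^sub>M lborel :: ('a \<times> 'a) measure)"
      unfolding lborel_prod by (rule sigma_finite_lborel)+
    have m1: "(\<lambda>z. H (fst z) (fst (snd z)) (fst (snd (snd z))) (snd (snd (snd z)))) \<in> borel_measurable (lborel \<Otimes>\<^sub>M (lborel \<Otimes>\<^sub>M (lborel \<Otimes>\<^sub>M lborel)))"
      by measurable
    have m2: "(\<lambda>z. H s (fst z) (fst (snd z)) (snd (snd z))) \<in> borel_measurable (lborel \<Otimes>\<^sub>M (lborel \<Otimes>\<^sub>M lborel))" for s
      by measurable
    have m3: "(\<lambda>z. H s t (fst z) (snd z)) \<in> borel_measurable (lborel \<Otimes>\<^sub>M lborel)" for s t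
      by measurable
    show ?thesis
      unfolding sigma_finite_measure.nn_integral_fst[OF sf(1) m1, symmetric] fst_conv snd_conv
        sigma_finite_measure.nn_integral_fst[OF sf(2) m2, symmetric]
        sigma_finite_measure.nn_integral_fst[OF sigma_finite_lborel m3, symmetric] ..
  qed
  also have "\<dots> = Q1 \<alpha> \<epsilon> m"
  proof -
    have 1: "(\<integral>\<^sup>+y. H s t x y \<partial>lborel) = (\<integral>\<^sup>+y\<in>cball 0 R. F s t x y \<partial>lborel) * indicator (cball 0 R) x * indicator {0..T} t * indicator {0..T} s" for s t x
      by (cases "x \<in> cball 0 R"; cases "t \<in> {0..T}"; cases "s \<in> {0..T}") (simp_all add: H_def del: mem_cball atLeastAtMost_iff)
    have 2: "(\<integral>\<^sup>+x. f x * c1 * c2 \<partial>lborel) = (\<integral>\<^sup>+x. f x \<partial>lborel) * c1 * c2" if "c1 \<in> {0, 1}" "c2 \<in> {0, 1}" for f :: "'a \<Rightarrow> ennreal" and c1 c2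
      using that by auto
    have 3: "(\<integral>\<^sup>+t. f t * c1 \<partial>lborel) = (\<integral>\<^sup>+t. f t \<partial>lborel) * c1" if "c1 \<in> {0, 1}" for f :: "real \<Rightarrow> ennreal" and c1
      using that by auto
    have ind: "indicator A z \<in> {0, 1 :: ennreal}" for A and z :: "'z" by (auto simp: indicator_def)
    show ?thesis
      unfolding Q1_def F_def[symmetric] 1 2[OF ind ind] 3[OF ind] ..
  qed
  finally show ?thesis unfolding F_def by simp
qed

lemma good_path_continuous:
  assumes "0 < T" "0 < R" "continuous_on UNIV w" "continuous_on UNIV (\<lambda>(r, x). g r x)" "\<And>r x. \<bar>g r x\<bar> \<le> B"
  shows "good_path T R w g (\<lambda>_. g) (\<lambda>_. 0)"
proof
  show "(\<lambda>(r, x). g r x) \<in> borel_measurable (borel \<Otimes>\<^sub>M borel)"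
    unfolding borel_prod using assms(4) by (rule borel_measurable_continuous_onI)
  show "\<exists>B. \<forall>r x. \<bar>g r x\<bar> \<le> B" using assms(5) by blast
qed (use assms in auto)

definition mixed_norm :: "real \<Rightarrow> real \<Rightarrow> real \<Rightarrow> (real \<Rightarrow> 'a::euclidean_space \<Rightarrow> ennreal) \<Rightarrow> ennreal" where
  "mixed_norm T q p g = Lnorm lborel q (\<lambda>r. indicator {0..T} r * Lnorm lborel p (g r))"

lemma mixed_norm_mono:
  assumes "0 < p" "0 < q" "\<And>r x. r \<in> {0..T} \<Longrightarrow> g r x \<le> g' r x"
  shows "mixed_norm T q p g \<le> mixed_norm T q p g'"
  unfolding mixed_norm_def
proof (rule Lnorm_mono)
  fix r show "indicator {0..T} r * Lnorm lborel p (g r) \<le> indicator {0..T} r * Lnorm lborel p (g' r)"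
    using assms by (cases "r \<in> {0..T}") (auto intro!: Lnorm_mono)
qed (rule assms)

context modified_brownian_motion
begin

lemma difference_moment:
  fixes C :: "nat \<Rightarrow> real" and p q \<beta> :: real
  assumes C: "\<And>(g :: real \<Rightarrow> 'a \<Rightarrow> real) z B s0 t A n s w.
    (\<lambda>(r, w). g r w) \<in> borel_measurable (borel \<Otimes>\<^sub>M borel) \<Longrightarrow> (\<forall>r w. \<bar>g r w\<bar> \<le> B) \<Longrightarrow> s0 < t \<Longrightarrow> 0 \<le> A \<Longrightarrow>
    Lnorm lborel q (\<lambda>r. indicator {s0<..<t} r * Lnorm lborel p (\<lambda>w. ennreal \<bar>g r w\<bar>)) \<le> ennreal A \<Longrightarrow> s \<in> {s0..t} \<Longrightarrow>
    \<bar>mom (\<lambda>r w. g r (w + z) - g r w) t n s w\<bar> \<le> C n * (norm z powr \<beta> * A * (t - s0) powr \<kappa>) ^ n"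
    and pq: "0 < p" "0 < q"
    and gc: "continuous_on UNIV (\<lambda>(r, x). g r x)" and gb: "\<And>r x. \<bar>g r x\<bar> \<le> B"
    and A: "0 \<le> A" "mixed_norm T q p (\<lambda>r x. ennreal \<bar>g r x\<bar>) \<le> ennreal A"
    and st: "0 \<le> s" "s < t" "t \<le> T" and n: "even n"
  shows "(\<integral>\<^sup>+\<omega>. ennreal (\<bar>Iv s t (\<lambda>r. g r (V r \<omega> + x)) - Iv s t (\<lambda>r. g r (V r \<omega> + y))\<bar> ^ n) \<partial>M)
    \<le> ennreal (C n * (norm (x - y) powr \<beta> * A * (t - s) powr \<kappa>) ^ n)"
proof -
  define h where "h r w = g r (w + x) - g r (w + y)" for r w
  have hc: "continuous_on UNIV (\<lambda>(r, w). h r w)"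
  proof -
    have "continuous_on UNIV (\<lambda>z. (\<lambda>(r, x). g r x) (fst z, snd z + a))" for a :: 'a
      by (rule continuous_on_compose2[OF gc]) (auto intro!: continuous_intros)
    then show ?thesis unfolding h_def split_beta by (intro continuous_intros) simp_all
  qed
  have hb: "\<bar>h r w\<bar> \<le> 2 * B" for r w
    using gb[of r "w + x"] gb[of r "w + y"] unfolding h_def by linarith
  define g' where "g' r w = g r (w + y)" for r w
  have g'm: "(\<lambda>(r, w). g' r w) \<in> borel_measurable (borel \<Otimes>\<^sub>M borel)"
  proof -
    have "continuous_on UNIV (\<lambda>z. (\<lambda>(r, x). g r x) (fst z, snd z + y))"
      by (rule continuous_on_compose2[OF gc]) (auto intro!: continuous_intros)
    then show ?thesis unfolding borel_prod g'_def split_beta by (intro borel_measurable_continuous_onI) simp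
  qed
  have h_eq: "h = (\<lambda>r w. g' r (w + (x - y)) - g' r w)" by (auto simp: h_def g'_def fun_eq_iff)
  have gr: "g r \<in> borel_measurable borel" for r
  proof (rule borel_measurable_continuous_onI)
    have "continuous_on UNIV (\<lambda>x::'a. (r, x))" by (intro continuous_on_Pair continuous_on_const continuous_on_id)
    from continuous_on_compose2[OF gc this] show "continuous_on UNIV (g r)" by simp
  qed
  have norm': "Lnorm lborel q (\<lambda>r. indicator {s<..<t} r * Lnorm lborel p (\<lambda>w. ennreal \<bar>g' r w\<bar>)) \<le> ennreal A"
  proof (rule order_trans[OF _ A(2)], unfold mixed_norm_def, rule Lnorm_mono)
    fix r
    have "Lnorm lborel p (\<lambda>w. ennreal \<bar>g' r w\<bar>) = Lnorm lborel p (\<lambda>w. ennreal \<bar>g r w\<bar>)"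
      unfolding g'_def using Lnorm_lborel_shift[of "\<lambda>w. ennreal \<bar>g r w\<bar>" p y] gr by simp
    then show "indicator {s<..<t} r * Lnorm lborel p (\<lambda>w. ennreal \<bar>g' r w\<bar>) \<le> indicator {0..T} r * Lnorm lborel p (\<lambda>x. ennreal \<bar>g r x\<bar>)"
      using st by (auto simp: indicator_def)
  qed (rule pq)
  have bound: "\<bar>mom h t n s w\<bar> \<le> C n * (norm (x - y) powr \<beta> * A * (t - s) powr \<kappa>) ^ n" for w
    unfolding h_eq by (rule C[OF g'm _ st(2) A(1) norm']) (use gb st in \<open>auto simp: g'_def\<close>)
  have tail_eq: "Iv s t (\<lambda>r. g r (V r \<omega> + x)) - Iv s t (\<lambda>r. g r (V r \<omega> + y)) = tail h t s \<omega>" for \<omega>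
  proof -
    have i: "integrable lborel (\<lambda>r. indicator {s..t} r * g r (V r \<omega> + a))" for a
    proof -
      have "continuous_on UNIV (\<lambda>r. (\<lambda>(r, x). g r x) (r, V r \<omega> + a))"
        by (rule continuous_on_compose2[OF gc]) (auto intro!: continuous_on_Pair continuous_on_id continuous_on_add V_continuous)
      then have "continuous_on {s..t} (\<lambda>r. g r (V r \<omega> + a))" by (auto intro: continuous_on_subset)
      from borel_integrable_atLeastAtMost'[OF this] show ?thesis by (simp add: set_integrable_def)
    qed
    have "Iv s t (\<lambda>r. g r (V r \<omega> + x)) - Iv s t (\<lambda>r. g r (V r \<omega> + y)) = Iv s t (\<lambda>r. h r (V r \<omega>))"
      unfolding h_def by (rule Iv_diff[OF i i]) auto
    also have "\<dots> = tail h t s \<omega>"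
      unfolding Iv_def tail_def
      by (rule integral_discrete_difference[where X="{t}"]) (auto simp: indicator_def)
    finally show ?thesis .
  qed
  have tm: "tail h t s \<in> borel_measurable M"
    using measurable_compose[OF measurable_Pair1' tail_meas[OF hc hb, of t], of s] by simp
  have tb: "\<bar>tail h t s \<omega>\<bar> \<le> 2 * B * (t - s)" for \<omega> using tail_bound[OF hc hb, of s t \<omega>] st by simp
  have int: "integrable M (\<lambda>\<omega>. tail h t s \<omega> ^ n)"
  proof (rule integrable_const_bound[where B="(2 * B * (t - s)) ^ n"])
    show "AE \<omega> in M. norm (tail h t s \<omega> ^ n) \<le> (2 * B * (t - s)) ^ n"
      unfolding real_norm_def power_abs by (intro AE_I2 power_mono tb) auto
  qed (use tm in auto)
  have "(\<integral>\<^sup>+\<omega>. ennreal (\<bar>tail h t s \<omega>\<bar> ^ n) \<partial>M) = ennreal (LINT \<omega>|M. tail h t s \<omega> ^ n)"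
    using int n by (simp add: power_even_abs nn_integral_eq_integral zero_le_even_power)
  also have "(LINT \<omega>|M. tail h t s \<omega> ^ n) = (LINT \<omega>|M. mom h t n s (V s \<omega>))"
    using moment_identity[OF hc hb st(1) _ past_const[OF st(1), of 1], of t n] st by simp
  also have "\<dots> \<le> (LINT \<omega>|M. C n * (norm (x - y) powr \<beta> * A * (t - s) powr \<kappa>) ^ n)"
  proof (rule integral_mono)
    have [measurable]: "(\<lambda>(r, w). h r w) \<in> borel_measurable (borel \<Otimes>\<^sub>M borel)" by (rule h_meas[OF hc hb])
    show "integrable M (\<lambda>\<omega>. mom h t n s (V s \<omega>))"
      by (rule integrable_const_bound[where B="C n * (norm (x - y) powr \<beta> * A * (t - s) powr \<kappa>) ^ n"])
         (use bound in \<open>auto intro!: AE_I2\<close>)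
    show "mom h t n s (V s \<omega>) \<le> C n * (norm (x - y) powr \<beta> * A * (t - s) powr \<kappa>) ^ n" for \<omega>
      using bound[of "V s \<omega>"] by linarith
  qed simp
  also have "\<dots> = C n * (norm (x - y) powr \<beta> * A * (t - s) powr \<kappa>) ^ n" by (simp add: prob_space)
  finally show ?thesis unfolding tail_eq by (simp add: ennreal_leI)
qed

lemma first_moment:
  fixes p q :: real
  assumes p: "2 < p" and q: "2 < q" and pq: "2 / q + real DIM('a) / p < 1" and T: "0 < T"
  shows "\<exists>C\<ge>0. \<forall>g :: real \<Rightarrow> 'a \<Rightarrow> real. \<forall>B. continuous_on UNIV (\<lambda>(r, x). g r x) \<longrightarrow> (\<forall>r x. \<bar>g r x\<bar> \<le> B) \<longrightarrow> (\<forall>r x. 0 \<le> g r x) \<longrightarrow>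
    (\<integral>\<^sup>+\<omega>. (\<integral>\<^sup>+r. ennreal (indicator {0..T} r * g r (V r \<omega>)) \<partial>lborel) \<partial>M) \<le> ennreal C * mixed_norm T q p (\<lambda>r x. ennreal \<bar>g r x\<bar>)"
proof -
  define q' where "q' = q / (q - 1)"
  define k where "k = power_kernel 1 (real DIM('a) / (2 * p)) T"
  define \<gamma> where "\<gamma> = real DIM('a) / (2 * p)"
  have "\<gamma> + 1 / q < 1" using pq by (simp add: \<gamma>_def)
  then have "\<gamma> * q' < 1" using q by (simp add: q'_def field_simps)
  then have gq: "real DIM('a) / (2 * p) * q' < 1" by (simp add: \<gamma>_def)
  have q': "1 < q'" "1 / q' + 1 / q = 1" using q by (auto simp: q'_def field_simps)
  have "Lnorm lborel q' k < \<top>"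
    unfolding k_def using T gq q' by (subst Lnorm_power_kernel) auto
  then obtain C where C: "Lnorm lborel q' k = ennreal C" "0 \<le> C" by (cases "Lnorm lborel q' k") auto
  show ?thesis
  proof (intro exI[of _ C] conjI allI impI)
    fix g :: "real \<Rightarrow> 'a \<Rightarrow> real" and B
    assume gc: "continuous_on UNIV (\<lambda>(r, x). g r x)" and "\<forall>r x. \<bar>g r x\<bar> \<le> B" and "\<forall>r x. 0 \<le> g r x"
    then have gb: "\<And>r x. \<bar>g r x\<bar> \<le> B" and g0: "\<And>r x. 0 \<le> g r x" by auto
    note gpm [measurable] = h_path_meas[OF gc gb]
    have gm [measurable]: "(\<lambda>(r, x). g r x) \<in> borel_measurable (borel \<Otimes>\<^sub>M borel)" by (rule h_meas[OF gc gb])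
    have gr [measurable]: "g r \<in> borel_measurable borel" for r by (rule h_meas'[OF gc gb])
    interpret PS: pair_sigma_finite lborel M ..
    define na where "na r = Lnorm lborel p (\<lambda>x. ennreal \<bar>g r x\<bar>)" for r
    have [measurable]: "na \<in> borel_measurable borel" unfolding na_def[abs_def] Lnorm_def by measurable
    have pt: "(\<integral>\<^sup>+\<omega>. ennreal (g r (V r \<omega>)) \<partial>M) \<le> k r * na r" if r: "0 < r" "r < T" for r
    proof -
      have gp: "(\<lambda>\<omega>. g r (V r \<omega>)) \<in> borel_measurable M"
        using measurable_compose[OF measurable_Pair1' gpm, of r] by simp
      have "(\<integral>\<^sup>+\<omega>. ennreal (g r (V r \<omega>)) \<partial>M) = ennreal (LINT \<omega>|M. g r (V r \<omega>))"
        by (rule nn_integral_eq_integral) (use gp gb g0 in \<open>auto intro!: integrable_const_bound[where B=B]\<close>)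
      also have "(LINT \<omega>|M. g r (V r \<omega>)) = (LINT v|lborel. heat r v * g r v)"
        using past_markov[OF past_const[of 0 1] r(1) gr gb, of r] by (simp add: V_start prob_space)
      also have "ennreal (LINT v|lborel. heat r v * g r v) = (\<integral>\<^sup>+v. ennreal (heat r v * g r v) \<partial>lborel)"
        by (rule nn_integral_eq_integral[symmetric]) (use integrable_heat_mult[OF r(1) gr gb] g0 in \<open>auto intro!: AE_I2\<close>)
      also have "\<dots> = conv (\<lambda>v. ennreal (heat r v)) (\<lambda>v. ennreal \<bar>g r v\<bar>) 0"
        unfolding conv_def using g0 by (simp add: ennreal_mult)
      also have "\<dots> \<le> 1 * ennreal ((2 * pi * r) powr (- real DIM('a) / 2)) epowr (1 / p) * na r"
        unfolding na_def using p r heat_le[OF r(1), where 'a='a]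
        by (intro conv_sup) (auto simp: nn_integral_heat intro!: ennreal_leI)
      also have "\<dots> \<le> k r * na r"
        using heat_sup_factor[OF r(1), of "1 / p" "real DIM('a)"] p r by (intro mult_right_mono) (auto simp: k_def power_kernel_def)
      finally show ?thesis .
    qed
    have "(\<integral>\<^sup>+\<omega>. (\<integral>\<^sup>+r. ennreal (indicator {0..T} r * g r (V r \<omega>)) \<partial>lborel) \<partial>M) = (\<integral>\<^sup>+r. (\<integral>\<^sup>+\<omega>. ennreal (indicator {0..T} r * g r (V r \<omega>)) \<partial>M) \<partial>lborel)"
      by (rule PS.Fubini') measurable
    also have "\<dots> \<le> (\<integral>\<^sup>+r. k r * (indicator {0..T} r * na r) \<partial>lborel)"
    proof (rule nn_integral_mono_AE)
      show "AE r in lborel. (\<integral>\<^sup>+\<omega>. ennreal (indicator {0..T} r * g r (V r \<omega>)) \<partial>M) \<le> k r * (indicator {0..T} r * na r)"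
        using AE_lborel_singleton[of 0] AE_lborel_singleton[of T]
        by eventually_elim (use pt in \<open>auto simp: indicator_def\<close>)
    qed
    also have "\<dots> \<le> Lnorm lborel q' k * Lnorm lborel q (\<lambda>r. indicator {0..T} r * na r)"
      by (rule hoelder) (use q q' in \<open>auto simp: k_def\<close>)
    finally show "(\<integral>\<^sup>+\<omega>. (\<integral>\<^sup>+r. ennreal (indicator {0..T} r * g r (V r \<omega>)) \<partial>lborel) \<partial>M) \<le> ennreal C * mixed_norm T q p (\<lambda>r x. ennreal \<bar>g r x\<bar>)"
      unfolding C mixed_norm_def na_def .
  qed (rule C)
qed

end

definition admissible :: "real \<Rightarrow> real \<Rightarrow> (real \<Rightarrow> 'a::euclidean_space) \<Rightarrow> real \<Rightarrow> bool" where
  "admissible T R \<psi> v \<longleftrightarrow> \<psi> ` {0..T} \<subseteq> cball 0 R \<and> variation \<psi> 0 T \<le> ennreal v \<and> 0 \<le> v"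

lemma nonneg_path_bound:
  fixes g :: "real \<Rightarrow> 'a::euclidean_space \<Rightarrow> real"
  assumes gp: "good_path T R w g (\<lambda>_. g) (\<lambda>_. 0)" and g0: "\<And>r x. 0 \<le> g r x"
    and ea: "0 < \<epsilon>" "\<epsilon> < \<alpha>" "\<epsilon> < 1" and m: "1 \<le> m" and \<psi>: "admissible T R \<psi> v"
  shows "(\<integral>\<^sup>+r. ennreal (indicator {0..T} r * g r (w r + \<psi> r)) \<partial>lborel)
    \<le> ((\<integral>\<^sup>+r. ennreal (indicator {0..T} r * g r (w r)) \<partial>lborel)
      + ennreal ((sewing_const \<epsilon> \<alpha> + R powr (1 - \<epsilon>)) * (grr_const 1 m \<alpha> * grr_const DIM('a) m (1 - \<epsilon>)) powr (1 / m) * T powr \<alpha> + 1)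
        * good_path.Q1 T R w g \<alpha> \<epsilon> m epowr (1 / m)) * ennreal (1 + v)"
proof -
  interpret good_path T R w g "\<lambda>_. g" "\<lambda>_. 0" by fact
  define K1 where "K1 = (grr_const 1 m \<alpha> * grr_const DIM('a) m (1 - \<epsilon>)) powr (1 / m)"
  have K1: "0 \<le> K1" by (simp add: K1_def)
  have sp: "0 \<le> sewing_const \<epsilon> \<alpha>"
    unfolding sewing_const_def using ea powr_less_mono[of "\<epsilon> - \<alpha>" 0 2] by simp
  define C where "C = (sewing_const \<epsilon> \<alpha> + R powr (1 - \<epsilon>)) * K1 * T powr \<alpha>"
  have C: "0 \<le> C" using K1 sp by (simp add: C_def)
  have ps: "\<psi> ` {0..T} \<subseteq> cball 0 R" "variation \<psi> 0 T \<le> ennreal v" "0 \<le> v" "variation \<psi> 0 T < \<top>"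
    using \<psi> by (auto simp: admissible_def intro: le_less_trans)
  show ?thesis
  proof (cases "Q1 \<alpha> \<epsilon> m")
    case top
    have "ennreal (C + 1) * \<top> = \<top>" using C by (simp add: ennreal_mult_top)
    moreover have "\<top> * ennreal (1 + v) = \<top>" using ps(3) by (simp add: ennreal_top_mult)
    ultimately show ?thesis unfolding top K1_def[symmetric] C_def[symmetric] by simp
  next
    case (real Q)
    have DH: "\<bar>D a b x y\<bar> \<le> (K1 * Q powr (1 / m)) * (b - a) powr \<alpha> * norm (x - y) powr (1 - \<epsilon>)"
      if "0 \<le> a" "a \<le> b" "b \<le> T" "x \<in> cball 0 R" "y \<in> cball 0 R" for a b x y
      using space_time_bound[OF m _ ea(3), of \<alpha> Q a b x y] real that ea by (simp add: K1_def mult_ac)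
    have eqI: "(\<integral>\<^sup>+r. ennreal (indicator {0..T} r * g r (w r + \<phi> r)) \<partial>lborel) = ennreal (Iv 0 T (\<lambda>r. g r (w r + \<phi> r)))"
      if "\<phi> ` {0..T} \<subseteq> cball 0 R" "variation \<phi> 0 T < \<top>" for \<phi>
    proof -
      have "(\<integral>\<^sup>+r. ennreal (indicator {0..T} r * g r (w r + \<phi> r)) \<partial>lborel) = ennreal (LINT r|lborel. indicator {0..T} r * g r (w r + \<phi> r))"
        by (rule nn_integral_eq_integral[OF f_integrable[OF that]]) (use g0 in auto)
      also have "(LINT r|lborel. indicator {0..T} r * g r (w r + \<phi> r)) = Iv 0 T (\<lambda>r. g r (w r + \<phi> r))"
        unfolding Iv_def by (rule integral_discrete_difference[where X="{T}"]) (auto simp: indicator_def)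
      finally show ?thesis .
    qed
    have p0: "\<psi> 0 \<in> cball 0 R" by (rule subsetD[OF ps(1)], rule imageI) (use T in simp)
    have z0: "(0::'a) \<in> cball 0 R" using R by simp
    have vv: "v powr (1 - \<epsilon>) \<le> 1 + v"
    proof (cases "1 \<le> v")
      case True
      then have "v powr (1 - \<epsilon>) \<le> v powr 1" using ea by (intro powr_mono) auto
      then show ?thesis using True by simp
    next
      case False
      then have "v powr (1 - \<epsilon>) \<le> 1 powr (1 - \<epsilon>)" using ea ps(3) by (intro powr_mono2) auto
      then show ?thesis using ps(3) by simp
    qed
    have "\<bar>Iv 0 T (\<lambda>r. g r (w r + \<psi> r)) - Iv 0 T (\<lambda>r. g r (w r + \<psi> 0))\<bar> \<le> sewing_const \<epsilon> \<alpha> * (K1 * Q powr (1 / m)) * v powr (1 - \<epsilon>) * (T - 0) powr \<alpha>"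
      by (rule sewing[OF ea _ DH _ _ _ ps(1,4,2,3)]) (use T K1 in auto)
    also have "\<dots> \<le> sewing_const \<epsilon> \<alpha> * (K1 * Q powr (1 / m)) * (1 + v) * T powr \<alpha>"
      unfolding diff_0_right using vv sp K1 by (intro mult_right_mono mult_left_mono) auto
    finally have 1: "\<bar>Iv 0 T (\<lambda>r. g r (w r + \<psi> r)) - Iv 0 T (\<lambda>r. g r (w r + \<psi> 0))\<bar> \<le> sewing_const \<epsilon> \<alpha> * (K1 * Q powr (1 / m)) * (1 + v) * T powr \<alpha>" .
    have "\<bar>Iv 0 T (\<lambda>r. g r (w r + \<psi> 0)) - Iv 0 T (\<lambda>r. g r (w r + 0))\<bar> \<le> (K1 * Q powr (1 / m)) * (T - 0) powr \<alpha> * norm (\<psi> 0 - 0) powr (1 - \<epsilon>)"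
      using DH[of 0 T "\<psi> 0" 0] D_eq_Iv[OF p0 z0, of 0 T] T p0 z0 by simp
    also have "\<dots> \<le> (K1 * Q powr (1 / m)) * (T - 0) powr \<alpha> * R powr (1 - \<epsilon>)"
      using p0 K1 ea by (intro mult_left_mono powr_mono2) auto
    also have "\<dots> \<le> (K1 * Q powr (1 / m)) * T powr \<alpha> * R powr (1 - \<epsilon>) * (1 + v)"
      using mult_left_mono[of 1 "1 + v" "K1 * Q powr (1 / m) * T powr \<alpha> * R powr (1 - \<epsilon>)"] K1 ps(3) by simp
    finally have 2: "\<bar>Iv 0 T (\<lambda>r. g r (w r + \<psi> 0)) - Iv 0 T (\<lambda>r. g r (w r + 0))\<bar> \<le> (K1 * Q powr (1 / m)) * T powr \<alpha> * R powr (1 - \<epsilon>) * (1 + v)" .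
    have I0: "0 \<le> Iv 0 T (\<lambda>r. g r (w r + 0))"
      unfolding Iv_def using g0 by (intro integral_nonneg_AE AE_I2) simp
    have "Iv 0 T (\<lambda>r. g r (w r + \<psi> r)) \<le> Iv 0 T (\<lambda>r. g r (w r + 0)) + C * Q powr (1 / m) * (1 + v)"
      using 1 2 unfolding C_def by (simp add: algebra_simps)
    also have "\<dots> \<le> (Iv 0 T (\<lambda>r. g r (w r + 0)) + (C + 1) * Q powr (1 / m)) * (1 + v)"
    proof -
      have "0 \<le> Q powr (1 / m) * (1 + v)" using ps(3) by simp
      moreover have "Iv 0 T (\<lambda>r. g r (w r + 0)) * 1 \<le> Iv 0 T (\<lambda>r. g r (w r + 0)) * (1 + v)"
        using I0 ps(3) by (intro mult_left_mono) auto
      moreover have "(Iv 0 T (\<lambda>r. g r (w r + 0)) + (C + 1) * Q powr (1 / m)) * (1 + v)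
        = Iv 0 T (\<lambda>r. g r (w r + 0)) * (1 + v) + C * Q powr (1 / m) * (1 + v) + Q powr (1 / m) * (1 + v)"
        by (simp add: algebra_simps)
      ultimately show ?thesis by linarith
    qed
    finally have "ennreal (Iv 0 T (\<lambda>r. g r (w r + \<psi> r))) \<le> ennreal ((Iv 0 T (\<lambda>r. g r (w r + 0)) + (C + 1) * Q powr (1 / m)) * (1 + v))"
      by (rule ennreal_leI)
    also have "\<dots> = (ennreal (Iv 0 T (\<lambda>r. g r (w r + 0))) + ennreal (C + 1) * ennreal (Q powr (1 / m))) * ennreal (1 + v)"
      using I0 C ps(3) by (simp add: ennreal_mult ennreal_plus del: ennreal_plus[symmetric])
    also have "ennreal (Iv 0 T (\<lambda>r. g r (w r + 0))) = (\<integral>\<^sup>+r. ennreal (indicator {0..T} r * g r (w r)) \<partial>lborel)"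
      using eqI[of "\<lambda>_. 0"] const_ok[OF z0] by (simp add: le_less_trans)
    finally show ?thesis
      unfolding eqI[OF ps(1,4)] using real by (simp add: C_def K1_def)
  qed
qed

context modified_brownian_motion
begin

text \<open>The mixed norm of \<open>g\<close> controls its integral along all admissible perturbations of the path
  simultaneously. The constant does not depend on \<open>g\<close>, which makes the property stable under
  increasing limits.\<close>

definition tame :: "real \<Rightarrow> real \<Rightarrow> real \<Rightarrow> real \<Rightarrow> real \<Rightarrow> (real \<Rightarrow> 'a \<Rightarrow> ennreal) \<Rightarrow> bool" where
  "tame p q T R C g \<longleftrightarrow> (\<exists>Y\<in>borel_measurable M. (\<integral>\<^sup>+\<omega>. Y \<omega> \<partial>M) \<le> ennreal C * mixed_norm T q p g \<and>
     (AE \<omega> in M. \<forall>\<psi> v. admissible T R \<psi> v \<longrightarrow> (\<integral>\<^sup>+r. indicator {0..T} r * g r (V r \<omega> + \<psi> r) \<partial>lborel) \<le> Y \<omega> * ennreal (1 + v)))"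

lemma Iv_path_measurable:
  assumes gc: "continuous_on UNIV (\<lambda>(r, x). g r x)" and gb: "\<And>r x. \<bar>g r x\<bar> \<le> B"
  shows "(\<lambda>(\<omega>, t, x). Iv 0 t (\<lambda>r. g r (V r \<omega> + x))) \<in> borel_measurable (M \<Otimes>\<^sub>M (borel \<Otimes>\<^sub>M borel))"
proof -
  note gm = h_meas[OF gc gb]
  have [measurable]: "(\<lambda>z. g (a z) (b z)) \<in> borel_measurable N" if "a \<in> borel_measurable N" "b \<in> borel_measurable N" for a b and N :: "'z measure"
    using measurable_compose[OF measurable_Pair gm, of a N b] that by simp
  have [measurable]: "(\<lambda>z. V (a z) (b z)) \<in> borel_measurable N" if "a \<in> borel_measurable N" "b \<in> measurable N M" for a b and N :: "'z measure"
    using measurable_compose[OF measurable_Pair V_measurable, of a N b] that by simp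
  have "(\<lambda>(\<omega>, t, x). LINT r|lborel. (if 0 \<le> r \<and> r < t then g r (V r \<omega> + x) else 0)) \<in> borel_measurable (M \<Otimes>\<^sub>M (borel \<Otimes>\<^sub>M borel))"
    unfolding split_beta by measurable
  moreover have "Iv 0 t (\<lambda>r. g r (V r \<omega> + x)) = (LINT r|lborel. (if 0 \<le> r \<and> r < t then g r (V r \<omega> + x) else 0))" for \<omega> t x
    unfolding Iv_def by (intro Bochner_Integration.integral_cong) (auto simp: indicator_def)
  ultimately show ?thesis by simp
qed

lemma tame_continuous:
  fixes p q :: real
  assumes p: "2 < p" and q: "2 < q" and pq: "2 / q + real DIM('a) / p < 1" and T: "0 < T" and R: "0 < R"
  shows "\<exists>C>0. \<forall>(g :: real \<Rightarrow> 'a \<Rightarrow> real) B. continuous_on UNIV (\<lambda>(r, x). g r x) \<longrightarrow> (\<forall>r x. \<bar>g r x\<bar> \<le> B) \<longrightarrow> (\<forall>r x. 0 \<le> g r x) \<longrightarrow>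
    tame p q T R C (\<lambda>r x. ennreal (g r x))"
proof -
  define d where "d = real DIM('a)"
  define \<kappa>0 where "\<kappa>0 = 1 / 2 - d / (2 * p) - 1 / q"
  have \<kappa>0: "0 < \<kappa>0" "\<kappa>0 < 1 / 2"
  proof -
    have "2 * \<kappa>0 = 1 - (2 / q + d / p)" by (simp add: \<kappa>0_def)
    then show "0 < \<kappa>0" using pq by (simp add: d_def)
    have "0 \<le> d / (2 * p)" "0 < 1 / q" using p q by (auto simp: d_def)
    then show "\<kappa>0 < 1 / 2" unfolding \<kappa>0_def by linarith
  qed
  define \<alpha> where "\<alpha> = \<kappa>0 / 2"
  define \<epsilon> where "\<epsilon> = \<kappa>0 / 4"
  define \<beta> where "\<beta> = 1 - \<epsilon> / 2"
  define \<kappa> where "\<kappa> = 1 - \<beta> / 2 - d / (2 * p) - 1 / q"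
  have \<kappa>: "\<kappa> = \<kappa>0 + \<epsilon> / 4" by (simp add: \<kappa>_def \<kappa>0_def \<beta>_def diff_divide_distrib)
  have ea: "0 < \<epsilon>" "\<epsilon> < \<alpha>" "\<epsilon> < 1" "0 < \<beta>" "\<beta> < 1" "\<alpha> < \<kappa>" using \<kappa>0 by (auto simp: \<alpha>_def \<epsilon>_def \<beta>_def \<kappa>)
  obtain Cm where Cm0: "\<And>n. 0 \<le> Cm n" and Cm: "\<And>(g :: real \<Rightarrow> 'a \<Rightarrow> real) z B s0 t A n s w.
    (\<lambda>(r, w). g r w) \<in> borel_measurable (borel \<Otimes>\<^sub>M borel) \<Longrightarrow> (\<forall>r w. \<bar>g r w\<bar> \<le> B) \<Longrightarrow> s0 < t \<Longrightarrow> 0 \<le> A \<Longrightarrow>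
    Lnorm lborel q (\<lambda>r. indicator {s0<..<t} r * Lnorm lborel p (\<lambda>w. ennreal \<bar>g r w\<bar>)) \<le> ennreal A \<Longrightarrow> s \<in> {s0..t} \<Longrightarrow>
    \<bar>mom (\<lambda>r w. g r (w + z) - g r w) t n s w\<bar> \<le> Cm n * (norm z powr \<beta> * A * (t - s0) powr \<kappa>) ^ n"
    using gradient_moment_bound[OF p q pq ea(4,5)] unfolding \<kappa>_def d_def by blast
  obtain C1 where C1: "0 \<le> C1" "\<And>(g :: real \<Rightarrow> 'a \<Rightarrow> real) B. continuous_on UNIV (\<lambda>(r, x). g r x) \<Longrightarrow> (\<forall>r x. \<bar>g r x\<bar> \<le> B) \<Longrightarrow> (\<forall>r x. 0 \<le> g r x) \<Longrightarrow>
    (\<integral>\<^sup>+\<omega>. (\<integral>\<^sup>+r. ennreal (indicator {0..T} r * g r (V r \<omega>)) \<partial>lborel) \<partial>M) \<le> ennreal C1 * mixed_norm T q p (\<lambda>r x. ennreal \<bar>g r x\<bar>)"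
    using first_moment[OF p q pq T] by blast
  obtain N :: nat where N: "max (2 / (\<kappa> - \<alpha>)) (4 * d / \<epsilon>) + 1 < real N" using reals_Archimedean2 by blast
  define n where "n = 2 * N"
  define m where "m = real n"
  have m: "2 / (\<kappa> - \<alpha>) \<le> m" "4 * d / \<epsilon> \<le> m" "1 \<le> m" "n \<noteq> 0" "even n"
  proof -
    have "0 \<le> 4 * d / \<epsilon>" using ea by (simp add: d_def)
    then have "1 < real N" using N by linarith
    moreover have "real N \<le> m" by (simp add: m_def n_def)
    ultimately show "2 / (\<kappa> - \<alpha>) \<le> m" "4 * d / \<epsilon> \<le> m" "1 \<le> m" "n \<noteq> 0" "even n"
      using N by (auto simp: n_def)
  qed
  define e1 where "e1 = m * \<kappa> - (\<alpha> * m + 2)"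
  define e2 where "e2 = m * \<beta> - ((1 - \<epsilon>) * m + 2 * d)"
  have e1: "0 \<le> e1" using m(1) ea(6) by (simp add: e1_def field_simps)
  have e2: "0 \<le> e2" using m(2) ea(1) by (simp add: e2_def \<beta>_def field_simps)
  define vol where "vol = measure lborel (cball (0::'a) R)"
  define K0 where "K0 = Cm n * T powr e1 * (2 * R) powr e2 * (T * T * vol * vol)"
  have K0: "0 \<le> K0" using Cm0 T by (simp add: K0_def vol_def)
  define C2 where "C2 = (sewing_const \<epsilon> \<alpha> + R powr (1 - \<epsilon>)) * (grr_const 1 m \<alpha> * grr_const DIM('a) m (1 - \<epsilon>)) powr (1 / m) * T powr \<alpha> + 1"
  have C2: "0 \<le> C2"
  proof -
    have "0 \<le> sewing_const \<epsilon> \<alpha>" unfolding sewing_const_def using ea powr_less_mono[of "\<epsilon> - \<alpha>" 0 2] by simp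
    then show ?thesis by (simp add: C2_def)
  qed
  define C where "C = C1 + C2 * K0 powr (1 / m) + 1"
  have Cpos: "0 < C" using C1(1) C2 by (simp add: C_def add_nonneg_pos)
  show ?thesis
  proof (intro exI[of _ C] conjI Cpos allI impI)
    fix g :: "real \<Rightarrow> 'a \<Rightarrow> real" and B
    assume gc: "continuous_on UNIV (\<lambda>(r, x). g r x)" and gbd: "\<forall>r x. \<bar>g r x\<bar> \<le> B" and g0: "\<forall>r x. 0 \<le> g r x"
    from gbd have gb: "\<And>r x. \<bar>g r x\<bar> \<le> B" by auto
    have absg: "(\<lambda>r x. ennreal \<bar>g r x\<bar>) = (\<lambda>r x. ennreal (g r x))" using g0 by (auto simp: fun_eq_iff)
    show "tame p q T R C (\<lambda>r x. ennreal (g r x))"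
    proof (cases "mixed_norm T q p (\<lambda>r x. ennreal (g r x))")
      case top
      have "ennreal C * \<top> = \<top>" using Cpos by (simp add: ennreal_mult_top)
      moreover have "\<top> * ennreal (1 + v) = \<top>" if "admissible T R \<psi> v" for \<psi> :: "real \<Rightarrow> 'a" and v
        using that by (simp add: admissible_def ennreal_top_mult)
      ultimately show ?thesis unfolding tame_def top by (intro bexI[of _ "\<lambda>_. \<top>"]) auto
    next
      case (real A)
      have gp: "good_path T R (\<lambda>r. V r \<omega>) g (\<lambda>_. g) (\<lambda>_. 0)" for \<omega>
        by (rule good_path_continuous[OF T R V_continuous gc gb])
      define D where "D \<omega> = good_path.D (\<lambda>r. V r \<omega>) g" for \<omega>
      define Q where "Q \<omega> = good_path.Q1 T R (\<lambda>r. V r \<omega>) g \<alpha> \<epsilon> m" for \<omega>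
      define Z where "Z \<omega> z = (case z of (s, t, x, y) \<Rightarrow> ennreal (\<bar>D \<omega> s t x y\<bar> powr m / (\<bar>t - s\<bar> powr (\<alpha> * m + 2) * norm (x - y) powr ((1 - \<epsilon>) * m + 2 * d))))
          * indicator ({0..T} \<times> {0..T} \<times> cball 0 R \<times> cball 0 R) z" for \<omega> and z :: "real \<times> real \<times> 'a \<times> 'a"
      have Qz: "Q \<omega> = (\<integral>\<^sup>+z. Z \<omega> z \<partial>lborel)" for \<omega>
        unfolding Q_def good_path.Q1_eq_product[OF gp] Z_def D_def d_def ..
      have Deq: "D \<omega> s t x y = (Iv 0 t (\<lambda>r. g r (V r \<omega> + x)) - Iv 0 s (\<lambda>r. g r (V r \<omega> + x))) - (Iv 0 t (\<lambda>r. g r (V r \<omega> + y)) - Iv 0 s (\<lambda>r. g r (V r \<omega> + y)))" for \<omega> s t x y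
        unfolding D_def good_path.D_def[OF gp] good_path.G_def[OF gp] ..
      have Dm: "(\<lambda>z. D (om z) (s z) (t z) (x z) (y z)) \<in> borel_measurable N'"
        if "om \<in> measurable N' M" "s \<in> borel_measurable N'" "t \<in> borel_measurable N'" "x \<in> borel_measurable N'" "y \<in> borel_measurable N'" for om s t x y and N' :: "'z measure"
      proof -
        have G: "(\<lambda>z. Iv 0 (t z) (\<lambda>r. g r (V r (om z) + x z))) \<in> borel_measurable N'" if "t \<in> borel_measurable N'" "x \<in> borel_measurable N'" for t x
          using measurable_compose[OF measurable_Pair[OF \<open>om \<in> measurable N' M\<close> measurable_Pair[OF that]] Iv_path_measurable[OF gc gb]] by simp
        show ?thesis unfolding Deq by (intro borel_measurable_diff G that)
      qed
      have [measurable]: "(\<lambda>(z, \<omega>). Z \<omega> z) \<in> borel_measurable (lborel \<Otimes>\<^sub>M M)"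
      proof -
        let ?N = "(borel :: (real \<times> real \<times> 'a \<times> 'a) measure) \<Otimes>\<^sub>M M"
        have "{0..T} \<times> {0..T} \<times> cball (0::'a) R \<times> cball (0::'a) R \<in> sets (borel :: (real \<times> real \<times> 'a \<times> 'a) measure)"
          by (intro borel_closed closed_Times) auto
        then have I [measurable]: "(\<lambda>x. indicator ({0..T} \<times> {0..T} \<times> cball 0 R \<times> cball 0 R) (fst x) :: ennreal) \<in> borel_measurable ?N"
          by (intro measurable_compose[OF measurable_fst borel_measurable_indicator])
        define q1 where "q1 = (\<lambda>x :: (real \<times> real \<times> 'a \<times> 'a) \<times> 'w. fst (fst x))"
        define q2 where "q2 = (\<lambda>x :: (real \<times> real \<times> 'a \<times> 'a) \<times> 'w. fst (snd (fst x)))"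
        define q3 where "q3 = (\<lambda>x :: (real \<times> real \<times> 'a \<times> 'a) \<times> 'w. fst (snd (snd (fst x))))"
        define q4 where "q4 = (\<lambda>x :: (real \<times> real \<times> 'a \<times> 'a) \<times> 'w. snd (snd (snd (fst x))))"
        have [measurable]: "q1 \<in> borel_measurable ?N" "q2 \<in> borel_measurable ?N" "q3 \<in> borel_measurable ?N" "q4 \<in> borel_measurable ?N"
          unfolding q1_def q2_def q3_def q4_def
          by (intro measurable_compose[OF measurable_fst] borel_measurable_continuous_onI continuous_intros)+
        define E where "E = (\<lambda>x. D (snd x) (q1 x) (q2 x) (q3 x) (q4 x))"
        have [measurable]: "E \<in> borel_measurable ?N" unfolding E_def by (rule Dm) auto
        have "(\<lambda>x. ennreal (\<bar>E x\<bar> powr m / (\<bar>q2 x - q1 x\<bar> powr (\<alpha> * m + 2) * norm (q3 x - q4 x) powr ((1 - \<epsilon>) * m + 2 * d)))) \<in> borel_measurable ?N"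
          by measurable
        from borel_measurable_times_ennreal[OF this I]
        have "(\<lambda>(z, \<omega>). Z \<omega> z) \<in> borel_measurable ?N"
          unfolding Z_def split_beta E_def q1_def q2_def q3_def q4_def .
        moreover have "sets (lborel \<Otimes>\<^sub>M M) = sets ?N" by (rule sets_pair_measure_cong) auto
        ultimately show ?thesis using measurable_cong_sets by blast
      qed
      have Zm: "(\<lambda>\<omega>. Z \<omega> z) \<in> borel_measurable M" for z
        using measurable_compose[OF measurable_Pair1'[of z lborel M] \<open>(\<lambda>(z, \<omega>). Z \<omega> z) \<in> _\<close>] by simp
      interpret PS: pair_sigma_finite lborel M ..
      have Qm [measurable]: "Q \<in> borel_measurable M" unfolding Qz[abs_def] by measurable
      have EZ: "(\<integral>\<^sup>+\<omega>. Z \<omega> z \<partial>M) \<le> ennreal (Cm n * A ^ n * T powr e1 * (2 * R) powr e2) * indicator ({0..T} \<times> {0..T} \<times> cball 0 R \<times> cball 0 R) z" for z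
      proof -
        obtain s t x y where z: "z = (s, t, x, y)" by (cases z)
        show ?thesis
        proof (cases "s \<in> {0..T} \<and> t \<in> {0..T} \<and> x \<in> cball 0 R \<and> y \<in> cball 0 R \<and> s \<noteq> t \<and> x \<noteq> y")
          case False
          then have "Z \<omega> z = 0" for \<omega> by (auto simp: Z_def z Deq)
          then show ?thesis by simp
        next
          case True
          define a where "a = min s t"
          define b where "b = max s t"
          have ab: "0 \<le> a" "a < b" "b \<le> T" "\<bar>t - s\<bar> = b - a" using True by (auto simp: a_def b_def)
          have Dab: "\<bar>D \<omega> s t x y\<bar> = \<bar>Iv a b (\<lambda>r. g r (V r \<omega> + x)) - Iv a b (\<lambda>r. g r (V r \<omega> + y))\<bar>" for \<omega>
          proof -
            have "D \<omega> a b x y = Iv a b (\<lambda>r. g r (V r \<omega> + x)) - Iv a b (\<lambda>r. g r (V r \<omega> + y))"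
              unfolding D_def by (rule good_path.D_eq_Iv[OF gp]) (use True ab in auto)
            moreover have "\<bar>D \<omega> s t x y\<bar> = \<bar>D \<omega> a b x y\<bar>"
              by (cases "s \<le> t") (auto simp: a_def b_def Deq min_def max_def)
            ultimately show ?thesis by simp
          qed
          define P where "P = (b - a) powr (\<alpha> * m + 2) * norm (x - y) powr ((1 - \<epsilon>) * m + 2 * d)"
          have P: "0 < P" using ab True by (simp add: P_def)
          have "(\<integral>\<^sup>+\<omega>. Z \<omega> z \<partial>M) = (\<integral>\<^sup>+\<omega>. ennreal (1 / P) * ennreal (\<bar>Iv a b (\<lambda>r. g r (V r \<omega> + x)) - Iv a b (\<lambda>r. g r (V r \<omega> + y))\<bar> ^ n) \<partial>M)"
          proof (rule nn_integral_cong)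
            fix \<omega>
            have "Z \<omega> z = ennreal (\<bar>D \<omega> s t x y\<bar> powr m / P)" using True by (simp add: Z_def z P_def ab)
            then show "Z \<omega> z = ennreal (1 / P) * ennreal (\<bar>Iv a b (\<lambda>r. g r (V r \<omega> + x)) - Iv a b (\<lambda>r. g r (V r \<omega> + y))\<bar> ^ n)"
              using P m(4) unfolding Dab m_def by (simp add: powr_realpow' ennreal_mult[symmetric])
          qed
          also have "\<dots> = ennreal (1 / P) * (\<integral>\<^sup>+\<omega>. ennreal (\<bar>Iv a b (\<lambda>r. g r (V r \<omega> + x)) - Iv a b (\<lambda>r. g r (V r \<omega> + y))\<bar> ^ n) \<partial>M)"
          proof (rule nn_integral_cmult)
            have "(\<lambda>\<omega>. \<bar>D \<omega> s t x y\<bar>) \<in> borel_measurable M" by (intro borel_measurable_abs Dm) auto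
            then show "(\<lambda>\<omega>. ennreal (\<bar>Iv a b (\<lambda>r. g r (V r \<omega> + x)) - Iv a b (\<lambda>r. g r (V r \<omega> + y))\<bar> ^ n)) \<in> borel_measurable M"
              unfolding Dab by measurable
          qed
          also have "\<dots> \<le> ennreal (1 / P) * ennreal (Cm n * (norm (x - y) powr \<beta> * A * (b - a) powr \<kappa>) ^ n)"
            using real p q by (intro mult_left_mono difference_moment[where T=T and q=q and p=p, OF Cm _ _ gc gb _ _ ab(1-3) m(5)]) (auto simp: absg)
          also have "\<dots> = ennreal (Cm n * A ^ n * ((b - a) powr e1 * norm (x - y) powr e2))"
          proof -
            have "((b - a) powr \<kappa>) ^ n = (b - a) powr (m * \<kappa>)" "(norm (x - y) powr \<beta>) ^ n = norm (x - y) powr (m * \<beta>)"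
              using ab True by (simp_all add: powr_power m_def mult.commute)
            then have "1 / P * (Cm n * (norm (x - y) powr \<beta> * A * (b - a) powr \<kappa>) ^ n)
              = Cm n * A ^ n * (((b - a) powr (m * \<kappa>) / (b - a) powr (\<alpha> * m + 2)) * (norm (x - y) powr (m * \<beta>) / norm (x - y) powr ((1 - \<epsilon>) * m + 2 * d)))"
              by (simp add: P_def power_mult_distrib)
            also have "\<dots> = Cm n * A ^ n * ((b - a) powr e1 * norm (x - y) powr e2)"
              by (simp add: e1_def e2_def powr_diff)
            finally show ?thesis using P Cm0 real by (simp add: ennreal_mult[symmetric])
          qed
          also have "\<dots> \<le> ennreal (Cm n * A ^ n * (T powr e1 * (2 * R) powr e2))"
          proof (intro ennreal_leI mult_left_mono mult_mono powr_mono2)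
            show "norm (x - y) \<le> 2 * R" using True norm_triangle_ineq4[of x y] by simp
          qed (use e1 e2 ab Cm0 real in auto)
          finally show ?thesis using True by (simp add: z mult.assoc)
        qed
      qed
      have EQ: "(\<integral>\<^sup>+\<omega>. Q \<omega> \<partial>M) \<le> ennreal (K0 * A ^ n)"
      proof -
        have "(\<integral>\<^sup>+\<omega>. Q \<omega> \<partial>M) = (\<integral>\<^sup>+z. (\<integral>\<^sup>+\<omega>. Z \<omega> z \<partial>M) \<partial>lborel)"
          unfolding Qz by (rule PS.Fubini') measurable
        also have "\<dots> \<le> (\<integral>\<^sup>+z. ennreal (Cm n * A ^ n * T powr e1 * (2 * R) powr e2) * indicator ({0..T} \<times> {0..T} \<times> cball (0::'a) R \<times> cball (0::'a) R) z \<partial>lborel)"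
          by (intro nn_integral_mono EZ)
        also have "\<dots> = ennreal (Cm n * A ^ n * T powr e1 * (2 * R) powr e2) * emeasure lborel ({0..T} \<times> {0..T} \<times> cball (0::'a) R \<times> cball (0::'a) R)"
        proof (rule nn_integral_cmult_indicator)
          show "{0..T} \<times> {0..T} \<times> cball (0::'a) R \<times> cball (0::'a) R \<in> sets lborel"
            unfolding sets_lborel by (intro borel_closed closed_Times) auto
        qed
        also have "emeasure lborel ({0..T} \<times> {0..T} \<times> cball (0::'a) R \<times> cball (0::'a) R) = ennreal (T * T * vol * vol)"
        proof -
          have fin: "emeasure lborel (cball (0::'a) R) = ennreal vol"
            unfolding vol_def by (rule emeasure_eq_ennreal_measure) (use emeasure_lborel_cball_finite[of "0::'a" R] in auto)
          have sf: "sigma_finite_measure (lborel :: (real \<times> 'a \<times> 'a) measure)" "sigma_finite_measure (lborel :: ('a \<times> 'a) measure)" "sigma_finite_measure (lborel :: 'a measure)"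
            by (rule sigma_finite_lborel)+
          have s: "cball (0::'a) R \<times> cball (0::'a) R \<in> sets lborel" "{0..T} \<times> cball (0::'a) R \<times> cball (0::'a) R \<in> sets lborel"
            unfolding sets_lborel by (intro borel_closed closed_Times; auto)+
          have "emeasure lborel ({0..T} \<times> {0..T} \<times> cball (0::'a) R \<times> cball (0::'a) R) = emeasure lborel {0..T} * (emeasure lborel {0..T} * (emeasure lborel (cball (0::'a) R) * emeasure lborel (cball (0::'a) R)))"
            unfolding lborel_prod[symmetric, where ?'a=real and ?'b="real \<times> 'a \<times> 'a"]
            apply (subst sigma_finite_measure.emeasure_pair_measure_Times[OF sf(1)], simp, rule s)
            unfolding lborel_prod[symmetric, where ?'a=real and ?'b="'a \<times> 'a"]
            apply (subst sigma_finite_measure.emeasure_pair_measure_Times[OF sf(2)], simp, rule s)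
            unfolding lborel_prod[symmetric, where ?'a='a and ?'b='a]
            apply (subst sigma_finite_measure.emeasure_pair_measure_Times[OF sf(3)], simp, simp)
            done
          also have "\<dots> = ennreal (T * T * vol * vol)"
            unfolding fin using T by (simp add: ennreal_mult[symmetric] vol_def mult.assoc)
          finally show ?thesis .
        qed
        also have "ennreal (Cm n * A ^ n * T powr e1 * (2 * R) powr e2) * ennreal (T * T * vol * vol) = ennreal (K0 * A ^ n)"
          using Cm0 real T by (simp add: ennreal_mult[symmetric] K0_def vol_def mult_ac)
        finally show ?thesis .
      qed
      define G0 where "G0 \<omega> = (\<integral>\<^sup>+r. ennreal (indicator {0..T} r * g r (V r \<omega>)) \<partial>lborel)" for \<omega>
      have G0m [measurable]: "G0 \<in> borel_measurable M"
      proof -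
        note gpm [measurable] = h_path_meas[OF gc gb]
        have [measurable]: "(\<lambda>(\<omega>, r). g r (V r \<omega>)) \<in> borel_measurable (M \<Otimes>\<^sub>M borel)"
          using measurable_compose[OF measurable_Pair[OF measurable_snd measurable_fst] gpm] by (simp add: split_beta)
        show ?thesis unfolding G0_def[abs_def] by measurable
      qed
      define Y where "Y \<omega> = G0 \<omega> + ennreal C2 * Q \<omega> epowr (1 / m)" for \<omega>
      show ?thesis unfolding tame_def
      proof (intro bexI[of _ Y] conjI AE_I2 allI impI)
        show "Y \<in> borel_measurable M" unfolding Y_def[abs_def] by measurable
        have "(\<integral>\<^sup>+\<omega>. Q \<omega> epowr (1 / m) \<partial>M) epowr m \<le> (\<integral>\<^sup>+\<omega>. Q \<omega> \<partial>M)"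
          using jensen_weighted[of "\<lambda>\<omega>. Q \<omega> epowr (1 / m)" M "\<lambda>_. 1" m] m(3) by (simp add: emeasure_space_1)
        also have "\<dots> \<le> ennreal (K0 * A ^ n)" by (rule EQ)
        also have "\<dots> = ennreal (K0 powr (1 / m) * A) epowr m"
        proof -
          have "A powr m = A ^ n" unfolding m_def using real m(4) by (intro powr_realpow') auto
          moreover have "(K0 powr (1 / m)) powr m = K0" using K0 m(3) by (simp add: powr_powr)
          ultimately have "(K0 powr (1 / m) * A) powr m = K0 * A ^ n" by (simp only: powr_mult)
          moreover have "0 \<le> K0 powr (1 / m) * A" using real by simp
          ultimately show ?thesis by (simp only: epowr_ennreal)
        qed
        finally have Qr: "(\<integral>\<^sup>+\<omega>. Q \<omega> epowr (1 / m) \<partial>M) \<le> ennreal (K0 powr (1 / m) * A)"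
          by (rule epowr_le_cancel[of m, rotated]) (use m(3) in simp)
        have "(\<integral>\<^sup>+\<omega>. Y \<omega> \<partial>M) = (\<integral>\<^sup>+\<omega>. G0 \<omega> \<partial>M) + ennreal C2 * (\<integral>\<^sup>+\<omega>. Q \<omega> epowr (1 / m) \<partial>M)"
          unfolding Y_def by (simp add: nn_integral_add nn_integral_cmult)
        also have "\<dots> \<le> ennreal C1 * ennreal A + ennreal C2 * ennreal (K0 powr (1 / m) * A)"
          using C1(2)[OF gc gbd g0] real Qr unfolding G0_def absg by (intro add_mono mult_left_mono) auto
        also have "\<dots> = ennreal ((C1 + C2 * K0 powr (1 / m)) * A)"
          using C1(1) C2 real by (simp add: ennreal_mult[symmetric] ennreal_plus[symmetric] distrib_right mult.assoc del: ennreal_plus)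
        also have "\<dots> \<le> ennreal (C * A)"
          using real by (intro ennreal_leI mult_right_mono) (auto simp: C_def)
        finally show "(\<integral>\<^sup>+\<omega>. Y \<omega> \<partial>M) \<le> ennreal C * mixed_norm T q p (\<lambda>r x. ennreal (g r x))"
          using real Cpos by (simp add: ennreal_mult)
        fix \<omega> and \<psi> :: "real \<Rightarrow> 'a" and v assume \<psi>: "admissible T R \<psi> v"
        have "(\<integral>\<^sup>+r. ennreal (indicator {0..T} r * g r (V r \<omega> + \<psi> r)) \<partial>lborel) \<le> Y \<omega> * ennreal (1 + v)"
          using nonneg_path_bound[OF gp _ ea(1-3) m(3) \<psi>] g0 unfolding Y_def G0_def Q_def C2_def by blast
        then show "(\<integral>\<^sup>+r. indicator {0..T} r * ennreal (g r (V r \<omega> + \<psi> r)) \<partial>lborel) \<le> Y \<omega> * ennreal (1 + v)"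
          by (simp add: ennreal_mult' ennreal_indicator)
      qed
    qed
  qed
qed

end

section \<open>Approximation in the mixed norm\<close>

lemma epowr_tendsto_0:
  assumes "(f \<longlongrightarrow> (0::ennreal)) F" "0 < a"
  shows "((\<lambda>x. f x epowr a) \<longlongrightarrow> 0) F"
proof (rule order_tendstoI)
  fix b :: ennreal assume "0 < b"
  then have "0 < b epowr (1 / a)" by (simp add: zero_less_iff_neq_zero)
  from order_tendstoD(2)[OF assms(1) this]
  show "\<forall>\<^sub>F x in F. f x epowr a < b"
  proof eventually_elim
    case (elim x)
    show ?case
    proof (rule ccontr)
      assume "\<not> f x epowr a < b"
      then have "b epowr (1 / a) \<le> f x" using assms(2) by (simp add: epowr_inverse_le_iff)
      with elim show False by simp
    qed
  qed
qed auto

lemma mixed_norm_measurable [measurable]: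
  fixes g :: "real \<Rightarrow> 'a::euclidean_space \<Rightarrow> ennreal"
  assumes [measurable]: "(\<lambda>(r, x). g r x) \<in> borel_measurable (borel \<Otimes>\<^sub>M borel)"
  shows "(\<lambda>r. Lnorm lborel p (g r)) \<in> borel_measurable borel"
  unfolding Lnorm_def by measurable

lemma Lnorm_finite_AE:
  assumes [measurable]: "f \<in> borel_measurable M" and "Lnorm M p f < \<top>"
  shows "AE x in M. f x < \<top>"
proof -
  have "(\<integral>\<^sup>+x. f x epowr p \<partial>M) \<noteq> \<infinity>" using assms(2) by (auto simp: Lnorm_def)
  from nn_integral_PInf_AE[OF _ this] have "AE x in M. f x epowr p \<noteq> \<infinity>" by simp
  then show ?thesis by eventually_elim (simp add: less_top)
qed

lemma mixed_norm_tendsto_0: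
  fixes h :: "nat \<Rightarrow> real \<Rightarrow> 'a::euclidean_space \<Rightarrow> ennreal"
  assumes pq: "0 < p" "0 < q"
    and hm: "\<And>j. (\<lambda>(r, x). h j r x) \<in> borel_measurable (borel \<Otimes>\<^sub>M borel)"
    and Gm: "(\<lambda>(r, x). G r x) \<in> borel_measurable (borel \<Otimes>\<^sub>M borel)"
    and le: "\<And>j r x. r \<in> {0..T} \<Longrightarrow> h j r x \<le> G r x" and fin: "mixed_norm T q p G < \<top>"
    and lim: "AE z in lborel. fst z \<in> {0..T} \<longrightarrow> (\<lambda>j. h j (fst z) (snd z)) \<longlonglongrightarrow> 0"
  shows "(\<lambda>j. mixed_norm T q p (h j)) \<longlonglongrightarrow> 0"
proof -
  note hm [measurable] Gm [measurable]
  note [measurable] = mixed_norm_measurable[OF hm] mixed_norm_measurable[OF Gm]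
  have "AE r in lborel. AE x in lborel. r \<in> {0..T} \<longrightarrow> (\<lambda>j. h j r x) \<longlonglongrightarrow> 0"
  proof -
    from lim have "AE z in (lborel \<Otimes>\<^sub>M lborel). fst z \<in> {0..T} \<longrightarrow> (\<lambda>j. h j (fst z) (snd z)) \<longlonglongrightarrow> 0"
      unfolding lborel_prod .
    from lborel_pair.AE_pair[OF this] show ?thesis by simp
  qed
  moreover have "AE r in lborel. indicator {0..T} r * Lnorm lborel p (G r) < \<top>"
    by (rule Lnorm_finite_AE[where p=q]) (use fin in \<open>auto simp: mixed_norm_def\<close>)
  ultimately have conv: "AE r in lborel. (\<lambda>j. (indicator {0..T} r * Lnorm lborel p (h j r)) epowr q) \<longlonglongrightarrow> 0"
  proof eventually_elim
    case (elim r)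
    show ?case
    proof (cases "r \<in> {0..T}")
      case True
      have "(\<lambda>j. \<integral>\<^sup>+x. h j r x epowr p \<partial>lborel) \<longlonglongrightarrow> (\<integral>\<^sup>+(x::'a). 0 \<partial>lborel)"
      proof (rule nn_integral_dominated_convergence[where w="\<lambda>x. G r x epowr p"])
        show "AE x in lborel. h j r x epowr p \<le> G r x epowr p" for j
          using le[OF True] pq by (auto intro!: AE_I2 epowr_mono)
        have "Lnorm lborel p (G r) < \<top>" using elim(2) True by simp
        then show "(\<integral>\<^sup>+x. G r x epowr p \<partial>lborel) < \<infinity>" by (simp add: Lnorm_def)
        show "AE x in lborel. (\<lambda>j. h j r x epowr p) \<longlonglongrightarrow> 0"
          using elim(1) by eventually_elim (use True pq in \<open>auto intro!: epowr_tendsto_0\<close>)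
      qed auto
      then have "(\<lambda>j. (\<integral>\<^sup>+x. h j r x epowr p \<partial>lborel) epowr (1 / p)) \<longlonglongrightarrow> 0"
        using pq by (intro epowr_tendsto_0) auto
      then have "(\<lambda>j. Lnorm lborel p (h j r)) \<longlonglongrightarrow> 0" by (simp only: Lnorm_def)
      from epowr_tendsto_0[OF this pq(2)] show ?thesis using True by simp
    qed simp
  qed
  have "(\<lambda>j. \<integral>\<^sup>+r. (indicator {0..T} r * Lnorm lborel p (h j r)) epowr q \<partial>lborel) \<longlonglongrightarrow> (\<integral>\<^sup>+(r::real). 0 \<partial>lborel)"
  proof (rule nn_integral_dominated_convergence[where w="\<lambda>r. (indicator {0..T} r * Lnorm lborel p (G r)) epowr q"])
    show "AE r in lborel. (indicator {0..T} r * Lnorm lborel p (h j r)) epowr q \<le> (indicator {0..T} r * Lnorm lborel p (G r)) epowr q" for j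
    proof (intro AE_I2 epowr_mono)
      fix r show "indicator {0..T} r * Lnorm lborel p (h j r) \<le> indicator {0..T} r * Lnorm lborel p (G r)"
        using le pq by (cases "r \<in> {0..T}") (auto intro!: Lnorm_mono)
    qed (use pq in auto)
    show "(\<integral>\<^sup>+r. (indicator {0..T} r * Lnorm lborel p (G r)) epowr q \<partial>lborel) < \<infinity>"
      using fin by (simp add: mixed_norm_def Lnorm_def)
  qed (use conv in auto)
  then have "(\<lambda>j. (\<integral>\<^sup>+r. (indicator {0..T} r * Lnorm lborel p (h j r)) epowr q \<partial>lborel) epowr (1 / q)) \<longlonglongrightarrow> 0"
    using pq by (intro epowr_tendsto_0) auto
  then show ?thesis unfolding mixed_norm_def by (simp add: Lnorm_def[of lborel q])
qed

lemma mixed_norm_suminf_le: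
  fixes h :: "nat \<Rightarrow> real \<Rightarrow> 'a::euclidean_space \<Rightarrow> ennreal"
  assumes pq: "1 \<le> p" "1 \<le> q"
    and hm: "\<And>j. (\<lambda>(r, x). h j r x) \<in> borel_measurable (borel \<Otimes>\<^sub>M borel)"
  shows "mixed_norm T q p (\<lambda>r x. \<Sum>j. h j r x) \<le> (\<Sum>j. mixed_norm T q p (h j))"
proof -
  note hm [measurable]
  note [measurable] = mixed_norm_measurable[OF hm]
  have sf: "sigma_finite_measure (count_space (UNIV :: nat set))" by (rule sigma_finite_measure_count_space)
  have inner: "Lnorm lborel p (\<lambda>x. \<Sum>j. h j r x) \<le> (\<Sum>j. Lnorm lborel p (h j r))" for r
  proof -
    have "Lnorm lborel p (\<lambda>x. \<integral>\<^sup>+j. h j r x \<partial>count_space UNIV) \<le> (\<integral>\<^sup>+j. Lnorm lborel p (h j r) \<partial>count_space UNIV)"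
      using pq by (intro minkowski_integral lborel.sigma_finite_measure_axioms sf measurable_pair_measure_countable1) auto
    then show ?thesis by (simp add: nn_integral_count_space_nat)
  qed
  have "mixed_norm T q p (\<lambda>r x. \<Sum>j. h j r x) \<le> Lnorm lborel q (\<lambda>r. \<integral>\<^sup>+j. indicator {0..T} r * Lnorm lborel p (h j r) \<partial>count_space UNIV)"
    unfolding mixed_norm_def
  proof (rule Lnorm_mono)
    fix r
    have "indicator {0..T} r * Lnorm lborel p (\<lambda>x. \<Sum>j. h j r x) \<le> indicator {0..T} r * (\<Sum>j. Lnorm lborel p (h j r))"
      by (intro mult_left_mono inner) auto
    also have "\<dots> = (\<integral>\<^sup>+j. indicator {0..T} r * Lnorm lborel p (h j r) \<partial>count_space UNIV)"
      by (simp add: nn_integral_count_space_nat)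
    finally show "indicator {0..T} r * Lnorm lborel p (\<lambda>x. \<Sum>j. h j r x) \<le> \<dots>" .
  qed (use pq in auto)
  also have "\<dots> \<le> (\<integral>\<^sup>+j. Lnorm lborel q (\<lambda>r. indicator {0..T} r * Lnorm lborel p (h j r)) \<partial>count_space UNIV)"
    using pq by (intro minkowski_integral lborel.sigma_finite_measure_axioms sf measurable_pair_measure_countable1) auto
  finally show ?thesis by (simp add: nn_integral_count_space_nat mixed_norm_def)
qed

lemma mixed_norm_finite_AE:
  fixes g :: "real \<Rightarrow> 'a::euclidean_space \<Rightarrow> ennreal"
  assumes gm [measurable]: "(\<lambda>(r, x). g r x) \<in> borel_measurable (borel \<Otimes>\<^sub>M borel)" and fin: "mixed_norm T q p g < \<top>"
  shows "AE z in lborel. fst z \<in> {0..T} \<longrightarrow> g (fst z) (snd z) < \<top>"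
proof -
  note [measurable] = mixed_norm_measurable[OF gm]
  have "AE r in lborel. indicator {0..T} r * Lnorm lborel p (g r) < \<top>"
    by (rule Lnorm_finite_AE[where p=q]) (use fin in \<open>auto simp: mixed_norm_def\<close>)
  then have AE: "AE r in lborel. AE x in lborel. r \<in> {0..T} \<longrightarrow> g r x < \<top>"
  proof eventually_elim
    case (elim r)
    show ?case
    proof (cases "r \<in> {0..T}")
      case True
      then have "Lnorm lborel p (g r) < \<top>" using elim by simp
      from Lnorm_finite_AE[OF _ this] show ?thesis by (simp add: True)
    qed auto
  qed
  have "AE z in (lborel \<Otimes>\<^sub>M lborel). fst z \<in> {0..T} \<longrightarrow> g (fst z) (snd z) < \<top>"
  proof (rule lborel_pair.AE_pair_measure)
    have "(\<lambda>z. g (fst z) (snd z)) \<in> borel_measurable (lborel \<Otimes>\<^sub>M lborel)"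
      using gm by (simp add: split_beta cong: measurable_cong_sets)
    then show "{z \<in> space (lborel \<Otimes>\<^sub>M lborel). fst z \<in> {0..T} \<longrightarrow> g (fst z) (snd z) < \<top>} \<in> sets (lborel \<Otimes>\<^sub>M lborel)"
      by measurable
  qed (use AE in simp)
  then show ?thesis unfolding lborel_prod .
qed

lemma mixed_norm_bounded_support:
  fixes L :: real
  assumes pq: "0 < p" "0 < q"
  shows "mixed_norm T q p (\<lambda>r (x::'a::euclidean_space). ennreal B * indicator (cball 0 L) x) < \<top>"
proof -
  have "(\<integral>\<^sup>+x. (ennreal B * indicator (cball 0 L) (x::'a)) epowr p \<partial>lborel) = ennreal B epowr p * emeasure lborel (cball (0::'a) L)"
    by (subst nn_integral_cmult_indicator[symmetric]) (auto intro!: nn_integral_cong simp: indicator_def)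
  also have "\<dots> < \<top>" using emeasure_lborel_cball_finite[of "0::'a" L] by (simp add: ennreal_mult_less_top)
  finally have 1: "Lnorm lborel p (\<lambda>x::'a. ennreal B * indicator (cball 0 L) x) < \<top>" by (simp add: Lnorm_def)
  define c where "c = Lnorm lborel p (\<lambda>x::'a. ennreal B * indicator (cball 0 L) x)"
  have "(\<integral>\<^sup>+r. (indicator {0..T} r * c) epowr q \<partial>lborel) = c epowr q * emeasure lborel {0..T}"
    by (subst nn_integral_cmult_indicator[symmetric]) (auto intro!: nn_integral_cong simp: indicator_def)
  also have "\<dots> < \<top>" using 1 by (simp add: c_def ennreal_mult_less_top emeasure_lborel_Icc_eq)
  finally show ?thesis unfolding mixed_norm_def c_def[symmetric] by (simp add: Lnorm_def)
qed

lemma mixed_norm_add_le: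
  fixes g h :: "real \<Rightarrow> 'a::euclidean_space \<Rightarrow> ennreal"
  assumes pq: "1 \<le> p" "1 \<le> q"
    and gm: "(\<lambda>(r, x). g r x) \<in> borel_measurable (borel \<Otimes>\<^sub>M borel)" and hm: "(\<lambda>(r, x). h r x) \<in> borel_measurable (borel \<Otimes>\<^sub>M borel)"
  shows "mixed_norm T q p (\<lambda>r x. g r x + h r x) \<le> mixed_norm T q p g + mixed_norm T q p h"
proof -
  note [measurable] = gm hm mixed_norm_measurable[OF hm] mixed_norm_measurable[OF gm]
  have "mixed_norm T q p (\<lambda>r x. g r x + h r x) \<le> Lnorm lborel q (\<lambda>r. indicator {0..T} r * Lnorm lborel p (g r) + indicator {0..T} r * Lnorm lborel p (h r))"
    unfolding mixed_norm_def distrib_left[symmetric]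
    using pq by (intro Lnorm_mono mult_left_mono Lnorm_add_le lborel.sigma_finite_measure_axioms) auto
  also have "\<dots> \<le> mixed_norm T q p g + mixed_norm T q p h"
    unfolding mixed_norm_def using pq by (intro Lnorm_add_le lborel.sigma_finite_measure_axioms) auto
  finally show ?thesis .
qed

lemma continuous_dense_mixed_norm:
  fixes f :: "real \<Rightarrow> 'a::euclidean_space \<Rightarrow> real"
  assumes pq: "1 \<le> p" "1 \<le> q"
    and fm: "(\<lambda>(r, x). f r x) \<in> borel_measurable (borel \<Otimes>\<^sub>M borel)"
    and fin: "mixed_norm T q p (\<lambda>r x. ennreal \<bar>f r x\<bar>) < \<top>" and \<eta>: "0 < \<eta>"
  shows "\<exists>\<phi> B. continuous_on UNIV (\<lambda>(r, x). \<phi> r x) \<and> (\<forall>r x. \<bar>\<phi> r x\<bar> \<le> B) \<and> mixed_norm T q p (\<lambda>r x. ennreal \<bar>f r x - \<phi> r x\<bar>) \<le> \<eta>"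
proof -
  have pq0: "0 < p" "0 < q" using pq by auto
  obtain e where e: "0 < e" "ennreal e \<le> \<eta>"
  proof (cases \<eta>)
    case (real e) then show ?thesis using \<eta> that[of e] by simp
  next
    case top then show ?thesis using that[of 1] by simp
  qed
  have e2: "0 < ennreal (e / 2)" using e by simp
  have fm' [measurable]: "(\<lambda>x. f (a x) (b x)) \<in> borel_measurable N" if "a \<in> borel_measurable N" "b \<in> borel_measurable N" for a b and N :: "'z measure"
    using measurable_compose[OF measurable_Pair fm, of a N b] that by simp
  define tr where "tr j r x = (if \<bar>f r x\<bar> \<le> real j \<and> norm x \<le> real j then f r x else 0)" for j r x
  have trm: "(\<lambda>(r, x). tr j r x) \<in> borel_measurable (borel \<Otimes>\<^sub>M borel)" for j
    unfolding tr_def split_beta by measurable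
  have "(\<lambda>j. mixed_norm T q p (\<lambda>r x. ennreal \<bar>f r x - tr j r x\<bar>)) \<longlonglongrightarrow> 0"
  proof (rule mixed_norm_tendsto_0[OF pq0 _ _ _ fin])
    show "(\<lambda>(r, x). ennreal \<bar>f r x - tr j r x\<bar>) \<in> borel_measurable (borel \<Otimes>\<^sub>M borel)" for j
      unfolding tr_def split_beta by measurable
    show "(\<lambda>(r, x). ennreal \<bar>f r x\<bar>) \<in> borel_measurable (borel \<Otimes>\<^sub>M borel)" unfolding split_beta by measurable
    show "ennreal \<bar>f r x - tr j r x\<bar> \<le> ennreal \<bar>f r x\<bar>" for j r x by (auto simp: tr_def)
    show "AE z in lborel. fst z \<in> {0..T} \<longrightarrow> (\<lambda>j. ennreal \<bar>f (fst z) (snd z) - tr j (fst z) (snd z)\<bar>) \<longlonglongrightarrow> 0"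
    proof (intro AE_I2 impI tendsto_eventually)
      fix z :: "real \<times> 'a"
      obtain N where N: "max \<bar>f (fst z) (snd z)\<bar> (norm (snd z)) \<le> real N" using real_arch_simple by blast
      show "\<forall>\<^sub>F j in sequentially. ennreal \<bar>f (fst z) (snd z) - tr j (fst z) (snd z)\<bar> = 0"
        using eventually_ge_at_top[of N] by eventually_elim (use N in \<open>auto simp: tr_def\<close>)
    qed
  qed
  from order_tendstoD(2)[OF this e2]
  obtain j where j: "mixed_norm T q p (\<lambda>r x. ennreal \<bar>f r x - tr j r x\<bar>) < ennreal (e / 2)" by (auto simp: eventually_sequentially)
  define B where "B = real j"
  have "(\<lambda>(r, x). tr j r x) \<in> borel_measurable lebesgue"
    using trm[of j] unfolding borel_prod by (intro measurable_completion) simp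
  from lebesgue_measurable_imp_measurable_on_real[OF this, of UNIV]
  obtain N gn where N: "negligible N" and gc: "\<And>n. continuous_on UNIV (gn n)"
    and lim: "\<And>z. z \<notin> N \<Longrightarrow> (\<lambda>n. gn n z) \<longlonglongrightarrow> (\<lambda>(r, x). tr j r x) z"
    unfolding measurable_on_def by auto
  define cut where "cut x = max 0 (min 1 (B + 1 - norm x))" for x :: 'a
  define \<phi> where "\<phi> n r x = max (- B) (min B (gn n (r, x))) * cut x" for n r x
  have cut: "0 \<le> cut x" "cut x \<le> 1" "norm x \<le> B \<Longrightarrow> cut x = 1" "B + 1 \<le> norm x \<Longrightarrow> cut x = 0" for x
    by (auto simp: cut_def)
  have \<phi>b: "\<bar>\<phi> n r x\<bar> \<le> B" for n r x
  proof -
    have "\<bar>\<phi> n r x\<bar> \<le> \<bar>max (- B) (min B (gn n (r, x)))\<bar> * 1"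
      unfolding \<phi>_def abs_mult using cut[of x] by (intro mult_left_mono) auto
    also have "\<dots> \<le> B" by (auto simp: B_def)
    finally show ?thesis .
  qed
  have \<phi>c: "continuous_on UNIV (\<lambda>(r, x). \<phi> n r x)" for n
    unfolding \<phi>_def cut_def split_beta prod.collapse by (intro continuous_intros gc)
  have \<phi>m: "(\<lambda>(r, x). \<phi> n r x) \<in> borel_measurable (borel \<Otimes>\<^sub>M borel)" for n
    unfolding borel_prod using \<phi>c by (rule borel_measurable_continuous_onI)
  have [measurable]: "(\<lambda>z. \<phi> n (fst z) (snd z)) \<in> borel_measurable (borel \<Otimes>\<^sub>M borel)" "(\<lambda>z. tr j (fst z) (snd z)) \<in> borel_measurable (borel \<Otimes>\<^sub>M borel)" for n
    using \<phi>m[of n] trm[of j] by (simp_all add: split_beta)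
  have "(\<lambda>n. mixed_norm T q p (\<lambda>r x. ennreal \<bar>tr j r x - \<phi> n r x\<bar>)) \<longlonglongrightarrow> 0"
  proof (rule mixed_norm_tendsto_0[OF pq0 _ _ _ mixed_norm_bounded_support[OF pq0, of T "2 * B" "B + 1"]])
    show "(\<lambda>(r, x). ennreal \<bar>tr j r x - \<phi> n r x\<bar>) \<in> borel_measurable (borel \<Otimes>\<^sub>M borel)" for n
      unfolding split_beta by measurable
    have [measurable]: "cball (0::'a) (B + 1) \<in> sets borel" by simp
    show "(\<lambda>(r, x). ennreal (2 * B) * indicator (cball (0::'a) (B + 1)) x) \<in> borel_measurable (borel \<Otimes>\<^sub>M borel)"
      unfolding split_beta by measurable
    show "ennreal \<bar>tr j r x - \<phi> n r x\<bar> \<le> ennreal (2 * B) * indicator (cball 0 (B + 1)) x" for n r x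
    proof (cases "norm x \<le> B + 1")
      case True
      have "\<bar>tr j r x\<bar> \<le> B" by (auto simp: tr_def B_def)
      then show ?thesis using True \<phi>b[of n r x] by (auto intro!: ennreal_leI)
    next
      case False
      then show ?thesis using cut(4)[of x] by (auto simp: tr_def B_def \<phi>_def)
    qed
    have "N \<in> null_sets lebesgue" using N by (simp add: negligible_iff_null_sets)
    then have "AE z in lebesgue. z \<notin> N" by (rule AE_not_in)
    then have "AE z in lborel. z \<notin> N" by (simp add: AE_completion_iff)
    then show "AE z in lborel. fst z \<in> {0..T} \<longrightarrow> (\<lambda>n. ennreal \<bar>tr j (fst z) (snd z) - \<phi> n (fst z) (snd z)\<bar>) \<longlonglongrightarrow> 0"
    proof eventually_elim
      case (elim z)
      have "(\<lambda>n. gn n z) \<longlonglongrightarrow> tr j (fst z) (snd z)" using lim[OF elim] by (simp add: split_beta)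
      then have "(\<lambda>n. \<bar>tr j (fst z) (snd z) - max (- B) (min B (gn n z)) * cut (snd z)\<bar>) \<longlonglongrightarrow> \<bar>tr j (fst z) (snd z) - max (- B) (min B (tr j (fst z) (snd z))) * cut (snd z)\<bar>"
        by (intro tendsto_intros)
      also have "max (- B) (min B (tr j (fst z) (snd z))) * cut (snd z) = tr j (fst z) (snd z)"
        using cut(3)[of "snd z"] by (auto simp: tr_def B_def)
      finally have "(\<lambda>n. \<bar>tr j (fst z) (snd z) - \<phi> n (fst z) (snd z)\<bar>) \<longlonglongrightarrow> 0" by (simp add: \<phi>_def)
      from tendsto_ennrealI[OF this] show ?case by simp
    qed
  qed
  from order_tendstoD(2)[OF this e2]
  obtain n where n: "mixed_norm T q p (\<lambda>r x. ennreal \<bar>tr j r x - \<phi> n r x\<bar>) < ennreal (e / 2)" by (auto simp: eventually_sequentially)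
  have "mixed_norm T q p (\<lambda>r x. ennreal \<bar>f r x - \<phi> n r x\<bar>) \<le> mixed_norm T q p (\<lambda>r x. ennreal \<bar>f r x - tr j r x\<bar> + ennreal \<bar>tr j r x - \<phi> n r x\<bar>)"
    by (intro mixed_norm_mono pq0) (simp add: ennreal_plus[symmetric] ennreal_leI del: ennreal_plus)
  also have "\<dots> \<le> mixed_norm T q p (\<lambda>r x. ennreal \<bar>f r x - tr j r x\<bar>) + mixed_norm T q p (\<lambda>r x. ennreal \<bar>tr j r x - \<phi> n r x\<bar>)"
    by (intro mixed_norm_add_le pq; unfold split_beta; measurable)
  also have "\<dots> \<le> ennreal (e / 2) + ennreal (e / 2)" using j n by (intro add_mono) auto
  also have "\<dots> = ennreal e" using e by (simp add: ennreal_plus[symmetric] del: ennreal_plus)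
  also note e(2)
  finally show ?thesis using \<phi>c \<phi>b by blast
qed

lemma infinitely_many_indicators_suminf:
  assumes "infinite {j. z \<in> U j}"
  shows "(\<Sum>j. indicator (U j) z :: ennreal) = \<top>"
proof -
  have "of_nat k \<le> (\<Sum>j. indicator (U j) z :: ennreal)" for k
  proof -
    obtain A where A: "A \<subseteq> {j. z \<in> U j}" "finite A" "card A = k" using infinite_arbitrarily_large[OF assms] by blast
    have "of_nat k = (\<Sum>j\<in>A. indicator (U j) z :: ennreal)" using A by (simp add: subset_iff)
    also have "\<dots> \<le> (\<Sum>j. indicator (U j) z)" by (rule sum_le_suminf) (use A in auto)
    finally show ?thesis .
  qed
  then have "(SUP k. of_nat k) \<le> (\<Sum>j. indicator (U j) z :: ennreal)" by (intro SUP_least)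
  then show ?thesis by (simp add: ennreal_SUP_of_nat_eq_top top_unique)
qed

lemma null_set_open_cover:
  fixes Z :: "(real \<times> 'a::euclidean_space) set"
  assumes pq: "0 < p" "0 < q" and Z: "Z \<in> null_sets lborel" and \<eta>: "0 < \<eta>"
  shows "\<exists>U. open U \<and> Z \<inter> (UNIV \<times> ball 0 L) \<subseteq> U \<and> mixed_norm T q p (\<lambda>r x. indicator U (r, x)) \<le> \<eta>"
proof -
  have Zl: "Z \<in> null_sets lebesgue" by (rule null_sets_completionI[OF Z])
  have "\<exists>U. open U \<and> Z \<subseteq> U \<and> emeasure lborel U \<le> ennreal ((1/2) ^ n)" for n :: nat
  proof -
    obtain U where U: "open U" "Z \<subseteq> U" "emeasure lebesgue (U - Z) < ennreal ((1/2) ^ n)"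
      by (rule sets_lebesgue_outer_open[OF null_setsD2[OF Zl], of "(1/2) ^ n"]) auto
    have "emeasure lebesgue U = emeasure lebesgue (U - Z)"
      by (rule emeasure_Diff_null_set[OF Zl, symmetric]) (use U in auto)
    then show ?thesis using U by (auto intro!: exI[of _ U])
  qed
  then have "\<forall>n. \<exists>U. open U \<and> Z \<subseteq> U \<and> emeasure lborel U \<le> ennreal ((1/2) ^ n)" by blast
  from choice[OF this] obtain U where "\<forall>n. open (U n) \<and> Z \<subseteq> U n \<and> emeasure lborel (U n) \<le> ennreal ((1/2) ^ n)" by blast
  then have U: "\<And>n. open (U n)" "\<And>n. Z \<subseteq> U n" "\<And>n. emeasure lborel (U n) \<le> ennreal ((1/2) ^ n)" by blast+
  define U' where "U' n = U n \<inter> (UNIV \<times> ball 0 L)" for n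
  have oU': "open (U' n)" for n using U(1) by (auto simp: U'_def open_Times)
  have [measurable]: "U n \<in> sets borel" for n using U(1) by simp
  have "(\<lambda>n. mixed_norm T q p (\<lambda>r x. indicator (U' n) (r, x))) \<longlonglongrightarrow> 0"
  proof (rule mixed_norm_tendsto_0[OF pq _ _ _ mixed_norm_bounded_support[OF pq, of T 1 L]])
    show "(\<lambda>(r, x). indicator (U' n) (r, x) :: ennreal) \<in> borel_measurable (borel \<Otimes>\<^sub>M borel)" for n
      unfolding borel_prod split_beta prod.collapse using oU' by simp
    have [measurable]: "cball (0::'a) L \<in> sets borel" by simp
    show "(\<lambda>(r, x). ennreal 1 * indicator (cball (0::'a) L) x) \<in> borel_measurable (borel \<Otimes>\<^sub>M borel)"
      unfolding split_beta by measurable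
    show "indicator (U' n) (r, x) \<le> ennreal 1 * indicator (cball 0 L) x" for n r x
      by (auto simp: U'_def indicator_def)
    have "(\<integral>\<^sup>+z. (\<Sum>n. indicator (U n) z) \<partial>lborel) = (\<Sum>n. emeasure lborel (U n))"
      by (subst nn_integral_suminf) auto
    also have "\<dots> \<le> (\<Sum>n. ennreal ((1/2) ^ n))" by (intro suminf_le U) auto
    also have "\<dots> = ennreal 2" using suminf_geometric[of "1/2 :: real"] by (subst suminf_ennreal2) auto
    finally have "(\<integral>\<^sup>+z. (\<Sum>n. indicator (U n) z) \<partial>lborel) \<noteq> \<infinity>" by (auto simp: top_unique)
    then have "AE z in lborel. (\<Sum>n. indicator (U n) z :: ennreal) \<noteq> \<infinity>" by (intro nn_integral_PInf_AE) auto
    then show "AE z in lborel. fst z \<in> {0..T} \<longrightarrow> (\<lambda>n. indicator (U' n) (fst z, snd z) :: ennreal) \<longlonglongrightarrow> 0"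
    proof eventually_elim
      case (elim z)
      have "finite {n. z \<in> U n}"
        using infinitely_many_indicators_suminf[of z U] elim by auto
      then obtain m where m: "\<And>n. z \<in> U n \<Longrightarrow> n \<le> m" using finite_nat_set_iff_bounded_le by auto
      have "\<forall>\<^sub>F n in sequentially. indicator (U' n) (fst z, snd z) = (0 :: ennreal)"
        using eventually_gt_at_top[of m] by eventually_elim (auto simp: U'_def indicator_def dest!: m)
      then show ?case by (auto intro: tendsto_eventually)
    qed
  qed
  from order_tendstoD(2)[OF this \<eta>] obtain n where "mixed_norm T q p (\<lambda>r x. indicator (U' n) (r, x)) < \<eta>"
    by (auto simp: eventually_sequentially)
  moreover have "Z \<inter> (UNIV \<times> ball 0 L) \<subseteq> U' n" using U(2) by (auto simp: U'_def)
  ultimately show ?thesis using oU' by (intro exI[of _ "U' n"]) auto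
qed

lemma telescoping_tail_bound:
  fixes a :: real
  assumes "(\<Sum>j. ennreal \<bar>a - \<phi> j\<bar>) < \<top>"
  shows "ennreal \<bar>a - \<phi> k\<bar> \<le> (\<Sum>j. ennreal \<bar>\<phi> (Suc (j + k)) - \<phi> (j + k)\<bar>)"
proof (cases "(\<Sum>j. ennreal \<bar>\<phi> (Suc (j + k)) - \<phi> (j + k)\<bar>) = \<top>")
  case False
  have "summable (\<lambda>j. \<bar>a - \<phi> j\<bar>)" using assms by (intro summable_suminf_not_top) auto
  then have "(\<lambda>j. a - \<phi> j) \<longlonglongrightarrow> 0" by (rule tendsto_rabs_zero_cancel[OF summable_LIMSEQ_zero])
  from tendsto_diff[OF tendsto_const[of a] this] have "\<phi> \<longlonglongrightarrow> a" by simp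
  then have "(\<lambda>j. \<phi> (j + k)) \<longlonglongrightarrow> a" by (rule LIMSEQ_ignore_initial_segment)
  from telescope_sums[OF this] have 1: "(\<lambda>j. \<phi> (Suc (j + k)) - \<phi> (j + k)) sums (a - \<phi> k)" by simp
  have 2: "summable (\<lambda>j. \<bar>\<phi> (Suc (j + k)) - \<phi> (j + k)\<bar>)" using False by (intro summable_suminf_not_top) auto
  have "\<bar>a - \<phi> k\<bar> \<le> (\<Sum>j. \<bar>\<phi> (Suc (j + k)) - \<phi> (j + k)\<bar>)"
    using summable_rabs[OF 2] sums_unique[OF 1] by simp
  then have "ennreal \<bar>a - \<phi> k\<bar> \<le> ennreal (\<Sum>j. \<bar>\<phi> (Suc (j + k)) - \<phi> (j + k)\<bar>)" by (rule ennreal_leI)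
  also have "\<dots> = (\<Sum>j. ennreal \<bar>\<phi> (Suc (j + k)) - \<phi> (j + k)\<bar>)" using 2 by (intro suminf_ennreal2[symmetric]) auto
  finally show ?thesis .
next
  case True
  show ?thesis unfolding True by (rule top_greatest)
qed

context modified_brownian_motion
begin

lemma tame_SUP:
  fixes g :: "nat \<Rightarrow> real \<Rightarrow> 'a \<Rightarrow> ennreal"
  assumes pq: "0 < p" "0 < q" and gm: "\<And>n. (\<lambda>(r, x). g n r x) \<in> borel_measurable (borel \<Otimes>\<^sub>M borel)"
    and inc: "\<And>r x. incseq (\<lambda>n. g n r x)" and tame: "\<And>n. tame p q T R C (g n)"
  shows "tame p q T R C (\<lambda>r x. SUP n. g n r x)"
proof -
  let ?I = "\<lambda>h \<omega> \<psi>. \<integral>\<^sup>+r. indicator {0..T} r * h r (V r \<omega> + \<psi> r) \<partial>lborel"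
  from tame have "\<forall>n. \<exists>Y. Y \<in> borel_measurable M \<and> (\<integral>\<^sup>+\<omega>. Y \<omega> \<partial>M) \<le> ennreal C * mixed_norm T q p (g n) \<and>
     (AE \<omega> in M. \<forall>\<psi> v. admissible T R \<psi> v \<longrightarrow> ?I (g n) \<omega> \<psi> \<le> Y \<omega> * ennreal (1 + v))"
    unfolding tame_def by blast
  from choice[OF this] obtain Y where Ym [measurable]: "\<And>n. Y n \<in> borel_measurable M"
    and YE: "\<And>n. (\<integral>\<^sup>+\<omega>. Y n \<omega> \<partial>M) \<le> ennreal C * mixed_norm T q p (g n)"
    and Yb: "\<And>n. AE \<omega> in M. \<forall>\<psi> v. admissible T R \<psi> v \<longrightarrow> ?I (g n) \<omega> \<psi> \<le> Y n \<omega> * ennreal (1 + v)"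
    by blast
  define Y' where "Y' \<omega> = liminf (\<lambda>n. Y n \<omega>)" for \<omega>
  show ?thesis unfolding tame_def
  proof (intro bexI[of _ Y'] conjI)
    show "Y' \<in> borel_measurable M" unfolding Y'_def[abs_def] by measurable
    have "(\<integral>\<^sup>+\<omega>. Y' \<omega> \<partial>M) \<le> liminf (\<lambda>n. \<integral>\<^sup>+\<omega>. Y n \<omega> \<partial>M)"
      unfolding Y'_def by (rule nn_integral_liminf) measurable
    also have "\<dots> \<le> liminf (\<lambda>n::nat. ennreal C * mixed_norm T q p (\<lambda>r x. SUP n. g n r x))"
    proof (rule Liminf_mono, rule always_eventually, rule allI)
      fix n
      have "mixed_norm T q p (g n) \<le> mixed_norm T q p (\<lambda>r x. SUP n. g n r x)"
        by (rule mixed_norm_mono[OF pq]) (rule SUP_upper, simp)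
      then have "ennreal C * mixed_norm T q p (g n) \<le> ennreal C * mixed_norm T q p (\<lambda>r x. SUP n. g n r x)"
        by (rule mult_left_mono) simp
      with YE[of n] show "(\<integral>\<^sup>+\<omega>. Y n \<omega> \<partial>M) \<le> ennreal C * mixed_norm T q p (\<lambda>r x. SUP n. g n r x)"
        by (rule order_trans)
    qed
    also have "\<dots> = ennreal C * mixed_norm T q p (\<lambda>r x. SUP n. g n r x)" by (intro Liminf_const) simp
    finally show "(\<integral>\<^sup>+\<omega>. Y' \<omega> \<partial>M) \<le> ennreal C * mixed_norm T q p (\<lambda>r x. SUP n. g n r x)" .
    from Yb have "AE \<omega> in M. \<forall>n. \<forall>\<psi> v. admissible T R \<psi> v \<longrightarrow> ?I (g n) \<omega> \<psi> \<le> Y n \<omega> * ennreal (1 + v)"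
      unfolding AE_all_countable by blast
    then show "AE \<omega> in M. \<forall>\<psi> v. admissible T R \<psi> v \<longrightarrow> ?I (\<lambda>r x. SUP n. g n r x) \<omega> \<psi> \<le> Y' \<omega> * ennreal (1 + v)"
    proof (eventually_elim, intro allI impI)
      fix \<omega> and \<psi> :: "real \<Rightarrow> 'a" and v
      assume H: "\<forall>n. \<forall>\<psi> v. admissible T R \<psi> v \<longrightarrow> ?I (g n) \<omega> \<psi> \<le> Y n \<omega> * ennreal (1 + v)" and \<psi>: "admissible T R \<psi> v"
      have fin: "variation \<psi> 0 T < \<top>" and v: "0 \<le> v" using \<psi> by (auto simp: admissible_def intro: le_less_trans)
      have cc: "ennreal (1 / (1 + v)) * ennreal (1 + v) = 1" using v by (simp add: ennreal_mult[symmetric] del: ennreal_plus)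
      then have cc': "ennreal (1 + v) * ennreal (1 / (1 + v)) = 1" by (simp only: mult.commute)
      have I: "?I (\<lambda>r x. SUP n. g n r x) \<omega> \<psi> = (SUP n. ?I (g n) \<omega> \<psi>)"
      proof -
        have "?I (\<lambda>r x. SUP n. g n r x) \<omega> \<psi> = (\<integral>\<^sup>+r. (SUP n. indicator {0..T} r * g n r (V r \<omega> + \<psi> r)) \<partial>lborel)"
          by (simp add: SUP_mult_left_ennreal)
        also have "\<dots> = (SUP n. ?I (g n) \<omega> \<psi>)"
        proof (rule nn_integral_monotone_convergence_SUP)
          show "incseq (\<lambda>n r. indicator {0..T} r * g n r (V r \<omega> + \<psi> r))"
            using inc by (auto simp: incseq_def le_fun_def intro!: mult_left_mono)
          show "(\<lambda>r. indicator {0..T} r * g n r (V r \<omega> + \<psi> r)) \<in> borel_measurable lborel" for n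
            using path_measurable_ennreal[OF gm V_continuous fin] by simp
        qed
        finally show ?thesis .
      qed
      have Iinc: "?I (g n) \<omega> \<psi> \<le> ?I (g k) \<omega> \<psi>" if "n \<le> k" for n k
        using incseqD[OF inc that] by (intro nn_integral_mono mult_left_mono) auto
      have "?I (g n) \<omega> \<psi> * ennreal (1 / (1 + v)) \<le> Y' \<omega>" for n
        unfolding Y'_def
      proof (rule Liminf_bounded)
        show "\<forall>\<^sub>F k in sequentially. ?I (g n) \<omega> \<psi> * ennreal (1 / (1 + v)) \<le> Y k \<omega>"
          using eventually_ge_at_top[of n]
        proof eventually_elim
          case (elim k)
          have "?I (g n) \<omega> \<psi> \<le> Y k \<omega> * ennreal (1 + v)"
            using Iinc[OF elim] H \<psi> by (blast intro: order_trans)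
          then have "?I (g n) \<omega> \<psi> * ennreal (1 / (1 + v)) \<le> (Y k \<omega> * ennreal (1 + v)) * ennreal (1 / (1 + v))"
            by (rule mult_right_mono) simp
          also have "\<dots> = Y k \<omega>" by (simp only: mult.assoc cc' mult_1_right)
          finally show ?case .
        qed
      qed
      then have "(SUP n. ?I (g n) \<omega> \<psi>) * ennreal (1 / (1 + v)) \<le> Y' \<omega>"
        unfolding SUP_mult_right_ennreal by (intro SUP_least)
      then have "(SUP n. ?I (g n) \<omega> \<psi>) * ennreal (1 / (1 + v)) * ennreal (1 + v) \<le> Y' \<omega> * ennreal (1 + v)"
        by (rule mult_right_mono) simp
      then show "?I (\<lambda>r x. SUP n. g n r x) \<omega> \<psi> \<le> Y' \<omega> * ennreal (1 + v)"
        unfolding I by (simp only: mult.assoc cc mult_1_right)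
    qed
  qed
qed

lemma tame_open:
  fixes U :: "(real \<times> 'a) set"
  assumes pq: "0 < p" "0 < q" and U: "open U"
    and C: "\<And>g B. continuous_on UNIV (\<lambda>(r, x). g r x) \<Longrightarrow> (\<forall>r x. \<bar>g r x\<bar> \<le> B) \<Longrightarrow> (\<forall>r x. 0 \<le> g r x) \<Longrightarrow>
      tame p q T R C (\<lambda>r x. ennreal (g r x))"
  shows "tame p q T R C (\<lambda>r x. indicator U (r, x))"
proof (cases "U = UNIV")
  case True
  have "tame p q T R C (\<lambda>r x. ennreal 1)" by (rule C[of "\<lambda>_ _. 1" 1]) (simp_all add: case_prod_unfold)
  then show ?thesis by (simp add: True)
next
  case False
  define g where "g n r x = min 1 (real n * infdist (r, x) (- U))" for n r and x :: 'a
  have gc: "continuous_on UNIV (\<lambda>(r, x). g n r x)" for n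
    unfolding g_def case_prod_unfold prod.collapse
    by (intro continuous_on_min continuous_on_mult continuous_on_const continuous_on_infdist continuous_on_id)
  have g01: "0 \<le> g n r x" "g n r x \<le> 1" for n r x unfolding g_def by (simp_all add: infdist_nonneg)
  have sup: "(SUP n. ennreal (g n r x)) = indicator U (r, x)" for r x
  proof (cases "(r, x) \<in> U")
    case True
    have "closed (- U)" "- U \<noteq> {}" using U False by (blast intro: closed_Compl)+
    from in_closed_iff_infdist_zero[OF this, of "(r, x)"] True
    have "infdist (r, x) (- U) \<noteq> 0" by simp
    then have d: "0 < infdist (r, x) (- U)" using infdist_nonneg[of "(r, x)" "- U"] by simp
    obtain n where "1 \<le> real n * infdist (r, x) (- U)"
      using reals_Archimedean3[OF d, rule_format, of 1] by (meson less_imp_le)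
    then have "1 \<le> (SUP n. ennreal (g n r x))" by (intro SUP_upper2[of n]) (simp_all add: g_def)
    moreover have "(SUP n. ennreal (g n r x)) \<le> 1" using g01 by (intro SUP_least) (simp add: ennreal_le_1)
    ultimately have "(SUP n. ennreal (g n r x)) = 1" by (rule antisym[rotated])
    then show ?thesis using True by simp
  next
    case False
    then have "infdist (r, x) (- U) = 0" by simp
    then show ?thesis using False by (simp add: g_def)
  qed
  have "tame p q T R C (\<lambda>r x. SUP n. ennreal (g n r x))"
  proof (rule tame_SUP[OF pq])
    show "(\<lambda>(r, x). ennreal (g n r x)) \<in> borel_measurable (borel \<Otimes>\<^sub>M borel)" for n
      using borel_measurable_continuous_onI[OF gc[of n]] unfolding borel_prod case_prod_unfold by measurable
    show "incseq (\<lambda>n. ennreal (g n r x))" for r x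
    proof (rule incseq_SucI, rule ennreal_leI)
      fix n
      have "real n * infdist (r, x) (- U) \<le> real (Suc n) * infdist (r, x) (- U)"
        by (intro mult_right_mono) (auto simp: infdist_nonneg)
      then show "g n r x \<le> g (Suc n) r x" unfolding g_def by linarith
    qed
    show "tame p q T R C (\<lambda>r x. ennreal (g n r x))" for n
      by (rule C[OF gc[of n], of 1]) (use g01 in auto)
  qed
  then show ?thesis by (simp only: sup)
qed

lemma tame_null_cover:
  fixes f :: "real \<Rightarrow> 'a \<Rightarrow> real"
  assumes p: "2 < p" and q: "2 < q" and pq: "2 / q + real DIM('a) / p < 1" and T: "0 < T" and R: "0 < R"
    and fm: "(\<lambda>(r, x). f r x) \<in> borel_measurable (borel \<Otimes>\<^sub>M borel)" and fin: "mixed_norm T q p (\<lambda>r x. ennreal \<bar>f r x\<bar>) < \<top>"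
  obtains C \<phi> U where "\<And>k. continuous_on UNIV (\<lambda>(r, x). \<phi> k r x)" and "\<And>k. \<exists>B. \<forall>r x. \<bar>\<phi> k r x\<bar> \<le> B"
    and "\<And>j. open (U j)"
    and "\<And>j. tame p q T R C (\<lambda>r x. ennreal \<bar>\<phi> (Suc j) r x - \<phi> j r x\<bar>)" and "\<And>j. tame p q T R C (\<lambda>r x. indicator (U j) (r, x))"
    and "\<And>j. mixed_norm T q p (\<lambda>r x. ennreal \<bar>\<phi> (Suc j) r x - \<phi> j r x\<bar>) \<le> ennreal (2 * (1/2) ^ j)"
    and "\<And>j. mixed_norm T q p (\<lambda>r x. indicator (U j) (r, x)) \<le> ennreal ((1/2) ^ j)"
    and "\<And>k r x. r \<in> {0..T} \<Longrightarrow> ennreal \<bar>f r x - \<phi> k r x\<bar> \<le>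
      (\<Sum>j. ennreal \<bar>\<phi> (Suc (j + k)) r x - \<phi> (j + k) r x\<bar> + indicator (U (j + k)) (r, x))"
proof -
  have pq1: "1 \<le> p" "1 \<le> q" "0 < p" "0 < q" using p q by auto
  obtain C where C: "\<And>(g :: real \<Rightarrow> 'a \<Rightarrow> real) B. continuous_on UNIV (\<lambda>(r, x). g r x) \<Longrightarrow> (\<forall>r x. \<bar>g r x\<bar> \<le> B) \<Longrightarrow> (\<forall>r x. 0 \<le> g r x) \<Longrightarrow>
    tame p q T R C (\<lambda>r x. ennreal (g r x))"
    using tame_continuous[OF p q pq T R] by blast
  have "\<forall>k. \<exists>\<phi> B. continuous_on UNIV (\<lambda>(r, x). \<phi> r x) \<and> (\<forall>r x. \<bar>\<phi> r x\<bar> \<le> B) \<and> mixed_norm T q p (\<lambda>r x. ennreal \<bar>f r x - \<phi> r x\<bar>) \<le> ennreal ((1/2) ^ k)"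
    by (intro allI continuous_dense_mixed_norm[OF pq1(1,2) fm fin]) simp
  from choice[OF this] obtain \<phi> :: "nat \<Rightarrow> real \<Rightarrow> 'a \<Rightarrow> real" where
    "\<forall>k. \<exists>B. continuous_on UNIV (\<lambda>(r, x). \<phi> k r x) \<and> (\<forall>r x. \<bar>\<phi> k r x\<bar> \<le> B) \<and> mixed_norm T q p (\<lambda>r x. ennreal \<bar>f r x - \<phi> k r x\<bar>) \<le> ennreal ((1/2) ^ k)" by blast
  then have \<phi>c: "\<And>k. continuous_on UNIV (\<lambda>(r, x). \<phi> k r x)" and \<phi>b: "\<And>k. \<exists>B. \<forall>r x. \<bar>\<phi> k r x\<bar> \<le> B"
    and \<phi>n: "\<And>k. mixed_norm T q p (\<lambda>r x. ennreal \<bar>f r x - \<phi> k r x\<bar>) \<le> ennreal ((1/2) ^ k)" by blast+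
  have \<phi>m: "(\<lambda>(r, x). \<phi> k r x) \<in> borel_measurable (borel \<Otimes>\<^sub>M borel)" for k
    unfolding borel_prod using \<phi>c by (rule borel_measurable_continuous_onI)
  have [measurable]: "(\<lambda>z. f (fst z) (snd z)) \<in> borel_measurable (borel \<Otimes>\<^sub>M borel)" "(\<lambda>z. \<phi> k (fst z) (snd z)) \<in> borel_measurable (borel \<Otimes>\<^sub>M borel)" for k
    using fm \<phi>m[of k] by (simp_all add: case_prod_unfold)
  have hm: "(\<lambda>(r, x). ennreal \<bar>f r x - \<phi> k r x\<bar>) \<in> borel_measurable (borel \<Otimes>\<^sub>M borel)" for k
    unfolding case_prod_unfold by measurable
  define H where "H r x = (\<Sum>k. ennreal \<bar>f r x - \<phi> k r x\<bar>)" for r x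
  have Hm: "(\<lambda>(r, x). H r x) \<in> borel_measurable (borel \<Otimes>\<^sub>M borel)"
    unfolding H_def case_prod_unfold by measurable
  have "mixed_norm T q p H \<le> (\<Sum>k. mixed_norm T q p (\<lambda>r x. ennreal \<bar>f r x - \<phi> k r x\<bar>))"
    unfolding H_def[abs_def] by (rule mixed_norm_suminf_le[OF pq1(1,2) hm])
  also have "\<dots> \<le> (\<Sum>k. ennreal ((1/2) ^ k))" by (intro suminf_le \<phi>n) auto
  also have "\<dots> = ennreal 2" using suminf_geometric[of "1/2 :: real"] by (subst suminf_ennreal2) auto
  finally have Hfin: "mixed_norm T q p H < \<top>" by (rule le_less_trans) simp
  define Z where "Z = {z. fst z \<in> {0..T} \<and> H (fst z) (snd z) = \<top>}"
  have Zs: "Z \<in> sets lborel"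
  proof -
    have [measurable]: "(\<lambda>z. H (fst z) (snd z)) \<in> borel_measurable (borel \<Otimes>\<^sub>M borel)" using Hm by (simp add: case_prod_unfold)
    have "{z \<in> space (borel \<Otimes>\<^sub>M borel). fst z \<in> {0..T} \<and> H (fst z) (snd z) = \<top>} \<in> sets (borel \<Otimes>\<^sub>M borel)" by measurable
    then show ?thesis unfolding Z_def borel_prod by simp
  qed
  have "AE z in lborel. z \<notin> Z"
    using mixed_norm_finite_AE[OF Hm Hfin] by eventually_elim (auto simp: Z_def)
  then have Zn: "Z \<in> null_sets lborel" using Zs AE_iff_null_sets[of Z lborel] by simp
  have "\<forall>j. \<exists>U. open U \<and> Z \<inter> (UNIV \<times> ball 0 (real j)) \<subseteq> U \<and> mixed_norm T q p (\<lambda>r x. indicator U (r, x)) \<le> ennreal ((1/2) ^ j)"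
    by (intro allI null_set_open_cover[OF pq1(3,4) Zn]) simp
  from choice[OF this] obtain U where "\<forall>j. open (U j) \<and> Z \<inter> (UNIV \<times> ball 0 (real j)) \<subseteq> U j \<and> mixed_norm T q p (\<lambda>r x. indicator (U j) (r, x)) \<le> ennreal ((1/2) ^ j)" by blast
  then have Uo: "\<And>j. open (U j)" and UZ: "\<And>j. Z \<inter> (UNIV \<times> ball 0 (real j)) \<subseteq> U j"
    and Un: "\<And>j. mixed_norm T q p (\<lambda>r x. indicator (U j) (r, x)) \<le> ennreal ((1/2) ^ j)" by blast+
  have diff_tame: "tame p q T R C (\<lambda>r x. ennreal \<bar>\<phi> (Suc j) r x - \<phi> j r x\<bar>)" for j
  proof -
    obtain B where B: "\<And>r x. \<bar>\<phi> (Suc j) r x\<bar> \<le> B" using \<phi>b by blast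
    obtain B' where B': "\<And>r x. \<bar>\<phi> j r x\<bar> \<le> B'" using \<phi>b by blast
    show ?thesis
    proof (rule C[of "\<lambda>r x. \<bar>\<phi> (Suc j) r x - \<phi> j r x\<bar>" "B + B'"])
      show "continuous_on UNIV (\<lambda>(r, x). \<bar>\<phi> (Suc j) r x - \<phi> j r x\<bar>)"
        using \<phi>c[of "Suc j"] \<phi>c[of j] unfolding case_prod_unfold by (intro continuous_on_rabs continuous_on_diff)
      show "\<forall>r x. \<bar>\<bar>\<phi> (Suc j) r x - \<phi> j r x\<bar>\<bar> \<le> B + B'"
      proof (intro allI)
        fix r x show "\<bar>\<bar>\<phi> (Suc j) r x - \<phi> j r x\<bar>\<bar> \<le> B + B'" using B[of r x] B'[of r x] by linarith
      qed
    qed simp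
  qed
  have diff_norm: "mixed_norm T q p (\<lambda>r x. ennreal \<bar>\<phi> (Suc j) r x - \<phi> j r x\<bar>) \<le> ennreal (2 * (1/2) ^ j)" for j
  proof -
    have "mixed_norm T q p (\<lambda>r x. ennreal \<bar>\<phi> (Suc j) r x - \<phi> j r x\<bar>) \<le> mixed_norm T q p (\<lambda>r x. ennreal \<bar>f r x - \<phi> (Suc j) r x\<bar> + ennreal \<bar>f r x - \<phi> j r x\<bar>)"
      by (intro mixed_norm_mono pq1) (simp add: ennreal_plus[symmetric] ennreal_leI del: ennreal_plus)
    also have "\<dots> \<le> mixed_norm T q p (\<lambda>r x. ennreal \<bar>f r x - \<phi> (Suc j) r x\<bar>) + mixed_norm T q p (\<lambda>r x. ennreal \<bar>f r x - \<phi> j r x\<bar>)"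
      by (rule mixed_norm_add_le[OF pq1(1,2) hm hm])
    also have "\<dots> \<le> ennreal ((1/2) ^ Suc j) + ennreal ((1/2) ^ j)" by (intro add_mono \<phi>n)
    also have "\<dots> = ennreal ((1/2) ^ Suc j + (1/2) ^ j)" by (rule ennreal_plus[symmetric]) auto
    also have "\<dots> \<le> ennreal (2 * (1/2) ^ j)" by (rule ennreal_leI) simp
    finally show ?thesis .
  qed
  have U_tame: "tame p q T R C (\<lambda>r x. indicator (U j) (r, x))" for j
    by (rule tame_open[OF pq1(3,4) Uo C])
  have pointwise: "ennreal \<bar>f r x - \<phi> k r x\<bar> \<le> (\<Sum>j. ennreal \<bar>\<phi> (Suc (j + k)) r x - \<phi> (j + k) r x\<bar> + indicator (U (j + k)) (r, x))"
    if r: "r \<in> {0..T}" for k r x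
  proof (cases "(r, x) \<in> Z")
    case True
    obtain N where N: "norm x < real N" using reals_Archimedean2 by blast
    have "(r, x) \<in> U (j + k)" if "N \<le> j" for j
      using UZ[of "j + k"] True N that by (auto simp: subset_iff)
    then have "{N..} \<subseteq> {j. (r, x) \<in> U (j + k)}" by auto
    then have "infinite {j. (r, x) \<in> U (j + k)}" using infinite_Ici by (rule infinite_super)
    then have "(\<Sum>j. indicator (U (j + k)) (r, x) :: ennreal) = \<top>"
      by (rule infinitely_many_indicators_suminf)
    moreover have "(\<Sum>j. indicator (U (j + k)) (r, x) :: ennreal) \<le> (\<Sum>j. ennreal \<bar>\<phi> (Suc (j + k)) r x - \<phi> (j + k) r x\<bar> + indicator (U (j + k)) (r, x))"
      by (intro suminf_le) auto
    ultimately show ?thesis by (simp add: top_unique)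
  next
    case False
    then have "H r x \<noteq> \<top>" using r by (simp add: Z_def)
    then have "(\<Sum>j. ennreal \<bar>f r x - \<phi> j r x\<bar>) < \<top>" unfolding H_def top.not_eq_extremum .
    from telescoping_tail_bound[OF this, of k]
    show ?thesis by (rule order_trans) (intro suminf_le; simp)
  qed
  show thesis
    by (rule that[OF \<phi>c \<phi>b Uo diff_tame U_tame diff_norm Un pointwise])
qed

lemma good_path_AE:
  fixes f :: "real \<Rightarrow> 'a \<Rightarrow> real"
  assumes p: "2 < p" and q: "2 < q" and pq: "2 / q + real DIM('a) / p < 1" and T: "0 < T" and R: "0 < R"
    and fm: "(\<lambda>(r, x). f r x) \<in> borel_measurable (borel \<Otimes>\<^sub>M borel)" and fin: "mixed_norm T q p (\<lambda>r x. ennreal \<bar>f r x\<bar>) < \<top>"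
  shows "AE \<omega> in M. \<exists>fk c. good_path T R (\<lambda>r. V r \<omega>) f fk c"
proof -
  obtain C \<phi> U where \<phi>c: "\<And>k. continuous_on UNIV (\<lambda>(r, x). \<phi> k r x)" and \<phi>b: "\<And>k. \<exists>B. \<forall>r x. \<bar>\<phi> k r x\<bar> \<le> B"
    and Uo: "\<And>j. open (U j)"
    and t1: "\<And>j. tame p q T R C (\<lambda>r x. ennreal \<bar>\<phi> (Suc j) r x - \<phi> j r x\<bar>)" and t2: "\<And>j. tame p q T R C (\<lambda>r x. indicator (U j) (r, x))"
    and n1: "\<And>j. mixed_norm T q p (\<lambda>r x. ennreal \<bar>\<phi> (Suc j) r x - \<phi> j r x\<bar>) \<le> ennreal (2 * (1/2) ^ j)"
    and n2: "\<And>j. mixed_norm T q p (\<lambda>r x. indicator (U j) (r, x)) \<le> ennreal ((1/2) ^ j)"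
    and pw: "\<And>k r x. r \<in> {0..T} \<Longrightarrow> ennreal \<bar>f r x - \<phi> k r x\<bar> \<le>
      (\<Sum>j. ennreal \<bar>\<phi> (Suc (j + k)) r x - \<phi> (j + k) r x\<bar> + indicator (U (j + k)) (r, x))"
    by (rule tame_null_cover[OF assms]) (rule that)
  let ?I = "\<lambda>h \<omega> \<psi>. \<integral>\<^sup>+r. indicator {0..T} r * h r (V r \<omega> + \<psi> r) \<partial>lborel"
  define g where "g j r x = ennreal \<bar>\<phi> (Suc j) r x - \<phi> j r x\<bar>" for j r x
  define u :: "nat \<Rightarrow> real \<Rightarrow> 'a \<Rightarrow> ennreal" where "u j r x = indicator (U j) (r, x)" for j r x
  note t1 = t1[folded g_def] and n1 = n1[folded g_def] and t2 = t2[folded u_def] and n2 = n2[folded u_def]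
    and pw = pw[folded g_def u_def]
  have \<phi>m: "(\<lambda>(r, x). \<phi> k r x) \<in> borel_measurable (borel \<Otimes>\<^sub>M borel)" for k
    unfolding borel_prod using \<phi>c by (rule borel_measurable_continuous_onI)
  have [measurable]: "(\<lambda>z. \<phi> k (fst z) (snd z)) \<in> borel_measurable (borel \<Otimes>\<^sub>M borel)" for k
    using \<phi>m[of k] by (simp add: case_prod_unfold)
  have gm: "(\<lambda>(r, x). g j r x) \<in> borel_measurable (borel \<Otimes>\<^sub>M borel)" for j
    unfolding g_def case_prod_unfold by measurable
  have um: "(\<lambda>(r, x). u j r x) \<in> borel_measurable (borel \<Otimes>\<^sub>M borel)" for j
    unfolding u_def case_prod_unfold prod.collapse borel_prod using Uo[of j] by (intro borel_measurable_indicator) simp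
  have "\<forall>j. \<exists>Y. Y \<in> borel_measurable M \<and> (\<integral>\<^sup>+\<omega>. Y \<omega> \<partial>M) \<le> ennreal C * mixed_norm T q p (g j) \<and>
     (AE \<omega> in M. \<forall>\<psi> v. admissible T R \<psi> v \<longrightarrow> ?I (g j) \<omega> \<psi> \<le> Y \<omega> * ennreal (1 + v))"
    using t1 unfolding tame_def by blast
  from choice[OF this] obtain Y where Ym [measurable]: "\<And>n. Y n \<in> borel_measurable M"
    and YE: "\<And>n. (\<integral>\<^sup>+\<omega>. Y n \<omega> \<partial>M) \<le> ennreal C * mixed_norm T q p (g n)"
    and Yb: "\<And>n. AE \<omega> in M. \<forall>\<psi> v. admissible T R \<psi> v \<longrightarrow> ?I (g n) \<omega> \<psi> \<le> Y n \<omega> * ennreal (1 + v)" by blast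
  have "\<forall>j. \<exists>Y. Y \<in> borel_measurable M \<and> (\<integral>\<^sup>+\<omega>. Y \<omega> \<partial>M) \<le> ennreal C * mixed_norm T q p (u j) \<and>
     (AE \<omega> in M. \<forall>\<psi> v. admissible T R \<psi> v \<longrightarrow> ?I (u j) \<omega> \<psi> \<le> Y \<omega> * ennreal (1 + v))"
    using t2 unfolding tame_def by blast
  from choice[OF this] obtain X where Xm [measurable]: "\<And>n. X n \<in> borel_measurable M"
    and XE: "\<And>n. (\<integral>\<^sup>+\<omega>. X n \<omega> \<partial>M) \<le> ennreal C * mixed_norm T q p (u n)"
    and Xb: "\<And>n. AE \<omega> in M. \<forall>\<psi> v. admissible T R \<psi> v \<longrightarrow> ?I (u n) \<omega> \<psi> \<le> X n \<omega> * ennreal (1 + v)" by blast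
  have "(\<integral>\<^sup>+\<omega>. (\<Sum>j. Y j \<omega> + X j \<omega>) \<partial>M) = (\<Sum>j. (\<integral>\<^sup>+\<omega>. Y j \<omega> \<partial>M) + (\<integral>\<^sup>+\<omega>. X j \<omega> \<partial>M))"
    by (subst nn_integral_suminf) (auto simp: nn_integral_add)
  also have "\<dots> \<le> (\<Sum>j. ennreal C * ennreal (3 * (1/2) ^ j))"
  proof (rule suminf_le[rotated 1])
    fix j
    have "(\<integral>\<^sup>+\<omega>. Y j \<omega> \<partial>M) + (\<integral>\<^sup>+\<omega>. X j \<omega> \<partial>M) \<le> ennreal C * ennreal (2 * (1/2) ^ j) + ennreal C * ennreal ((1/2) ^ j)"
      by (rule add_mono; rule order_trans[OF YE mult_left_mono[OF n1]] order_trans[OF XE mult_left_mono[OF n2]]; simp)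
    also have "\<dots> = ennreal C * ennreal (3 * (1/2) ^ j)"
      unfolding distrib_left[symmetric] by (subst ennreal_plus[symmetric]) auto
    finally show "(\<integral>\<^sup>+\<omega>. Y j \<omega> \<partial>M) + (\<integral>\<^sup>+\<omega>. X j \<omega> \<partial>M) \<le> ennreal C * ennreal (3 * (1/2) ^ j)" .
  qed auto
  also have "\<dots> = ennreal C * ennreal 6"
  proof -
    have "(\<Sum>j. ennreal (3 * (1/2) ^ j)) = ennreal 6"
      using suminf_geometric[of "1/2 :: real"] by (subst suminf_ennreal2) (auto simp: suminf_mult)
    then show ?thesis by simp
  qed
  finally have "(\<integral>\<^sup>+\<omega>. (\<Sum>j. Y j \<omega> + X j \<omega>) \<partial>M) \<noteq> \<infinity>" by (auto simp: ennreal_mult_eq_top_iff top_unique)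
  then have "AE \<omega> in M. (\<Sum>j. Y j \<omega> + X j \<omega>) \<noteq> \<infinity>" by (intro nn_integral_PInf_AE) auto
  moreover have "AE \<omega> in M. \<forall>n. \<forall>\<psi> v. admissible T R \<psi> v \<longrightarrow> ?I (g n) \<omega> \<psi> \<le> Y n \<omega> * ennreal (1 + v)"
    unfolding AE_all_countable using Yb by blast
  moreover have "AE \<omega> in M. \<forall>n. \<forall>\<psi> v. admissible T R \<psi> v \<longrightarrow> ?I (u n) \<omega> \<psi> \<le> X n \<omega> * ennreal (1 + v)"
    unfolding AE_all_countable using Xb by blast
  ultimately show ?thesis
  proof eventually_elim
    case (elim \<omega>)
    have fin1: "Y j \<omega> + X j \<omega> < \<top>" for j
    proof -
      have "Y j \<omega> + X j \<omega> \<le> (\<Sum>j. Y j \<omega> + X j \<omega>)"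
        using sum_le_suminf[of "\<lambda>j. Y j \<omega> + X j \<omega>" "{j}"] by simp
      also have "\<dots> < \<top>" using elim(1) unfolding infinity_ennreal_def top.not_eq_extremum .
      finally show ?thesis .
    qed
    define y where "y j = enn2real (Y j \<omega> + X j \<omega>)" for j
    have y: "ennreal (y j) = Y j \<omega> + X j \<omega>" "0 \<le> y j" for j using fin1[of j] by (auto simp: y_def)
    have sy: "summable y" using elim(1) y by (intro summable_suminf_not_top) auto
    define c where "c k = (\<Sum>j. y (j + k))" for k
    have syk: "summable (\<lambda>j. y (j + k))" for k using sy by (simp add: summable_iff_shift)
    have "(\<lambda>k. suminf y - (\<Sum>j<k. y j)) \<longlonglongrightarrow> suminf y - suminf y"
      by (intro tendsto_diff tendsto_const summable_LIMSEQ sy)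
    moreover have "c = (\<lambda>k. suminf y - (\<Sum>j<k. y j))"
    proof
      fix k show "c k = suminf y - (\<Sum>j<k. y j)"
        unfolding c_def suminf_split_initial_segment[OF sy, of k] by simp
    qed
    ultimately have c: "c \<longlonglongrightarrow> 0" by simp
    have "good_path T R (\<lambda>r. V r \<omega>) f \<phi> c"
    proof
      show "0 \<le> c k" for k unfolding c_def by (intro suminf_nonneg syk y)
      fix \<psi> :: "real \<Rightarrow> 'a" and v k assume \<psi>: "\<psi> ` {0..T} \<subseteq> cball 0 R" "variation \<psi> 0 T \<le> ennreal v" "0 \<le> v"
      then have ad: "admissible T R \<psi> v" by (simp add: admissible_def)
      have fin: "variation \<psi> 0 T < \<top>" using \<psi>(2) by (auto intro: le_less_trans)
      note pm [measurable] = path_measurable_ennreal[OF gm V_continuous fin] path_measurable_ennreal[OF um V_continuous fin]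
      have "(\<integral>\<^sup>+r. ennreal \<bar>indicator {0..T} r * (f r (V r \<omega> + \<psi> r) - \<phi> k r (V r \<omega> + \<psi> r))\<bar> \<partial>lborel)
        \<le> (\<integral>\<^sup>+r. (\<Sum>j. indicator {0..T} r * g (j + k) r (V r \<omega> + \<psi> r) + indicator {0..T} r * u (j + k) r (V r \<omega> + \<psi> r)) \<partial>lborel)"
      proof (rule nn_integral_mono)
        fix r
        show "ennreal \<bar>indicator {0..T} r * (f r (V r \<omega> + \<psi> r) - \<phi> k r (V r \<omega> + \<psi> r))\<bar>
          \<le> (\<Sum>j. indicator {0..T} r * g (j + k) r (V r \<omega> + \<psi> r) + indicator {0..T} r * u (j + k) r (V r \<omega> + \<psi> r))"
          using pw[of r "V r \<omega> + \<psi> r" k] by (cases "r \<in> {0..T}") simp_all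
      qed
      also have "\<dots> = (\<Sum>j. ?I (g (j + k)) \<omega> \<psi> + ?I (u (j + k)) \<omega> \<psi>)"
        by (subst nn_integral_suminf) (auto simp: nn_integral_add)
      also have "\<dots> \<le> (\<Sum>j. ennreal (y (j + k)) * ennreal (1 + v))"
      proof (rule suminf_le[rotated 1])
        fix j
        show "?I (g (j + k)) \<omega> \<psi> + ?I (u (j + k)) \<omega> \<psi> \<le> ennreal (y (j + k)) * ennreal (1 + v)"
          unfolding y(1) distrib_right using elim(2,3) ad by (intro add_mono) blast+
      qed auto
      also have "\<dots> = ennreal (c k * (1 + v))"
      proof -
        have "(\<Sum>j. ennreal (y (j + k)) * ennreal (1 + v)) = (\<Sum>j. ennreal (y (j + k))) * ennreal (1 + v)" by simp
        also have "(\<Sum>j. ennreal (y (j + k))) = ennreal (c k)"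
          unfolding c_def by (rule suminf_ennreal2[OF y(2) syk])
        also have "ennreal (c k) * ennreal (1 + v) = ennreal (c k * (1 + v))"
          using \<psi>(3) by (intro ennreal_mult[symmetric]) (auto simp: c_def intro!: suminf_nonneg syk y)
        finally show ?thesis .
      qed
      finally show "(\<integral>\<^sup>+r. ennreal \<bar>indicator {0..T} r * (f r (V r \<omega> + \<psi> r) - \<phi> k r (V r \<omega> + \<psi> r))\<bar> \<partial>lborel) \<le> ennreal (c k * (1 + v))" .
    qed (use T R V_continuous fm \<phi>c \<phi>b c in blast)+
    then show ?case by blast
  qed
qed

end

section \<open>The pathwise estimates\<close>

definition path_const :: "nat \<Rightarrow> real \<Rightarrow> real \<Rightarrow> real \<Rightarrow> real" where
  "path_const d \<epsilon> \<alpha> m = (sewing_const \<epsilon> \<alpha> + 1) * (grr_const 1 m \<alpha> * grr_const d m (1 - \<epsilon>)) powr (1 / m)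
     + grr_const 1 m \<alpha> powr (1 / m) + 1"

context good_path
begin

lemma Xi_eq:
  assumes w': "\<And>r. r \<in> {0..T} \<Longrightarrow> w' r = w r" and f': "\<And>r x. r \<in> {0..T} \<Longrightarrow> f' r x = f r x"
  shows "Xi T R \<alpha> \<epsilon> m f' w' = (P1 \<alpha> m + Q1 \<alpha> \<epsilon> m) epowr (1 / m)"
proof -
  have z: "(0::'a) \<in> cball 0 R" using R by simp
  have 1: "\<bar>LBINT r=s..t. f' r (w' r)\<bar> = \<bar>G t 0 - G s 0\<bar>" if st: "s \<in> {0..T}" "t \<in> {0..T}" for s t
  proof -
    have *: "Iv a b (\<lambda>r. f' r (w' r)) = G b 0 - G a 0" if "0 \<le> a" "a \<le> b" "b \<le> T" for a b
      unfolding G_increment[OF z that] by (rule Iv_cong) (use that w' f' in simp)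
    show ?thesis
    proof (cases "s \<le> t")
      case True
      then show ?thesis using st *[of s t] interval_integral_eq_Iv[OF True, of "\<lambda>r. f' r (w' r)"] by simp
    next
      case False
      then have ts: "t \<le> s" by simp
      have "\<bar>LBINT r=s..t. f' r (w' r)\<bar> = \<bar>G s 0 - G t 0\<bar>"
        using st *[of t s] interval_integral_eq_Iv'[OF ts, of "\<lambda>r. f' r (w' r)"] ts by simp
      then show ?thesis by (simp only: abs_minus_commute)
    qed
  qed
  have 2: "\<bar>LBINT r=s..t. (f' r (w' r + x) - f' r (w' r + y))\<bar> = \<bar>D s t x y\<bar>"
    if st: "s \<in> {0..T}" "t \<in> {0..T}" and xy: "x \<in> cball 0 R" "y \<in> cball 0 R" for s t x y
  proof -
    have *: "Iv a b (\<lambda>r. f' r (w' r + x) - f' r (w' r + y)) = D a b x y" if ab: "0 \<le> a" "a \<le> b" "b \<le> T" for a b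
    proof -
      have "D a b x y = Iv a b (\<lambda>r. f r (w r + x) - f r (w r + y))"
        unfolding D_eq_Iv[OF xy ab] by (rule Iv_diff[OF const_integrable[OF xy(1)] const_integrable[OF xy(2)]]) (use ab in auto)
      also have "\<dots> = Iv a b (\<lambda>r. f' r (w' r + x) - f' r (w' r + y))"
        by (rule Iv_cong) (use ab w' f' in simp)
      finally show ?thesis by simp
    qed
    show ?thesis
    proof (cases "s \<le> t")
      case True
      then show ?thesis using st *[of s t] interval_integral_eq_Iv[OF True, of "\<lambda>r. f' r (w' r + x) - f' r (w' r + y)"] by simp
    next
      case False
      then have ts: "t \<le> s" by simp
      have "\<bar>LBINT r=s..t. (f' r (w' r + x) - f' r (w' r + y))\<bar> = \<bar>D t s x y\<bar>"
        using st *[of t s] interval_integral_eq_Iv'[OF ts, of "\<lambda>r. f' r (w' r + x) - f' r (w' r + y)"] ts by simp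
      also have "\<dots> = \<bar>D s t x y\<bar>" unfolding D_def by linarith
      finally show ?thesis .
    qed
  qed
  define F where "F z = ennreal (\<bar>G (snd z) 0 - G (fst z) 0\<bar> powr m / \<bar>snd z - fst z\<bar> powr (\<alpha> * m + 2)) * indicator ({0..T} \<times> {0..T}) z" for z :: "real \<times> real"
  have Fm: "F \<in> borel_measurable (lborel \<Otimes>\<^sub>M lborel)"
    unfolding F_def[abs_def] indicator_times by measurable
  have "(\<integral>\<^sup>+(s, t)\<in>{0..T} \<times> {0..T}. ennreal (\<bar>LBINT r=s..t. f' r (w' r)\<bar> powr m / \<bar>t - s\<bar> powr (\<alpha> * m + 2)) \<partial>lborel) = (\<integral>\<^sup>+z. F z \<partial>lborel)"
  proof (rule nn_integral_cong)
    fix z :: "real \<times> real"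
    show "(case z of (s, t) \<Rightarrow> ennreal (\<bar>LBINT r=s..t. f' r (w' r)\<bar> powr m / \<bar>t - s\<bar> powr (\<alpha> * m + 2))) * indicator ({0..T} \<times> {0..T}) z = F z"
      unfolding F_def by (cases z; cases "z \<in> {0..T} \<times> {0..T}") (simp_all add: 1 del: atLeastAtMost_iff)
  qed
  also have "\<dots> = (\<integral>\<^sup>+s. (\<integral>\<^sup>+t. F (s, t) \<partial>lborel) \<partial>lborel)"
    unfolding lborel_prod[symmetric] by (rule lborel.nn_integral_fst[OF Fm, symmetric])
  also have "\<dots> = P1 \<alpha> m"
    unfolding P1_def
  proof (rule nn_integral_cong)
    fix s
    show "(\<integral>\<^sup>+t. F (s, t) \<partial>lborel) = (\<integral>\<^sup>+t\<in>{0..T}. ennreal (\<bar>G t 0 - G s 0\<bar> powr m / \<bar>t - s\<bar> powr (\<alpha> * m + 2)) \<partial>lborel) * indicator {0..T} s"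
      by (cases "s \<in> {0..T}") (simp_all add: F_def indicator_times)
  qed
  finally have P: "(\<integral>\<^sup>+(s, t)\<in>{0..T} \<times> {0..T}. ennreal (\<bar>LBINT r=s..t. f' r (w' r)\<bar> powr m / \<bar>t - s\<bar> powr (\<alpha> * m + 2)) \<partial>lborel) = P1 \<alpha> m" .
  have "(\<integral>\<^sup>+(s, t, x, y)\<in>{0..T} \<times> {0..T} \<times> cball 0 R \<times> cball 0 R.
     ennreal (\<bar>LBINT r=s..t. (f' r (w' r + x) - f' r (w' r + y))\<bar> powr m / (\<bar>t - s\<bar> powr (\<alpha> * m + 2) * norm (x - y) powr ((1 - \<epsilon>) * m + 2 * real DIM('a)))) \<partial>lborel) = Q1 \<alpha> \<epsilon> m"
    unfolding Q1_eq_product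
  proof (rule nn_integral_cong)
    fix z :: "real \<times> real \<times> 'a \<times> 'a"
    obtain s t x y where z: "z = (s, t, x, y)" by (cases z) auto
    show "(case z of (s, t, x, y) \<Rightarrow> ennreal (\<bar>LBINT r=s..t. (f' r (w' r + x) - f' r (w' r + y))\<bar> powr m / (\<bar>t - s\<bar> powr (\<alpha> * m + 2) * norm (x - y) powr ((1 - \<epsilon>) * m + 2 * real DIM('a)))))
        * indicator ({0..T} \<times> {0..T} \<times> cball 0 R \<times> cball 0 R) z
      = (case z of (s, t, x, y) \<Rightarrow> ennreal (\<bar>D s t x y\<bar> powr m / (\<bar>t - s\<bar> powr (\<alpha> * m + 2) * norm (x - y) powr ((1 - \<epsilon>) * m + 2 * real DIM('a)))))
        * indicator ({0..T} \<times> {0..T} \<times> cball 0 R \<times> cball 0 R) z"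
    proof (cases "s \<in> {0..T} \<and> t \<in> {0..T} \<and> x \<in> cball 0 R \<and> y \<in> cball 0 R")
      case True
      then show ?thesis unfolding z using 2[of s t x y] by (simp del: mem_cball atLeastAtMost_iff)
    next
      case False
      then have "z \<notin> {0..T} \<times> {0..T} \<times> cball 0 R \<times> cball 0 R" unfolding z by blast
      then have "indicator ({0..T} \<times> {0..T} \<times> cball 0 R \<times> cball 0 R) z = (0 :: ennreal)" by (rule indicator_simps(2))
      then show ?thesis by simp
    qed
  qed
  with P show ?thesis unfolding Xi_def by simp
qed

lemma path_estimates:
  assumes e: "0 < \<epsilon>" "\<epsilon> < \<alpha>" "\<epsilon> < 1" and m: "1 \<le> m"
    and st: "0 \<le> s" "s \<le> t" "t \<le> T" and \<psi>: "\<psi> ` {0..T} \<subseteq> cball 0 R" and fin: "variation \<psi> 0 T < \<top>"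
  defines "C \<equiv> path_const DIM('a) \<epsilon> \<alpha> m" and "X \<equiv> (P1 \<alpha> m + Q1 \<alpha> \<epsilon> m) epowr (1 / m)"
  shows "ennreal \<bar>Iv s t (\<lambda>r. f r (w r + \<psi> r)) - Iv s t (\<lambda>r. f r (w r + \<psi> s))\<bar>
      \<le> ennreal C * X * variation \<psi> s t epowr (1 - \<epsilon>) * ennreal ((t - s) powr \<alpha>)"
    and "ennreal \<bar>Iv s t (\<lambda>r. f r (w r + \<psi> r))\<bar>
      \<le> ennreal C * X * (1 + ennreal (norm (\<psi> s) powr (1 - \<epsilon>)) + variation \<psi> s t epowr (1 - \<epsilon>)) * ennreal ((t - s) powr \<alpha>)"
proof -
  let ?A = "Iv s t (\<lambda>r. f r (w r + \<psi> r))" and ?B = "Iv s t (\<lambda>r. f r (w r + \<psi> s))"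
  define K1 where "K1 = (grr_const 1 m \<alpha> * grr_const DIM('a) m (1 - \<epsilon>)) powr (1 / m)"
  define K0 where "K0 = grr_const 1 m \<alpha> powr (1 / m)"
  define S where "S = sewing_const \<epsilon> \<alpha>"
  have K: "0 \<le> K1" "0 \<le> K0" by (simp_all add: K1_def K0_def)
  have S: "0 \<le> S"
    unfolding S_def sewing_const_def using e powr_less_mono[of "\<epsilon> - \<alpha>" 0 2] by simp
  have C: "C = (S + 1) * K1 + K0 + 1" by (simp add: C_def path_const_def K1_def K0_def S_def)
  have SK: "0 \<le> S * K1" using S K by simp
  have C1: "S * K1 \<le> C" "K1 \<le> C" "K0 \<le> C" "0 < C" using SK K unfolding C distrib_right by linarith+
  have "variation \<psi> s t \<le> variation \<psi> 0 T" by (rule variation_mono) (use st in auto)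
  then have "variation \<psi> s t < \<top>" using fin by (rule le_less_trans)
  then obtain V where V: "variation \<psi> s t = ennreal V" "0 \<le> V" by (cases "variation \<psi> s t") auto
  have "(ennreal \<bar>?A - ?B\<bar> \<le> ennreal C * X * variation \<psi> s t epowr (1 - \<epsilon>) * ennreal ((t - s) powr \<alpha>)) \<and>
    (ennreal \<bar>?A\<bar> \<le> ennreal C * X * (1 + ennreal (norm (\<psi> s) powr (1 - \<epsilon>)) + variation \<psi> s t epowr (1 - \<epsilon>)) * ennreal ((t - s) powr \<alpha>))"
  proof (cases "s = t")
    case True
    then show ?thesis by simp
  next
    case False
    with st have st': "s < t" by simp
    have tpos: "0 < ennreal ((t - s) powr \<alpha>)" using st' by simp
    show ?thesis
    proof (cases "P1 \<alpha> m + Q1 \<alpha> \<epsilon> m")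
      case top
      have Xt: "ennreal C * X = \<top>" using C1(4) unfolding X_def top by (simp add: ennreal_mult_eq_top_iff)
      have top1: "\<top> * c * ennreal ((t - s) powr \<alpha>) = \<top>" if "0 < c" for c :: ennreal
        using that tpos by (simp add: ennreal_top_mult zero_less_iff_neq_zero)
      have "0 < 1 + ennreal (norm (\<psi> s) powr (1 - \<epsilon>)) + variation \<psi> s t epowr (1 - \<epsilon>)"
        by (simp add: add_pos_nonneg)
      from top1[OF this] have 2: "ennreal C * X * (1 + ennreal (norm (\<psi> s) powr (1 - \<epsilon>)) + variation \<psi> s t epowr (1 - \<epsilon>)) * ennreal ((t - s) powr \<alpha>) = \<top>"
        unfolding Xt .
      show ?thesis
      proof (cases "V = 0")
        case True
        have "?A = ?B"
        proof (rule Iv_cong)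
          fix r assume r: "s \<le> r" "r < t"
          have "ennreal (norm (\<psi> r - \<psi> s)) \<le> variation \<psi> s r" by (rule norm_le_variation[OF r(1)])
          also have "\<dots> \<le> variation \<psi> s t" by (rule variation_mono) (use r in auto)
          finally have "\<psi> r = \<psi> s" using True by (simp add: V)
          then show "f r (w r + \<psi> r) = f r (w r + \<psi> s)" by simp
        qed
        then show ?thesis unfolding 2 by simp
      next
        case False
        then have "0 < variation \<psi> s t epowr (1 - \<epsilon>)" using V by (simp add: epowr_ennreal)
        from top1[OF this] have "ennreal C * X * variation \<psi> s t epowr (1 - \<epsilon>) * ennreal ((t - s) powr \<alpha>) = \<top>"
          unfolding Xt .
        with 2 show ?thesis by (simp only: top_greatest simp_thms)
      qed
    next
      case (real z)
      define x where "x = z powr (1 / m)"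
      have x: "0 \<le> x" by (simp add: x_def)
      have X: "X = ennreal x" unfolding X_def real(2) x_def using real(1) by (simp add: epowr_ennreal)
      have PQ: "P1 \<alpha> m \<le> ennreal z" "Q1 \<alpha> \<epsilon> m \<le> ennreal z" unfolding real(2)[symmetric] by simp_all
      have a0: "0 < \<alpha>" using e by simp
      have DH: "\<bar>D a b x1 y\<bar> \<le> (K1 * x) * (b - a) powr \<alpha> * norm (x1 - y) powr (1 - \<epsilon>)"
        if "0 \<le> a" "a \<le> b" "b \<le> T" "x1 \<in> cball 0 R" "y \<in> cball 0 R" for a b x1 y
        using space_time_bound[OF m a0 e(3) PQ(2) real(1), of a b x1 y] that by (simp add: K1_def x_def mult_ac)
      have z0: "(0::'a) \<in> cball 0 R" using R by simp
      have ps: "\<psi> s \<in> cball 0 R" by (rule subsetD[OF \<psi>], rule imageI) (use st in auto)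
      have b1: "\<bar>?A - ?B\<bar> \<le> S * (K1 * x) * V powr (1 - \<epsilon>) * (t - s) powr \<alpha>"
        unfolding S_def by (rule sewing[OF e _ DH st \<psi> fin _ V(2)]) (use K x V in auto)
      have b2: "\<bar>?B - Iv s t (\<lambda>r. f r (w r + 0))\<bar> \<le> (K1 * x) * (t - s) powr \<alpha> * norm (\<psi> s) powr (1 - \<epsilon>)"
        using DH[OF st ps z0] unfolding D_eq_Iv[OF ps z0 st] by simp
      have b3: "\<bar>Iv s t (\<lambda>r. f r (w r + 0))\<bar> \<le> K0 * (t - s) powr \<alpha> * x"
        using time_bound[OF m a0 PQ(1) real(1), of s t] st unfolding G_increment[OF z0 st] by (simp add: K0_def x_def)
      define \<tau> where "\<tau> = (t - s) powr \<alpha>"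
      define n where "n = norm (\<psi> s) powr (1 - \<epsilon>)"
      define u where "u = V powr (1 - \<epsilon>)"
      have nn: "0 \<le> \<tau>" "0 \<le> n" "0 \<le> u" by (simp_all add: \<tau>_def n_def u_def)
      have c1: "S * (K1 * x) * u * \<tau> \<le> C * x * u * \<tau>"
        unfolding mult.assoc[symmetric] using C1(1) x nn by (intro mult_right_mono) auto
      have c2: "K1 * x * \<tau> * n \<le> C * x * \<tau> * n" using C1(2) x nn by (intro mult_right_mono) auto
      have c3: "K0 * \<tau> * x \<le> C * \<tau> * x" using C1(3) x nn by (intro mult_right_mono) auto
      have 1: "\<bar>?A - ?B\<bar> \<le> C * x * u * \<tau>" using b1 c1 unfolding u_def \<tau>_def by linarith
      have "\<bar>?A\<bar> \<le> C * x * u * \<tau> + C * x * \<tau> * n + C * \<tau> * x"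
        using 1 b2 b3 c2 c3 unfolding n_def \<tau>_def by linarith
      also have "\<dots> = C * x * (1 + n + u) * \<tau>" by (simp add: algebra_simps)
      finally have 2: "\<bar>?A\<bar> \<le> C * x * (1 + n + u) * \<tau>" .
      have vu: "variation \<psi> s t epowr (1 - \<epsilon>) = ennreal u" using V by (simp add: epowr_ennreal u_def)
      have "ennreal C * X * variation \<psi> s t epowr (1 - \<epsilon>) * ennreal ((t - s) powr \<alpha>) = ennreal (C * x * u * \<tau>)"
        unfolding vu X \<tau>_def[symmetric] using C1(4) x nn by (simp add: ennreal_mult)
      moreover have "1 + ennreal n + ennreal u = ennreal (1 + n + u)" using nn by simp
      then have "ennreal C * X * (1 + ennreal (norm (\<psi> s) powr (1 - \<epsilon>)) + variation \<psi> s t epowr (1 - \<epsilon>)) * ennreal ((t - s) powr \<alpha>) = ennreal (C * x * (1 + n + u) * \<tau>)"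
        unfolding vu X \<tau>_def[symmetric] n_def[symmetric] using C1(4) x nn by (simp add: ennreal_mult del: ennreal_plus)
      ultimately show ?thesis using ennreal_leI[OF 1] ennreal_leI[OF 2] by simp
    qed
  qed
  then show "ennreal \<bar>?A - ?B\<bar> \<le> ennreal C * X * variation \<psi> s t epowr (1 - \<epsilon>) * ennreal ((t - s) powr \<alpha>)"
    "ennreal \<bar>?A\<bar> \<le> ennreal C * X * (1 + ennreal (norm (\<psi> s) powr (1 - \<epsilon>)) + variation \<psi> s t epowr (1 - \<epsilon>)) * ennreal ((t - s) powr \<alpha>)"
    by blast+
qed

end

lemma Lqp_time_restriction:
  fixes f :: "real \<Rightarrow> 'a::euclidean_space \<Rightarrow> real"
  assumes f: "f \<in> Lqp T q p" and pq: "0 < p" "0 < q"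
  shows "(\<lambda>(r, x). indicator {0..T} r * f r x) \<in> borel_measurable (borel \<Otimes>\<^sub>M borel)"
    and "mixed_norm T q p (\<lambda>r x. ennreal \<bar>indicator {0..T} r * f r x\<bar>) < \<top>"
proof -
  have "(\<lambda>z. indicator ({0..T} \<times> UNIV) z *\<^sub>R (case z of (r, x) \<Rightarrow> f r x)) \<in> borel_measurable borel"
    using f by (simp add: Lqp_def set_borel_measurable_def)
  also have "(\<lambda>z. indicator ({0..T} \<times> UNIV) z *\<^sub>R (case z of (r, x) \<Rightarrow> f r x)) = (\<lambda>(r, x). indicator {0..T} r * f r x)"
    by (simp add: fun_eq_iff indicator_times)
  finally show "(\<lambda>(r, x). indicator {0..T} r * f r x) \<in> borel_measurable (borel \<Otimes>\<^sub>M borel)"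
    unfolding borel_prod .
  have "mixed_norm T q p (\<lambda>r x. ennreal \<bar>indicator {0..T} r * f r x\<bar>) = Lqp_norm T q p f"
    unfolding mixed_norm_def Lqp_norm_def Lnorm_def[of lborel q]
  proof (intro arg_cong[where f="\<lambda>z. z epowr (1 / q)"] nn_integral_cong)
    fix r
    show "(indicator {0..T} r * Lnorm lborel p (\<lambda>x. ennreal \<bar>indicator {0..T} r * f r x\<bar>)) epowr q
      = (\<integral>\<^sup>+x. ennreal (\<bar>f r x\<bar> powr p) \<partial>lborel) epowr (q / p) * indicator {0..T} r"
      using pq by (cases "r \<in> {0..T}") (simp_all add: Lnorm_def epowr_epowr epowr_ennreal)
  qed
  then show "mixed_norm T q p (\<lambda>r x. ennreal \<bar>indicator {0..T} r * f r x\<bar>) < \<top>"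
    using f by (simp add: Lqp_def)
qed

theorem lemma4p4:
  fixes p q :: real and m :: "real \<Rightarrow> real \<Rightarrow> real"
  assumes "2 < p" and "2 < q" and "2 / q + real DIM('a::euclidean_space) / p < 1"
    and "\<And>\<alpha> \<epsilon>. \<alpha> \<in> {0<..<1/2 - real DIM('a) / (2 * p) - 1 / q} \<Longrightarrow> \<epsilon> \<in> {0<..<\<alpha>} \<Longrightarrow>
      1 \<le> m \<alpha> \<epsilon> \<and>
      1 / m \<alpha> \<epsilon> < 1/2 - real DIM('a) / (2 * p) - 1 / q - \<alpha> \<and>
      real DIM('a) / m \<alpha> \<epsilon> < \<epsilon>"
  shows "\<exists>C :: real \<Rightarrow> real \<Rightarrow> real.
    \<forall>(M :: 'w measure) (W :: real \<Rightarrow> 'w \<Rightarrow> 'a) (T :: real) (R :: real) (f :: real \<Rightarrow> 'a \<Rightarrow> real).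
      standard_brownian_motion M W \<and> 0 < T \<and> 0 < R \<and> f \<in> Lqp T q p \<longrightarrow>
      (\<exists>\<Omega>' \<in> sets M. measure M \<Omega>' = 1 \<and>
        (\<forall>\<omega> \<in> \<Omega>'.
         \<forall>\<alpha> \<in> {0<..<1/2 - real DIM('a) / (2 * p) - 1 / q}. \<forall>\<epsilon> \<in> {0<..<\<alpha>}.
         \<forall>s t. \<forall>\<psi> :: real \<Rightarrow> 'a.
           0 \<le> s \<and> s \<le> t \<and> t \<le> T \<and> \<psi> ` {0..T} \<subseteq> cball 0 R \<and> variation \<psi> 0 T < \<top> \<longrightarrow>
           set_integrable lborel {0..T} (\<lambda>r. f r (W r \<omega> + \<psi> r)) \<and>
           ennreal \<bar>(LBINT r=s..t. f r (W r \<omega> + \<psi> r)) - (LBINT r=s..t. f r (W r \<omega> + \<psi> s))\<bar>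
             \<le> ennreal (C \<epsilon> \<alpha>) * Xi T R \<alpha> \<epsilon> (m \<alpha> \<epsilon>) f (\<lambda>r. W r \<omega>)
                * variation \<psi> s t epowr (1 - \<epsilon>) * ennreal ((t - s) powr \<alpha>) \<and>
           ennreal \<bar>LBINT r=s..t. f r (W r \<omega> + \<psi> r)\<bar>
             \<le> ennreal (C \<epsilon> \<alpha>) * Xi T R \<alpha> \<epsilon> (m \<alpha> \<epsilon>) f (\<lambda>r. W r \<omega>)
                * (1 + ennreal (norm (\<psi> s) powr (1 - \<epsilon>)) + variation \<psi> s t epowr (1 - \<epsilon>))
                * ennreal ((t - s) powr \<alpha>)))"
proof (rule exI[of _ "\<lambda>\<epsilon> \<alpha>. path_const DIM('a) \<epsilon> \<alpha> (m \<alpha> \<epsilon>)"], intro allI impI)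
  fix M :: "'w measure" and W :: "real \<Rightarrow> 'w \<Rightarrow> 'a" and T R :: real and f :: "real \<Rightarrow> 'a \<Rightarrow> real"
  assume H: "standard_brownian_motion M W \<and> 0 < T \<and> 0 < R \<and> f \<in> Lqp T q p"
  then have T: "0 < T" and R: "0 < R" and f: "f \<in> Lqp T q p" by auto
  interpret standard_brownian_motion M W using H by simp
  obtain V where "modified_brownian_motion M W V" using modification_exists by blast
  then interpret V: modified_brownian_motion M W V .
  define f1 where "f1 r x = indicator {0..T} r * f r x" for r x
  have pq0: "0 < p" "0 < q" using assms(1,2) by auto
  note f1 = Lqp_time_restriction[OF f pq0, folded f1_def]
  have ff: "f r x = f1 r x" if "r \<in> {0..T}" for r x using that by (simp add: f1_def)
  have "AE \<omega> in M. (\<exists>fk c. good_path T R (\<lambda>r. V r \<omega>) f1 fk c) \<and> (\<forall>r\<ge>0. V r \<omega> = W r \<omega>)"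
    using V.good_path_AE[OF assms(1-3) T R f1] V.V_AE by eventually_elim simp
  then obtain N where N: "N \<in> null_sets M"
    "{\<omega> \<in> space M. \<not> ((\<exists>fk c. good_path T R (\<lambda>r. V r \<omega>) f1 fk c) \<and> (\<forall>r\<ge>0. V r \<omega> = W r \<omega>))} \<subseteq> N"
    by (auto simp: eventually_ae_filter)
  show "\<exists>\<Omega>' \<in> sets M. measure M \<Omega>' = 1 \<and>
        (\<forall>\<omega> \<in> \<Omega>'.
         \<forall>\<alpha> \<in> {0<..<1/2 - real DIM('a) / (2 * p) - 1 / q}. \<forall>\<epsilon> \<in> {0<..<\<alpha>}.
         \<forall>s t. \<forall>\<psi> :: real \<Rightarrow> 'a.
           0 \<le> s \<and> s \<le> t \<and> t \<le> T \<and> \<psi> ` {0..T} \<subseteq> cball 0 R \<and> variation \<psi> 0 T < \<top> \<longrightarrow>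
           set_integrable lborel {0..T} (\<lambda>r. f r (W r \<omega> + \<psi> r)) \<and>
           ennreal \<bar>(LBINT r=s..t. f r (W r \<omega> + \<psi> r)) - (LBINT r=s..t. f r (W r \<omega> + \<psi> s))\<bar>
             \<le> ennreal (path_const DIM('a) \<epsilon> \<alpha> (m \<alpha> \<epsilon>)) * Xi T R \<alpha> \<epsilon> (m \<alpha> \<epsilon>) f (\<lambda>r. W r \<omega>)
                * variation \<psi> s t epowr (1 - \<epsilon>) * ennreal ((t - s) powr \<alpha>) \<and>
           ennreal \<bar>LBINT r=s..t. f r (W r \<omega> + \<psi> r)\<bar>
             \<le> ennreal (path_const DIM('a) \<epsilon> \<alpha> (m \<alpha> \<epsilon>)) * Xi T R \<alpha> \<epsilon> (m \<alpha> \<epsilon>) f (\<lambda>r. W r \<omega>)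
                * (1 + ennreal (norm (\<psi> s) powr (1 - \<epsilon>)) + variation \<psi> s t epowr (1 - \<epsilon>))
                * ennreal ((t - s) powr \<alpha>))"
  proof (rule bexI[of _ "space M - N"], rule conjI, goal_cases)
    case 1
    have "N \<in> sets M" using N(1) by auto
    then show ?case using N(1) by (simp add: prob_compl measure_eq_0_null_sets)
  next
    case 3
    show ?case using N(1) by auto
  next
    case 2
    show ?case
    proof (intro ballI allI impI, goal_cases)
      case (1 \<omega> \<alpha> \<epsilon> s t \<psi>)
      have st: "0 \<le> s" "s \<le> t" "t \<le> T" and \<psi>: "\<psi> ` {0..T} \<subseteq> cball 0 R" "variation \<psi> 0 T < \<top>" using 1(4) by auto
      have "(\<exists>fk c. good_path T R (\<lambda>r. V r \<omega>) f1 fk c) \<and> (\<forall>r\<ge>0. V r \<omega> = W r \<omega>)" using N(2) 1(1) by blast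
      then obtain fk c where gp: "good_path T R (\<lambda>r. V r \<omega>) f1 fk c" and VW: "\<And>r. 0 \<le> r \<Longrightarrow> W r \<omega> = V r \<omega>" by auto
      interpret good_path T R "\<lambda>r. V r \<omega>" f1 fk c by (rule gp)
      have "0 \<le> real DIM('a) / (2 * p)" "0 < 1 / q" using pq0 by auto
      then have e: "0 < \<epsilon>" "\<epsilon> < \<alpha>" "\<epsilon> < 1" using 1(2,3) unfolding greaterThanLessThan_iff by linarith+
      have m: "1 \<le> m \<alpha> \<epsilon>" using assms(4) 1(2,3) by blast
      have X: "Xi T R \<alpha> \<epsilon> (m \<alpha> \<epsilon>) f (\<lambda>r. W r \<omega>) = (P1 \<alpha> (m \<alpha> \<epsilon>) + Q1 \<alpha> \<epsilon> (m \<alpha> \<epsilon>)) epowr (1 / m \<alpha> \<epsilon>)"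
        by (rule Xi_eq) (use VW ff in auto)
      have I1: "(LBINT r=s..t. f r (W r \<omega> + \<psi> r)) = Iv s t (\<lambda>r. f1 r (V r \<omega> + \<psi> r))"
        unfolding interval_integral_eq_Iv[OF st(2)] by (rule Iv_cong) (use st VW ff in auto)
      have I2: "(LBINT r=s..t. f r (W r \<omega> + \<psi> s)) = Iv s t (\<lambda>r. f1 r (V r \<omega> + \<psi> s))"
        unfolding interval_integral_eq_Iv[OF st(2)] by (rule Iv_cong) (use st VW ff in auto)
      have "set_integrable lborel {0..T} (\<lambda>r. f r (W r \<omega> + \<psi> r))"
      proof -
        have "(\<lambda>r. indicator {0..T} r *\<^sub>R f r (W r \<omega> + \<psi> r)) = (\<lambda>r. indicator {0..T} r * f1 r (V r \<omega> + \<psi> r))"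
          using VW ff by (auto simp: fun_eq_iff indicator_def)
        then show ?thesis unfolding set_integrable_def using f_integrable[OF \<psi>] by (simp only:)
      qed
      then show ?case unfolding X I1 I2 using path_estimates[OF e m st \<psi>] by blast
    qed
  qed
qed

end
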